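(* Let $R$ be a commutative Noetherian ring and $M$ an Artinian $R$-module such that $\operatorname{Ann}_R(0:_M\mathfrak{p})=\mathfrak{p}$ for every $\mathfrak{p}\in V(\operatorname{Ann}_RM)$. Then the following are equivalent: (1) $M$ is a Co-Cohen–Macaulay $R$-module. (2) $\operatorname{Cograde}_{R_{\mathfrak{p}}}\operatorname{Hom}_R(R_{\mathfrak{p}},M)=\operatorname{ht}_M\mathfrak{p}$ for every $\mathfrak{p}\in\operatorname{Cos}_RM$, and $\operatorname{ht}_M\mathfrak{m}=\operatorname{Co\text{-}dim}_RM$ for every $\mathfrak{m}\in\operatorname{Supp}_RM$. (3) $\pi_i(\mathfrak{p},M)=0$ for all $0\le i<\operatorname{ht}_M\mathfrak{p}$ and all $\mathfrak{p}\in\operatorname{Cos}_RM$, and $\operatorname{ht}_M\mathfrak{m}=\operatorname{Co\text{-}dim}_RM$ for every $\mathfrak{m}\in\operatorname{Supp}_RM$. (4) $\operatorname{Cograde}_R(\mathfrak{m},M)=\operatorname{ht}_M\mathfrak{m}=\operatorname{Co\text{-}dim}_RM$ for every $\mathfrak{m}\in\operatorname{Supp}_RM$. (5) $\pi_i(\mathfrak{m},M)=0$ for all $0\le i<\operatorname{ht}_M\mathfrak{m}$, and $\operatorname{ht}_M\mathfrak{m}=\operatorname{Co\text{-}dim}_RM$, for every $\mathfrak{m}\in\operatorname{Supp}_RM$.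
   Context: For an ideal $I$, $(0:_M I)=\{m\in M:Im=0\}$. An element $x\in R$ is $M$-co-regular if $xM=M$ and $(0:_Mx)\neq0$; a sequence $x_1,\dots,x_n$ is an $M$-co-regular sequence if $(0:_M(x_1,\dots,x_n))\neq0$ and $x_i(0:_M(x_1,\dots,x_{i-1}))=(0:_M(x_1,\dots,x_{i-1}))$ for each $i$. $\operatorname{Cograde}_R(I,M)$ is the common length of maximal $M$-co-regular sequences contained in $I$. $\operatorname{Cos}_RM=\{\mathfrak{p}\in\operatorname{Spec}R:\operatorname{Hom}_R(R_{\mathfrak{p}},M)\neq0\}$; $\operatorname{Co\text{-}dim}_RM=\sup\{\dim R/\mathfrak{p}:\mathfrak{p}\in\operatorname{Cos}_RM\}$. For $\mathfrak{p}\in\operatorname{Cos}_RM$, $\operatorname{ht}_M\mathfrak{p}=\sup\{n:\mathfrak{p}_0\subsetneq\cdots\subsetneq\mathfrak{p}_n=\mathfrak{p},\ \mathfrak{p}_i\in\operatorname{Cos}_RM\}$. With $k(\mathfrak{p})=R_{\mathfrak{p}}/\mathfrak{p}R_{\mathfrak{p}}$, the dual Bass numbers are $\pi_i(\mathfrak{p},M)=\dim_{k(\mathfrak{p})}\operatorname{Tor}_i^{R_{\mathfrak{p}}}(k(\mathfrak{p}),\operatorname{Hom}_R(R_{\mathfrak{p}},M))$ and $\operatorname{Cograde}_{R_{\mathfrak{p}}}\operatorname{Hom}_R(R_{\mathfrak{p}},M)=\inf\{i:\operatorname{Tor}_i^{R_{\mathfrak{p}}}(k(\mathfrak{p}),\operatorname{Hom}_R(R_{\mathfrak{p}},M))\neq0\}$.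 For Artinian $M$, $\operatorname{Supp}_RM$ is a finite set of maximal ideals and $J(M)=\bigcap_{\mathfrak{m}\in\operatorname{Supp}_RM}\mathfrak{m}$. $\operatorname{Ndim}_RM$ (Noetherian dimension): $-1$ if $M=0$; for $d\ge0$, $\operatorname{Ndim}_RM=d$ if $\operatorname{Ndim}_RM<d$ is false and for every ascending chain $M_0\subseteq M_1\subseteq\cdots$ of submodules there is $n_0$ with $\operatorname{Ndim}_R(M_{n+1}/M_n)<d$ for all $n>n_0$. An Artinian $M$ is Co-Cohen–Macaulay if $\operatorname{Cograde}_R(J(M),M)=\operatorname{Ndim}_RM$. *)

theory Defs
  imports "HOL-Algebra.Algebra" "HOL-Library.Extended_Nat"
begin

definition colon :: "('a, 'm) module \<Rightarrow> 'a set \<Rightarrow> 'm set" where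
  "colon M I = {x \<in> carrier M. \<forall>r\<in>I. r \<odot>\<^bsub>M\<^esub> x = \<zero>\<^bsub>M\<^esub>}"

definition annih :: "'a ring \<Rightarrow> ('a, 'm) module \<Rightarrow> 'm set \<Rightarrow> 'a set" where
  "annih R M T = {r \<in> carrier R. \<forall>x\<in>T. r \<odot>\<^bsub>M\<^esub> x = \<zero>\<^bsub>M\<^esub>}"

definition Vset :: "'a ring \<Rightarrow> 'a set \<Rightarrow> 'a set set" where
  "Vset R I = {p. primeideal p R \<and> I \<subseteq> p}"

definition artinian_module :: "'a ring \<Rightarrow> ('a, 'm) module \<Rightarrow> bool" where
  "artinian_module R M \<longleftrightarrow>
     (\<forall>K :: nat \<Rightarrow> 'm set. (\<forall>n. submodule (K n) R M \<and> K (Suc n) \<subseteq> K n)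
        \<longrightarrow> (\<exists>n0. \<forall>n\<ge>n0. K n = K n0))"

definition loc_rel :: "'a ring \<Rightarrow> 'a set \<Rightarrow> (('a \<times> 'a) \<times> ('a \<times> 'a)) set" where
  "loc_rel R S = {((a, s), (b, t)). a \<in> carrier R \<and> s \<in> S \<and> b \<in> carrier R \<and> t \<in> S \<and>
      (\<exists>u\<in>S. u \<otimes>\<^bsub>R\<^esub> ((a \<otimes>\<^bsub>R\<^esub> t) \<ominus>\<^bsub>R\<^esub> (b \<otimes>\<^bsub>R\<^esub> s)) = \<zero>\<^bsub>R\<^esub>)}"

definition frac :: "'a ring \<Rightarrow> 'a set \<Rightarrow> 'a \<Rightarrow> 'a \<Rightarrow> ('a \<times> 'a) set" where
  "frac R p a s = loc_rel R (carrier R - p) `` {(a, s)}"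

definition loc_ring :: "'a ring \<Rightarrow> 'a set \<Rightarrow> ('a \<times> 'a) set ring" where
  "loc_ring R p =
    \<lparr>carrier = (carrier R \<times> (carrier R - p)) // loc_rel R (carrier R - p),
     monoid.mult = (\<lambda>U V. SOME Z. \<exists>a s b t. (a, s) \<in> U \<and> (b, t) \<in> V \<and>
                        Z = frac R p (a \<otimes>\<^bsub>R\<^esub> b) (s \<otimes>\<^bsub>R\<^esub> t)),
     one = frac R p \<one>\<^bsub>R\<^esub> \<one>\<^bsub>R\<^esub>,
     ring.zero = frac R p \<zero>\<^bsub>R\<^esub> \<one>\<^bsub>R\<^esub>,
     ring.add = (\<lambda>U V. SOME Z. \<exists>a s b t. (a, s) \<in> U \<and> (b, t) \<in> V \<and>
                        Z = frac R p ((a \<otimes>\<^bsub>R\<^esub> t) \<oplus>\<^bsub>R\<^esub> (b \<otimes>\<^bsub>R\<^esub> s)) (s \<otimes>\<^bsub>R\<^esub> t))\<rparr>"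

definition res_ideal :: "'a ring \<Rightarrow> 'a set \<Rightarrow> ('a \<times> 'a) set set" where
  "res_ideal R p = {frac R p a s | a s. a \<in> p \<and> s \<in> carrier R - p}"

definition hom_loc :: "'a ring \<Rightarrow> ('a, 'm) module \<Rightarrow> 'a set
                         \<Rightarrow> (('a \<times> 'a) set, ('a \<times> 'a) set \<Rightarrow> 'm) module" where
  "hom_loc R M p =
    (let Rp = loc_ring R p in
    \<lparr>carrier = {f. f \<in> carrier Rp \<rightarrow> carrier M \<and> f \<in> extensional (carrier Rp) \<and>
                  (\<forall>x\<in>carrier Rp. \<forall>y\<in>carrier Rp. f (x \<oplus>\<^bsub>Rp\<^esub> y) = f x \<oplus>\<^bsub>M\<^esub> f y) \<and>
                  (\<forall>r\<in>carrier R. \<forall>x\<in>carrier Rp.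
                      f (frac R p r \<one>\<^bsub>R\<^esub> \<otimes>\<^bsub>Rp\<^esub> x) = r \<odot>\<^bsub>M\<^esub> f x)},
     monoid.mult = (\<lambda>f g. restrict (\<lambda>x. \<zero>\<^bsub>M\<^esub>) (carrier Rp)),
     one = restrict (\<lambda>x. \<zero>\<^bsub>M\<^esub>) (carrier Rp),
     ring.zero = restrict (\<lambda>x. \<zero>\<^bsub>M\<^esub>) (carrier Rp),
     ring.add = (\<lambda>f g. restrict (\<lambda>x. f x \<oplus>\<^bsub>M\<^esub> g x) (carrier Rp)),
     module.smult = (\<lambda>a f. restrict (\<lambda>x. f (a \<otimes>\<^bsub>Rp\<^esub> x)) (carrier Rp))\<rparr>)"

definition fvec :: "('b, 'z) ring_scheme \<Rightarrow> nat \<Rightarrow> (nat \<Rightarrow> 'b) set" where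
  "fvec A n = {x. (\<forall>j<n. x j \<in> carrier A) \<and> (\<forall>j\<ge>n. x j = \<zero>\<^bsub>A\<^esub>)}"

definition rmat :: "('b, 'z) ring_scheme \<Rightarrow> (nat \<Rightarrow> nat \<Rightarrow> 'b) \<Rightarrow> nat \<Rightarrow> nat
                      \<Rightarrow> (nat \<Rightarrow> 'b) \<Rightarrow> (nat \<Rightarrow> 'b)" where
  "rmat A D m n x = (\<lambda>i. if i < m then (\<Oplus>\<^bsub>A\<^esub>j\<in>{..<n}. D i j \<otimes>\<^bsub>A\<^esub> x j) else \<zero>\<^bsub>A\<^esub>)"

text \<open>the map N^n -> N^m induced by D (i.e. D tensor N)\<close>
definition mmat :: "('b, 'n) module \<Rightarrow> (nat \<Rightarrow> nat \<Rightarrow> 'b) \<Rightarrow> nat \<Rightarrow> nat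
                      \<Rightarrow> (nat \<Rightarrow> 'n) \<Rightarrow> (nat \<Rightarrow> 'n)" where
  "mmat N D m n y = (\<lambda>i. if i < m then (\<Oplus>\<^bsub>N\<^esub>j\<in>{..<n}. D i j \<odot>\<^bsub>N\<^esub> y j) else \<zero>\<^bsub>N\<^esub>)"

text \<open>A free resolution ... -> A^(r 2) -> A^(r 1) -> A^(r 0) = A -> A/J -> 0;
  D n is the matrix of the differential A^(r n) -> A^(r (n-1)) (n >= 1).\<close>
definition is_free_res :: "'b ring \<Rightarrow> 'b set \<Rightarrow> (nat \<Rightarrow> nat) \<Rightarrow> (nat \<Rightarrow> nat \<Rightarrow> nat \<Rightarrow> 'b) \<Rightarrow> bool" where
  "is_free_res A J r D \<longleftrightarrow>
     r 0 = 1 \<and> (\<forall>n i j. D n i j \<in> carrier A) \<and>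
     rmat A (D 1) (r 0) (r 1) ` fvec A (r 1) = {x \<in> fvec A 1. x 0 \<in> J} \<and>
     (\<forall>n\<ge>1. {x \<in> fvec A (r n). rmat A (D n) (r (n - 1)) (r n) x = (\<lambda>_. \<zero>\<^bsub>A\<^esub>)}
              = rmat A (D (Suc n)) (r n) (r (Suc n)) ` fvec A (r (Suc n)))"

text \<open>Tor_i^A(A/J, N) = 0: the i-th homology of F tensor N vanishes (for free resolutions F of A/J)\<close>
definition tor_vanishes :: "'b ring \<Rightarrow> 'b set \<Rightarrow> ('b, 'n) module \<Rightarrow> nat \<Rightarrow> bool" where
  "tor_vanishes A J N i \<longleftrightarrow>
     (\<forall>r D. is_free_res A J r D \<longrightarrow>
        {y \<in> fvec N (r i). i = 0 \<or> mmat N (D i) (r (i - 1)) (r i) y = (\<lambda>_. \<zero>\<^bsub>N\<^esub>)}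
          \<subseteq> mmat N (D (Suc i)) (r i) (r (Suc i)) ` fvec N (r (Suc i)))"

definition dual_bass_zero :: "'a ring \<Rightarrow> ('a, 'm) module \<Rightarrow> 'a set \<Rightarrow> nat \<Rightarrow> bool" where
  "dual_bass_zero R M p i \<longleftrightarrow> tor_vanishes (loc_ring R p) (res_ideal R p) (hom_loc R M p) i"

definition cograde_loc :: "'a ring \<Rightarrow> ('a, 'm) module \<Rightarrow> 'a set \<Rightarrow> enat" where
  "cograde_loc R M p =
     (if \<forall>i. dual_bass_zero R M p i then \<infinity> else enat (LEAST i. \<not> dual_bass_zero R M p i))"

definition Cos :: "'a ring \<Rightarrow> ('a, 'm) module \<Rightarrow> 'a set set" where
  "Cos R M = {p. primeideal p R \<and> carrier (hom_loc R M p) \<noteq> {\<zero>\<^bsub>hom_loc R M p\<^esub>}}"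

definition dim_quot :: "'a ring \<Rightarrow> 'a set \<Rightarrow> enat" where
  "dim_quot R p = Sup {enat n | n. \<exists>c :: nat \<Rightarrow> 'a set. c 0 = p \<and>
        (\<forall>i\<le>n. primeideal (c i) R) \<and> (\<forall>i<n. c i \<subset> c (Suc i))}"

definition codim :: "'a ring \<Rightarrow> ('a, 'm) module \<Rightarrow> enat" where
  "codim R M = Sup (dim_quot R ` Cos R M)"

definition ht_M :: "'a ring \<Rightarrow> ('a, 'm) module \<Rightarrow> 'a set \<Rightarrow> enat" where
  "ht_M R M p = Sup {enat n | n. \<exists>c :: nat \<Rightarrow> 'a set. c n = p \<and>
        (\<forall>i\<le>n. c i \<in> Cos R M) \<and> (\<forall>i<n. c i \<subset> c (Suc i))}"

text \<open>Supp_R M = {p prime : M_p \<noteq> 0}, with M_p \<noteq> 0 unfolded\<close>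
definition Supp :: "'a ring \<Rightarrow> ('a, 'm) module \<Rightarrow> 'a set set" where
  "Supp R M = {p. primeideal p R \<and>
      (\<exists>x\<in>carrier M. \<forall>s\<in>carrier R - p. s \<odot>\<^bsub>M\<^esub> x \<noteq> \<zero>\<^bsub>M\<^esub>)}"

definition JM :: "'a ring \<Rightarrow> ('a, 'm) module \<Rightarrow> 'a set" where
  "JM R M = carrier R \<inter> \<Inter> (Supp R M)"

definition coreg_seq :: "'a ring \<Rightarrow> ('a, 'm) module \<Rightarrow> 'a list \<Rightarrow> bool" where
  "coreg_seq R M xs \<longleftrightarrow> set xs \<subseteq> carrier R \<and> colon M (set xs) \<noteq> {\<zero>\<^bsub>M\<^esub>} \<and>
     (\<forall>i<length xs. (\<lambda>y. (xs ! i) \<odot>\<^bsub>M\<^esub> y) ` colon M (set (take i xs)) = colon M (set (take i xs)))"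

definition cograde :: "'a ring \<Rightarrow> 'a set \<Rightarrow> ('a, 'm) module \<Rightarrow> enat" where
  "cograde R I M = Sup {enat (length xs) | xs. coreg_seq R M xs \<and> set xs \<subseteq> I}"

text \<open>ndle R M k N L  <->  Ndim (N/L) < k  (so k = 0 means N/L = 0, i.e. Ndim = -1)\<close>
primrec ndle :: "'a ring \<Rightarrow> ('a, 'm) module \<Rightarrow> nat \<Rightarrow> 'm set \<Rightarrow> 'm set \<Rightarrow> bool" where
  "ndle R M 0 N L = (N = L)"
| "ndle R M (Suc k) N L =
     (ndle R M k N L \<or>
      (\<forall>K :: nat \<Rightarrow> 'm set. (\<forall>n. submodule (K n) R M \<and> L \<subseteq> K n \<and> K n \<subseteq> N \<and> K n \<subseteq> K (Suc n))
          \<longrightarrow> (\<exists>n0. \<forall>n>n0. ndle R M k (K (Suc n)) (K n))))"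

definition ndim_eq :: "'a ring \<Rightarrow> ('a, 'm) module \<Rightarrow> nat \<Rightarrow> bool" where
  "ndim_eq R M d \<longleftrightarrow> \<not> ndle R M d (carrier M) {\<zero>\<^bsub>M\<^esub>} \<and> ndle R M (Suc d) (carrier M) {\<zero>\<^bsub>M\<^esub>}"

definition co_CM :: "'a ring \<Rightarrow> ('a, 'm) module \<Rightarrow> bool" where
  "co_CM R M \<longleftrightarrow> (\<exists>d. ndim_eq R M d \<and> cograde R (JM R M) M = enat d)"

end

theory Submission
  imports Defs
begin

text \<open>
  Artinian modules are linearly compact, so an element acting surjectively on \<open>M\<close> also acts
  surjectively on \<open>Hom(R\<^sub>p, M)\<close>, and \<open>Cos M = V(Ann M)\<close>. For \<open>x \<in> p\<close> with \<open>x M = M\<close> the first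
  \<open>n + 1\<close> dual Bass numbers of \<open>M\<close> at \<open>p\<close> vanish iff the first \<open>n\<close> of \<open>0 :\<^sub>M x\<close> do; secondary
  decomposition shows that an ideal without such an \<open>x\<close> lies in an attached prime \<open>q = Ann (M/K)\<close>,
  and then the zeroth dual Bass number at \<open>q\<close> is nonzero. Induction along co-regular sequences
  gives \<open>Cograde(m, M) \<le> ht\<^sub>M m\<close>, and a chain of \<open>n\<close> primes starting at \<open>q\<close> whenever the first \<open>n\<close>
  dual Bass numbers vanish at \<open>m \<in> Supp (M/K)\<close>. Concatenating such chains turns condition (4) at the maximal
  ideals into (2) at all primes.

  For (1), Noetherian dimension is treated as the deviation of an ordered set. If \<open>xs\<close> is a co-regular sequence
  in \<open>J(M)\<close>, each of its elements acts locally nilpotently and changes the deviation of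
  the lattice of submodules by exactly one, and, dually, that of the lattice of ideals above
  \<open>Ann M\<close> by at most one. When \<open>0 :\<^sub>M xs\<close> has finite length this
  bounds both \<open>Ndim M\<close> and, the annihilator condition making all primes above \<open>Ann M + (xs)\<close> maximal,
  the length of chains of primes in \<open>V(Ann M)\<close>.
\<close>

section \<open>Deviation of ordered sets\<close>

text \<open>Localization says nothing about Artinian modules away from maximal ideals, where
  \<open>M_p = 0\<close>. Its replacement \<open>Hom(R_p, M)\<close> need not be Artinian over
  \<open>R_p\<close>, so every chain condition is used in \<open>M\<close> itself, and only
  surjectivity of multiplications, kernels and values at 1 are carried over.
  \<open>tor_vanishes\<close> speaks of all free resolutions. Resolutions are never compared: degree
  shifts run on an arbitrary fixed one, and only nonvanishing needs one to exist. The annihilator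
  condition lets \<open>M\<close> see all of V(Ann M): for T inside a prime p above Ann M, the
  submodule 0 :_M T is nonzero and its annihilator lies in p. Hence co-regular sequences in p do not
  collapse, and their lengths bound heights from below. From (1) to (4), chains of primes must be
  bounded by Ndim M. As R is neither local nor complete, no dual Noetherian module is at hand to
  count dimensions on. Instead the recursive definition of Ndim is applied to two lattices,
  submodules of \<open>M\<close> and ideals above Ann M, and the same co-regular sequence cuts both
  down to finite length. In either lattice the upper bound comes from leading parts with respect to
  powers of one element.\<close>

text \<open>The deviation of the interval from \<open>a\<close> to \<open>b\<close> in \<open>P\<close> is less than the numerical argument; \<open>ndle\<close>
  is the instance of submodules ordered by inclusion.\<close>
primrec devlt :: "'p set \<Rightarrow> ('p \<Rightarrow> 'p \<Rightarrow> bool) \<Rightarrow> nat \<Rightarrow> 'p \<Rightarrow> 'p \<Rightarrow> bool" where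
  "devlt P lq 0 a b = (a = b)"
| "devlt P lq (Suc k) a b =
     (devlt P lq k a b \<or>
      (\<forall>K :: nat \<Rightarrow> 'p. (\<forall>n. K n \<in> P \<and> lq a (K n) \<and> lq (K n) b \<and> lq (K n) (K (Suc n)))
          \<longrightarrow> (\<exists>n0. \<forall>n>n0. devlt P lq k (K n) (K (Suc n)))))"

lemma devlt_mono_nat: "devlt P lq k a b \<Longrightarrow> k \<le> l \<Longrightarrow> devlt P lq l a b"
  by (induction l) (auto simp: le_Suc_eq)

text \<open>A chain in the source is mapped to a chain in the target, and injectivity on comparable
  pairs settles level 0. Surjectivity plays no part in this, so a bound is pulled back along any
  strict embedding of an interval, such as preimages under a power of x or sequences of leading
  parts.\<close>

lemma devlt_transport:
  assumes trans: "\<And>x y z. x \<in> P \<Longrightarrow> y \<in> P \<Longrightarrow> z \<in> P \<Longrightarrow> lq x y \<Longrightarrow> lq y z \<Longrightarrow> lq x z"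
    and ab: "a \<in> P" "b \<in> P"
    and into: "\<And>x. x \<in> P \<Longrightarrow> lq a x \<Longrightarrow> lq x b \<Longrightarrow> f x \<in> P'"
    and mono: "\<And>x y. x \<in> P \<Longrightarrow> y \<in> P \<Longrightarrow> lq a x \<Longrightarrow> lq x y \<Longrightarrow> lq y b \<Longrightarrow> lq' (f x) (f y)"
    and strict: "\<And>x y. x \<in> P \<Longrightarrow> y \<in> P \<Longrightarrow> lq a x \<Longrightarrow> lq x y \<Longrightarrow> lq y b \<Longrightarrow> f x = f y \<Longrightarrow> x = y"
  shows "x \<in> P \<Longrightarrow> y \<in> P \<Longrightarrow> lq a x \<Longrightarrow> lq x y \<Longrightarrow> lq y b \<Longrightarrow> devlt P' lq' k (f x) (f y)
    \<Longrightarrow> devlt P lq k x y"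
proof (induction k arbitrary: x y)
  case 0
  then show ?case using strict by simp
next
  case (Suc k)
  show ?case
  proof (cases "devlt P' lq' k (f x) (f y)")
    case True
    then show ?thesis using Suc by simp
  next
    case False
    have "\<exists>n0. \<forall>n>n0. devlt P lq k (K n) (K (Suc n))"
      if K: "\<forall>n. K n \<in> P \<and> lq x (K n) \<and> lq (K n) y \<and> lq (K n) (K (Suc n))" for K
    proof -
      have aK: "lq a (K n)" "lq (K n) b" for n
        using K Suc.prems ab trans by meson+
      have "\<forall>n. f (K n) \<in> P' \<and> lq' (f x) (f (K n)) \<and> lq' (f (K n)) (f y) \<and> lq' (f (K n)) (f (K (Suc n)))"
        using K Suc.prems aK into mono by metis
      then obtain n0 where "\<forall>n>n0. devlt P' lq' k (f (K n)) (f (K (Suc n)))"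
        using False Suc.prems(6) by (auto dest!: spec[of _ "\<lambda>n. f (K n)"])
      then show ?thesis using Suc.IH K aK by meson
    qed
    then show ?thesis by simp
  qed
qed

lemma devlt_subinterval:
  assumes trans: "\<And>x y z. x \<in> P \<Longrightarrow> y \<in> P \<Longrightarrow> z \<in> P \<Longrightarrow> lq x y \<Longrightarrow> lq y z \<Longrightarrow> lq x z"
    and P: "a \<in> P" "b \<in> P" "x \<in> P" "y \<in> P"
    and "lq a x" "lq y b" "devlt P lq k a b" "lq x y"
    and antisym: "\<And>x y. x \<in> P \<Longrightarrow> y \<in> P \<Longrightarrow> lq x y \<Longrightarrow> lq y x \<Longrightarrow> x = y"
  shows "devlt P lq k x y"
  using \<open>devlt P lq k a b\<close>
proof (induction k)
  case 0
  then show ?case using P assms by (metis devlt.simps(1))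
next
  case (Suc k)
  show ?case
  proof (cases "devlt P lq k a b")
    case True
    then show ?thesis using Suc by simp
  next
    case False
    have "\<exists>n0. \<forall>n>n0. devlt P lq k (K n) (K (Suc n))"
      if K: "\<forall>n. K n \<in> P \<and> lq x (K n) \<and> lq (K n) y \<and> lq (K n) (K (Suc n))" for K
    proof -
      have "\<forall>n. K n \<in> P \<and> lq a (K n) \<and> lq (K n) b \<and> lq (K n) (K (Suc n))"
        using K P assms trans by meson
      then show ?thesis using Suc.prems False by simp
    qed
    then show ?thesis by simp
  qed
qed

text \<open>The target of the leading part maps: a submodule or ideal is recorded by one element of
  \<open>P\<close> for each power of x. For ideals the order is reversed, so the sequences there are
  ascending chains of ideals.\<close>

definition decseqs :: "'p set \<Rightarrow> ('p \<Rightarrow> 'p \<Rightarrow> bool) \<Rightarrow> (nat \<Rightarrow> 'p) set" where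
  "decseqs P lq = {G. \<forall>i. G i \<in> P \<and> lq (G (Suc i)) (G i)}"

lemma finite_eventually_ball:
  fixes i0 :: nat
  assumes "\<And>i. i < i0 \<Longrightarrow> \<exists>n0::nat. \<forall>n>n0. Q i n"
  shows "\<exists>n0. \<forall>n>n0. \<forall>i<i0. Q i n"
  using assms
proof (induction i0)
  case (Suc i0)
  obtain n1 where n1: "\<forall>n>n1. \<forall>i<i0. Q i n" using Suc by fastforce
  obtain n2 where n2: "\<forall>n>n2. Q i0 n" using Suc by blast
  show ?case using n1 n2 by (intro exI[of _ "max n1 n2"]) (auto simp: less_Suc_eq)
qed simp

text \<open>Below an interval, beyond the point where both bounding sequences are constant only one
  interval of \<open>P\<close> matters; this makes the bound uniform over all positions.\<close>
lemma devlt_decseqs: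
  assumes trans: "\<And>x y z. x \<in> P \<Longrightarrow> y \<in> P \<Longrightarrow> z \<in> P \<Longrightarrow> lq x y \<Longrightarrow> lq y z \<Longrightarrow> lq x z"
    and antisym: "\<And>x y. x \<in> P \<Longrightarrow> y \<in> P \<Longrightarrow> lq x y \<Longrightarrow> lq y x \<Longrightarrow> x = y"
    and dcc: "\<And>G. G \<in> decseqs P lq \<Longrightarrow> \<exists>n0. \<forall>n\<ge>n0. G n = G n0"
  shows "\<lbrakk>G \<in> decseqs P lq; G' \<in> decseqs P lq; \<forall>i. lq (G i) (G' i);
      \<forall>i. devlt P lq (Suc j) (G i) (G' i); \<exists>i0. \<forall>i\<ge>i0. devlt P lq j (G i) (G' i)\<rbrakk>
    \<Longrightarrow> devlt (decseqs P lq) (\<lambda>G G'. \<forall>i. lq (G i) (G' i)) (Suc j) G G'"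
proof (induction j arbitrary: G G')
  case (0 G G')
  obtain i0 where i0: "\<forall>i\<ge>i0. G i = G' i" using 0 by auto
  have GP: "G i \<in> P" "G' i \<in> P" for i using 0 by (auto simp: decseqs_def)
  have "\<exists>n0. \<forall>n>n0. K n = K (Suc n)"
    if K: "\<forall>n. K n \<in> decseqs P lq \<and> (\<forall>i. lq (G i) (K n i)) \<and> (\<forall>i. lq (K n i) (G' i)) \<and>
        (\<forall>i. lq (K n i) (K (Suc n) i))" for K
  proof -
    have KP: "K n i \<in> P" for n i using K by (auto simp: decseqs_def)
    have ev: "\<exists>n0. \<forall>n>n0. K n i = K (Suc n) i" for i
    proof (cases "G i = G' i")
      case True
      then have "K n i = G i" for n using K GP KP antisym by metis
      then show ?thesis by simp
    next
      case False
      then show ?thesis using 0(4)[rule_format, of i] K KP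
        by (auto dest!: spec[of _ "\<lambda>n. K n i"])
    qed
    obtain n0 where n0: "\<forall>n>n0. \<forall>i<i0. K n i = K (Suc n) i"
      using finite_eventually_ball[of i0 "\<lambda>i n. K n i = K (Suc n) i"] ev by blast
    have "K n i = K (Suc n) i" if "i \<ge> i0" for n i
      using i0 that K GP KP antisym by metis
    then show ?thesis using n0 by (metis ext not_le)
  qed
  then show ?case by simp
next
  case (Suc j G G')
  have GP: "G i \<in> P" "G' i \<in> P" for i using Suc.prems by (auto simp: decseqs_def)
  obtain a where a: "\<forall>i\<ge>a. G i = G a" using dcc Suc.prems by blast
  obtain b where b: "\<forall>i\<ge>b. G' i = G' b" using dcc Suc.prems by blast
  obtain c where c: "\<forall>i\<ge>c. devlt P lq (Suc j) (G i) (G' i)" using Suc.prems by blast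
  \<comment> \<open>From \<open>i0\<close> on, both bounding sequences are constant and the interval
    between them has the smaller deviation. Only the finitely many positions below \<open>i0\<close>
    remain to be treated one by one.\<close>
  define i0 where "i0 = max a (max b c)"
  have i0: "G i = G i0" "G' i = G' i0" if "i \<ge> i0" for i
    using that a b unfolding i0_def by (metis max.bounded_iff max.cobounded1 max.cobounded2)+
  have di0: "devlt P lq (Suc j) (G i0) (G' i0)" using c i0_def by simp
  have "\<exists>n0. \<forall>n>n0. devlt (decseqs P lq) (\<lambda>G G'. \<forall>i. lq (G i) (G' i)) (Suc j) (K n) (K (Suc n))"
    if K: "\<forall>n. K n \<in> decseqs P lq \<and> (\<forall>i. lq (G i) (K n i)) \<and> (\<forall>i. lq (K n i) (G' i)) \<and>
        (\<forall>i. lq (K n i) (K (Suc n) i))" for K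
  proof -
    have KP: "K n i \<in> P" for n i using K by (auto simp: decseqs_def)
    have sub: "devlt P lq k (K n i) (K (Suc n) i)" if "devlt P lq k (G i) (G' i)" for k n i
      by (rule devlt_subinterval[of P lq "G i" "G' i", OF trans]) (use that K KP GP antisym in auto)
    have ev: "\<exists>n0. \<forall>n>n0. devlt P lq (Suc j) (K n i) (K (Suc n) i)" for i
    proof (cases "devlt P lq (Suc j) (G i) (G' i)")
      case True
      then show ?thesis using sub by blast
    next
      case False
      then show ?thesis using Suc.prems(4)[rule_format, of i] K KP
        unfolding devlt.simps(2)[of P lq "Suc j"] by (auto dest!: spec[of _ "\<lambda>n. K n i"])
    qed
    obtain n0 where n0: "\<forall>n>n0. \<forall>i<i0. devlt P lq (Suc j) (K n i) (K (Suc n) i)"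
      using finite_eventually_ball[of i0 "\<lambda>i n. devlt P lq (Suc j) (K n i) (K (Suc n) i)"] ev by blast
    have all: "devlt P lq (Suc j) (K n i) (K (Suc n) i)" if "n > n0" for n i
    proof (cases "i < i0")
      case False
      then have "devlt P lq (Suc j) (G i) (G' i)" using di0 i0[of i] by simp
      then show ?thesis by (rule sub)
    qed (use n0 that in blast)
    have "\<exists>l. \<forall>i\<ge>l. K n i = K n l" for n using dcc K by blast
    then obtain l where l: "\<forall>i\<ge>l n. K n i = K n (l n)" for n by metis
    \<comment> \<open>The limits \<open>K n (l' n)\<close> form a chain between \<open>G i0\<close>
      and \<open>G' i0\<close>. The bound at \<open>i0\<close> applies to it and supplies the
      smaller deviation far out that the induction hypothesis asks for.\<close>
    define l' where "l' n = max i0 (l n)" for n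
    have l': "K n i = K n (l' n)" if "i \<ge> l' n" for n i
      using that l unfolding l'_def by (metis max.bounded_iff max.cobounded2)
    have lim: "\<exists>i1. \<forall>i\<ge>i1. K n i = K n (l' n) \<and> K (Suc n) i = K (Suc n) (l' (Suc n))" for n
      using l' by (metis max.bounded_iff)
    have incr: "lq (K n (l' n)) (K (Suc n) (l' (Suc n)))" for n
    proof -
      obtain i where "K n i = K n (l' n)" "K (Suc n) i = K (Suc n) (l' (Suc n))"
        using lim[of n] by blast
      then show ?thesis using K by metis
    qed
    have bnd: "lq (G i0) (K n (l' n))" "lq (K n (l' n)) (G' i0)" for n
      using i0[of "l' n"] K by (metis l'_def max.cobounded1)+
    have "\<exists>n1. \<forall>n>n1. devlt P lq j (K n (l' n)) (K (Suc n) (l' (Suc n)))"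
    proof (cases "devlt P lq j (G i0) (G' i0)")
      case True
      have "devlt P lq j (K n (l' n)) (K (Suc n) (l' (Suc n)))" for n
        by (rule devlt_subinterval[of P lq "G i0" "G' i0", OF trans])
          (use True bnd KP GP antisym incr in auto)
      then show ?thesis by blast
    next
      case False
      then show ?thesis using di0 bnd incr KP
        by (auto dest!: spec[of _ "\<lambda>n. K n (l' n)"])
    qed
    then obtain n1 where n1: "\<forall>n>n1. devlt P lq j (K n (l' n)) (K (Suc n) (l' (Suc n)))" by blast
    have "devlt (decseqs P lq) (\<lambda>G G'. \<forall>i. lq (G i) (G' i)) (Suc j) (K n) (K (Suc n))"
      if "n > max n0 n1" for n
    proof (rule Suc.IH)
      show "\<exists>i0. \<forall>i\<ge>i0. devlt P lq j (K n i) (K (Suc n) i)"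
        using lim[of n] n1 that by fastforce
      show "\<forall>i. devlt P lq (Suc j) (K n i) (K (Suc n) i)" using all that by (simp del: devlt.simps)
    qed (use K in auto)
    then show ?thesis by blast
  qed
  then show ?case unfolding devlt.simps(2)[of "decseqs P lq" _ "Suc j"] by blast
qed

section \<open>Submodules of Artinian modules\<close>

lemma (in module) submodule_iff:
  "submodule K R M \<longleftrightarrow> K \<subseteq> carrier M \<and> \<zero>\<^bsub>M\<^esub> \<in> K \<and> (\<forall>x\<in>K. \<forall>y\<in>K. x \<oplus>\<^bsub>M\<^esub> y \<in> K) \<and>
     (\<forall>r\<in>carrier R. \<forall>x\<in>K. r \<odot>\<^bsub>M\<^esub> x \<in> K)"
proof
  assume K: "submodule K R M"
  then have "\<zero>\<^bsub>M\<^esub> \<in> K"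
    using submodule.axioms(1) subgroup.one_closed by fastforce
  then show "K \<subseteq> carrier M \<and> \<zero>\<^bsub>M\<^esub> \<in> K \<and> (\<forall>x\<in>K. \<forall>y\<in>K. x \<oplus>\<^bsub>M\<^esub> y \<in> K) \<and>
     (\<forall>r\<in>carrier R. \<forall>x\<in>K. r \<odot>\<^bsub>M\<^esub> x \<in> K)"
    using submoduleE[OF K] by blast
next
  assume K: "K \<subseteq> carrier M \<and> \<zero>\<^bsub>M\<^esub> \<in> K \<and> (\<forall>x\<in>K. \<forall>y\<in>K. x \<oplus>\<^bsub>M\<^esub> y \<in> K) \<and>
     (\<forall>r\<in>carrier R. \<forall>x\<in>K. r \<odot>\<^bsub>M\<^esub> x \<in> K)"
  have "\<ominus>\<^bsub>M\<^esub> x \<in> K" if "x \<in> K" for x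
  proof -
    have "(\<ominus> \<one>) \<odot>\<^bsub>M\<^esub> x \<in> K" using K that by blast
    moreover have "(\<ominus> \<one>) \<odot>\<^bsub>M\<^esub> x = \<ominus>\<^bsub>M\<^esub> x" using K that by (simp add: smult_l_minus subset_iff)
    ultimately show ?thesis by simp
  qed
  then show "submodule K R M" using K by (intro submoduleI) auto
qed

lemma (in cring) ideal_iff:
  "ideal I R \<longleftrightarrow> I \<subseteq> carrier R \<and> \<zero> \<in> I \<and> (\<forall>x\<in>I. \<forall>y\<in>I. x \<oplus> y \<in> I) \<and>
     (\<forall>r\<in>carrier R. \<forall>x\<in>I. r \<otimes> x \<in> I)" (is "_ \<longleftrightarrow> ?rhs")
proof
  assume I: "ideal I R"
  show ?rhs
    using ideal.Icarr[OF I] additive_subgroup.zero_closed[OF ideal.axioms(1)[OF I]]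
      additive_subgroup.a_closed[OF ideal.axioms(1)[OF I]] ideal.I_l_closed[OF I] by blast
next
  assume I: ?rhs
  have neg: "\<ominus> x \<in> I" if "x \<in> I" for x
  proof -
    have "(\<ominus> \<one>) \<otimes> x \<in> I" using I that by blast
    moreover have "(\<ominus> \<one>) \<otimes> x = \<ominus> x" using I that by (simp add: l_minus subset_iff)
    ultimately show ?thesis by simp
  qed
  have "subgroup I (add_monoid R)"
    using I neg by (intro add.subgroupI) (auto simp: a_inv_def)
  moreover have "x \<otimes> r \<in> I" if "r \<in> carrier R" "x \<in> I" for r x
    using I that m_comm[of x r] by (simp add: subset_iff)
  ultimately show "ideal I R" using I by (intro idealI) (auto simp: subset_iff ring_axioms)
qed

lemma (in cring) primeideal_iff:
  "primeideal p R \<longleftrightarrow> ideal p R \<and> \<one> \<notin> p \<and>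
     (\<forall>a\<in>carrier R. \<forall>b\<in>carrier R. a \<otimes> b \<in> p \<longrightarrow> a \<in> p \<or> b \<in> p)" (is "_ \<longleftrightarrow> ?rhs")
proof
  assume p: "primeideal p R"
  then interpret primeideal p R .
  show ?rhs using one_imp_carrier I_notcarr I_prime is_ideal by blast
next
  assume ?rhs
  then show "primeideal p R" by (intro primeidealI) (auto simp: is_cring)
qed

definition art_module :: "'a ring \<Rightarrow> ('a, 'm) module \<Rightarrow> bool" where
  "art_module R M \<longleftrightarrow> cring R \<and> noetherian_ring R \<and> module R M \<and> artinian_module R M"

text \<open>\<open>sub M K\<close> is \<open>K\<close> viewed as a module; quotients \<open>M/K\<close> are never formed, statements
  about them are expressed by submodules of \<open>M\<close> containing \<open>K\<close>.\<close>
abbreviation sub :: "('a, 'm) module \<Rightarrow> 'm set \<Rightarrow> ('a, 'm) module" where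
  "sub M K \<equiv> M\<lparr>carrier := K\<rparr>"

definition mulset :: "('a, 'm) module \<Rightarrow> 'a \<Rightarrow> 'm set \<Rightarrow> 'm set" where
  "mulset M x K = (\<lambda>y. x \<odot>\<^bsub>M\<^esub> y) ` K"

definition addset :: "('a, 'm) module \<Rightarrow> 'm set \<Rightarrow> 'm set \<Rightarrow> 'm set" where
  "addset M K L = {x \<oplus>\<^bsub>M\<^esub> y | x y. x \<in> K \<and> y \<in> L}"

locale artmod =
  fixes R :: "'a ring" (structure) and M :: "('a, 'm) module" (structure)
  assumes art: "art_module R M"
begin

sublocale module R M
  using art by (simp add: art_module_def)

sublocale noetherian_ring R
  using art by (simp add: art_module_def)

lemma artinian: "artinian_module R M"
  using art by (simp add: art_module_def)

abbreviation "sm K \<equiv> submodule K R M"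

lemma smD:
  assumes "sm K"
  shows "K \<subseteq> carrier M" "\<zero>\<^bsub>M\<^esub> \<in> K" "\<And>x y. x \<in> K \<Longrightarrow> y \<in> K \<Longrightarrow> x \<oplus>\<^bsub>M\<^esub> y \<in> K"
    "\<And>r x. r \<in> carrier R \<Longrightarrow> x \<in> K \<Longrightarrow> r \<odot>\<^bsub>M\<^esub> x \<in> K" "\<And>x. x \<in> K \<Longrightarrow> \<ominus>\<^bsub>M\<^esub> x \<in> K"
    "\<And>x y. x \<in> K \<Longrightarrow> y \<in> K \<Longrightarrow> x \<ominus>\<^bsub>M\<^esub> y \<in> K" "\<And>x. x \<in> K \<Longrightarrow> x \<in> carrier M"
  using assms submoduleE[OF assms] by (auto simp: submodule_iff a_minus_def)

lemma submodule_sub: "sm K \<Longrightarrow> submodule L R (sub M K) \<longleftrightarrow> sm L \<and> L \<subseteq> K"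
proof -
  assume K: "sm K"
  interpret S: module R "sub M K" using submodule.submodule_is_module[OF K] module_axioms .
  show ?thesis using smD[OF K] by (auto simp: submodule_iff S.submodule_iff)
qed

lemma art_sub: "sm K \<Longrightarrow> art_module R (sub M K)"
  using art submodule.submodule_is_module[of K R M] submodule_sub[of K] module_axioms
  by (auto simp: art_module_def artinian_module_def)

lemma artinian_minimal:
  assumes "\<K> \<noteq> {}" "\<And>K. K \<in> \<K> \<Longrightarrow> sm K"
  shows "\<exists>K\<in>\<K>. \<forall>L\<in>\<K>. L \<subseteq> K \<longrightarrow> L = K"
proof (rule ccontr)
  assume "\<not> ?thesis"
  then have "\<forall>K\<in>\<K>. \<exists>L\<in>\<K>. L \<subset> K" by blast
  then obtain f where f: "\<forall>K\<in>\<K>. f K \<in> \<K> \<and> f K \<subset> K" by metis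
  obtain K0 where K0: "K0 \<in> \<K>" using assms by blast
  define K where "K n = (f ^^ n) K0" for n
  have K: "K n \<in> \<K>" for n using f K0 by (induction n) (auto simp: K_def)
  have "K (Suc n) \<subset> K n" for n using f K[of n] by (simp add: K_def)
  moreover from this obtain n0 where "\<forall>n\<ge>n0. K n = K n0"
    using artinian assms K unfolding artinian_module_def by blast
  ultimately show False by (metis lessI less_imp_le order.irrefl psubsetE)
qed

lemma noetherian_maximal:
  assumes "\<I> \<noteq> {}" "\<And>I. I \<in> \<I> \<Longrightarrow> ideal I R"
  shows "\<exists>I\<in>\<I>. \<forall>J\<in>\<I>. I \<subseteq> J \<longrightarrow> J = I"
proof (rule subset_Zorn_nonempty[OF assms(1)])
  fix C assume C: "C \<noteq> {}" "subset.chain \<I> C"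
  then have "subset.chain {I. ideal I R} C"
    using assms(2) unfolding subset_chain_def by auto
  then have "\<Union> C \<in> C" using ideal_chain_is_trivial C by metis
  then show "\<Union> C \<in> \<I>" using C(2) unfolding subset_chain_def by auto
qed

lemma idealD:
  assumes "ideal K R"
  shows "K \<subseteq> carrier R" "\<zero> \<in> K" "\<And>x y. x \<in> K \<Longrightarrow> y \<in> K \<Longrightarrow> x \<oplus> y \<in> K"
    "\<And>r x. r \<in> carrier R \<Longrightarrow> x \<in> K \<Longrightarrow> r \<otimes> x \<in> K" "\<And>x. x \<in> K \<Longrightarrow> \<ominus> x \<in> K"
    "\<And>x y. x \<in> K \<Longrightarrow> y \<in> K \<Longrightarrow> x \<ominus> y \<in> K" "\<And>x. x \<in> K \<Longrightarrow> x \<in> carrier R"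
    "\<And>r x. r \<in> carrier R \<Longrightarrow> x \<in> K \<Longrightarrow> x \<otimes> r \<in> K"
  using assms ideal_iff[of K] additive_subgroup.a_inv_closed[OF ideal.axioms(1)[OF assms]]
    ideal.I_r_closed[OF assms]
  by (auto simp: a_minus_def)

lemma primeD:
  assumes "primeideal p R"
  shows "ideal p R" "\<one> \<notin> p" "\<And>a b. a \<in> carrier R \<Longrightarrow> b \<in> carrier R \<Longrightarrow> a \<otimes> b \<in> p \<Longrightarrow> a \<in> p \<or> b \<in> p"
    "p \<subseteq> carrier R"
  using assms idealD(1) by (auto simp: primeideal_iff)

lemma prime_pow: "primeideal p R \<Longrightarrow> a \<in> carrier R \<Longrightarrow> a [^] (n::nat) \<in> p \<Longrightarrow> a \<in> p"
  by (induction n) (auto simp: nat_pow_Suc dest: primeD(2) primeD(3)[of p "_ [^] _" a])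

lemma smult_r_diff:
  "a \<in> carrier R \<Longrightarrow> x \<in> carrier M \<Longrightarrow> y \<in> carrier M \<Longrightarrow>
    a \<odot>\<^bsub>M\<^esub> (x \<ominus>\<^bsub>M\<^esub> y) = a \<odot>\<^bsub>M\<^esub> x \<ominus>\<^bsub>M\<^esub> a \<odot>\<^bsub>M\<^esub> y"
  by (simp add: a_minus_def smult_r_distr smult_r_minus)

lemma smult_l_diff:
  "a \<in> carrier R \<Longrightarrow> b \<in> carrier R \<Longrightarrow> x \<in> carrier M \<Longrightarrow>
    (a \<ominus> b) \<odot>\<^bsub>M\<^esub> x = a \<odot>\<^bsub>M\<^esub> x \<ominus>\<^bsub>M\<^esub> b \<odot>\<^bsub>M\<^esub> x"
  by (simp add: a_minus_def smult_l_distr smult_l_minus)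

lemma smult_comm:
  "a \<in> carrier R \<Longrightarrow> b \<in> carrier R \<Longrightarrow> x \<in> carrier M \<Longrightarrow>
    a \<odot>\<^bsub>M\<^esub> (b \<odot>\<^bsub>M\<^esub> x) = b \<odot>\<^bsub>M\<^esub> (a \<odot>\<^bsub>M\<^esub> x)"
  by (metis m_comm smult_assoc1)

lemma mdiff_add: "x \<in> carrier M \<Longrightarrow> y \<in> carrier M \<Longrightarrow> (x \<ominus>\<^bsub>M\<^esub> y) \<oplus>\<^bsub>M\<^esub> y = x"
  by (simp add: a_minus_def M.a_assoc M.l_neg)

lemma mdiff_zero: "x \<in> carrier M \<Longrightarrow> y \<in> carrier M \<Longrightarrow> x \<ominus>\<^bsub>M\<^esub> y = \<zero>\<^bsub>M\<^esub> \<longleftrightarrow> x = y"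
  using mdiff_add[of x y] by (auto simp: a_minus_def M.r_neg)

lemma mdiff_self [simp]: "x \<in> carrier M \<Longrightarrow> x \<ominus>\<^bsub>M\<^esub> x = \<zero>\<^bsub>M\<^esub>"
  by (simp add: mdiff_zero)

lemma add_mdiff: "x \<in> carrier M \<Longrightarrow> y \<in> carrier M \<Longrightarrow> (x \<oplus>\<^bsub>M\<^esub> y) \<ominus>\<^bsub>M\<^esub> y = x"
  by (simp add: a_minus_def M.a_assoc M.r_neg)

lemma sm_diff_cancel:
  assumes "sm K" "x \<ominus>\<^bsub>M\<^esub> y \<in> K" "y \<in> K" "x \<in> carrier M" shows "x \<in> K"
  using smD(3)[OF assms(1-3)] smD(1)[OF assms(1)] assms mdiff_add[of x y] by (metis subsetD)

lemma sm_carrier: "sm (carrier M)" by (rule carrier_is_submodule)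

lemma sm_zero: "sm {\<zero>\<^bsub>M\<^esub>}" by (auto simp: submodule_iff)

lemma sm_Int: "sm K \<Longrightarrow> sm L \<Longrightarrow> sm (K \<inter> L)" by (auto simp: submodule_iff)

lemma sm_mulset: "sm K \<Longrightarrow> x \<in> carrier R \<Longrightarrow> sm (mulset M x K)"
proof -
  assume K: "sm K" and x: "x \<in> carrier R"
  have "r \<odot>\<^bsub>M\<^esub> (x \<odot>\<^bsub>M\<^esub> y) \<in> mulset M x K" if "r \<in> carrier R" "y \<in> K" for r y
    using smD[OF K] that x by (auto simp: mulset_def smult_comm[of r x])
  moreover have "x \<odot>\<^bsub>M\<^esub> y \<oplus>\<^bsub>M\<^esub> x \<odot>\<^bsub>M\<^esub> z \<in> mulset M x K" if "y \<in> K" "z \<in> K" for y z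
    using smD[OF K] that x by (auto simp: mulset_def smult_r_distr[symmetric])
  moreover have "\<zero>\<^bsub>M\<^esub> \<in> mulset M x K"
    using smD[OF K] x by (force simp: mulset_def image_iff)
  ultimately show ?thesis using smD[OF K] x by (auto simp: submodule_iff mulset_def)
qed

lemma sm_preimage:
  assumes "sm K" "sm L" "x \<in> carrier R" shows "sm {y \<in> L. x \<odot>\<^bsub>M\<^esub> y \<in> K}"
proof -
  note k = smD[OF assms(1)] and l = smD[OF assms(2)]
  have "x \<odot>\<^bsub>M\<^esub> (r \<odot>\<^bsub>M\<^esub> y) \<in> K" if "r \<in> carrier R" "y \<in> L" "x \<odot>\<^bsub>M\<^esub> y \<in> K" for r y
    using that k l assms by (subst smult_comm) auto
  then show ?thesis using k l assms(3) by (auto simp: submodule_iff smult_r_distr)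
qed

lemma sm_colon: "I \<subseteq> carrier R \<Longrightarrow> sm (colon M I)"
proof -
  assume I: "I \<subseteq> carrier R"
  have "a \<odot>\<^bsub>M\<^esub> (r \<odot>\<^bsub>M\<^esub> y) = \<zero>\<^bsub>M\<^esub>"
    if "r \<in> carrier R" "y \<in> carrier M" "a \<odot>\<^bsub>M\<^esub> y = \<zero>\<^bsub>M\<^esub>" "a \<in> I" for a r y
    using that I by (subst smult_comm) auto
  then show ?thesis using I by (auto simp: submodule_iff colon_def smult_r_distr subset_iff)
qed

lemma addsetI: "x \<in> K \<Longrightarrow> y \<in> L \<Longrightarrow> x \<oplus>\<^bsub>M\<^esub> y \<in> addset M K L"
  by (auto simp: addset_def)

lemma sm_addset:
  assumes "sm K" "sm L" shows "sm (addset M K L)" "K \<subseteq> addset M K L" "L \<subseteq> addset M K L"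
proof -
  note k = smD[OF assms(1)] and l = smD[OF assms(2)]
  show "K \<subseteq> addset M K L"
  proof
    fix x assume "x \<in> K"
    then show "x \<in> addset M K L" using addsetI[of x K "\<zero>\<^bsub>M\<^esub>" L] l(2) k(7) by simp
  qed
  show "L \<subseteq> addset M K L"
  proof
    fix x assume "x \<in> L"
    then show "x \<in> addset M K L" using addsetI[of "\<zero>\<^bsub>M\<^esub>" K x L] k(2) l(7) by simp
  qed
  then have "\<zero>\<^bsub>M\<^esub> \<in> addset M K L" using l by blast
  moreover have "(x \<oplus>\<^bsub>M\<^esub> y) \<oplus>\<^bsub>M\<^esub> (x' \<oplus>\<^bsub>M\<^esub> y') \<in> addset M K L" if "x \<in> K" "y \<in> L" "x' \<in> K" "y' \<in> L" for x y x' y'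
  proof -
    have "(x \<oplus>\<^bsub>M\<^esub> y) \<oplus>\<^bsub>M\<^esub> (x' \<oplus>\<^bsub>M\<^esub> y') = (x \<oplus>\<^bsub>M\<^esub> x') \<oplus>\<^bsub>M\<^esub> (y \<oplus>\<^bsub>M\<^esub> y')"
      using that k l by (simp add: M.a_ac)
    then show ?thesis using addsetI k(3) l(3) that by simp
  qed
  moreover have "r \<odot>\<^bsub>M\<^esub> (x \<oplus>\<^bsub>M\<^esub> y) \<in> addset M K L" if "x \<in> K" "y \<in> L" "r \<in> carrier R" for r x y
    using that k l addsetI[of "r \<odot>\<^bsub>M\<^esub> x" K "r \<odot>\<^bsub>M\<^esub> y" L] by (simp add: smult_r_distr)
  moreover have "addset M K L \<subseteq> carrier M" using k(7) l(7) unfolding addset_def by auto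
  ultimately show "sm (addset M K L)" unfolding submodule_iff
    by (auto simp: addset_def)
qed

lemma addset_least: "sm N \<Longrightarrow> K \<subseteq> N \<Longrightarrow> L \<subseteq> N \<Longrightarrow> addset M K L \<subseteq> N"
  using smD(3)[of N] by (auto simp: addset_def subset_iff)

lemma ideal_annih: "T \<subseteq> carrier M \<Longrightarrow> ideal (annih R M T) R"
  unfolding ideal_iff annih_def by (auto simp: smult_l_distr smult_assoc1 subset_iff)

lemma ideal_quot_annih: "sm K \<Longrightarrow> T \<subseteq> carrier M \<Longrightarrow> ideal {r \<in> carrier R. \<forall>x\<in>T. r \<odot>\<^bsub>M\<^esub> x \<in> K} R"
  unfolding ideal_iff by (auto simp: smult_l_distr smult_assoc1 subset_iff smD)

end

section \<open>Linear compactness\<close>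

context artmod
begin

text \<open>These are the cosets of submodules, described without naming the submodule;
  \<open>sm_differences\<close> recovers it.\<close>

definition aff :: "'m set \<Rightarrow> bool" where
  "aff C \<longleftrightarrow> C \<noteq> {} \<and> C \<subseteq> carrier M \<and>
    (\<forall>r\<in>carrier R. \<forall>a\<in>C. \<forall>b\<in>C. \<forall>c\<in>C. c \<oplus>\<^bsub>M\<^esub> r \<odot>\<^bsub>M\<^esub> (a \<ominus>\<^bsub>M\<^esub> b) \<in> C)"

lemma affI:
  assumes "C \<noteq> {}" "C \<subseteq> carrier M"
    "\<And>r a b c. r \<in> carrier R \<Longrightarrow> a \<in> C \<Longrightarrow> b \<in> C \<Longrightarrow> c \<in> C \<Longrightarrow> c \<oplus>\<^bsub>M\<^esub> r \<odot>\<^bsub>M\<^esub> (a \<ominus>\<^bsub>M\<^esub> b) \<in> C"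
  shows "aff C"
  using assms by (simp add: aff_def)

lemma affD:
  assumes "aff C" 
  shows "C \<noteq> {}" "\<And>x. x \<in> C \<Longrightarrow> x \<in> carrier M"
    "\<And>r a b c. r \<in> carrier R \<Longrightarrow> a \<in> C \<Longrightarrow> b \<in> C \<Longrightarrow> c \<in> C \<Longrightarrow> c \<oplus>\<^bsub>M\<^esub> r \<odot>\<^bsub>M\<^esub> (a \<ominus>\<^bsub>M\<^esub> b) \<in> C"
  using assms by (auto simp add: aff_def)

lemma sm_differences:
  assumes "aff C" shows "sm {a \<ominus>\<^bsub>M\<^esub> b | a b. a \<in> C \<and> b \<in> C}" (is "sm ?K")
proof -
  note c = affD[OF assms]
  obtain c0 where c0: "c0 \<in> C" using c(1) by blast
  have "\<zero>\<^bsub>M\<^esub> = c0 \<ominus>\<^bsub>M\<^esub> c0" using c(2)[OF c0] by simp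
  then have "\<zero>\<^bsub>M\<^esub> \<in> ?K" using c0 by blast
  moreover have "(a \<ominus>\<^bsub>M\<^esub> b) \<oplus>\<^bsub>M\<^esub> (a' \<ominus>\<^bsub>M\<^esub> b') \<in> ?K" if "a \<in> C" "b \<in> C" "a' \<in> C" "b' \<in> C" for a b a' b'
  proof -
    have "(a \<ominus>\<^bsub>M\<^esub> b) \<oplus>\<^bsub>M\<^esub> (a' \<ominus>\<^bsub>M\<^esub> b') = (a \<oplus>\<^bsub>M\<^esub> \<one> \<odot>\<^bsub>M\<^esub> (a' \<ominus>\<^bsub>M\<^esub> b')) \<ominus>\<^bsub>M\<^esub> b"
      using c(2) that by (simp add: a_minus_def M.a_ac)
    then show ?thesis using c(3)[OF one_closed] that by blast
  qed
  moreover have "r \<odot>\<^bsub>M\<^esub> (a \<ominus>\<^bsub>M\<^esub> b) \<in> ?K" if "a \<in> C" "b \<in> C" "r \<in> carrier R" for a b r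
  proof -
    have "(b \<oplus>\<^bsub>M\<^esub> r \<odot>\<^bsub>M\<^esub> (a \<ominus>\<^bsub>M\<^esub> b)) \<ominus>\<^bsub>M\<^esub> b = r \<odot>\<^bsub>M\<^esub> (a \<ominus>\<^bsub>M\<^esub> b)"
      using c(2) that add_mdiff[of "r \<odot>\<^bsub>M\<^esub> (a \<ominus>\<^bsub>M\<^esub> b)" b] by (simp add: M.a_comm)
    then show ?thesis using c(3)[OF that(3) that(1,2,2)] that(2) by (metis (mono_tags, lifting) mem_Collect_eq)
  qed
  moreover have "?K \<subseteq> carrier M" using c(2) by auto
  ultimately show ?thesis unfolding submodule_iff by fastforce
qed

text \<open>A coset inside another one with the same difference module is equal to it. The
  descending chain condition therefore passes from submodules to cosets.\<close>

lemma aff_minimal: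
  assumes "\<C> \<noteq> {}" "\<And>C. C \<in> \<C> \<Longrightarrow> aff C"
  shows "\<exists>C\<in>\<C>. \<forall>D\<in>\<C>. D \<subseteq> C \<longrightarrow> D = C"
proof -
  define K where "K C = {a \<ominus>\<^bsub>M\<^esub> b | a b. a \<in> C \<and> b \<in> C}" for C
  have "\<exists>L\<in>K ` \<C>. \<forall>L'\<in>K ` \<C>. L' \<subseteq> L \<longrightarrow> L' = L"
    by (rule artinian_minimal) (use assms sm_differences in \<open>auto simp: K_def\<close>)
  then obtain C where C: "C \<in> \<C>" "\<forall>D\<in>\<C>. K D \<subseteq> K C \<longrightarrow> K D = K C" by auto
  have "D = C" if D: "D \<in> \<C>" "D \<subseteq> C" for D
  proof -
    have "K D = K C" using D C(2) unfolding K_def by blast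
    obtain d where d: "d \<in> D" using D assms(2) affD(1) by blast
    note dd = affD[OF assms(2)[OF D(1)]] and cc = affD(2)[OF assms(2)[OF C(1)]]
    have "c \<in> D" if c: "c \<in> C" for c
    proof -
      have "c \<ominus>\<^bsub>M\<^esub> d \<in> K C" using c d D unfolding K_def by blast
      then obtain a b where ab: "a \<in> D" "b \<in> D" "c \<ominus>\<^bsub>M\<^esub> d = a \<ominus>\<^bsub>M\<^esub> b"
        using \<open>K D = K C\<close> unfolding K_def by blast
      have "d \<oplus>\<^bsub>M\<^esub> \<one> \<odot>\<^bsub>M\<^esub> (a \<ominus>\<^bsub>M\<^esub> b) \<in> D" using dd(3)[OF one_closed ab(1,2) d] .
      moreover have "d \<oplus>\<^bsub>M\<^esub> \<one> \<odot>\<^bsub>M\<^esub> (a \<ominus>\<^bsub>M\<^esub> b) = c"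
        using ab(3)[symmetric] cc[OF c] dd(2)[OF d] mdiff_add[of c d] by (simp add: M.a_comm)
      ultimately show ?thesis by simp
    qed
    then show ?thesis using D by blast
  qed
  then show ?thesis using C(1) by blast
qed

lemma aff_mulset: 
  assumes "aff C" "t \<in> carrier R" shows "aff (mulset M t C)"
proof (rule affI)
  note c = affD[OF assms(1)]
  show "mulset M t C \<noteq> {}" "mulset M t C \<subseteq> carrier M" using c(1,2) assms(2) by (auto simp: mulset_def)
  fix r a b d assume r: "r \<in> carrier R" and "a \<in> mulset M t C" "b \<in> mulset M t C" "d \<in> mulset M t C"
  then obtain a' b' d' where "a' \<in> C" "b' \<in> C" "d' \<in> C" and
    eq: "a = t \<odot>\<^bsub>M\<^esub> a'" "b = t \<odot>\<^bsub>M\<^esub> b'" "d = t \<odot>\<^bsub>M\<^esub> d'" by (auto simp: mulset_def)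
  then have "d' \<oplus>\<^bsub>M\<^esub> r \<odot>\<^bsub>M\<^esub> (a' \<ominus>\<^bsub>M\<^esub> b') \<in> C" "a' \<in> carrier M" "b' \<in> carrier M" "d' \<in> carrier M"
    using c(2,3) r by blast+
  moreover from this have "d \<oplus>\<^bsub>M\<^esub> r \<odot>\<^bsub>M\<^esub> (a \<ominus>\<^bsub>M\<^esub> b) = t \<odot>\<^bsub>M\<^esub> (d' \<oplus>\<^bsub>M\<^esub> r \<odot>\<^bsub>M\<^esub> (a' \<ominus>\<^bsub>M\<^esub> b'))"
    using r assms(2) unfolding eq by (simp add: smult_r_distr smult_r_diff smult_comm[of t r])
  ultimately show "d \<oplus>\<^bsub>M\<^esub> r \<odot>\<^bsub>M\<^esub> (a \<ominus>\<^bsub>M\<^esub> b) \<in> mulset M t C" by (auto simp: mulset_def)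
qed

lemma aff_fibre:
  assumes "aff C" "t \<in> carrier R" "y \<in> carrier M" "{z \<in> C. t \<odot>\<^bsub>M\<^esub> z = y} \<noteq> {}"
  shows "aff {z \<in> C. t \<odot>\<^bsub>M\<^esub> z = y}"
proof (rule affI[OF assms(4)])
  note c = affD[OF assms(1)]
  show "{z \<in> C. t \<odot>\<^bsub>M\<^esub> z = y} \<subseteq> carrier M" using c(2) by blast
  fix r a b d assume r: "r \<in> carrier R" and h: "a \<in> {z \<in> C. t \<odot>\<^bsub>M\<^esub> z = y}" "b \<in> {z \<in> C. t \<odot>\<^bsub>M\<^esub> z = y}"
    "d \<in> {z \<in> C. t \<odot>\<^bsub>M\<^esub> z = y}"
  have m: "a \<in> carrier M" "b \<in> carrier M" "d \<in> carrier M" using h c(2) by blast+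
  have "t \<odot>\<^bsub>M\<^esub> (d \<oplus>\<^bsub>M\<^esub> r \<odot>\<^bsub>M\<^esub> (a \<ominus>\<^bsub>M\<^esub> b)) = t \<odot>\<^bsub>M\<^esub> d \<oplus>\<^bsub>M\<^esub> r \<odot>\<^bsub>M\<^esub> (t \<odot>\<^bsub>M\<^esub> a \<ominus>\<^bsub>M\<^esub> t \<odot>\<^bsub>M\<^esub> b)"
    using m r assms(2) by (simp add: smult_r_distr smult_r_diff smult_comm[of t r])
  also have "\<dots> = y" using h r assms(3) by simp
  finally show "d \<oplus>\<^bsub>M\<^esub> r \<odot>\<^bsub>M\<^esub> (a \<ominus>\<^bsub>M\<^esub> b) \<in> {z \<in> C. t \<odot>\<^bsub>M\<^esub> z = y}" using h c(3)[OF r] by blast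
qed

text \<open>Artinian modules are linearly compact: a minimal compatible family below \<open>C\<close> consists of
  singletons, because shrinking it to the images of its members, or to the fibres over a chosen
  point, gives compatible families again.\<close>
lemma compatible_section:
  assumes S: "S \<subseteq> carrier R" "\<one> \<in> S" "\<And>s t. s \<in> S \<Longrightarrow> t \<in> S \<Longrightarrow> s \<otimes> t \<in> S"
    and C0: "\<And>s. s \<in> S \<Longrightarrow> aff (C s)"
      "\<And>s t y. s \<in> S \<Longrightarrow> t \<in> S \<Longrightarrow> y \<in> C (s \<otimes> t) \<Longrightarrow> t \<odot>\<^bsub>M\<^esub> y \<in> C s"
  shows "\<exists>f. \<forall>s\<in>S. f s \<in> C s \<and> (\<forall>t\<in>S. t \<odot>\<^bsub>M\<^esub> f (s \<otimes> t) = f s)"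
proof -
  \<comment> \<open>Fixing the value \<open>{}\<close> outside \<open>S\<close> makes the pointwise
    order on functions compare families on \<open>S\<close> only, so that minimality yields an
    equation between functions.\<close>
  define A where "A = {D. (\<forall>s\<in>S. aff (D s) \<and> D s \<subseteq> C s) \<and> (\<forall>s. s \<notin> S \<longrightarrow> D s = {}) \<and>
      (\<forall>s\<in>S. \<forall>t\<in>S. \<forall>y\<in>D (s \<otimes> t). t \<odot>\<^bsub>M\<^esub> y \<in> D s)}"
  have SR: "s \<in> carrier R" if "s \<in> S" for s using S that by blast
  have "(\<lambda>s. if s \<in> S then C s else {}) \<in> A" using C0 S by (auto simp: A_def)
  then have ne: "A \<noteq> {}" by blast
  have "\<exists>D\<in>A. \<forall>E\<in>A. E \<le> D \<longrightarrow> E = D"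
  proof (rule predicate_Zorn)
    show "partial_order_on A (relation_of (\<lambda>x y. y \<le> x) A)"
      by (rule partial_order_on_relation_ofI) auto
    fix Ch assume Ch: "Ch \<in> Chains (relation_of (\<lambda>x y. y \<le> x) A)"
    have ChA: "D \<in> A" if "D \<in> Ch" for D
      using Ch that unfolding Chains_def relation_of_def by blast
    have lin: "D \<le> E \<or> E \<le> D" if "D \<in> Ch" "E \<in> Ch" for D E
      using Ch that unfolding Chains_def relation_of_def by blast
    show "\<exists>u\<in>A. \<forall>a\<in>Ch. u \<le> a"
    proof (cases "Ch = {}")
      case True
      then show ?thesis using ne by blast
    next
      case False
      define u where "u s = (\<Inter>D\<in>Ch. D s)" for s
      \<comment> \<open>By the chain condition for cosets some member of the chain attains the
        intersection at \<open>s\<close>. In particular the intersection is not empty.\<close>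
      have att: "\<exists>D\<in>Ch. u s = D s" if s: "s \<in> S" for s
      proof -
        define \<F> where "\<F> = {D s | D. D \<in> Ch}"
        have "\<exists>U\<in>\<F>. \<forall>V\<in>\<F>. V \<subseteq> U \<longrightarrow> V = U"
          by (rule aff_minimal) (use False ChA s in \<open>auto simp: A_def \<F>_def\<close>)
        then obtain U where U: "U \<in> \<F>" "\<And>V. V \<in> \<F> \<Longrightarrow> V \<subseteq> U \<Longrightarrow> V = U" by metis
        obtain D where D: "D \<in> Ch" "U = D s" using U(1) by (auto simp: \<F>_def)
        have D': "E s = D s" if "E \<in> Ch" "E s \<subseteq> D s" for E
          using U(2)[of "E s"] that D(2) by (auto simp: \<F>_def)
        have "D s \<subseteq> E s" if "E \<in> Ch" for E
          using lin[OF D(1) that] D'[OF that] by (auto simp: le_fun_def)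
        then have "u s = D s" using D(1) unfolding u_def by blast
        then show ?thesis using D(1) by blast
      qed
      have "u \<in> A"
      proof -
        have "aff (u s) \<and> u s \<subseteq> C s" if s: "s \<in> S" for s
        proof -
          obtain D where "D \<in> Ch" "u s = D s" using att[OF s] by blast
          then show ?thesis using ChA[of D] s by (simp add: A_def)
        qed
        moreover have "u s = {}" if "s \<notin> S" for s
          using that False ChA unfolding u_def A_def by blast
        moreover have "t \<odot>\<^bsub>M\<^esub> y \<in> u s" if "s \<in> S" "t \<in> S" "y \<in> u (s \<otimes> t)" for s t y
          using that ChA unfolding u_def A_def by blast
        ultimately show ?thesis unfolding A_def by blast
      qed
      moreover have "\<forall>a\<in>Ch. u \<le> a" by (auto simp: u_def le_fun_def)
      ultimately show ?thesis by blast
    qed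
  qed
  then obtain D where D: "D \<in> A" "\<And>E. E \<in> A \<Longrightarrow> E \<le> D \<Longrightarrow> E = D" by blast
  have Daff: "aff (D s)" if "s \<in> S" for s using D(1) that by (simp add: A_def)
  have DC: "D s \<subseteq> C s" if "s \<in> S" for s using D(1) that by (simp add: A_def)
  have Dt: "t \<odot>\<^bsub>M\<^esub> y \<in> D s" if "s \<in> S" "t \<in> S" "y \<in> D (s \<otimes> t)" for s t y
    using D(1) that by (simp add: A_def)
  have Dm: "y \<in> carrier M" if "s \<in> S" "y \<in> D s" for s y using Daff affD(2) that by blast
  have Deq: "E s = D s" if "s \<in> S" "\<And>s. s \<in> S \<Longrightarrow> aff (E s) \<and> E s \<subseteq> D s"
    "\<And>s t y. s \<in> S \<Longrightarrow> t \<in> S \<Longrightarrow> y \<in> E (s \<otimes> t) \<Longrightarrow> t \<odot>\<^bsub>M\<^esub> y \<in> E s" for E s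
  proof -
    let ?E = "\<lambda>s. if s \<in> S then E s else {}"
    have "E s \<subseteq> C s" if "s \<in> S" for s
      using \<open>\<And>s. s \<in> S \<Longrightarrow> aff (E s) \<and> E s \<subseteq> D s\<close>[OF that] DC[OF that] by blast
    then have "?E \<in> A" using that(2,3) S(3) by (simp add: A_def)
    moreover have "?E \<le> D" using that(2) by (simp add: le_fun_def)
    ultimately have "?E = D" by (rule D(2))
    then have "?E s = D s" by (rule fun_cong)
    then show ?thesis using that(1) by simp
  qed
  have surj: "D s = mulset M t (D (s \<otimes> t))" if s: "s \<in> S" and t: "t \<in> S" for s t
  proof -
    define E where "E s = (\<Inter>t\<in>S. mulset M t (D (s \<otimes> t)))" for s
    have att: "\<exists>t0\<in>S. E s = mulset M t0 (D (s \<otimes> t0))" if s: "s \<in> S" for s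
    proof -
      define \<F> where "\<F> = {mulset M t (D (s \<otimes> t)) | t. t \<in> S}"
      have "\<exists>U\<in>\<F>. \<forall>V\<in>\<F>. V \<subseteq> U \<longrightarrow> V = U"
        by (rule aff_minimal) (use S s Daff aff_mulset SR in \<open>auto simp: \<F>_def\<close>)
      then obtain U where U: "U \<in> \<F>" "\<And>V. V \<in> \<F> \<Longrightarrow> V \<subseteq> U \<Longrightarrow> V = U" by metis
      obtain t0 where t0: "t0 \<in> S" "U = mulset M t0 (D (s \<otimes> t0))" using U(1) by (auto simp: \<F>_def)
      have t0': "mulset M t (D (s \<otimes> t)) = mulset M t0 (D (s \<otimes> t0))"
        if "t \<in> S" "mulset M t (D (s \<otimes> t)) \<subseteq> mulset M t0 (D (s \<otimes> t0))" for t
        using U(2)[of "mulset M t (D (s \<otimes> t))"] that t0(2) by (auto simp: \<F>_def)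
      \<comment> \<open>The images are directed downwards, the one for \<open>u \<otimes> v\<close>
        lying in those for \<open>u\<close> and for \<open>v\<close>. Hence a minimal image is the
        least one and equals the whole intersection.\<close>
      have mono: "mulset M (u \<otimes> v) (D (s \<otimes> (u \<otimes> v))) \<subseteq> mulset M u (D (s \<otimes> u))" if "u \<in> S" "v \<in> S" for u v
      proof
        fix x assume "x \<in> mulset M (u \<otimes> v) (D (s \<otimes> (u \<otimes> v)))"
        then obtain y where "y \<in> D (s \<otimes> (u \<otimes> v))" and y2: "x = (u \<otimes> v) \<odot>\<^bsub>M\<^esub> y"
          unfolding mulset_def by blast
        then have y: "y \<in> D (s \<otimes> u \<otimes> v)" using SR s that by (simp add: m_assoc)
        then have "v \<odot>\<^bsub>M\<^esub> y \<in> D (s \<otimes> u)" using Dt that s S(3) by blast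
        moreover have "x = u \<odot>\<^bsub>M\<^esub> (v \<odot>\<^bsub>M\<^esub> y)"
          using y2 Dm[OF _ y] S(3) s that SR by (simp add: smult_assoc1)
        ultimately show "x \<in> mulset M u (D (s \<otimes> u))" by (auto simp: mulset_def)
      qed
      have "mulset M t0 (D (s \<otimes> t0)) \<subseteq> mulset M t (D (s \<otimes> t))" if t: "t \<in> S" for t
      proof -
        have "mulset M (t0 \<otimes> t) (D (s \<otimes> (t0 \<otimes> t))) = mulset M t0 (D (s \<otimes> t0))"
          using t0'[OF S(3)[OF t0(1) t]] mono[OF t0(1) t] by blast
        then show ?thesis using mono[OF t t0(1)] m_comm[OF SR[OF t] SR[OF t0(1)]] by simp
      qed
      then have "E s = mulset M t0 (D (s \<otimes> t0))" using t0(1) unfolding E_def by blast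
      then show ?thesis using t0(1) by blast
    qed
    have "E s = D s"
    proof (rule Deq[OF s])
      fix s assume s: "s \<in> S"
      obtain t0 where "t0 \<in> S" "E s = mulset M t0 (D (s \<otimes> t0))" using att[OF s] by blast
      then have "aff (E s)" using aff_mulset[OF Daff[OF S(3)[OF s]] SR] by simp
      moreover have "E s \<subseteq> mulset M \<one> (D (s \<otimes> \<one>))" unfolding E_def using S(2) by blast
      moreover have "mulset M \<one> (D (s \<otimes> \<one>)) \<subseteq> D s"
        using Dt[OF s S(2)] by (auto simp: mulset_def)
      ultimately show "aff (E s) \<and> E s \<subseteq> D s" by blast
    next
      fix s u y assume s: "s \<in> S" and u: "u \<in> S" and y: "y \<in> E (s \<otimes> u)"
      have "u \<odot>\<^bsub>M\<^esub> y \<in> mulset M t (D (s \<otimes> t))" if t: "t \<in> S" for t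
      proof -
        obtain z where z: "z \<in> D (s \<otimes> u \<otimes> t)" "y = t \<odot>\<^bsub>M\<^esub> z"
          using y t unfolding E_def mulset_def by blast
        have "s \<otimes> u \<otimes> t = (s \<otimes> t) \<otimes> u" using SR s t u by (simp add: m_ac)
        then have "u \<odot>\<^bsub>M\<^esub> z \<in> D (s \<otimes> t)" using Dt[of "s \<otimes> t" u z] S(3) s t u z(1) by simp
        moreover have "u \<odot>\<^bsub>M\<^esub> y = t \<odot>\<^bsub>M\<^esub> (u \<odot>\<^bsub>M\<^esub> z)"
          using z Dm[OF _ z(1)] S(3) s t u SR smult_comm by simp
        ultimately show ?thesis by (auto simp: mulset_def)
      qed
      then show "u \<odot>\<^bsub>M\<^esub> y \<in> E s" unfolding E_def by blast
    qed
    moreover have "E s \<subseteq> mulset M t (D (s \<otimes> t))" unfolding E_def using t by blast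
    moreover have "mulset M t (D (s \<otimes> t)) \<subseteq> D s" using Dt[OF s t] by (auto simp: mulset_def)
    ultimately show ?thesis by blast
  qed
  have single: "D s1 = {c}" if s1: "s1 \<in> S" and c: "c \<in> D s1" for s1 c
  proof -
    \<comment> \<open>\<open>E s\<close> keeps the points at \<open>s\<close> below a point at
      \<open>s \<otimes> s1\<close> that also lies above \<open>c\<close>. Such points exist because
      the transition maps are onto, and at \<open>s1\<close> itself only \<open>c\<close>
      survives.\<close>
    define E where "E s = mulset M s1 {z \<in> D (s \<otimes> s1). s \<odot>\<^bsub>M\<^esub> z = c}" for s
    have "E s1 = D s1"
    proof (rule Deq[OF s1])
      fix s assume s: "s \<in> S"
      have "c \<in> mulset M s (D (s1 \<otimes> s))" using surj[OF s1 s] c by simp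
      then have "{z \<in> D (s \<otimes> s1). s \<odot>\<^bsub>M\<^esub> z = c} \<noteq> {}"
        using m_comm[OF SR[OF s] SR[OF s1]] by (auto simp: mulset_def)
      then have "aff {z \<in> D (s \<otimes> s1). s \<odot>\<^bsub>M\<^esub> z = c}"
        using aff_fibre[OF Daff[OF S(3)[OF s s1]] SR[OF s] Dm[OF s1 c]] by blast
      then show "aff (E s) \<and> E s \<subseteq> D s"
        using aff_mulset SR[OF s1] Dt[OF s s1] unfolding E_def by (auto simp: mulset_def)
    next
      fix s t y assume s: "s \<in> S" and t: "t \<in> S" and y: "y \<in> E (s \<otimes> t)"
      then obtain z where z: "z \<in> D (s \<otimes> t \<otimes> s1)" "(s \<otimes> t) \<odot>\<^bsub>M\<^esub> z = c" "y = s1 \<odot>\<^bsub>M\<^esub> z"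
        unfolding E_def mulset_def by blast
      have zM: "z \<in> carrier M" using Dm[OF _ z(1)] S(3) s t s1 by simp
      have "s \<otimes> t \<otimes> s1 = (s \<otimes> s1) \<otimes> t" using SR s t s1 by (simp add: m_ac)
      then have "t \<odot>\<^bsub>M\<^esub> z \<in> D (s \<otimes> s1)" using Dt[of "s \<otimes> s1" t z] S(3) s t s1 z(1) by simp
      moreover have "s \<odot>\<^bsub>M\<^esub> (t \<odot>\<^bsub>M\<^esub> z) = c" using z zM SR s t by (simp add: smult_assoc1)
      moreover have "t \<odot>\<^bsub>M\<^esub> y = s1 \<odot>\<^bsub>M\<^esub> (t \<odot>\<^bsub>M\<^esub> z)" using z zM SR t s1 smult_comm by simp
      ultimately show "t \<odot>\<^bsub>M\<^esub> y \<in> E s" unfolding E_def by (auto simp: mulset_def)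
    qed
    moreover have "E s1 \<subseteq> {c}" by (auto simp: E_def mulset_def)
    ultimately show ?thesis using c by blast
  qed
  define f where "f s = (SOME c. c \<in> D s)" for s
  have f: "f s \<in> D s" if "s \<in> S" for s using affD(1)[OF Daff[OF that]] by (auto simp: f_def some_in_eq)
  have "t \<odot>\<^bsub>M\<^esub> f (s \<otimes> t) = f s" if "s \<in> S" "t \<in> S" for s t
    using single[OF that(1) f[OF that(1)]] Dt[OF that f[OF S(3)[OF that]]] by blast
  then show ?thesis using f DC by blast
qed

end

section \<open>Localization and colocalization\<close>

locale locring = cring R for R :: "'a ring" (structure) +
  fixes p assumes prime: "primeideal p R"
begin

definition "S = carrier R - p"
abbreviation "fr \<equiv> frac R p"
abbreviation "Q \<equiv> loc_ring R p"

lemma S_one [simp]: "\<one> \<in> S" using prime by (simp add: primeideal_iff S_def)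

lemma S_mult [simp]: "s \<in> S \<Longrightarrow> t \<in> S \<Longrightarrow> s \<otimes> t \<in> S" using prime by (auto simp: primeideal_iff S_def)

lemma S_closed [simp]: "s \<in> S \<Longrightarrow> s \<in> carrier R" by (simp add: S_def)

lemma p_sub: "p \<subseteq> carrier R" using prime by (simp add: primeideal_iff ideal_iff)

lemma mem_frac: "(b, t) \<in> fr a s \<longleftrightarrow> a \<in> carrier R \<and> s \<in> S \<and> b \<in> carrier R \<and> t \<in> S \<and>
   (\<exists>u\<in>S. u \<otimes> (a \<otimes> t) = u \<otimes> (b \<otimes> s))"
proof -
  have "u \<otimes> (a \<otimes> t \<ominus> b \<otimes> s) = \<zero> \<longleftrightarrow> u \<otimes> (a \<otimes> t) = u \<otimes> (b \<otimes> s)"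
    if "a \<in> carrier R" "b \<in> carrier R" "s \<in> S" "t \<in> S" "u \<in> S" for u
    using that r_right_minus_eq[of "u \<otimes> (a \<otimes> t)" "u \<otimes> (b \<otimes> s)"]
    by (simp add: minus_eq r_distr r_minus)
  then show ?thesis unfolding frac_def loc_rel_def S_def[symmetric] by auto
qed

lemma fracI: "a \<in> carrier R \<Longrightarrow> s \<in> S \<Longrightarrow> (a, s) \<in> fr a s"
  using S_one by (auto simp: mem_frac)

lemma frac_eq:
  assumes "a \<in> carrier R" "s \<in> S" "b \<in> carrier R" "t \<in> S"
  shows "fr a s = fr b t \<longleftrightarrow> (\<exists>u\<in>S. u \<otimes> (a \<otimes> t) = u \<otimes> (b \<otimes> s))"
proof
  assume "fr a s = fr b t"
  then have "(b, t) \<in> fr a s" using fracI assms by simp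
  then show "\<exists>u\<in>S. u \<otimes> (a \<otimes> t) = u \<otimes> (b \<otimes> s)" by (simp add: mem_frac)
next
  assume "\<exists>u\<in>S. u \<otimes> (a \<otimes> t) = u \<otimes> (b \<otimes> s)"
  have trans: "(c, w) \<in> fr a s"
    if "a \<in> carrier R" "s \<in> S" "b \<in> carrier R" "t \<in> S" "(c, w) \<in> fr b t" "u \<in> S"
      "u \<otimes> (a \<otimes> t) = u \<otimes> (b \<otimes> s)" for a s b t c w u
  proof -
    obtain v where v: "v \<in> S" "v \<otimes> (b \<otimes> w) = v \<otimes> (c \<otimes> t)" "c \<in> carrier R" "w \<in> S"
      using \<open>(c, w) \<in> fr b t\<close> unfolding mem_frac by blast
    have "u \<otimes> v \<otimes> t \<otimes> (a \<otimes> w) = v \<otimes> w \<otimes> (u \<otimes> (a \<otimes> t))" using that(1-4,6) v(1,3,4) by (simp add: m_ac)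
    also have "\<dots> = v \<otimes> w \<otimes> (u \<otimes> (b \<otimes> s))" unfolding that(7) ..
    also have "\<dots> = u \<otimes> s \<otimes> (v \<otimes> (b \<otimes> w))" using that(1-4,6) v(1,3,4) by (simp add: m_ac)
    also have "\<dots> = u \<otimes> v \<otimes> t \<otimes> (c \<otimes> s)" unfolding v(2) using that(1-4,6) v(1,3,4) by (simp add: m_ac)
    finally show ?thesis using that v unfolding mem_frac by (meson S_mult)
  qed
  show "fr a s = fr b t"
  proof (rule Set.set_eqI)
    fix x :: "'a \<times> 'a"
    obtain c w where x: "x = (c, w)" by (cases x)
    show "x \<in> fr a s \<longleftrightarrow> x \<in> fr b t"
      using trans[of a s b t c w] trans[of b t a s c w] assms
        \<open>\<exists>u\<in>S. u \<otimes> (a \<otimes> t) = u \<otimes> (b \<otimes> s)\<close> unfolding x by metis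
  qed
qed

lemma frac_eqI:
  "a \<otimes> t = b \<otimes> s \<Longrightarrow> a \<in> carrier R \<Longrightarrow> s \<in> S \<Longrightarrow> b \<in> carrier R \<Longrightarrow> t \<in> S \<Longrightarrow> fr a s = fr b t"
  using S_one by (auto simp: frac_eq)

lemma carrier_Q: "x \<in> carrier Q \<longleftrightarrow> (\<exists>a\<in>carrier R. \<exists>s\<in>S. x = fr a s)"
  by (auto simp: loc_ring_def quotient_def frac_def S_def)

lemma frac_closed [simp]: "a \<in> carrier R \<Longrightarrow> s \<in> S \<Longrightarrow> fr a s \<in> carrier Q"
  by (auto simp: carrier_Q)

lemma Q_cases: "x \<in> carrier Q \<Longrightarrow> (\<And>a s. a \<in> carrier R \<Longrightarrow> s \<in> S \<Longrightarrow> x = fr a s \<Longrightarrow> P) \<Longrightarrow> P"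
  by (auto simp: carrier_Q)

text \<open>The product is defined by choosing a class obtained from representatives. The choice is
  harmless because all pairs of representatives give the same class.\<close>

lemma Q_mult:
  assumes "a \<in> carrier R" "s \<in> S" "b \<in> carrier R" "t \<in> S"
  shows "fr a s \<otimes>\<^bsub>Q\<^esub> fr b t = fr (a \<otimes> b) (s \<otimes> t)"
proof -
  have "Z = fr (a \<otimes> b) (s \<otimes> t)"
    if h: "(a', s') \<in> fr a s" "(b', t') \<in> fr b t" "Z = fr (a' \<otimes> b') (s' \<otimes> t')" for Z a' s' b' t'
  proof -
    obtain u v where uv: "u \<in> S" "v \<in> S" "u \<otimes> (a \<otimes> s') = u \<otimes> (a' \<otimes> s)" "v \<otimes> (b \<otimes> t') = v \<otimes> (b' \<otimes> t)"
      and c: "a' \<in> carrier R" "s' \<in> S" "b' \<in> carrier R" "t' \<in> S" using h by (auto simp: mem_frac)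
    have "u \<otimes> v \<otimes> ((a' \<otimes> b') \<otimes> (s \<otimes> t)) = (u \<otimes> (a' \<otimes> s)) \<otimes> (v \<otimes> (b' \<otimes> t))"
      using assms c uv(1,2) by (simp add: m_ac)
    also have "\<dots> = u \<otimes> v \<otimes> ((a \<otimes> b) \<otimes> (s' \<otimes> t'))"
      unfolding uv(3,4)[symmetric] using assms c uv(1,2) by (simp add: m_ac)
    finally show ?thesis using h(3) S_mult assms c uv by (subst h(3), subst frac_eq) auto
  qed
  then have "(SOME Z. \<exists>a' s' b' t'. (a', s') \<in> fr a s \<and> (b', t') \<in> fr b t \<and>
      Z = fr (a' \<otimes> b') (s' \<otimes> t')) = fr (a \<otimes> b) (s \<otimes> t)"
    using fracI[OF assms(1,2)] fracI[OF assms(3,4)]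
    by (intro some_equality) (intro exI conjI | assumption | rule refl | elim exE conjE)+
  then show ?thesis by (simp add: loc_ring_def)
qed

lemma Q_add:
  assumes "a \<in> carrier R" "s \<in> S" "b \<in> carrier R" "t \<in> S"
  shows "fr a s \<oplus>\<^bsub>Q\<^esub> fr b t = fr (a \<otimes> t \<oplus> b \<otimes> s) (s \<otimes> t)"
proof -
  have "Z = fr (a \<otimes> t \<oplus> b \<otimes> s) (s \<otimes> t)"
    if h: "(a', s') \<in> fr a s" "(b', t') \<in> fr b t" "Z = fr (a' \<otimes> t' \<oplus> b' \<otimes> s') (s' \<otimes> t')" for Z a' s' b' t'
  proof -
    obtain u v where uv: "u \<in> S" "v \<in> S" "u \<otimes> (a \<otimes> s') = u \<otimes> (a' \<otimes> s)" "v \<otimes> (b \<otimes> t') = v \<otimes> (b' \<otimes> t)"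
      and c: "a' \<in> carrier R" "s' \<in> S" "b' \<in> carrier R" "t' \<in> S" using h by (auto simp: mem_frac)
    have "u \<otimes> v \<otimes> ((a' \<otimes> t' \<oplus> b' \<otimes> s') \<otimes> (s \<otimes> t)) =
        (u \<otimes> (a' \<otimes> s)) \<otimes> (v \<otimes> (t \<otimes> t')) \<oplus> (v \<otimes> (b' \<otimes> t)) \<otimes> (u \<otimes> (s \<otimes> s'))"
      using assms c uv(1,2) by (simp add: m_ac l_distr r_distr)
    also have "\<dots> = u \<otimes> v \<otimes> ((a \<otimes> t \<oplus> b \<otimes> s) \<otimes> (s' \<otimes> t'))"
      unfolding uv(3,4)[symmetric] using assms c uv(1,2) by (simp add: m_ac l_distr r_distr)
    finally show ?thesis using h(3) S_mult assms c uv by (subst h(3), subst frac_eq) auto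
  qed
  then have "(SOME Z. \<exists>a' s' b' t'. (a', s') \<in> fr a s \<and> (b', t') \<in> fr b t \<and>
      Z = fr (a' \<otimes> t' \<oplus> b' \<otimes> s') (s' \<otimes> t')) = fr (a \<otimes> t \<oplus> b \<otimes> s) (s \<otimes> t)"
    using fracI[OF assms(1,2)] fracI[OF assms(3,4)]
    by (intro some_equality) (intro exI conjI | assumption | rule refl | elim exE conjE)+
  then show ?thesis by (simp add: loc_ring_def)
qed

lemma Q_zero: "\<zero>\<^bsub>Q\<^esub> = fr \<zero> \<one>" and Q_one: "\<one>\<^bsub>Q\<^esub> = fr \<one> \<one>"
  by (simp_all add: loc_ring_def)


lemma cring_Q: "cring Q"
proof (rule cringI)
  show "abelian_group Q"
  proof (rule abelian_groupI)
    fix x y assume "x \<in> carrier Q" "y \<in> carrier Q"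
    then show "x \<oplus>\<^bsub>Q\<^esub> y \<in> carrier Q" 
      by (elim Q_cases) (simp add: Q_add)
  next
    show "\<zero>\<^bsub>Q\<^esub> \<in> carrier Q" using S_one by (simp add: Q_zero)
  next
    fix x y z assume "x \<in> carrier Q" "y \<in> carrier Q" "z \<in> carrier Q"
    then obtain a s b t c w where h: "x = fr a s" "y = fr b t" "z = fr c w" "a \<in> carrier R"
      "b \<in> carrier R" "c \<in> carrier R" "s \<in> S" "t \<in> S" "w \<in> S" by (auto simp: carrier_Q)
    show "x \<oplus>\<^bsub>Q\<^esub> y \<oplus>\<^bsub>Q\<^esub> z = x \<oplus>\<^bsub>Q\<^esub> (y \<oplus>\<^bsub>Q\<^esub> z)"
      using h(4-9) unfolding h(1-3) by (simp add: Q_add S_mult l_distr r_distr m_ac a_ac)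
  next
    fix x y assume "x \<in> carrier Q" "y \<in> carrier Q"
    then obtain a s b t where h: "x = fr a s" "y = fr b t" "a \<in> carrier R"
      "b \<in> carrier R" "s \<in> S" "t \<in> S" by (auto simp: carrier_Q)
    show "x \<oplus>\<^bsub>Q\<^esub> y = y \<oplus>\<^bsub>Q\<^esub> x"
      using h(3-6) unfolding h(1,2) by (simp add: Q_add a_comm m_comm)
  next
    fix x assume "x \<in> carrier Q"
    then obtain a s where h: "x = fr a s" "a \<in> carrier R" "s \<in> S" by (auto simp: carrier_Q)
    show "\<zero>\<^bsub>Q\<^esub> \<oplus>\<^bsub>Q\<^esub> x = x"
      using h(2,3) S_one unfolding h(1) Q_zero by (simp add: Q_add)
    have "fr (\<ominus> a) s \<oplus>\<^bsub>Q\<^esub> fr a s = \<zero>\<^bsub>Q\<^esub>"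
      using h(2,3) S_one S_mult unfolding Q_zero
      by (simp add: Q_add l_minus l_neg) (rule frac_eqI; simp)
    then show "\<exists>y\<in>carrier Q. y \<oplus>\<^bsub>Q\<^esub> x = \<zero>\<^bsub>Q\<^esub>"
      using h by (intro bexI[of _ "fr (\<ominus> a) s"]) simp_all
  qed
  show "comm_monoid Q"
  proof (rule comm_monoidI)
    fix x y assume "x \<in> carrier Q" "y \<in> carrier Q"
    then show "x \<otimes>\<^bsub>Q\<^esub> y \<in> carrier Q" 
      by (elim Q_cases) (simp add: Q_mult)
  next
    show "\<one>\<^bsub>Q\<^esub> \<in> carrier Q" using S_one by (simp add: Q_one)
  next
    fix x y z assume "x \<in> carrier Q" "y \<in> carrier Q" "z \<in> carrier Q"
    then obtain a s b t c w where h: "x = fr a s" "y = fr b t" "z = fr c w" "a \<in> carrier R"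
      "b \<in> carrier R" "c \<in> carrier R" "s \<in> S" "t \<in> S" "w \<in> S" by (auto simp: carrier_Q)
    show "x \<otimes>\<^bsub>Q\<^esub> y \<otimes>\<^bsub>Q\<^esub> z = x \<otimes>\<^bsub>Q\<^esub> (y \<otimes>\<^bsub>Q\<^esub> z)"
      using h(4-9) unfolding h(1-3) by (simp add: Q_mult S_mult m_assoc)
  next
    fix x assume "x \<in> carrier Q"
    then obtain a s where h: "x = fr a s" "a \<in> carrier R" "s \<in> S" by (auto simp: carrier_Q)
    show "\<one>\<^bsub>Q\<^esub> \<otimes>\<^bsub>Q\<^esub> x = x"
      using h(2,3) S_one unfolding h(1) Q_one by (simp add: Q_mult)
  next
    fix x y assume "x \<in> carrier Q" "y \<in> carrier Q"
    then obtain a s b t where h: "x = fr a s" "y = fr b t" "a \<in> carrier R"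
      "b \<in> carrier R" "s \<in> S" "t \<in> S" by (auto simp: carrier_Q)
    show "x \<otimes>\<^bsub>Q\<^esub> y = y \<otimes>\<^bsub>Q\<^esub> x"
      using h(3-6) unfolding h(1,2) by (simp add: Q_mult m_comm)
  qed
  fix x y z assume "x \<in> carrier Q" "y \<in> carrier Q" "z \<in> carrier Q"
  then obtain a s b t c w where h: "x = fr a s" "y = fr b t" "z = fr c w" "a \<in> carrier R"
    "b \<in> carrier R" "c \<in> carrier R" "s \<in> S" "t \<in> S" "w \<in> S" by (auto simp: carrier_Q)
  have "(x \<oplus>\<^bsub>Q\<^esub> y) \<otimes>\<^bsub>Q\<^esub> z = fr ((a \<otimes> t \<oplus> b \<otimes> s) \<otimes> c) (s \<otimes> t \<otimes> w)"
    using h(4-9) S_mult unfolding h(1-3) by (simp add: Q_add Q_mult)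
  moreover have "x \<otimes>\<^bsub>Q\<^esub> z \<oplus>\<^bsub>Q\<^esub> y \<otimes>\<^bsub>Q\<^esub> z = fr ((a \<otimes> c) \<otimes> (t \<otimes> w) \<oplus> (b \<otimes> c) \<otimes> (s \<otimes> w)) ((s \<otimes> w) \<otimes> (t \<otimes> w))"
    using h(4-9) S_mult unfolding h(1-3) by (simp add: Q_add Q_mult)
  moreover have "fr ((a \<otimes> t \<oplus> b \<otimes> s) \<otimes> c) (s \<otimes> t \<otimes> w) = fr ((a \<otimes> c) \<otimes> (t \<otimes> w) \<oplus> (b \<otimes> c) \<otimes> (s \<otimes> w)) ((s \<otimes> w) \<otimes> (t \<otimes> w))"
    using h(4-9) S_mult by (intro frac_eqI) (simp_all add: l_distr r_distr m_ac)
  ultimately show "(x \<oplus>\<^bsub>Q\<^esub> y) \<otimes>\<^bsub>Q\<^esub> z = x \<otimes>\<^bsub>Q\<^esub> z \<oplus>\<^bsub>Q\<^esub> y \<otimes>\<^bsub>Q\<^esub> z" by simp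
qed

end

context locring
begin

lemma frac_split: "a \<in> carrier R \<Longrightarrow> s \<in> S \<Longrightarrow> fr a s = fr a \<one> \<otimes>\<^bsub>Q\<^esub> fr \<one> s"
  by (simp add: Q_mult)

lemma ideal_res: "ideal (res_ideal R p) Q"
proof -
  interpret Q: cring Q by (rule cring_Q)
  have p: "\<zero> \<in> p" "\<And>x y. x \<in> p \<Longrightarrow> y \<in> p \<Longrightarrow> x \<oplus> y \<in> p" "\<And>x r. x \<in> p \<Longrightarrow> r \<in> carrier R \<Longrightarrow> r \<otimes> x \<in> p"
    using prime unfolding primeideal_iff ideal_iff by blast+
  have p': "x \<in> p \<Longrightarrow> r \<in> carrier R \<Longrightarrow> x \<otimes> r \<in> p" "x \<in> p \<Longrightarrow> x \<in> carrier R" for x r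
    using p(3) p_sub m_comm[of x r] by auto
  show ?thesis unfolding Q.ideal_iff res_ideal_def S_def[symmetric]
  proof (intro conjI ballI)
    show "{fr a s |a s. a \<in> p \<and> s \<in> S} \<subseteq> carrier Q" using p' by auto
    show "\<zero>\<^bsub>Q\<^esub> \<in> {fr a s |a s. a \<in> p \<and> s \<in> S}" using p(1) S_one Q_zero by blast
  next
    fix x y assume "x \<in> {fr a s |a s. a \<in> p \<and> s \<in> S}" "y \<in> {fr a s |a s. a \<in> p \<and> s \<in> S}"
    then obtain a s b t where h: "x = fr a s" "y = fr b t" "a \<in> p" "b \<in> p" "s \<in> S" "t \<in> S" by blast
    then have "x \<oplus>\<^bsub>Q\<^esub> y = fr (a \<otimes> t \<oplus> b \<otimes> s) (s \<otimes> t)" "a \<otimes> t \<oplus> b \<otimes> s \<in> p"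
      using p p' by (simp_all add: Q_add)
    then show "x \<oplus>\<^bsub>Q\<^esub> y \<in> {fr a s |a s. a \<in> p \<and> s \<in> S}" using S_mult[OF h(5,6)] S_mult[OF h(6,5)] by auto
  next
    fix x r assume "x \<in> {fr a s |a s. a \<in> p \<and> s \<in> S}" "r \<in> carrier Q"
    then obtain a s b t where h: "x = fr a s" "r = fr b t" "a \<in> p" "b \<in> carrier R" "s \<in> S" "t \<in> S"
      by (auto simp: carrier_Q)
    then have "r \<otimes>\<^bsub>Q\<^esub> x = fr (b \<otimes> a) (t \<otimes> s)" "b \<otimes> a \<in> p"
      using p p' by (simp_all add: Q_mult)
    then show "r \<otimes>\<^bsub>Q\<^esub> x \<in> {fr a s |a s. a \<in> p \<and> s \<in> S}" using S_mult[OF h(5,6)] S_mult[OF h(6,5)] by auto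
  qed
qed

text \<open>An ideal of the localization is generated by its contraction, since a/s = (1/s)(a/1).
  The images of finitely many generators of the contraction therefore suffice.\<close>

lemma noetherian_Q:
  assumes "noetherian_ring R" shows "noetherian_ring Q"
proof -
  interpret N: noetherian_ring R by fact
  interpret Q: cring Q by (rule cring_Q)
  show ?thesis
  proof (rule Q.noetherian_ringI)
    fix I assume I: "ideal I Q"
    note i = I[unfolded Q.ideal_iff]
    define J where "J = {a \<in> carrier R. fr a \<one> \<in> I}"
    have "ideal J R" unfolding ideal_iff J_def
    proof (intro conjI ballI)
      show "\<zero> \<in> {a \<in> carrier R. fr a \<one> \<in> I}" using i by (simp add: Q_zero)
    next
      fix x y assume h: "x \<in> {a \<in> carrier R. fr a \<one> \<in> I}" "y \<in> {a \<in> carrier R. fr a \<one> \<in> I}"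
      then have "fr x \<one> \<oplus>\<^bsub>Q\<^esub> fr y \<one> \<in> I" using i by blast
      then show "x \<oplus> y \<in> {a \<in> carrier R. fr a \<one> \<in> I}" using h by (simp add: Q_add)
    next
      fix r x assume h: "x \<in> {a \<in> carrier R. fr a \<one> \<in> I}" "r \<in> carrier R"
      then have "fr r \<one> \<otimes>\<^bsub>Q\<^esub> fr x \<one> \<in> I" using i by auto
      then show "r \<otimes> x \<in> {a \<in> carrier R. fr a \<one> \<in> I}" using h by (simp add: Q_mult)
    qed auto
    then obtain A where A: "A \<subseteq> carrier R" "finite A" "J = Idl A" using N.finetely_gen by blast
    define B where "B = (\<lambda>a. fr a \<one>) ` A"
    have "A \<subseteq> J" using A genideal_self by blast
    have Bc: "B \<subseteq> carrier Q" using A by (auto simp: B_def)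
    have "B \<subseteq> I" using \<open>A \<subseteq> J\<close> by (auto simp: B_def J_def)
    then have "Idl\<^bsub>Q\<^esub> B \<subseteq> I" using I Q.genideal_minimal by blast
    moreover have "I \<subseteq> Idl\<^bsub>Q\<^esub> B"
    proof
      fix x assume x: "x \<in> I"
      then have "x \<in> carrier Q" using i by blast
      then obtain a s where as: "a \<in> carrier R" "s \<in> S" "x = fr a s" by (auto simp: carrier_Q)
      note gb = Q.genideal_ideal[OF Bc, unfolded Q.ideal_iff]
      define L where "L = {a \<in> carrier R. fr a \<one> \<in> Idl\<^bsub>Q\<^esub> B}"
      have "ideal L R" unfolding ideal_iff L_def
      proof (intro conjI ballI)
        show "\<zero> \<in> {a \<in> carrier R. fr a \<one> \<in> Idl\<^bsub>Q\<^esub> B}" using gb by (simp add: Q_zero)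
      next
        fix x y assume h: "x \<in> {a \<in> carrier R. fr a \<one> \<in> Idl\<^bsub>Q\<^esub> B}" "y \<in> {a \<in> carrier R. fr a \<one> \<in> Idl\<^bsub>Q\<^esub> B}"
        then have "fr x \<one> \<oplus>\<^bsub>Q\<^esub> fr y \<one> \<in> Idl\<^bsub>Q\<^esub> B" using gb by blast
        then show "x \<oplus> y \<in> {a \<in> carrier R. fr a \<one> \<in> Idl\<^bsub>Q\<^esub> B}" using h by (simp add: Q_add)
      next
        fix r x assume h: "x \<in> {a \<in> carrier R. fr a \<one> \<in> Idl\<^bsub>Q\<^esub> B}" "r \<in> carrier R"
        then have "fr r \<one> \<otimes>\<^bsub>Q\<^esub> fr x \<one> \<in> Idl\<^bsub>Q\<^esub> B" using gb by auto
        then show "r \<otimes> x \<in> {a \<in> carrier R. fr a \<one> \<in> Idl\<^bsub>Q\<^esub> B}" using h by (simp add: Q_mult)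
      qed auto
      moreover have "A \<subseteq> L" using A(1) Q.genideal_self[OF Bc] by (auto simp: L_def B_def)
      ultimately have "J \<subseteq> L" unfolding A(3) by (rule genideal_minimal)
      have "fr s \<one> \<otimes>\<^bsub>Q\<^esub> x \<in> I" using i x as by auto
      moreover have "fr s \<one> \<otimes>\<^bsub>Q\<^esub> x = fr a \<one>" using as by (simp add: Q_mult) (rule frac_eqI; simp add: m_comm)
      ultimately have "a \<in> L" using \<open>J \<subseteq> L\<close> as by (auto simp: J_def)
      then have "fr \<one> s \<otimes>\<^bsub>Q\<^esub> fr a \<one> \<in> Idl\<^bsub>Q\<^esub> B" using gb as by (auto simp: L_def)
      then show "x \<in> Idl\<^bsub>Q\<^esub> B" using as by (simp add: Q_mult)
    qed
    ultimately show "\<exists>A\<subseteq>carrier Q. finite A \<and> I = Idl\<^bsub>Q\<^esub> A" using Bc A(2) by (intro exI[of _ B]) (auto simp: B_def)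
  qed
qed

end

section \<open>The colocalization Hom(R_p, M)\<close>

locale coloc = artmod R M + locring R p
  for R :: "'a ring" (structure) and M :: "('a, 'm) module" (structure) and p
begin

abbreviation "H \<equiv> hom_loc R M p"

lemma H_carrier: "f \<in> carrier H \<longleftrightarrow> f \<in> carrier Q \<rightarrow> carrier M \<and> f \<in> extensional (carrier Q) \<and>
    (\<forall>x\<in>carrier Q. \<forall>y\<in>carrier Q. f (x \<oplus>\<^bsub>Q\<^esub> y) = f x \<oplus>\<^bsub>M\<^esub> f y) \<and>
    (\<forall>r\<in>carrier R. \<forall>x\<in>carrier Q. f (fr r \<one> \<otimes>\<^bsub>Q\<^esub> x) = r \<odot>\<^bsub>M\<^esub> f x)"
  by (simp add: hom_loc_def Let_def)

lemma H_zero: "\<zero>\<^bsub>H\<^esub> = restrict (\<lambda>x. \<zero>\<^bsub>M\<^esub>) (carrier Q)"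
  and H_add: "f \<oplus>\<^bsub>H\<^esub> g = restrict (\<lambda>x. f x \<oplus>\<^bsub>M\<^esub> g x) (carrier Q)"
  and H_smult: "a \<odot>\<^bsub>H\<^esub> f = restrict (\<lambda>x. f (a \<otimes>\<^bsub>Q\<^esub> x)) (carrier Q)"
  by (simp_all add: hom_loc_def Let_def)

lemma HD:
  assumes "f \<in> carrier H"
  shows "\<And>x. x \<in> carrier Q \<Longrightarrow> f x \<in> carrier M"
    "\<And>x y. x \<in> carrier Q \<Longrightarrow> y \<in> carrier Q \<Longrightarrow> f (x \<oplus>\<^bsub>Q\<^esub> y) = f x \<oplus>\<^bsub>M\<^esub> f y"
    "\<And>r x. r \<in> carrier R \<Longrightarrow> x \<in> carrier Q \<Longrightarrow> f (fr r \<one> \<otimes>\<^bsub>Q\<^esub> x) = r \<odot>\<^bsub>M\<^esub> f x"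
    "f \<in> extensional (carrier Q)"
  using assms by (auto simp: H_carrier Pi_iff)

lemma H_eqI: "f \<in> carrier H \<Longrightarrow> g \<in> carrier H \<Longrightarrow> (\<And>x. x \<in> carrier Q \<Longrightarrow> f x = g x) \<Longrightarrow> f = g"
  using extensionalityI[OF HD(4) HD(4)] by blast

lemma module_H: "module Q H"
proof -
  interpret Q: cring Q by (rule cring_Q)
  have add: "f \<oplus>\<^bsub>H\<^esub> g \<in> carrier H" if "f \<in> carrier H" "g \<in> carrier H" for f g
    using HD(1-3)[OF that(1)] HD(1-3)[OF that(2)]
    by (auto simp: H_add H_carrier smult_r_distr M.a_ac)
  have sm: "a \<odot>\<^bsub>H\<^esub> f \<in> carrier H" if "a \<in> carrier Q" "f \<in> carrier H" for a f
    using HD(1-3)[OF that(2)] that(1)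
    by (auto simp: H_smult H_carrier Q.r_distr Q.m_lcomm[of a])
  have neg: "restrict (\<lambda>x. \<ominus>\<^bsub>M\<^esub> f x) (carrier Q) \<in> carrier H" if "f \<in> carrier H" for f
    using HD(1-3)[OF that] by (auto simp: H_carrier smult_r_minus M.minus_add M.a_comm)
  have zero: "\<zero>\<^bsub>H\<^esub> \<in> carrier H" by (auto simp: H_carrier H_zero)
  show ?thesis
  proof (rule moduleI)
    show "abelian_group H"
    proof (rule abelian_groupI)
      fix f g h assume fgh: "f \<in> carrier H" "g \<in> carrier H" "h \<in> carrier H"
      show "f \<oplus>\<^bsub>H\<^esub> g \<oplus>\<^bsub>H\<^esub> h = f \<oplus>\<^bsub>H\<^esub> (g \<oplus>\<^bsub>H\<^esub> h)"
        using HD(1)[OF fgh(1)] HD(1)[OF fgh(2)] HD(1)[OF fgh(3)]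
        by (auto simp: H_add M.a_assoc cong: restrict_cong)
    next
      fix f g assume fg: "f \<in> carrier H" "g \<in> carrier H"
      show "f \<oplus>\<^bsub>H\<^esub> g = g \<oplus>\<^bsub>H\<^esub> f"
        using HD(1)[OF fg(1)] HD(1)[OF fg(2)] by (auto simp: H_add M.a_comm cong: restrict_cong)
    next
      fix f assume f: "f \<in> carrier H"
      show "\<zero>\<^bsub>H\<^esub> \<oplus>\<^bsub>H\<^esub> f = f"
        by (rule H_eqI[OF add[OF zero f] f]) (use HD(1)[OF f] in \<open>auto simp: H_add H_zero\<close>)
      show "\<exists>g\<in>carrier H. g \<oplus>\<^bsub>H\<^esub> f = \<zero>\<^bsub>H\<^esub>"
        by (rule bexI[OF _ neg[OF f]])
          (use HD(1)[OF f] in \<open>auto simp: H_add H_zero M.l_neg cong: restrict_cong\<close>)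
    qed (use add zero in auto)
  next
    fix a b f assume h: "a \<in> carrier Q" "b \<in> carrier Q" "f \<in> carrier H"
    show "(a \<oplus>\<^bsub>Q\<^esub> b) \<odot>\<^bsub>H\<^esub> f = a \<odot>\<^bsub>H\<^esub> f \<oplus>\<^bsub>H\<^esub> b \<odot>\<^bsub>H\<^esub> f"
      using HD(2)[OF h(3)] h(1,2) by (auto simp: H_add H_smult Q.l_distr cong: restrict_cong)
    show "(a \<otimes>\<^bsub>Q\<^esub> b) \<odot>\<^bsub>H\<^esub> f = a \<odot>\<^bsub>H\<^esub> (b \<odot>\<^bsub>H\<^esub> f)"
      using h(1,2) by (auto simp: H_smult Q.m_ac cong: restrict_cong)
  next
    fix a f g assume h: "a \<in> carrier Q" "f \<in> carrier H" "g \<in> carrier H"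
    show "a \<odot>\<^bsub>H\<^esub> (f \<oplus>\<^bsub>H\<^esub> g) = a \<odot>\<^bsub>H\<^esub> f \<oplus>\<^bsub>H\<^esub> a \<odot>\<^bsub>H\<^esub> g"
      using h(1) by (auto simp: H_add H_smult cong: restrict_cong)
  next
    fix f assume f: "f \<in> carrier H"
    show "\<one>\<^bsub>Q\<^esub> \<odot>\<^bsub>H\<^esub> f = f"
      by (rule H_eqI[OF sm[OF Q.one_closed f] f]) (simp add: H_smult)
  qed (use sm cring_Q in auto)
qed

lemma H_frac:
  assumes "f \<in> carrier H" "a \<in> carrier R" "s \<in> S" shows "f (fr a s) = a \<odot>\<^bsub>M\<^esub> f (fr \<one> s)"
  using HD(3)[OF assms(1,2), of "fr \<one> s"] assms by (simp add: frac_split[symmetric])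

text \<open>Hom(R_p, M) is the inverse limit of copies of \<open>M\<close> indexed by
  \<open>S\<close>: \<open>f s\<close> is the value at 1/s, and the transition map from
  \<open>s \<otimes> t\<close> to \<open>s\<close> is multiplication by \<open>t\<close>.
  Well-definedness is checked at the common denominator \<open>s \<otimes> t \<otimes> u\<close>,
  where \<open>u\<close> witnesses the equality of the fractions.\<close>

lemma H_extend:
  assumes f: "\<And>s. s \<in> S \<Longrightarrow> f s \<in> carrier M"
    and c: "\<And>s t. s \<in> S \<Longrightarrow> t \<in> S \<Longrightarrow> t \<odot>\<^bsub>M\<^esub> f (s \<otimes> t) = f s"
  shows "\<exists>F\<in>carrier H. \<forall>a\<in>carrier R. \<forall>s\<in>S. F (fr a s) = a \<odot>\<^bsub>M\<^esub> f s"
proof -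
  have wd: "a \<odot>\<^bsub>M\<^esub> f s = b \<odot>\<^bsub>M\<^esub> f t"
    if h: "a \<in> carrier R" "s \<in> S" "b \<in> carrier R" "t \<in> S" "fr a s = fr b t" for a s b t
  proof -
    obtain u where u: "u \<in> S" "u \<otimes> (a \<otimes> t) = u \<otimes> (b \<otimes> s)" using h by (auto simp: frac_eq)
    have *: "a \<odot>\<^bsub>M\<^esub> f s = (u \<otimes> (a \<otimes> t)) \<odot>\<^bsub>M\<^esub> f (s \<otimes> t \<otimes> u)"
      if h: "a \<in> carrier R" "s \<in> S" "t \<in> S" for a s t
    proof -
      have "f s = (t \<otimes> u) \<odot>\<^bsub>M\<^esub> f (s \<otimes> (t \<otimes> u))" using c[of s "t \<otimes> u"] h u(1) by simp
      then have "a \<odot>\<^bsub>M\<^esub> f s = (a \<otimes> (t \<otimes> u)) \<odot>\<^bsub>M\<^esub> f (s \<otimes> (t \<otimes> u))"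
        using h u(1) f by (simp add: smult_assoc1)
      then show ?thesis using h u(1) by (simp add: m_ac)
    qed
    have "a \<odot>\<^bsub>M\<^esub> f s = (u \<otimes> (b \<otimes> s)) \<odot>\<^bsub>M\<^esub> f (s \<otimes> t \<otimes> u)" using *[OF h(1,2,4)] u(2) by simp
    also have "s \<otimes> t \<otimes> u = t \<otimes> s \<otimes> u" using h u by (simp add: m_comm)
    finally show ?thesis using *[OF h(3,4,2)] by simp
  qed
  define F where "F = restrict (\<lambda>x. SOME y. \<exists>a\<in>carrier R. \<exists>s\<in>S. x = fr a s \<and> y = a \<odot>\<^bsub>M\<^esub> f s) (carrier Q)"
  have F: "F (fr a s) = a \<odot>\<^bsub>M\<^esub> f s" if "a \<in> carrier R" "s \<in> S" for a s
  proof -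
    have "(SOME y. \<exists>b\<in>carrier R. \<exists>t\<in>S. fr a s = fr b t \<and> y = b \<odot>\<^bsub>M\<^esub> f t) = a \<odot>\<^bsub>M\<^esub> f s"
    proof (rule some_equality)
      show "\<exists>b\<in>carrier R. \<exists>t\<in>S. fr a s = fr b t \<and> a \<odot>\<^bsub>M\<^esub> f s = b \<odot>\<^bsub>M\<^esub> f t" using that by blast
      fix y assume "\<exists>b\<in>carrier R. \<exists>t\<in>S. fr a s = fr b t \<and> y = b \<odot>\<^bsub>M\<^esub> f t"
      then obtain b t where "b \<in> carrier R" "t \<in> S" "fr a s = fr b t" "y = b \<odot>\<^bsub>M\<^esub> f t" by blast
      then show "y = a \<odot>\<^bsub>M\<^esub> f s" using wd[of a s b t] that by simp
    qed
    then show ?thesis using that by (simp add: F_def)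
  qed
  have "F \<in> carrier H" unfolding H_carrier
  proof (intro conjI ballI)
    show "F \<in> carrier Q \<rightarrow> carrier M" using F f by (auto simp: carrier_Q)
    show "F \<in> extensional (carrier Q)" by (simp add: F_def)
  next
    fix x y assume "x \<in> carrier Q" "y \<in> carrier Q"
    then obtain a s b t where h: "x = fr a s" "y = fr b t" "a \<in> carrier R" "b \<in> carrier R" "s \<in> S" "t \<in> S"
      by (auto simp: carrier_Q)
    have "F (x \<oplus>\<^bsub>Q\<^esub> y) = (a \<otimes> t) \<odot>\<^bsub>M\<^esub> f (s \<otimes> t) \<oplus>\<^bsub>M\<^esub> (b \<otimes> s) \<odot>\<^bsub>M\<^esub> f (s \<otimes> t)"
      using h f by (simp add: Q_add F smult_l_distr)
    also have "(a \<otimes> t) \<odot>\<^bsub>M\<^esub> f (s \<otimes> t) = a \<odot>\<^bsub>M\<^esub> f s" using h f c by (simp add: smult_assoc1)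
    also have "(b \<otimes> s) \<odot>\<^bsub>M\<^esub> f (s \<otimes> t) = b \<odot>\<^bsub>M\<^esub> f t"
      using h f c[of t s] m_comm[of s t] by (simp add: smult_assoc1)
    finally show "F (x \<oplus>\<^bsub>Q\<^esub> y) = F x \<oplus>\<^bsub>M\<^esub> F y" using h by (simp add: F)
  next
    fix r x assume "r \<in> carrier R" "x \<in> carrier Q"
    then obtain a s where h: "x = fr a s" "a \<in> carrier R" "s \<in> S" "r \<in> carrier R" by (auto simp: carrier_Q)
    then show "F (fr r \<one> \<otimes>\<^bsub>Q\<^esub> x) = r \<odot>\<^bsub>M\<^esub> F x" using f by (simp add: Q_mult F smult_assoc1)
  qed
  then show ?thesis using F by blast
qed

lemma aff_submodule: "sm K \<Longrightarrow> aff K"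
  using smD(1,2)[of K] smD(3,4,6)[of K] by (intro affI) (blast, blast, simp)

text \<open>An inverse limit of cosets in an Artinian module is not empty. This is how linear
  compactness produces homomorphisms with prescribed properties.\<close>

lemma H_section:
  assumes "\<And>s. s \<in> S \<Longrightarrow> aff (C s)"
    "\<And>s t y. s \<in> S \<Longrightarrow> t \<in> S \<Longrightarrow> y \<in> C (s \<otimes> t) \<Longrightarrow> t \<odot>\<^bsub>M\<^esub> y \<in> C s"
  shows "\<exists>F\<in>carrier H. \<forall>s\<in>S. F (fr \<one> s) \<in> C s"
proof -
  have "\<exists>f. \<forall>s\<in>S. f s \<in> C s \<and> (\<forall>t\<in>S. t \<odot>\<^bsub>M\<^esub> f (s \<otimes> t) = f s)"
    by (rule compatible_section) (use assms S_closed in auto)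
  then obtain f where f: "\<forall>s\<in>S. f s \<in> C s \<and> (\<forall>t\<in>S. t \<odot>\<^bsub>M\<^esub> f (s \<otimes> t) = f s)" by blast
  have fM: "f s \<in> carrier M" if "s \<in> S" for s using f affD(2)[OF assms(1)] that by blast
  then obtain F where "F \<in> carrier H" "\<forall>a\<in>carrier R. \<forall>s\<in>S. F (fr a s) = a \<odot>\<^bsub>M\<^esub> f s"
    using H_extend[of f] f by blast
  then show ?thesis using f fM by (intro bexI[of _ F]) auto
qed

text \<open>The fibres of \<open>x\<close> over the values \<open>g (fr \<one> s)\<close> are
  nonempty cosets, and they are compatible because \<open>t\<close> commutes with \<open>x\<close>.
  A section through them is a preimage of \<open>g\<close>.\<close>

lemma H_surj:
  assumes x: "x \<in> carrier R" "mulset M x (carrier M) = carrier M"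
  shows "mulset H (fr x \<one>) (carrier H) = carrier H"
proof
  interpret H: module Q H by (rule module_H)
  show "mulset H (fr x \<one>) (carrier H) \<subseteq> carrier H" using x by (auto simp: mulset_def)
  show "carrier H \<subseteq> mulset H (fr x \<one>) (carrier H)"
  proof
    fix g assume g: "g \<in> carrier H"
    have "\<exists>F\<in>carrier H. \<forall>s\<in>S. F (fr \<one> s) \<in> {y \<in> carrier M. x \<odot>\<^bsub>M\<^esub> y = g (fr \<one> s)}"
    proof (rule H_section)
      fix s assume s: "s \<in> S"
      then have "g (fr \<one> s) \<in> carrier M" using HD(1)[OF g] by simp
      moreover from this have "\<exists>y\<in>carrier M. x \<odot>\<^bsub>M\<^esub> y = g (fr \<one> s)"
        using x(2) unfolding mulset_def by (metis imageE)
      ultimately show "aff {y \<in> carrier M. x \<odot>\<^bsub>M\<^esub> y = g (fr \<one> s)}"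
        using aff_fibre[OF aff_submodule[OF sm_carrier] x(1)] by blast
    next
      fix s t y assume h: "s \<in> S" "t \<in> S" "y \<in> {y \<in> carrier M. x \<odot>\<^bsub>M\<^esub> y = g (fr \<one> (s \<otimes> t))}"
      have "fr t (s \<otimes> t) = fr \<one> s" using h by (intro frac_eqI) (simp_all add: m_comm)
      then have "t \<odot>\<^bsub>M\<^esub> g (fr \<one> (s \<otimes> t)) = g (fr \<one> s)" using H_frac[OF g, of t "s \<otimes> t"] h by simp
      then show "t \<odot>\<^bsub>M\<^esub> y \<in> {y \<in> carrier M. x \<odot>\<^bsub>M\<^esub> y = g (fr \<one> s)}"
        using h x(1) smult_comm[of x t y] by simp
    qed
    then obtain F where F: "F \<in> carrier H" "\<And>s. s \<in> S \<Longrightarrow> x \<odot>\<^bsub>M\<^esub> F (fr \<one> s) = g (fr \<one> s)" by blast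
    have "fr x \<one> \<odot>\<^bsub>H\<^esub> F = g"
    proof (rule H_eqI)
      show "fr x \<one> \<odot>\<^bsub>H\<^esub> F \<in> carrier H" using F(1) x(1) by simp
      fix y assume y: "y \<in> carrier Q"
      then obtain a s where as: "a \<in> carrier R" "s \<in> S" "y = fr a s" by (auto simp: carrier_Q)
      have "(fr x \<one> \<odot>\<^bsub>H\<^esub> F) y = x \<odot>\<^bsub>M\<^esub> F y" using y x(1) HD(3)[OF F(1)] by (simp add: H_smult)
      also have "\<dots> = a \<odot>\<^bsub>M\<^esub> (x \<odot>\<^bsub>M\<^esub> F (fr \<one> s))"
        using as x(1) HD(1)[OF F(1)] H_frac[OF F(1) as(1,2)] smult_comm[of x a] by simp
      also have "\<dots> = g y" using F(2) as H_frac[OF g as(1,2)] by simp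
      finally show "(fr x \<one> \<odot>\<^bsub>H\<^esub> F) y = g y" .
    qed (rule g)
    then show "g \<in> mulset H (fr x \<one>) (carrier H)" using F(1) by (auto simp: mulset_def)
  qed
qed

text \<open>Choose \<open>s0\<close> so that \<open>s0 M\<close> is minimal among the submodules
  \<open>s M\<close> with \<open>s\<close> in \<open>S\<close>. Then each \<open>s\<close> in
  \<open>S\<close> acts surjectively on \<open>s0 M\<close>, so an element of \<open>s0 M\<close>
  can be divided by all of \<open>S\<close> compatibly without leaving it.\<close>

lemma H_eval:
  "\<exists>s0\<in>S. \<forall>y\<in>carrier M. \<exists>F\<in>carrier H. F \<one>\<^bsub>Q\<^esub> = s0 \<odot>\<^bsub>M\<^esub> y"
proof -
  define \<F> where "\<F> = (\<lambda>s. mulset M s (carrier M)) ` S"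
  have "\<exists>U\<in>\<F>. \<forall>V\<in>\<F>. V \<subseteq> U \<longrightarrow> V = U"
    by (rule artinian_minimal) (use sm_mulset[OF sm_carrier] in \<open>auto simp: \<F>_def intro: S_one\<close>)
  then obtain U where U: "U \<in> \<F>" "\<And>V. V \<in> \<F> \<Longrightarrow> V \<subseteq> U \<Longrightarrow> V = U" by metis
  obtain s0 where s0: "s0 \<in> S" "U = mulset M s0 (carrier M)" using U(1) by (auto simp: \<F>_def)
  have Us: "sm U" using s0 sm_mulset[OF sm_carrier] by simp
  have div: "\<exists>z\<in>U. s \<odot>\<^bsub>M\<^esub> z = y" if s: "s \<in> S" and y: "y \<in> U" for s y
  proof -
    have "mulset M (s0 \<otimes> s) (carrier M) \<subseteq> U"
      using s s0 by (auto simp: mulset_def smult_assoc1)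
    then have "mulset M (s0 \<otimes> s) (carrier M) = U" using U(2) s s0(1) by (auto simp: \<F>_def)
    then obtain w where w: "w \<in> carrier M" "y = (s0 \<otimes> s) \<odot>\<^bsub>M\<^esub> w" using y by (auto simp: mulset_def)
    then have "y = s \<odot>\<^bsub>M\<^esub> (s0 \<odot>\<^bsub>M\<^esub> w)" using s s0(1) smult_comm by (simp add: smult_assoc1)
    moreover have "s0 \<odot>\<^bsub>M\<^esub> w \<in> U" using s0 w by (auto simp: mulset_def)
    ultimately show ?thesis by blast
  qed
  have "\<exists>F\<in>carrier H. F \<one>\<^bsub>Q\<^esub> = s0 \<odot>\<^bsub>M\<^esub> y" if y: "y \<in> carrier M" for y
  proof -
    have yU: "s0 \<odot>\<^bsub>M\<^esub> y \<in> U" using y s0 by (auto simp: mulset_def)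
    have "\<exists>F\<in>carrier H. \<forall>s\<in>S. F (fr \<one> s) \<in> {z \<in> U. s \<odot>\<^bsub>M\<^esub> z = s0 \<odot>\<^bsub>M\<^esub> y}"
    proof (rule H_section)
      fix s assume s: "s \<in> S"
      show "aff {z \<in> U. s \<odot>\<^bsub>M\<^esub> z = s0 \<odot>\<^bsub>M\<^esub> y}"
        using aff_fibre[OF aff_submodule[OF Us] S_closed[OF s]] div[OF s yU] smD(7)[OF Us yU] by blast
    next
      fix s t z assume h: "s \<in> S" "t \<in> S" "z \<in> {z \<in> U. (s \<otimes> t) \<odot>\<^bsub>M\<^esub> z = s0 \<odot>\<^bsub>M\<^esub> y}"
      then show "t \<odot>\<^bsub>M\<^esub> z \<in> {z \<in> U. s \<odot>\<^bsub>M\<^esub> z = s0 \<odot>\<^bsub>M\<^esub> y}"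
        using smD(4,7)[OF Us] smult_assoc1[of s t z] by simp
    qed
    then obtain F where F: "F \<in> carrier H" "\<And>s. s \<in> S \<Longrightarrow> F (fr \<one> s) \<in> {z \<in> U. s \<odot>\<^bsub>M\<^esub> z = s0 \<odot>\<^bsub>M\<^esub> y}"
      by blast
    have "F (fr \<one> \<one>) = s0 \<odot>\<^bsub>M\<^esub> y" using F(2)[OF S_one] smD(7)[OF Us] by auto
    then show ?thesis using F(1) by (auto simp: Q_one)
  qed
  then show ?thesis using s0(1) by blast
qed

lemma H_zero_eval: "f \<in> carrier H \<Longrightarrow> f \<noteq> \<zero>\<^bsub>H\<^esub> \<Longrightarrow> \<exists>s\<in>S. f (fr \<one> s) \<noteq> \<zero>\<^bsub>M\<^esub>"
proof (rule ccontr)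
  interpret H: module Q H by (rule module_H)
  assume f: "f \<in> carrier H" "f \<noteq> \<zero>\<^bsub>H\<^esub>" and n: "\<not> (\<exists>s\<in>S. f (fr \<one> s) \<noteq> \<zero>\<^bsub>M\<^esub>)"
  have "f x = \<zero>\<^bsub>H\<^esub> x" if x: "x \<in> carrier Q" for x
  proof -
    obtain a s where as: "a \<in> carrier R" "s \<in> S" "x = fr a s" using x by (auto simp: carrier_Q)
    then have "f x = a \<odot>\<^bsub>M\<^esub> \<zero>\<^bsub>M\<^esub>" using n H_frac[OF f(1) as(1,2)] by simp
    then show ?thesis using that as(1) by (simp add: H_zero)
  qed
  then have "f = \<zero>\<^bsub>H\<^esub>" by (intro H_eqI f H.M.zero_closed)
  then show False using f by simp
qed

text \<open>An element r of Ann M outside \<open>p\<close> would kill every value, as f(1/s) = r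
  f(1/(sr)). Conversely, if Ann M is inside \<open>p\<close>, the \<open>s0\<close> of
  \<open>H_eval\<close> does not annihilate \<open>M\<close>, and some homomorphism has a nonzero
  value at 1.\<close>

lemma mem_Cos: "p \<in> Cos R M \<longleftrightarrow> p \<in> Vset R (annih R M (carrier M))"
proof
  assume "p \<in> Cos R M"
  interpret H: module Q H by (rule module_H)
  obtain f where f: "f \<in> carrier H" "f \<noteq> \<zero>\<^bsub>H\<^esub>" using \<open>p \<in> Cos R M\<close> H.M.zero_closed by (auto simp: Cos_def)
  obtain s where s: "s \<in> S" "f (fr \<one> s) \<noteq> \<zero>\<^bsub>M\<^esub>" using H_zero_eval[OF f] by blast
  have "r \<in> p" if r: "r \<in> annih R M (carrier M)" for r
  proof (rule ccontr)
    assume "r \<notin> p"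
    then have rS: "r \<in> S" using r by (auto simp: S_def annih_def)
    have "fr r (s \<otimes> r) = fr \<one> s" using s rS by (intro frac_eqI) (simp_all add: m_comm)
    then have "f (fr \<one> s) = r \<odot>\<^bsub>M\<^esub> f (fr \<one> (s \<otimes> r))" using H_frac[OF f(1), of r "s \<otimes> r"] s rS by simp
    also have "\<dots> = \<zero>\<^bsub>M\<^esub>" using r HD(1)[OF f(1)] s(1) rS by (auto simp: annih_def)
    finally show False using s by simp
  qed
  then show "p \<in> Vset R (annih R M (carrier M))" using prime by (auto simp: Vset_def)
next
  assume p: "p \<in> Vset R (annih R M (carrier M))"
  obtain s0 where s0: "s0 \<in> S" "\<forall>y\<in>carrier M. \<exists>F\<in>carrier H. F \<one>\<^bsub>Q\<^esub> = s0 \<odot>\<^bsub>M\<^esub> y" using H_eval by blast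
  have "s0 \<notin> annih R M (carrier M)" using p s0(1) by (auto simp: Vset_def S_def)
  then obtain y where y: "y \<in> carrier M" "s0 \<odot>\<^bsub>M\<^esub> y \<noteq> \<zero>\<^bsub>M\<^esub>" using s0(1) by (auto simp: annih_def)
  then obtain F where F: "F \<in> carrier H" "F \<one>\<^bsub>Q\<^esub> \<noteq> \<zero>\<^bsub>M\<^esub>" using s0(2) by fastforce
  have "\<one>\<^bsub>Q\<^esub> \<in> carrier Q" by (simp add: Q_one)
  then have "F \<noteq> \<zero>\<^bsub>H\<^esub>" using F(2) by (auto simp: H_zero)
  then show "p \<in> Cos R M" using F(1) prime by (auto simp: Cos_def)
qed

text \<open>Left exactness of Hom(R_p, -), stated as an equality of records so that Tor of one side
  rewrites to Tor of the other.\<close>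

lemma H_colon:
  assumes x: "x \<in> carrier R"
  shows "hom_loc R (sub M (colon M {x})) p = sub H (colon H {fr x \<one>})"
proof -
  interpret H: module Q H by (rule module_H)
  have "f \<in> carrier (hom_loc R (sub M (colon M {x})) p) \<longleftrightarrow> f \<in> colon H {fr x \<one>}" for f
  proof -
    have l: "f \<in> carrier (hom_loc R (sub M (colon M {x})) p) \<longleftrightarrow>
       f \<in> carrier H \<and> f \<in> carrier Q \<rightarrow> colon M {x}"
      by (auto simp: H_carrier hom_loc_def Let_def colon_def)
    have "f \<in> carrier Q \<rightarrow> colon M {x} \<longleftrightarrow> fr x \<one> \<odot>\<^bsub>H\<^esub> f = \<zero>\<^bsub>H\<^esub>" if f: "f \<in> carrier H"
    proof
      assume h: "f \<in> carrier Q \<rightarrow> colon M {x}"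
      show "fr x \<one> \<odot>\<^bsub>H\<^esub> f = \<zero>\<^bsub>H\<^esub>"
      proof (rule H_eqI)
        show "fr x \<one> \<odot>\<^bsub>H\<^esub> f \<in> carrier H" "\<zero>\<^bsub>H\<^esub> \<in> carrier H" using f x by simp_all
        fix y assume y: "y \<in> carrier Q"
        then have "x \<odot>\<^bsub>M\<^esub> f y = \<zero>\<^bsub>M\<^esub>" using h by (auto simp: colon_def)
        then show "(fr x \<one> \<odot>\<^bsub>H\<^esub> f) y = \<zero>\<^bsub>H\<^esub> y" using y HD(3)[OF f x] by (simp add: H_smult H_zero)
      qed
    next
      assume h: "fr x \<one> \<odot>\<^bsub>H\<^esub> f = \<zero>\<^bsub>H\<^esub>"
      show "f \<in> carrier Q \<rightarrow> colon M {x}"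
      proof
        fix y assume y: "y \<in> carrier Q"
        have "x \<odot>\<^bsub>M\<^esub> f y = (fr x \<one> \<odot>\<^bsub>H\<^esub> f) y" using y HD(3)[OF f x] by (simp add: H_smult)
        also have "\<dots> = \<zero>\<^bsub>M\<^esub>" using y by (simp add: h H_zero)
        finally show "f y \<in> colon M {x}" using HD(1)[OF f y] by (simp add: colon_def)
      qed
    qed
    moreover have "f \<in> colon H {fr x \<one>} \<longleftrightarrow> f \<in> carrier H \<and> fr x \<one> \<odot>\<^bsub>H\<^esub> f = \<zero>\<^bsub>H\<^esub>"
      by (simp add: colon_def)
    ultimately show ?thesis using l by blast
  qed
  then have "carrier (hom_loc R (sub M (colon M {x})) p) = colon H {fr x \<one>}" by blast
  then show ?thesis by (simp add: hom_loc_def Let_def)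
qed

text \<open>Since \<open>F (a/s) = a F (1/s)\<close>, elements of \<open>J H\<close> have values at \<open>1\<close> in \<open>K\<close>, whereas by
  \<open>H_eval\<close> these values cover \<open>s0 M\<close>.\<close>
lemma H_not_generated:
  assumes K: "sm K" and p: "{r \<in> carrier R. \<forall>y\<in>carrier M. r \<odot>\<^bsub>M\<^esub> y \<in> K} = p"
  shows "\<exists>F\<in>carrier H. F \<one>\<^bsub>Q\<^esub> \<notin> K" and "\<And>c F. c \<in> res_ideal R p \<Longrightarrow> F \<in> carrier H \<Longrightarrow> (c \<odot>\<^bsub>H\<^esub> F) \<one>\<^bsub>Q\<^esub> \<in> K"
proof -
  obtain s0 where s0: "s0 \<in> S" "\<forall>y\<in>carrier M. \<exists>F\<in>carrier H. F \<one>\<^bsub>Q\<^esub> = s0 \<odot>\<^bsub>M\<^esub> y" using H_eval by blast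
  have "s0 \<in> carrier R" "s0 \<notin> p" using s0(1) by (auto simp: S_def)
  then obtain y where y: "y \<in> carrier M" "s0 \<odot>\<^bsub>M\<^esub> y \<notin> K" using p by blast
  then obtain F where F: "F \<in> carrier H" "F \<one>\<^bsub>Q\<^esub> = s0 \<odot>\<^bsub>M\<^esub> y" using s0(2) by blast
  show "\<exists>F\<in>carrier H. F \<one>\<^bsub>Q\<^esub> \<notin> K" by (rule bexI[OF _ F(1)]) (simp add: F(2) y(2))
  fix c F assume c: "c \<in> res_ideal R p" and F: "F \<in> carrier H"
  interpret Q: cring Q by (rule cring_Q)
  obtain a s where as: "a \<in> p" "s \<in> S" "c = fr a s" using c by (auto simp: res_ideal_def S_def)
  then have aR: "a \<in> carrier R" using p_sub by blast
  have "(c \<odot>\<^bsub>H\<^esub> F) \<one>\<^bsub>Q\<^esub> = a \<odot>\<^bsub>M\<^esub> F (fr \<one> s)"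
    using as aR H_frac[OF F aR as(2)] by (simp add: H_smult)
  moreover have "F (fr \<one> s) \<in> carrier M" using HD(1)[OF F] as by simp
  moreover have "\<forall>y\<in>carrier M. a \<odot>\<^bsub>M\<^esub> y \<in> K" using as(1) p by blast
  ultimately show "(c \<odot>\<^bsub>H\<^esub> F) \<one>\<^bsub>Q\<^esub> \<in> K" by simp
qed

end

section \<open>Free resolutions and Tor\<close>

lemma (in abelian_monoid) finsum_lessThan_Suc:
  "f \<in> {..<Suc n} \<rightarrow> carrier G \<Longrightarrow> finsum G f {..<Suc n} = f n \<oplus> finsum G f {..<n}"
  by (simp add: lessThan_Suc Pi_iff)

lemma (in abelian_monoid) finsum_swap:
  fixes m n :: nat
  assumes "\<And>i j. i < m \<Longrightarrow> j < n \<Longrightarrow> f i j \<in> carrier G"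
  shows "finsum G (\<lambda>i. finsum G (f i) {..<n}) {..<m} = finsum G (\<lambda>j. finsum G (\<lambda>i. f i j) {..<m}) {..<n}"
  using assms
proof (induction m)
  case 0
  then show ?case by (simp add: finsum_zero)
next
  case (Suc m)
  have "finsum G (\<lambda>i. finsum G (f i) {..<n}) {..<Suc m}
      = finsum G (f m) {..<n} \<oplus> finsum G (\<lambda>j. finsum G (\<lambda>i. f i j) {..<m}) {..<n}"
    using Suc by (subst finsum_lessThan_Suc) (auto intro!: finsum_closed)
  also have "\<dots> = finsum G (\<lambda>j. f m j \<oplus> finsum G (\<lambda>i. f i j) {..<m}) {..<n}"
    using Suc by (subst finsum_addf) (auto intro!: finsum_closed)
  also have "\<dots> = finsum G (\<lambda>j. finsum G (\<lambda>i. f i j) {..<Suc m}) {..<n}"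
    using Suc by (intro finsum_cong') (auto intro!: finsum_closed simp: finsum_lessThan_Suc)
  finally show ?case .
qed

lemma (in abelian_monoid) finsum_zeroI: "(\<And>i. i \<in> A \<Longrightarrow> f i = \<zero>) \<Longrightarrow> finsum G f A = \<zero>"
  by (rule add.finprod_one_eqI)

section \<open>Matrices over the ring acting on tuples from a module\<close>

locale tmod = module R M for R :: "'b ring" (structure) and M :: "('b, 'n) module" (structure)
begin

lemma finsum_smult_rdistr:
  assumes "\<And>i. i < n \<Longrightarrow> f i \<in> carrier R" "x \<in> carrier M"
  shows "(\<Oplus>i\<in>{..<(n::nat)}. f i) \<odot>\<^bsub>M\<^esub> x = (\<Oplus>\<^bsub>M\<^esub>i\<in>{..<n}. f i \<odot>\<^bsub>M\<^esub> x)"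
  using assms
proof (induction n)
  case (Suc n)
  have "(\<Oplus>i\<in>{..<Suc n}. f i) \<odot>\<^bsub>M\<^esub> x = f n \<odot>\<^bsub>M\<^esub> x \<oplus>\<^bsub>M\<^esub> (\<Oplus>i\<in>{..<n}. f i) \<odot>\<^bsub>M\<^esub> x"
    using Suc by (subst R.finsum_lessThan_Suc) (auto intro!: R.finsum_closed simp: smult_l_distr)
  also have "\<dots> = (\<Oplus>\<^bsub>M\<^esub>i\<in>{..<Suc n}. f i \<odot>\<^bsub>M\<^esub> x)"
    using Suc by (subst M.finsum_lessThan_Suc) auto
  finally show ?case .
qed simp

definition mprod :: "(nat \<Rightarrow> nat \<Rightarrow> 'b) \<Rightarrow> (nat \<Rightarrow> nat \<Rightarrow> 'b) \<Rightarrow> nat \<Rightarrow> nat \<Rightarrow> nat \<Rightarrow> 'b" where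
  "mprod E D m i k = (\<Oplus>j\<in>{..<m}. E i j \<otimes> D j k)"

abbreviation "mcar D \<equiv> (\<forall>i j::nat. D i j \<in> carrier R)"

lemma mprod_closed: "mcar E \<Longrightarrow> mcar D \<Longrightarrow> mprod E D m i k \<in> carrier R"
  unfolding mprod_def by (intro R.finsum_closed) auto

lemma fvecD: "y \<in> fvec M n \<Longrightarrow> y j \<in> carrier M" "y \<in> fvec M n \<Longrightarrow> j \<ge> n \<Longrightarrow> y j = \<zero>\<^bsub>M\<^esub>"
  by (cases "j < n"; auto simp: fvec_def)+

lemma fvecI: "(\<And>j. y j \<in> carrier M) \<Longrightarrow> (\<And>j. j \<ge> n \<Longrightarrow> y j = \<zero>\<^bsub>M\<^esub>) \<Longrightarrow> y \<in> fvec M n"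
  by (auto simp: fvec_def)

lemma mmat_closed: "mcar D \<Longrightarrow> y \<in> fvec M n \<Longrightarrow> mmat M D m n y \<in> fvec M m"
  using fvecD(1)[of y n] by (intro fvecI) (auto simp: mmat_def intro!: M.finsum_closed)

lemma mmat_zero: "mcar D \<Longrightarrow> mmat M D m n (\<lambda>_. \<zero>\<^bsub>M\<^esub>) = (\<lambda>_. \<zero>\<^bsub>M\<^esub>)"
  by (rule ext) (auto simp: mmat_def intro!: M.finsum_zeroI)

lemma mmat_add:
  assumes "mcar D" "y \<in> fvec M n" "z \<in> fvec M n"
  shows "mmat M D m n (\<lambda>i. y i \<oplus>\<^bsub>M\<^esub> z i) = (\<lambda>i. mmat M D m n y i \<oplus>\<^bsub>M\<^esub> mmat M D m n z i)"
proof
  fix i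
  show "mmat M D m n (\<lambda>i. y i \<oplus>\<^bsub>M\<^esub> z i) i = mmat M D m n y i \<oplus>\<^bsub>M\<^esub> mmat M D m n z i"
  proof -
    note yz = fvecD(1)[OF assms(2)] fvecD(1)[OF assms(3)]
    have "(\<Oplus>\<^bsub>M\<^esub>j\<in>{..<n}. D i j \<odot>\<^bsub>M\<^esub> (y j \<oplus>\<^bsub>M\<^esub> z j)) = (\<Oplus>\<^bsub>M\<^esub>j\<in>{..<n}. D i j \<odot>\<^bsub>M\<^esub> y j \<oplus>\<^bsub>M\<^esub> D i j \<odot>\<^bsub>M\<^esub> z j)"
      using assms(1) yz by (intro M.finsum_cong') (auto simp: smult_r_distr)
    also have "\<dots> = (\<Oplus>\<^bsub>M\<^esub>j\<in>{..<n}. D i j \<odot>\<^bsub>M\<^esub> y j) \<oplus>\<^bsub>M\<^esub> (\<Oplus>\<^bsub>M\<^esub>j\<in>{..<n}. D i j \<odot>\<^bsub>M\<^esub> z j)"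
      using assms(1) yz by (intro M.finsum_addf) auto
    finally show ?thesis by (simp add: mmat_def)
  qed
qed

lemma mmat_smult:
  assumes "mcar D" "y \<in> fvec M n" "a \<in> carrier R"
  shows "mmat M D m n (\<lambda>i. a \<odot>\<^bsub>M\<^esub> y i) = (\<lambda>i. a \<odot>\<^bsub>M\<^esub> mmat M D m n y i)"
proof
  fix i
  have "D i j \<odot>\<^bsub>M\<^esub> (a \<odot>\<^bsub>M\<^esub> y j) = a \<odot>\<^bsub>M\<^esub> (D i j \<odot>\<^bsub>M\<^esub> y j)" for j
    using assms fvecD(1)[OF assms(2)] by (simp add: smult_assoc1[symmetric] m_comm)
  then show "mmat M D m n (\<lambda>i. a \<odot>\<^bsub>M\<^esub> y i) i = a \<odot>\<^bsub>M\<^esub> mmat M D m n y i"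
    using assms fvecD[OF assms(2)] by (auto simp: mmat_def finsum_smult_ldistr)
qed

lemma fvec_add: "y \<in> fvec M n \<Longrightarrow> z \<in> fvec M n \<Longrightarrow> (\<lambda>i. y i \<oplus>\<^bsub>M\<^esub> z i) \<in> fvec M n"
  by (auto simp: fvec_def)

lemma fvec_smult: "y \<in> fvec M n \<Longrightarrow> a \<in> carrier R \<Longrightarrow> (\<lambda>i. a \<odot>\<^bsub>M\<^esub> y i) \<in> fvec M n"
  by (auto simp: fvec_def)

lemma fvec_zero: "(\<lambda>_. \<zero>\<^bsub>M\<^esub>) \<in> fvec M n"
  by (auto simp: fvec_def)

lemma neg_smult: "x \<in> carrier M \<Longrightarrow> \<ominus>\<^bsub>M\<^esub> x = (\<ominus> \<one>) \<odot>\<^bsub>M\<^esub> x"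
  by (simp add: smult_l_minus)

lemma fvec_diff: "y \<in> fvec M n \<Longrightarrow> z \<in> fvec M n \<Longrightarrow> (\<lambda>i. y i \<ominus>\<^bsub>M\<^esub> z i) \<in> fvec M n"
  by (auto simp: fvec_def a_minus_def)

lemma mmat_diff:
  assumes "mcar D" "y \<in> fvec M n" "z \<in> fvec M n"
  shows "mmat M D m n (\<lambda>i. y i \<ominus>\<^bsub>M\<^esub> z i) = (\<lambda>i. mmat M D m n y i \<ominus>\<^bsub>M\<^esub> mmat M D m n z i)"
proof -
  have "(\<lambda>i. y i \<ominus>\<^bsub>M\<^esub> z i) = (\<lambda>i. y i \<oplus>\<^bsub>M\<^esub> (\<ominus> \<one>) \<odot>\<^bsub>M\<^esub> z i)"
    using fvecD(1)[OF assms(3)] by (simp add: a_minus_def neg_smult)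
  moreover have "mmat M D m n z i \<in> carrier M" for i using fvecD(1) mmat_closed assms by blast
  ultimately show ?thesis
    using assms mmat_add[OF assms(1,2) fvec_smult[OF assms(3)], of "\<ominus> \<one>"] mmat_smult[OF assms(1,3), of "\<ominus> \<one>"]
    by (simp add: a_minus_def neg_smult)
qed

lemma mmat_comp:
  assumes "mcar D" "mcar E" "y \<in> fvec M n"
  shows "mmat M E l m (mmat M D m n y) = mmat M (mprod E D m) l n y"
proof
  fix i
  note y = fvecD(1)[OF assms(3)]
  have "(\<Oplus>\<^bsub>M\<^esub>j\<in>{..<m}. E i j \<odot>\<^bsub>M\<^esub> mmat M D m n y j)
      = (\<Oplus>\<^bsub>M\<^esub>j\<in>{..<m}. \<Oplus>\<^bsub>M\<^esub>k\<in>{..<n}. (E i j \<otimes> D j k) \<odot>\<^bsub>M\<^esub> y k)"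
    using assms y by (intro M.finsum_cong')
      (auto simp: mmat_def finsum_smult_ldistr smult_assoc1 intro!: M.finsum_closed)
  also have "\<dots> = (\<Oplus>\<^bsub>M\<^esub>k\<in>{..<n}. \<Oplus>\<^bsub>M\<^esub>j\<in>{..<m}. (E i j \<otimes> D j k) \<odot>\<^bsub>M\<^esub> y k)"
    using assms y by (intro M.finsum_swap) auto
  also have "\<dots> = (\<Oplus>\<^bsub>M\<^esub>k\<in>{..<n}. mprod E D m i k \<odot>\<^bsub>M\<^esub> y k)"
    using assms y by (intro M.finsum_cong')
      (auto simp: mprod_def finsum_smult_rdistr intro!: M.finsum_closed R.finsum_closed)
  finally show "mmat M E l m (mmat M D m n y) i = mmat M (mprod E D m) l n y i"
    by (simp add: mmat_def)
qed

lemma mmat_matrix_add: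
  assumes "mcar D" "mcar E" "y \<in> fvec M n"
  shows "mmat M (\<lambda>i j. D i j \<oplus> E i j) m n y = (\<lambda>i. mmat M D m n y i \<oplus>\<^bsub>M\<^esub> mmat M E m n y i)"
proof
  fix i
  show "mmat M (\<lambda>i j. D i j \<oplus> E i j) m n y i = mmat M D m n y i \<oplus>\<^bsub>M\<^esub> mmat M E m n y i"
  proof -
    note y = fvecD(1)[OF assms(3)]
    have "(\<Oplus>\<^bsub>M\<^esub>j\<in>{..<n}. (D i j \<oplus> E i j) \<odot>\<^bsub>M\<^esub> y j) = (\<Oplus>\<^bsub>M\<^esub>j\<in>{..<n}. D i j \<odot>\<^bsub>M\<^esub> y j \<oplus>\<^bsub>M\<^esub> E i j \<odot>\<^bsub>M\<^esub> y j)"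
      using assms(1,2) y by (intro M.finsum_cong') (auto simp: smult_l_distr)
    also have "\<dots> = (\<Oplus>\<^bsub>M\<^esub>j\<in>{..<n}. D i j \<odot>\<^bsub>M\<^esub> y j) \<oplus>\<^bsub>M\<^esub> (\<Oplus>\<^bsub>M\<^esub>j\<in>{..<n}. E i j \<odot>\<^bsub>M\<^esub> y j)"
      using assms(1,2) y by (intro M.finsum_addf) auto
    finally show ?thesis by (simp add: mmat_def)
  qed
qed

lemma mmat_cong:
  assumes "\<And>i j. i < m \<Longrightarrow> j < n \<Longrightarrow> D i j = E i j" "mcar E" "y \<in> fvec M n"
  shows "mmat M D m n y = mmat M E m n y"
proof
  fix i
  show "mmat M D m n y i = mmat M E m n y i"
    using assms fvecD(1)[OF assms(3)] by (auto simp: mmat_def intro!: M.finsum_cong')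
qed

lemma mmat_zero_matrix: "y \<in> fvec M n \<Longrightarrow> mmat M (\<lambda>_ _. \<zero>) m n y = (\<lambda>_. \<zero>\<^bsub>M\<^esub>)"
  by (rule ext) (auto simp: mmat_def fvecD(1) intro!: M.finsum_zeroI)

lemma mmat_scalar:
  assumes "a \<in> carrier R" "y \<in> fvec M n"
  shows "mmat M (\<lambda>i j. if i = j then a else \<zero>) n n y = (\<lambda>i. a \<odot>\<^bsub>M\<^esub> y i)"
proof
  fix i
  note y = fvecD[OF assms(2)]
  show "mmat M (\<lambda>i j. if i = j then a else \<zero>) n n y i = a \<odot>\<^bsub>M\<^esub> y i"
  proof (cases "i < n")
    case True
    have "(\<Oplus>\<^bsub>M\<^esub>j\<in>{..<n}. (if i = j then a else \<zero>) \<odot>\<^bsub>M\<^esub> y j) = (\<Oplus>\<^bsub>M\<^esub>j\<in>{..<n}. if i = j then a \<odot>\<^bsub>M\<^esub> y j else \<zero>\<^bsub>M\<^esub>)"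
      using assms y by (intro M.finsum_cong') auto
    also have "\<dots> = a \<odot>\<^bsub>M\<^esub> y i" using True assms y by (intro M.finsum_singleton) auto
    finally show ?thesis using True by (simp add: mmat_def)
  qed (use assms y in \<open>auto simp: mmat_def\<close>)
qed

lemma mmat_sub:
  assumes K: "submodule K R M" and "mcar D" "y \<in> fvec (sub M K) n"
  shows "mmat (sub M K) D m n y = mmat M D m n y" and "y \<in> fvec M n"
proof -
  interpret S: tmod R "sub M K"
    unfolding tmod_def using submodule.submodule_is_module[OF K] module_axioms .
  note k = K[unfolded submodule_iff]
  have y: "y j \<in> K" for j using S.fvecD(1)[OF assms(3)] by simp
  have f: "finsum (sub M K) f {..<n} = finsum M f {..<n}" if "\<And>i. f i \<in> K" for f :: "nat \<Rightarrow> 'n" and n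
  proof (induction n)
    case (Suc n)
    then show ?case using that k by (subst S.M.finsum_lessThan_Suc, simp, subst M.finsum_lessThan_Suc) auto
  qed simp
  show "mmat (sub M K) D m n y = mmat M D m n y"
    using y k assms(2) by (auto simp: mmat_def f)
  show "y \<in> fvec M n" using assms(3) k by (auto simp: fvec_def)
qed

end

text \<open>With the ring as a module over itself, each fact about \<open>mmat\<close> specialises
  to one about \<open>rmat\<close>.\<close>

definition selfmod :: "('b, 'z) ring_scheme \<Rightarrow> ('b, 'b) module" where
  "selfmod A = \<lparr>carrier = carrier A, monoid.mult = monoid.mult A, one = one A, ring.zero = ring.zero A,
     ring.add = ring.add A, module.smult = monoid.mult A\<rparr>"

lemma selfmod_simps [simp]:
  "carrier (selfmod A) = carrier A" "ring.zero (selfmod A) = ring.zero A"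
  "ring.add (selfmod A) = ring.add A" "module.smult (selfmod A) = monoid.mult A"
  by (simp_all add: selfmod_def)

lemma finsum_selfmod: "finsum (selfmod A) = finsum A"
  by (intro ext) (auto simp add: finsum_def finprod_def)

lemma mmat_selfmod: "mmat (selfmod A) = rmat A"
  by (intro ext) (simp add: mmat_def rmat_def finsum_selfmod)

lemma fvec_selfmod: "fvec (selfmod A) = fvec A"
  by (intro ext) (simp add: fvec_def)

lemma (in cring) module_selfmod: "module R (selfmod R)"
proof (rule moduleI)
  show "abelian_group (selfmod R)"
    by (rule abelian_groupI) (auto simp: a_ac intro: a_inv_closed l_neg)
qed (auto simp: is_cring l_distr r_distr m_assoc)

lemma a_inv_selfmod: "a_inv (selfmod A) = a_inv A"
  by (intro ext) (simp add: a_inv_def m_inv_def)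

lemma a_minus_selfmod: "a_minus (selfmod A) = a_minus A"
  by (intro ext) (simp add: a_minus_def a_inv_selfmod)

context tmod
begin

lemma minus_zero_M [simp]: "\<ominus>\<^bsub>M\<^esub> \<zero>\<^bsub>M\<^esub> = \<zero>\<^bsub>M\<^esub>"
  by (simp add: neg_smult)

text \<open>The hypothesis is an identity between matrices over the ring, so it holds with
  coefficients in any module. In this way a homotopy found on free modules acts on the complex
  tensored with a module.\<close>

lemma mmat_homotopy:
  assumes "mcar d" "mcar h'" "mcar h" "mcar d'" "a \<in> carrier R" "y \<in> fvec M n"
    and e: "\<And>i k. i < n \<Longrightarrow> k < n \<Longrightarrow> mprod d h' m i k \<oplus> mprod h d' l i k = (if i = k then a else \<zero>)"
  shows "(\<lambda>i. mmat M d n m (mmat M h' m n y) i \<oplus>\<^bsub>M\<^esub> mmat M h n l (mmat M d' l n y) i) = (\<lambda>i. a \<odot>\<^bsub>M\<^esub> y i)"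
proof -
  have c: "mcar (mprod d h' m)" "mcar (mprod h d' l)" using mprod_closed assms by blast+
  have "(\<lambda>i. mmat M d n m (mmat M h' m n y) i \<oplus>\<^bsub>M\<^esub> mmat M h n l (mmat M d' l n y) i)
      = mmat M (\<lambda>i j. mprod d h' m i j \<oplus> mprod h d' l i j) n n y"
    using c by (simp add: mmat_comp[OF assms(2,1,6)] mmat_comp[OF assms(4,3,6)] mmat_matrix_add[OF _ _ assms(6)])
  also have "\<dots> = mmat M (\<lambda>i j. if i = j then a else \<zero>) n n y"
    using e assms by (intro mmat_cong) auto
  finally show ?thesis by (simp add: mmat_scalar assms)
qed

end

locale rescring = cring R for R :: "'b ring" (structure)
begin

sublocale S: tmod R "selfmod R"
  unfolding tmod_def by (rule module_selfmod)

lemmas sm_simps = mmat_selfmod fvec_selfmod selfmod_simps a_minus_selfmod a_inv_selfmod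

lemmas rmat_closed = S.mmat_closed[unfolded sm_simps]
lemmas rmat_diff = S.mmat_diff[unfolded sm_simps]
lemmas rmat_add = S.mmat_add[unfolded sm_simps]
lemmas rmat_smult = S.mmat_smult[unfolded sm_simps]
lemmas rmat_zero = S.mmat_zero[unfolded sm_simps]
lemmas rmat_comp = S.mmat_comp[unfolded sm_simps]
lemmas rmat_homotopy = S.mmat_homotopy[unfolded sm_simps]
lemmas rmat_zero_matrix = S.mmat_zero_matrix[unfolded sm_simps]
lemmas rvecD = S.fvecD[unfolded sm_simps]
lemmas rvecI = S.fvecI[unfolded sm_simps]
lemmas rvec_add = S.fvec_add[unfolded sm_simps]
lemmas rvec_diff = S.fvec_diff[unfolded sm_simps]
lemmas rvec_smult = S.fvec_smult[unfolded sm_simps]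
lemmas rvec_zero = S.fvec_zero[unfolded sm_simps]

definition unitv :: "nat \<Rightarrow> nat \<Rightarrow> 'b" where
  "unitv k = (\<lambda>j. if j = k then \<one> else \<zero>)"

lemma unitv_fvec: "k < n \<Longrightarrow> unitv k \<in> fvec R n"
  by (auto simp: unitv_def fvec_def)

lemma rmat_unitv:
  assumes "S.mcar D" "k < n"
  shows "rmat R D m n (unitv k) = (\<lambda>i. if i < m then D i k else \<zero>)"
proof
  fix i
  have "(\<Oplus>j\<in>{..<n}. D i j \<otimes> unitv k j) = (\<Oplus>j\<in>{..<n}. if k = j then D i j else \<zero>)"
    using assms by (intro finsum_cong') (auto simp: unitv_def)
  also have "\<dots> = D i k" using assms by (intro finsum_singleton) auto
  finally show "rmat R D m n (unitv k) i = (if i < m then D i k else \<zero>)" by (simp add: rmat_def)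
qed

end

section \<open>A fixed free resolution and its null-homotopies\<close>

locale freeres = rescring R for R :: "'b ring" (structure) +
  fixes J :: "'b set" and r :: "nat \<Rightarrow> nat" and D :: "nat \<Rightarrow> nat \<Rightarrow> nat \<Rightarrow> 'b"
  assumes J: "ideal J R" and res: "is_free_res R J r D"
begin

lemma r0: "r 0 = 1" and Dcar: "S.mcar (D n)"
  using res by (auto simp: is_free_res_def)

lemma im1: "rmat R (D (Suc 0)) 1 (r (Suc 0)) ` fvec R (r (Suc 0)) = {x \<in> fvec R 1. x 0 \<in> J}"
  using res by (auto simp: is_free_res_def)

lemma ker: "{x \<in> fvec R (r (Suc n)). rmat R (D (Suc n)) (r n) (r (Suc n)) x = (\<lambda>_. \<zero>)}
    = rmat R (D (Suc (Suc n))) (r (Suc n)) (r (Suc (Suc n))) ` fvec R (r (Suc (Suc n)))"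
  using res unfolding is_free_res_def by (elim conjE allE[of _ "Suc n"]) simp

lemma D_D: "x \<in> fvec R (r (Suc (Suc n))) \<Longrightarrow>
   rmat R (D (Suc n)) (r n) (r (Suc n)) (rmat R (D (Suc (Suc n))) (r (Suc n)) (r (Suc (Suc n))) x) = (\<lambda>_. \<zero>)"
  using ker[of n] by blast

text \<open>Exactness gives only that the composite kills tuples over the ring. Evaluating at unit
  vectors turns this into an identity of matrix entries, which makes sense on any module.\<close>

lemma mprod_D_D:
  assumes "i < r n" "k < r (Suc (Suc n))"
  shows "S.mprod (D (Suc n)) (D (Suc (Suc n))) (r (Suc n)) i k = \<zero>"
proof -
  have "rmat R (S.mprod (D (Suc n)) (D (Suc (Suc n))) (r (Suc n))) (r n) (r (Suc (Suc n))) (unitv k) = (\<lambda>_. \<zero>)"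
    using D_D[OF unitv_fvec[OF assms(2)]] rmat_comp[OF Dcar Dcar unitv_fvec[OF assms(2)]] by simp
  moreover have "S.mcar (S.mprod (D (Suc n)) (D (Suc (Suc n))) (r (Suc n)))"
    using S.mprod_closed Dcar by blast
  ultimately show ?thesis using rmat_unitv[OF _ assms(2)] assms(1) by metis
qed

lemma D1_in_J:
  assumes "k < r (Suc 0)" shows "D (Suc 0) 0 k \<in> J"
proof -
  have "rmat R (D (Suc 0)) 1 (r (Suc 0)) (unitv k) \<in> {x \<in> fvec R 1. x 0 \<in> J}"
    using im1 unitv_fvec[OF assms] by blast
  then show ?thesis using rmat_unitv[OF Dcar assms, of "Suc 0" 1] by simp
qed

text \<open>Multiplication by \<open>a \<in> J\<close> on a resolution of \<open>A/J\<close> is null-homotopic; \<open>h\<close> and \<open>h'\<close> are two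
  consecutive components of a contracting homotopy.\<close>
lemma null_homotopy:
  assumes a: "a \<in> J"
  shows "\<exists>h h'. S.mcar h \<and> S.mcar h' \<and> (n = 0 \<longrightarrow> h = (\<lambda>_ _. \<zero>)) \<and>
    (\<forall>i<r n. \<forall>k<r n. S.mprod (D (Suc n)) h' (r (Suc n)) i k \<oplus> S.mprod h (D n) (r (n - 1)) i k
       = (if i = k then a else \<zero>))"
proof (induction n)
  case 0
  have aR: "a \<in> carrier R" using a J ideal.Icarr by fastforce
  define v where "v j = (if j = (0::nat) then a else \<zero>)" for j
  have "v \<in> fvec R 1" by (rule rvecI) (simp_all add: v_def aR)
  moreover have "v 0 \<in> J" using a by (simp add: v_def)
  ultimately have "v \<in> {x \<in> fvec R 1. x 0 \<in> J}" by blast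
  then obtain c where c: "c \<in> fvec R (r (Suc 0))" "v = rmat R (D (Suc 0)) 1 (r (Suc 0)) c"
    unfolding im1[symmetric] by blast
  define h' where "h' = (\<lambda>j k::nat. c j)"
  have "S.mcar h'" using rvecD(1)[OF c(1)] by (simp add: h'_def)
  moreover have "S.mprod (D (Suc 0)) h' (r (Suc 0)) 0 0 = v 0"
    using c(2) by (simp add: S.mprod_def h'_def rmat_def)
  moreover have "S.mprod (\<lambda>_ _. \<zero>) (D 0) (r (0 - 1)) 0 0 = \<zero>"
    using Dcar by (auto simp: S.mprod_def intro!: finsum_zeroI)
  ultimately show ?case
    by (intro exI[of _ "\<lambda>_ _. \<zero>"] exI[of _ h']) (auto simp: r0 v_def aR)
next
  case (Suc n)
  have aR: "a \<in> carrier R" using a J ideal.Icarr by fastforce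
  obtain h h' where h: "S.mcar h" "S.mcar h'" "n = 0 \<longrightarrow> h = (\<lambda>_ _. \<zero>)"
    "\<forall>i<r n. \<forall>k<r n. S.mprod (D (Suc n)) h' (r (Suc n)) i k \<oplus> S.mprod h (D n) (r (n - 1)) i k
       = (if i = k then a else \<zero>)" using Suc.IH by (elim exE conjE) (rule that)
  let ?d = "\<lambda>k. rmat R (D (Suc n)) (r n) (r (Suc n)) (unitv k)"
  \<comment> \<open>With d the differential and e_k the unit vector, a e_k - h' d e_k is a cycle,
    because d h' d e_k = a d e_k - h d d e_k = a d e_k. By exactness it bounds some
    \<open>w k\<close>, which becomes column \<open>k\<close> of the next component.\<close>
  define v where "v k = (\<lambda>i. a \<otimes> unitv k i \<ominus> rmat R h' (r (Suc n)) (r n) (?d k) i)" for k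
  have "v k \<in> rmat R (D (Suc (Suc n))) (r (Suc n)) (r (Suc (Suc n))) ` fvec R (r (Suc (Suc n)))"
    if k: "k < r (Suc n)" for k
  proof -
    note u = unitv_fvec[OF k]
    have d: "?d k \<in> fvec R (r n)" by (rule rmat_closed[OF Dcar u])
    have h'd: "rmat R h' (r (Suc n)) (r n) (?d k) \<in> fvec R (r (Suc n))" by (rule rmat_closed[OF h(2) d])
    have v: "v k \<in> fvec R (r (Suc n))" unfolding v_def by (rule rvec_diff[OF rvec_smult[OF u aR] h'd])
    \<comment> \<open>For \<open>n = 0\<close> the matrix \<open>D 0\<close> is arbitrary, and the
      term vanishes because \<open>h\<close> is zero there. This is why the zero start of the
      homotopy is part of the statement.\<close>
    have z: "rmat R h (r n) (r (n - 1)) (rmat R (D n) (r (n - 1)) (r n) (?d k)) = (\<lambda>_. \<zero>)"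
    proof (cases n)
      case 0
      then show ?thesis using h(3) rmat_zero_matrix[OF rmat_closed[OF Dcar d]] by simp
    next
      case (Suc m)
      then show ?thesis using D_D[of "unitv k" m] u rmat_zero[OF h(1)] by simp
    qed
    have "rmat R (D (Suc n)) (r n) (r (Suc n)) (rmat R h' (r (Suc n)) (r n) (?d k)) i = a \<otimes> ?d k i" for i
    proof -
      have "rmat R (D (Suc n)) (r n) (r (Suc n)) (rmat R h' (r (Suc n)) (r n) (?d k)) i \<oplus> \<zero> = a \<otimes> ?d k i"
        using rmat_homotopy[OF Dcar h(2,1) Dcar aR d h(4)[rule_format], unfolded z] by (rule fun_cong)
      then show ?thesis using rvecD(1)[OF rmat_closed[OF Dcar h'd]] by simp
    qed
    then have "rmat R (D (Suc n)) (r n) (r (Suc n)) (v k) = (\<lambda>_. \<zero>)"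
      unfolding v_def rmat_diff[OF Dcar rvec_smult[OF u aR] h'd] rmat_smult[OF Dcar u aR]
      using aR rvecD(1)[OF d] by (simp add: minus_eq r_neg)
    then show ?thesis using v ker[of n] by blast
  qed
  note vim = this
  have "\<exists>w. k < r (Suc n) \<longrightarrow> w \<in> fvec R (r (Suc (Suc n))) \<and>
      v k = rmat R (D (Suc (Suc n))) (r (Suc n)) (r (Suc (Suc n))) w" for k
    using vim[of k] by blast
  then obtain w where w': "\<And>k. k < r (Suc n) \<longrightarrow> w k \<in> fvec R (r (Suc (Suc n))) \<and>
      v k = rmat R (D (Suc (Suc n))) (r (Suc n)) (r (Suc (Suc n))) (w k)" by metis
  have w: "w k \<in> fvec R (r (Suc (Suc n)))"
    "v k = rmat R (D (Suc (Suc n))) (r (Suc n)) (r (Suc (Suc n))) (w k)" if "k < r (Suc n)" for k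
    using w' that by blast+
  define h'' where "h'' i k = (if k < r (Suc n) then w k i else \<zero>)" for i k
  have ch: "S.mcar h''" using rvecD(1)[OF w(1)] by (simp add: h''_def)
  have "S.mprod (D (Suc (Suc n))) h'' (r (Suc (Suc n))) i k \<oplus> S.mprod h' (D (Suc n)) (r n) i k
       = (if i = k then a else \<zero>)" if ik: "i < r (Suc n)" "k < r (Suc n)" for i k
  proof -
    note u = unitv_fvec[OF ik(2)]
    have c: "S.mprod h' (D (Suc n)) (r n) i k \<in> carrier R" by (rule S.mprod_closed[OF h(2) Dcar])
    have "S.mprod (D (Suc (Suc n))) h'' (r (Suc (Suc n))) i k = v k i"
      using w(2)[OF ik(2)] ik by (simp add: S.mprod_def h''_def rmat_def)
    also have "\<dots> = a \<otimes> unitv k i \<ominus> rmat R (S.mprod h' (D (Suc n)) (r n)) (r (Suc n)) (r (Suc n)) (unitv k) i"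
      unfolding v_def rmat_comp[OF Dcar h(2) u] ..
    also have "rmat R (S.mprod h' (D (Suc n)) (r n)) (r (Suc n)) (r (Suc n)) (unitv k) i = S.mprod h' (D (Suc n)) (r n) i k"
      using rmat_unitv[OF allI[OF allI[OF S.mprod_closed[OF h(2) Dcar]]] ik(2)] ik(1) by simp
    finally have "S.mprod (D (Suc (Suc n))) h'' (r (Suc (Suc n))) i k = a \<otimes> unitv k i \<ominus> S.mprod h' (D (Suc n)) (r n) i k" .
    then show ?thesis using c aR by (auto simp: unitv_def minus_eq a_assoc l_neg)
  qed
  then show ?case using h(2) ch by (intro exI[of _ h'] exI[of _ h'']) (simp del: all_simps)
qed

end

text \<open>Vanishing of the homology in degree \<open>i\<close> of the complex with matrices \<open>D\<close> tensored with \<open>N\<close>.\<close>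
definition tv :: "('b, 'n) module \<Rightarrow> (nat \<Rightarrow> nat) \<Rightarrow> (nat \<Rightarrow> nat \<Rightarrow> nat \<Rightarrow> 'b) \<Rightarrow> nat \<Rightarrow> bool" where
  "tv N r D i \<longleftrightarrow> {y \<in> fvec N (r i). i = 0 \<or> mmat N (D i) (r (i - 1)) (r i) y = (\<lambda>_. \<zero>\<^bsub>N\<^esub>)}
          \<subseteq> mmat N (D (Suc i)) (r i) (r (Suc i)) ` fvec N (r (Suc i))"

locale rescomp = freeres R J r D + tmod R M
  for R :: "'b ring" (structure) and J r D and M :: "('b, 'n) module" (structure)
begin

lemma D_D_module: "y \<in> fvec M (r (Suc (Suc n))) \<Longrightarrow>
   mmat M (D (Suc n)) (r n) (r (Suc n)) (mmat M (D (Suc (Suc n))) (r (Suc n)) (r (Suc (Suc n))) y) = (\<lambda>_. \<zero>\<^bsub>M\<^esub>)"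
proof -
  assume y: "y \<in> fvec M (r (Suc (Suc n)))"
  have "mmat M (mprod (D (Suc n)) (D (Suc (Suc n))) (r (Suc n))) (r n) (r (Suc (Suc n))) y
      = mmat M (\<lambda>_ _. \<zero>) (r n) (r (Suc (Suc n))) y"
    using mprod_D_D y by (intro mmat_cong) auto
  then show ?thesis using y mmat_comp[OF Dcar Dcar y] mmat_zero_matrix[OF y] by simp
qed

lemma surj_lift:
  assumes "x \<in> carrier R" "mulset M x (carrier M) = carrier M" "y \<in> fvec M n"
  shows "\<exists>y'\<in>fvec M n. y = (\<lambda>i. x \<odot>\<^bsub>M\<^esub> y' i)"
proof -
  have "\<forall>i. \<exists>z\<in>carrier M. y i = x \<odot>\<^bsub>M\<^esub> z"
    using fvecD(1)[OF assms(3)] assms(2) unfolding mulset_def by blast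
  then obtain z where z: "\<And>i. z i \<in> carrier M" "\<And>i. y i = x \<odot>\<^bsub>M\<^esub> z i" by metis
  define y' where "y' i = (if i < n then z i else \<zero>\<^bsub>M\<^esub>)" for i
  have "y' \<in> fvec M n" using z by (auto simp: y'_def fvec_def)
  moreover have "y = (\<lambda>i. x \<odot>\<^bsub>M\<^esub> y' i)"
    using z(2) assms(1) fvecD(2)[OF assms(3)] by (auto simp: y'_def)
  ultimately show ?thesis by blast
qed

text \<open>On a cycle the summand h d of the null-homotopy vanishes, and the remaining one exhibits
  \<open>a y\<close> as a boundary. In short, J annihilates Tor(A/J, N).\<close>

lemma J_kills_cycle:
  assumes a: "a \<in> J" and y: "y \<in> fvec M (r n)" "n = 0 \<or> mmat M (D n) (r (n - 1)) (r n) y = (\<lambda>_. \<zero>\<^bsub>M\<^esub>)"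
  shows "(\<lambda>i. a \<odot>\<^bsub>M\<^esub> y i) \<in> mmat M (D (Suc n)) (r n) (r (Suc n)) ` fvec M (r (Suc n))"
proof -
  have aR: "a \<in> carrier R" using a J ideal.Icarr by fastforce
  obtain h h' where h: "mcar h" "mcar h'" "n = 0 \<longrightarrow> h = (\<lambda>_ _. \<zero>)"
    "\<forall>i<r n. \<forall>k<r n. mprod (D (Suc n)) h' (r (Suc n)) i k \<oplus> mprod h (D n) (r (n - 1)) i k
       = (if i = k then a else \<zero>)" using null_homotopy[OF a, of n] by (elim exE conjE) (rule that)
  have z: "mmat M h (r n) (r (n - 1)) (mmat M (D n) (r (n - 1)) (r n) y) = (\<lambda>_. \<zero>\<^bsub>M\<^esub>)"
    using y(2) mmat_zero[OF h(1)] h(3) mmat_zero_matrix[OF mmat_closed[OF Dcar y(1)]] by auto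
  have c: "mmat M h' (r (Suc n)) (r n) y \<in> fvec M (r (Suc n))" by (rule mmat_closed[OF h(2) y(1)])
  have "mmat M (D (Suc n)) (r n) (r (Suc n)) (mmat M h' (r (Suc n)) (r n) y) = (\<lambda>i. a \<odot>\<^bsub>M\<^esub> y i)"
    using mmat_homotopy[OF Dcar h(2,1) Dcar aR y(1) h(4)[rule_format], unfolded z]
      fvecD(1)[OF mmat_closed[OF Dcar c]] by simp
  then show ?thesis using c by (metis imageI)
qed

text \<open>In degree 0 every tuple is a cycle. Hence the \<open>y'\<close> with y = x y' is a
  cycle, and J kills its homology class.\<close>

lemma tv_0:
  assumes "x \<in> J" "mulset M x (carrier M) = carrier M" shows "tv M r D 0"
  unfolding tv_def
proof
  have xR: "x \<in> carrier R" using assms J ideal.Icarr by fastforce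
  fix y assume "y \<in> {y \<in> fvec M (r 0). 0 = 0 \<or> mmat M (D 0) (r (0 - 1)) (r 0) y = (\<lambda>_. \<zero>\<^bsub>M\<^esub>)}"
  then obtain y' where "y' \<in> fvec M (r 0)" "y = (\<lambda>i. x \<odot>\<^bsub>M\<^esub> y' i)"
    using surj_lift[OF xR assms(2)] by blast
  then show "y \<in> mmat M (D (Suc 0)) (r 0) (r (Suc 0)) ` fvec M (r (Suc 0))"
    using J_kills_cycle[OF assms(1)] by simp
qed

section \<open>Degree shift along 0 -> (0 : x) -> M -> M -> 0 for x in J acting surjectively\<close>

context
  fixes x assumes x: "x \<in> J" and surj: "mulset M x (carrier M) = carrier M"
begin

lemma xR: "x \<in> carrier R" using x J ideal.Icarr by fastforce

lemma colon_x: "submodule (colon M {x}) R M"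
  using xR by (auto simp: submodule_iff colon_def smult_r_distr smult_assoc1[symmetric] m_comm[of x])
    (simp add: smult_assoc1)

lemma fvec_colon: "y \<in> fvec (sub M (colon M {x})) n \<longleftrightarrow> y \<in> fvec M n \<and> (\<lambda>i. x \<odot>\<^bsub>M\<^esub> y i) = (\<lambda>_. \<zero>\<^bsub>M\<^esub>)"
  using xR by (auto simp: fvec_def colon_def fun_eq_iff) (metis linorder_not_less smult_r_null)

text \<open>Exactness of Tor_{i+1}(M) -> Tor_i(0 : x) -> Tor_i(M), by hand. A cycle y of 0 : x
  bounds some w over \<open>M\<close>; then x w is a cycle, hence the boundary of some x u'.
  Subtracting the boundary of u' from w gives a tuple in 0 : x with the same boundary y.\<close>

lemma tv_colon:
  assumes "tv M r D i" "tv M r D (Suc i)" shows "tv (sub M (colon M {x})) r D i"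
  unfolding tv_def
proof
  let ?N = "sub M (colon M {x})"
  fix y assume "y \<in> {y \<in> fvec ?N (r i). i = 0 \<or> mmat ?N (D i) (r (i - 1)) (r i) y = (\<lambda>_. \<zero>\<^bsub>?N\<^esub>)}"
  then have y: "y \<in> fvec ?N (r i)" "i = 0 \<or> mmat M (D i) (r (i - 1)) (r i) y = (\<lambda>_. \<zero>\<^bsub>M\<^esub>)"
    using mmat_sub(1)[OF colon_x Dcar] by auto
  have yM: "y \<in> fvec M (r i)" "(\<lambda>j. x \<odot>\<^bsub>M\<^esub> y j) = (\<lambda>_. \<zero>\<^bsub>M\<^esub>)" using y(1) fvec_colon by blast+
  obtain w where w: "w \<in> fvec M (r (Suc i))" "y = mmat M (D (Suc i)) (r i) (r (Suc i)) w"
    using assms(1) y yM unfolding tv_def by blast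
  have "mmat M (D (Suc i)) (r i) (r (Suc i)) (\<lambda>j. x \<odot>\<^bsub>M\<^esub> w j) = (\<lambda>_. \<zero>\<^bsub>M\<^esub>)"
    using mmat_smult[OF Dcar w(1) xR] w(2) yM(2) by simp
  then have "(\<lambda>j. x \<odot>\<^bsub>M\<^esub> w j) \<in> mmat M (D (Suc (Suc i))) (r (Suc i)) (r (Suc (Suc i))) ` fvec M (r (Suc (Suc i)))"
    using assms(2) fvec_smult[OF w(1) xR] unfolding tv_def by auto
  then obtain u where u: "u \<in> fvec M (r (Suc (Suc i)))"
    "(\<lambda>j. x \<odot>\<^bsub>M\<^esub> w j) = mmat M (D (Suc (Suc i))) (r (Suc i)) (r (Suc (Suc i))) u" by blast
  obtain u' where u': "u' \<in> fvec M (r (Suc (Suc i)))" "u = (\<lambda>j. x \<odot>\<^bsub>M\<^esub> u' j)"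
    using surj_lift[OF xR surj u(1)] by blast
  define v where "v = mmat M (D (Suc (Suc i))) (r (Suc i)) (r (Suc (Suc i))) u'"
  have v: "v \<in> fvec M (r (Suc i))" unfolding v_def by (rule mmat_closed[OF Dcar u'(1)])
  have xv: "x \<odot>\<^bsub>M\<^esub> w j = x \<odot>\<^bsub>M\<^esub> v j" for j
    using u(2) mmat_smult[OF Dcar u'(1) xR] unfolding u'(2) v_def by (metis (full_types))
  define w' where "w' = (\<lambda>j. w j \<ominus>\<^bsub>M\<^esub> v j)"
  have w'M: "w' \<in> fvec M (r (Suc i))" unfolding w'_def by (rule fvec_diff[OF w(1) v])
  have "x \<odot>\<^bsub>M\<^esub> w' j = \<zero>\<^bsub>M\<^esub>" for j
    using xv[of j] fvecD(1)[OF w(1)] fvecD(1)[OF v] xR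
    by (simp add: w'_def a_minus_def smult_r_distr smult_r_minus M.r_neg)
  then have w': "w' \<in> fvec ?N (r (Suc i))" using w'M fvec_colon by auto
  have "mmat M (D (Suc i)) (r i) (r (Suc i)) w' = (\<lambda>j. y j \<ominus>\<^bsub>M\<^esub> \<zero>\<^bsub>M\<^esub>)"
    unfolding w'_def mmat_diff[OF Dcar w(1) v] using w(2) D_D_module[OF u'(1)] by (simp add: v_def)
  also have "\<dots> = y" using fvecD(1)[OF yM(1)] by (simp add: a_minus_def)
  finally show "y \<in> mmat ?N (D (Suc i)) (r i) (r (Suc i)) ` fvec ?N (r (Suc i))"
    using w' mmat_sub(1)[OF colon_x Dcar w'] by (metis imageI)
qed

text \<open>Since x lies in J it acts as zero on homology, so the connecting map from Tor_{i+1}(M)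
  to Tor_i(0 : x) is injective. Concretely, write y = x y'; the boundary of y' is a cycle in 0 : x,
  hence bounds some z there. Now y' - z is a cycle, and multiplying it by x gives y.\<close>

lemma tv_Suc:
  assumes "tv (sub M (colon M {x})) r D i" shows "tv M r D (Suc i)"
  unfolding tv_def
proof
  let ?N = "sub M (colon M {x})"
  fix y assume "y \<in> {y \<in> fvec M (r (Suc i)). Suc i = 0 \<or> mmat M (D (Suc i)) (r (Suc i - 1)) (r (Suc i)) y = (\<lambda>_. \<zero>\<^bsub>M\<^esub>)}"
  then have y: "y \<in> fvec M (r (Suc i))" "mmat M (D (Suc i)) (r i) (r (Suc i)) y = (\<lambda>_. \<zero>\<^bsub>M\<^esub>)" by auto
  obtain y' where y': "y' \<in> fvec M (r (Suc i))" "y = (\<lambda>j. x \<odot>\<^bsub>M\<^esub> y' j)"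
    using surj_lift[OF xR surj y(1)] by blast
  define d where "d = mmat M (D (Suc i)) (r i) (r (Suc i)) y'"
  have dM: "d \<in> fvec M (r i)" unfolding d_def by (rule mmat_closed[OF Dcar y'(1)])
  have "(\<lambda>j. x \<odot>\<^bsub>M\<^esub> d j) = (\<lambda>_. \<zero>\<^bsub>M\<^esub>)"
    unfolding d_def using mmat_smult[OF Dcar y'(1) xR] y(2) y'(2) by simp
  then have dN: "d \<in> fvec ?N (r i)" using dM fvec_colon by blast
  have "i = 0 \<or> mmat M (D i) (r (i - 1)) (r i) d = (\<lambda>_. \<zero>\<^bsub>M\<^esub>)"
    unfolding d_def by (cases i) (use y'(1) D_D_module in auto)
  then have "d \<in> mmat ?N (D (Suc i)) (r i) (r (Suc i)) ` fvec ?N (r (Suc i))"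
    using assms dN mmat_sub(1)[OF colon_x Dcar dN] unfolding tv_def by auto
  then obtain z where z: "z \<in> fvec ?N (r (Suc i))" "d = mmat ?N (D (Suc i)) (r i) (r (Suc i)) z" by blast
  have zM: "z \<in> fvec M (r (Suc i))" "\<And>j. x \<odot>\<^bsub>M\<^esub> z j = \<zero>\<^bsub>M\<^esub>" using z(1) fvec_colon by metis+
  have dz: "d = mmat M (D (Suc i)) (r i) (r (Suc i)) z" using z mmat_sub(1)[OF colon_x Dcar z(1)] by simp
  define w where "w = (\<lambda>j. y' j \<ominus>\<^bsub>M\<^esub> z j)"
  have wM: "w \<in> fvec M (r (Suc i))" unfolding w_def by (rule fvec_diff[OF y'(1) zM(1)])
  have "mmat M (D (Suc i)) (r i) (r (Suc i)) w = (\<lambda>_. \<zero>\<^bsub>M\<^esub>)"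
    unfolding w_def mmat_diff[OF Dcar y'(1) zM(1)] using dz d_def fvecD(1)[OF dM]
    by (simp add: a_minus_def M.r_neg)
  then have "(\<lambda>j. x \<odot>\<^bsub>M\<^esub> w j) \<in> mmat M (D (Suc (Suc i))) (r (Suc i)) (r (Suc (Suc i))) ` fvec M (r (Suc (Suc i)))"
    using J_kills_cycle[OF x wM] by simp
  moreover have "(\<lambda>j. x \<odot>\<^bsub>M\<^esub> w j) = y"
    using y'(2) zM fvecD(1)[OF y'(1)] fvecD(1)[OF zM(1)] xR
    by (simp add: w_def a_minus_def smult_r_distr smult_r_minus fun_eq_iff)
  ultimately show "y \<in> mmat M (D (Suc (Suc i))) (r (Suc i)) (r (Suc (Suc i))) ` fvec M (r (Suc (Suc i)))" by simp
qed

end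

text \<open>The entries of the first differential lie in J, so boundaries in degree 0 are sums of
  products c y with c in J. An additively closed proper \<open>L\<close> containing these products
  thus shows N \<noteq> J N; J N itself is never formed.\<close>

lemma not_tv_0:
  assumes L: "\<zero>\<^bsub>M\<^esub> \<in> L" "\<And>x y. x \<in> L \<Longrightarrow> y \<in> L \<Longrightarrow> x \<oplus>\<^bsub>M\<^esub> y \<in> L" "L \<subseteq> carrier M"
    "\<And>c y. c \<in> J \<Longrightarrow> y \<in> carrier M \<Longrightarrow> c \<odot>\<^bsub>M\<^esub> y \<in> L" and z: "z \<in> carrier M" "z \<notin> L"
  shows "\<not> tv M r D 0"
proof
  assume t: "tv M r D 0"
  define v where "v j = (if j = (0::nat) then z else \<zero>\<^bsub>M\<^esub>)" for j
  have "v \<in> fvec M (r 0)" using z r0 by (auto simp: v_def fvec_def)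
  then obtain u where u: "u \<in> fvec M (r (Suc 0))" "v = mmat M (D (Suc 0)) (r 0) (r (Suc 0)) u"
    using t unfolding tv_def by blast
  have "(\<Oplus>\<^bsub>M\<^esub>j\<in>{..<n}. D (Suc 0) 0 j \<odot>\<^bsub>M\<^esub> u j) \<in> L" if "n \<le> r (Suc 0)" for n
    using that
  proof (induction n)
    case (Suc n)
    have "D (Suc 0) 0 n \<odot>\<^bsub>M\<^esub> u n \<in> L" using L(4) D1_in_J[of n] Suc.prems fvecD(1)[OF u(1)] by simp
    then show ?case using Suc L(2) Dcar fvecD(1)[OF u(1)] by (subst M.finsum_lessThan_Suc) auto
  qed (simp add: L)
  moreover have "v 0 = (\<Oplus>\<^bsub>M\<^esub>j\<in>{..<r (Suc 0)}. D (Suc 0) 0 j \<odot>\<^bsub>M\<^esub> u j)"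
    using u(2) r0 by (simp add: mmat_def)
  ultimately show False using z by (simp add: v_def)
qed

end

section \<open>Existence of free resolutions over a Noetherian ring\<close>

context rescring
begin

definition vsub :: "nat \<Rightarrow> (nat \<Rightarrow> 'b) set \<Rightarrow> bool" where
  "vsub n U \<longleftrightarrow> U \<subseteq> fvec R n \<and> (\<lambda>_. \<zero>) \<in> U \<and> (\<forall>x\<in>U. \<forall>y\<in>U. (\<lambda>i. x i \<oplus> y i) \<in> U) \<and>
    (\<forall>a\<in>carrier R. \<forall>x\<in>U. (\<lambda>i. a \<otimes> x i) \<in> U)"

lemma vsubD:
  assumes "vsub n U"
  shows "\<And>x. x \<in> U \<Longrightarrow> x \<in> fvec R n" "(\<lambda>_. \<zero>) \<in> U"
    "\<And>x y. x \<in> U \<Longrightarrow> y \<in> U \<Longrightarrow> (\<lambda>i. x i \<oplus> y i) \<in> U"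
    "\<And>a x. a \<in> carrier R \<Longrightarrow> x \<in> U \<Longrightarrow> (\<lambda>i. a \<otimes> x i) \<in> U"
  using assms by (auto simp: vsub_def)

lemma vsub_Int: "vsub m U \<Longrightarrow> vsub n V \<Longrightarrow> vsub n (U \<inter> V)"
  by (auto simp: vsub_def)

lemma vsub_image:
  assumes W: "S.mcar W" shows "vsub n (rmat R W n k ` fvec R k)"
  unfolding vsub_def
proof (intro conjI ballI)
  show "rmat R W n k ` fvec R k \<subseteq> fvec R n" using rmat_closed[OF W] by blast
  show "(\<lambda>_. \<zero>) \<in> rmat R W n k ` fvec R k"
    using rmat_zero[OF W, of n k] rvec_zero by (metis imageI)
next
  fix x y assume "x \<in> rmat R W n k ` fvec R k" "y \<in> rmat R W n k ` fvec R k"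
  then obtain a b where ab: "a \<in> fvec R k" "b \<in> fvec R k" and xy: "x = rmat R W n k a" "y = rmat R W n k b" by blast
  show "(\<lambda>i. x i \<oplus> y i) \<in> rmat R W n k ` fvec R k"
    unfolding xy rmat_add[OF W ab, symmetric] using rvec_add[OF ab] by (rule imageI)
next
  fix a x assume a: "a \<in> carrier R" and "x \<in> rmat R W n k ` fvec R k"
  then obtain b where b: "b \<in> fvec R k" and x: "x = rmat R W n k b" by blast
  show "(\<lambda>i. a \<otimes> x i) \<in> rmat R W n k ` fvec R k"
    unfolding x rmat_smult[OF W b a, symmetric] using rvec_smult[OF b a] by (rule imageI)
qed

lemma image_least:
  assumes U: "vsub n U" and W: "S.mcar W" and c: "c \<in> fvec R k"
    and col: "\<And>j. j < k \<Longrightarrow> (\<lambda>i. if i < n then W i j else \<zero>) \<in> U"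
  shows "rmat R W n k c \<in> U"
proof -
  have "(\<lambda>i. if i < n then \<Oplus>j\<in>{..<m}. W i j \<otimes> c j else \<zero>) \<in> U" if "m \<le> k" for m
    using that
  proof (induction m)
    case 0
    then show ?case using vsubD(2)[OF U] by (simp cong: if_cong)
  next
    case (Suc m)
    have "(\<lambda>i. c m \<otimes> (if i < n then W i m else \<zero>)) \<in> U"
      using vsubD(4)[OF U rvecD(1)[OF c] col] Suc.prems by simp
    from vsubD(3)[OF U this Suc.IH] Suc.prems
    have "(\<lambda>i. c m \<otimes> (if i < n then W i m else \<zero>) \<oplus> (if i < n then \<Oplus>j\<in>{..<m}. W i j \<otimes> c j else \<zero>)) \<in> U"
      by simp
    moreover have "(\<lambda>i. c m \<otimes> (if i < n then W i m else \<zero>) \<oplus> (if i < n then \<Oplus>j\<in>{..<m}. W i j \<otimes> c j else \<zero>))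
       = (\<lambda>i. if i < n then \<Oplus>j\<in>{..<Suc m}. W i j \<otimes> c j else \<zero>)"
    proof
      fix i
      have "(\<Oplus>j\<in>{..<Suc m}. W i j \<otimes> c j) = W i m \<otimes> c m \<oplus> (\<Oplus>j\<in>{..<m}. W i j \<otimes> c j)"
        using W rvecD(1)[OF c] by (intro finsum_lessThan_Suc) auto
      then show "c m \<otimes> (if i < n then W i m else \<zero>) \<oplus> (if i < n then \<Oplus>j\<in>{..<m}. W i j \<otimes> c j else \<zero>)
         = (if i < n then \<Oplus>j\<in>{..<Suc m}. W i j \<otimes> c j else \<zero>)"
        using W rvecD(1)[OF c] by (simp add: m_comm)
    qed
    ultimately show ?case by simp
  qed
  from this[OF le_refl] show ?thesis by (simp add: rmat_def[abs_def])
qed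

lemma ideal_coordinate:
  assumes U: "vsub m U" shows "ideal ((\<lambda>u. u n) ` U) R"
  unfolding ideal_iff
proof (intro conjI ballI)
  show "(\<lambda>u. u n) ` U \<subseteq> carrier R" using vsubD(1)[OF U] rvecD(1) by blast
  show "\<zero> \<in> (\<lambda>u. u n) ` U" using imageI[OF vsubD(2)[OF U], of "\<lambda>u. u n"] by simp
next
  fix x y assume "x \<in> (\<lambda>u. u n) ` U" "y \<in> (\<lambda>u. u n) ` U"
  then obtain u v where uv: "u \<in> U" "v \<in> U" "x = u n" "y = v n" by blast
  then show "x \<oplus> y \<in> (\<lambda>u. u n) ` U"
    using imageI[OF vsubD(3)[OF U uv(1,2)], of "\<lambda>u. u n"] by simp
next
  fix r x assume r: "r \<in> carrier R" and "x \<in> (\<lambda>u. u n) ` U"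
  then obtain u where u: "u \<in> U" "x = u n" by blast
  then show "r \<otimes> x \<in> (\<lambda>u. u n) ` U"
    using imageI[OF vsubD(4)[OF U r u(1)], of "\<lambda>u. u n"] by simp
qed

text \<open>Induction on the rank. The last coordinates of \<open>U\<close> form a finitely
  generated ideal, and the tuples with last coordinate zero form a submodule of smaller rank. The
  columns of \<open>W\<close> are generators of the latter followed by lifts of generators of the
  ideal.\<close>

lemma vsub_finitely_generated:
  assumes noeth: "noetherian_ring R"
  shows "vsub n U \<Longrightarrow> \<exists>k W. S.mcar W \<and> rmat R W n k ` fvec R k = U"
proof (induction n arbitrary: U)
  case 0
  have f0: "fvec R 0 = {\<lambda>_. \<zero>}" by (auto simp: fvec_def)
  then have "U = {\<lambda>_. \<zero>}" using 0 by (auto simp: vsub_def)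
  then have "rmat R (\<lambda>_ _. \<zero>) 0 0 ` fvec R 0 = U" unfolding f0 by (simp add: rmat_def)
  then show ?case by (intro exI[of _ 0] exI[of _ "\<lambda>_ _. \<zero>"]) simp
next
  case (Suc n)
  interpret N: noetherian_ring R by fact
  note U = vsubD[OF Suc.prems]
  define U0 where "U0 = {u \<in> U. u n = \<zero>}"
  have "vsub n U0" unfolding vsub_def
  proof (intro conjI ballI)
    show "U0 \<subseteq> fvec R n"
    proof
      fix u assume u: "u \<in> U0"
      then have uf: "u \<in> fvec R (Suc n)" and "u n = \<zero>" using U(1) by (auto simp: U0_def)
      then have "u j = \<zero>" if "n \<le> j" for j using rvecD(2)[OF uf, of j] that by (cases "j = n") auto
      then show "u \<in> fvec R n" using rvecD(1)[OF uf] by (intro rvecI)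
    qed
  qed (use U in \<open>auto simp: U0_def\<close>)
  then obtain k0 W0 where W0: "S.mcar W0" "rmat R W0 n k0 ` fvec R k0 = U0" using Suc.IH by blast
  obtain A where A: "A \<subseteq> carrier R" "finite A" "(\<lambda>u. u n) ` U = Idl A"
    using N.finetely_gen[OF ideal_coordinate[OF Suc.prems, of n]] by blast
  have "A \<subseteq> (\<lambda>u. u n) ` U" using genideal_self[OF A(1)] A(3) by blast
  then have "\<forall>a\<in>A. \<exists>u. u \<in> U \<and> u n = a" by blast
  then obtain uu where uu: "\<And>a. a \<in> A \<Longrightarrow> uu a \<in> U" "\<And>a. a \<in> A \<Longrightarrow> uu a n = a" by metis
  obtain as where as: "set as = A" using finite_list[OF A(2)] by blast
  define k where "k = k0 + length as"
  define W where "W i j = (if j < k0 then (if i < n then W0 i j else \<zero>)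
      else if j < k then uu (as ! (j - k0)) i else \<zero>)" for i j
  have asA: "as ! (j - k0) \<in> A" if "\<not> j < k0" "j < k" for j
    using that as nth_mem[of "j - k0" as] by (simp add: k_def)
  have Wc: "S.mcar W" using W0(1) rvecD(1)[OF U(1)[OF uu(1)[OF asA]]] by (simp add: W_def)
  let ?I = "rmat R W (Suc n) k ` fvec R k"
  have vI: "vsub (Suc n) ?I" by (rule vsub_image[OF Wc])
  have col0: "(\<lambda>i. if i < n then W0 i j else \<zero>) \<in> U0" if "j < k0" for j
    using rmat_unitv[OF W0(1) that, of n] unitv_fvec[OF that] W0(2) by (metis imageI)
  have colW: "(\<lambda>i. if i < Suc n then W i j else \<zero>) = (if j < k0 then (\<lambda>i. if i < n then W0 i j else \<zero>)
      else uu (as ! (j - k0)))" if "j < k" for j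
    using rvecD(2)[OF U(1)[OF uu(1)[OF asA[OF _ that]]]] that by (auto simp: W_def fun_eq_iff)
  have colI: "(\<lambda>i. if i < Suc n then W i j else \<zero>) \<in> ?I" if "j < k" for j
    using rmat_unitv[OF Wc that, of "Suc n"] unitv_fvec[OF that] by (metis imageI)
  have IU: "?I \<subseteq> U"
  proof
    fix x assume "x \<in> ?I"
    then obtain c where c: "c \<in> fvec R k" and x: "x = rmat R W (Suc n) k c" by blast
    show "x \<in> U" unfolding x
    proof (rule image_least[OF Suc.prems Wc c])
      fix j assume j: "j < k"
      show "(\<lambda>i. if i < Suc n then W i j else \<zero>) \<in> U"
        using colW[OF j] col0 uu(1)[OF asA[OF _ j]] by (auto simp: U0_def)
    qed
  qed
  have uuI: "uu a \<in> ?I" if a: "a \<in> A" for a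
  proof -
    obtain j where j: "j < length as" "as ! j = a" using a as by (metis in_set_conv_nth)
    then have "k0 + j < k" by (simp add: k_def)
    then show ?thesis using colI[of "k0 + j"] colW[of "k0 + j"] j by simp
  qed
  have "A \<subseteq> (\<lambda>u. u n) ` ?I" using uuI uu(2) by fastforce
  then have "Idl A \<subseteq> (\<lambda>u. u n) ` ?I" by (rule genideal_minimal[OF ideal_coordinate[OF vI]])
  then have UI: "(\<lambda>u. u n) ` U \<subseteq> (\<lambda>u. u n) ` ?I" by (simp only: A(3))
  have lift: "\<exists>w\<in>?I. w n = u n" if "u \<in> U" for u
    using subsetD[OF UI imageI[OF that]] unfolding image_iff[of "u n"] by metis
  have U0I: "U0 \<subseteq> ?I"
  proof
    fix x assume "x \<in> U0"
    then obtain c where c: "c \<in> fvec R k0" and x: "x = rmat R W0 n k0 c" using W0(2) by blast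
    have "vsub n (?I \<inter> U0)" by (rule vsub_Int[OF vI \<open>vsub n U0\<close>])
    moreover have "(\<lambda>i. if i < n then W0 i j else \<zero>) \<in> ?I \<inter> U0" if "j < k0" for j
      using col0[OF that] colI[of j] colW[of j] that by (simp add: k_def)
    ultimately show "x \<in> ?I" unfolding x using image_least[OF _ W0(1) c] by blast
  qed
  have "U \<subseteq> ?I"
  proof
    fix u assume u: "u \<in> U"
    obtain w where w: "w \<in> ?I" "w n = u n" using lift[OF u] by blast
    have "w \<in> U" using w(1) IU by blast
    note uc = rvecD(1)[OF U(1)[OF u]] and wc = rvecD(1)[OF U(1)[OF \<open>w \<in> U\<close>]]
    have "(\<lambda>i. u i \<oplus> (\<ominus> \<one>) \<otimes> w i) \<in> U" using U(3)[OF u U(4)[OF _ \<open>w \<in> U\<close>]] by simp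
    then have "(\<lambda>i. u i \<oplus> (\<ominus> \<one>) \<otimes> w i) \<in> U0" using w(2) uc[of n] by (simp add: U0_def l_minus r_neg)
    then have "(\<lambda>i. (u i \<oplus> (\<ominus> \<one>) \<otimes> w i) \<oplus> w i) \<in> ?I" using vsubD(3)[OF vI subsetD[OF U0I] w(1)] by simp
    moreover have "(\<lambda>i. (u i \<oplus> (\<ominus> \<one>) \<otimes> w i) \<oplus> w i) = u"
      using uc wc by (simp add: l_minus a_assoc l_neg)
    ultimately show "u \<in> ?I" by simp
  qed
  then show ?case using IU Wc by blast
qed

lemma vsub_kernel:
  assumes W: "S.mcar W" shows "vsub k {x \<in> fvec R k. rmat R W n k x = (\<lambda>_. \<zero>)}"
  unfolding vsub_def
  by (auto simp: rvec_zero rvec_add rvec_smult rmat_zero[OF W] rmat_add[OF W] rmat_smult[OF W])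

text \<open>\<open>tor_vanishes\<close> quantifies over all resolutions and would hold vacuously if
  there were none. Refuting it requires this existence statement.\<close>

lemma exists_free_res:
  assumes noeth: "noetherian_ring R" and J: "ideal J R"
  shows "\<exists>r D. is_free_res R J r D"
proof -
  have "vsub 1 {x \<in> fvec R 1. x 0 \<in> J}"
    using J unfolding vsub_def ideal_iff by (auto simp: rvec_zero rvec_add rvec_smult)
  then obtain k1 W1 where W1: "S.mcar W1" "rmat R W1 1 k1 ` fvec R k1 = {x \<in> fvec R 1. x 0 \<in> J}"
    using vsub_finitely_generated[OF noeth] by blast
  \<comment> \<open>A triple \<open>(m, k, W)\<close> stands for the \<open>m\<close> by
    \<open>k\<close> matrix \<open>W\<close>. \<open>Nx\<close> demands that the columns of the next
    matrix generate the kernel of the current one.\<close>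
  define Pr where "Pr n t \<longleftrightarrow> S.mcar (snd (snd t)) \<and> (n = 0 \<longrightarrow> t = (1, k1, W1))"
    for n :: nat and t :: "nat \<times> nat \<times> (nat \<Rightarrow> nat \<Rightarrow> 'b)"
  define Nx where "Nx t t' \<longleftrightarrow> fst t' = fst (snd t) \<and>
      {x \<in> fvec R (fst (snd t)). rmat R (snd (snd t)) (fst t) (fst (snd t)) x = (\<lambda>_. \<zero>)}
        = rmat R (snd (snd t')) (fst t') (fst (snd t')) ` fvec R (fst (snd t'))"
    for t t' :: "nat \<times> nat \<times> (nat \<Rightarrow> nat \<Rightarrow> 'b)"
  have "\<exists>f. \<forall>n. Pr n (f n) \<and> Nx (f n) (f (Suc n))"
  proof (rule dependent_nat_choice)
    show "\<exists>t. Pr 0 t" using W1(1) by (auto simp: Pr_def)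
  next
    fix t n assume "Pr n t"
    then have c: "S.mcar (snd (snd t))" by (simp add: Pr_def)
    obtain k W where "S.mcar W" "rmat R W (fst (snd t)) k ` fvec R k
      = {x \<in> fvec R (fst (snd t)). rmat R (snd (snd t)) (fst t) (fst (snd t)) x = (\<lambda>_. \<zero>)}"
      using vsub_finitely_generated[OF noeth vsub_kernel[OF c]] by blast
    then show "\<exists>t'. Pr (Suc n) t' \<and> Nx t t'"
      by (intro exI[of _ "(fst (snd t), k, W)"]) (simp add: Pr_def Nx_def)
  qed
  then obtain f where f: "\<And>n. Pr n (f n)" "\<And>n. Nx (f n) (f (Suc n))" by blast
  define r where "r n = fst (f n)" for n
  \<comment> \<open>The triple \<open>f m\<close> carries the differential in degree
    \<open>m + 1\<close>; the zero matrix in degree 0 is only a filler.\<close>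
  define D where "D n = (case n of 0 \<Rightarrow> (\<lambda>_ _. \<zero>) | Suc m \<Rightarrow> snd (snd (f m)))" for n
  have f0: "f 0 = (1, k1, W1)" using f(1)[of 0] by (simp add: Pr_def)
  have rS: "fst (snd (f n)) = r (Suc n)" for n using f(2)[of n] by (simp add: Nx_def r_def)
  have k1: "r (Suc 0) = k1" using rS[of 0] f0 by simp
  have "D n i j \<in> carrier R" for n i j
    using f(1)[of "n - 1"] by (cases n) (auto simp: D_def Pr_def)
  moreover have "r 0 = 1" by (simp add: r_def f0)
  moreover have "rmat R (D 1) (r 0) (r 1) ` fvec R (r 1) = {x \<in> fvec R 1. x 0 \<in> J}"
    using W1(2) k1 f0 by (simp add: r_def D_def)
  moreover have "{x \<in> fvec R (r n). rmat R (D n) (r (n - 1)) (r n) x = (\<lambda>_. \<zero>)}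
              = rmat R (D (Suc n)) (r n) (r (Suc n)) ` fvec R (r (Suc n))" if n: "n \<ge> 1" for n
  proof -
    obtain m where m: "n = Suc m" using n by (cases n) auto
    show ?thesis using f(2)[of m] unfolding Nx_def rS m by (simp add: D_def r_def)
  qed
  ultimately have "is_free_res R J r D" unfolding is_free_res_def by blast
  then show ?thesis by blast
qed

end

section \<open>Vanishing of the dual Bass numbers\<close>

definition tor_zero_below :: "'a ring \<Rightarrow> ('a, 'm) module \<Rightarrow> 'a set \<Rightarrow> nat \<Rightarrow> bool" where
  "tor_zero_below R M p n \<longleftrightarrow> (\<forall>i<n. dual_bass_zero R M p i)"

context coloc
begin

lemma dual_bass_zero_tv:
  "dual_bass_zero R M p i \<longleftrightarrow> (\<forall>r D. is_free_res Q (res_ideal R p) r D \<longrightarrow> tv H r D i)"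
  by (simp add: dual_bass_zero_def tor_vanishes_def tv_def)

lemma rescomp_H:
  assumes "is_free_res Q (res_ideal R p) r D"
  shows "rescomp Q (res_ideal R p) r D H"
  unfolding rescomp_def freeres_def freeres_axioms_def rescring_def tmod_def
  using cring_Q ideal_res module_H assms by blast

text \<open>By \<open>H_surj\<close> and \<open>H_colon\<close>, colocalizing 0 -> (0 : x) -> M -> M
  -> 0 gives an exact sequence of the same kind with \<open>fr x \<one>\<close> in the maximal
  ideal. The shift lemmas then apply to each resolution separately, and degree 0 is covered by
  \<open>tv_0\<close>.\<close>

lemma tor_zero_below_Suc:
  assumes x: "x \<in> p" and surj: "mulset M x (carrier M) = carrier M"
  shows "tor_zero_below R M p (Suc n) \<longleftrightarrow> tor_zero_below R (sub M (colon M {x})) p n"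
proof -
  have xR: "x \<in> carrier R" using x p_sub by blast
  have xJ: "fr x \<one> \<in> res_ideal R p" using x S_one by (auto simp: res_ideal_def S_def)
  have Hs: "mulset H (fr x \<one>) (carrier H) = carrier H" by (rule H_surj[OF xR surj])
  have N: "dual_bass_zero R (sub M (colon M {x})) p i \<longleftrightarrow>
     (\<forall>r D. is_free_res Q (res_ideal R p) r D \<longrightarrow> tv (sub H (colon H {fr x \<one>})) r D i)" for i
    by (simp add: dual_bass_zero_def tor_vanishes_def tv_def H_colon[OF xR])
  have "dual_bass_zero R M p 0"
    unfolding dual_bass_zero_tv using rescomp.tv_0[OF rescomp_H xJ Hs] by blast
  moreover have "dual_bass_zero R (sub M (colon M {x})) p i"
    if "dual_bass_zero R M p i" "dual_bass_zero R M p (Suc i)" for i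
    using that rescomp.tv_colon[OF rescomp_H xJ Hs] unfolding N dual_bass_zero_tv by blast
  moreover have "dual_bass_zero R M p (Suc i)" if "dual_bass_zero R (sub M (colon M {x})) p i" for i
    using that rescomp.tv_Suc[OF rescomp_H xJ Hs] unfolding N dual_bass_zero_tv by blast
  ultimately show ?thesis unfolding tor_zero_below_def
    by (metis Suc_lessD Suc_mono less_Suc_eq_0_disj)
qed

text \<open>The homomorphisms whose value at 1 lies in \<open>K\<close> contain all products of the
  maximal ideal with \<open>H\<close>, but not all of \<open>H\<close>. So the colocalization is not
  generated by these products, and its zeroth Tor with the residue field is nonzero.\<close>

lemma not_dual_bass_zero_0:
  assumes K: "sm K" and p: "{r \<in> carrier R. \<forall>y\<in>carrier M. r \<odot>\<^bsub>M\<^esub> y \<in> K} = p"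
  shows "\<not> dual_bass_zero R M p 0"
proof -
  interpret Q: rescring Q unfolding rescring_def by (rule cring_Q)
  interpret H: module Q H by (rule module_H)
  obtain r D where res: "is_free_res Q (res_ideal R p) r D"
    using Q.exists_free_res[OF noetherian_Q[OF noetherian_ring_axioms] ideal_res] by blast
  define L where "L = {F \<in> carrier H. F \<one>\<^bsub>Q\<^esub> \<in> K}"
  obtain F where F: "F \<in> carrier H" "F \<one>\<^bsub>Q\<^esub> \<notin> K" using H_not_generated(1)[OF K p] by blast
  have one: "\<one>\<^bsub>Q\<^esub> \<in> carrier Q" by simp
  have "\<not> tv H r D 0"
  proof (rule rescomp.not_tv_0[OF rescomp_H[OF res]])
    show "\<zero>\<^bsub>H\<^esub> \<in> L" using smD(2)[OF K] one H.M.zero_closed by (simp add: L_def H_zero)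
    show "f \<oplus>\<^bsub>H\<^esub> g \<in> L" if "f \<in> L" "g \<in> L" for f g
      using that smD(3)[OF K] one H.M.a_closed[of f g] by (simp add: L_def H_add)
    show "L \<subseteq> carrier H" by (auto simp: L_def)
    show "c \<odot>\<^bsub>H\<^esub> f \<in> L" if "c \<in> res_ideal R p" "f \<in> carrier H" for c f
    proof -
      have "c \<in> carrier Q" using that(1) ideal_res ideal.Icarr by fastforce
      then show ?thesis using H_not_generated(2)[OF K p that] H.smult_closed[OF _ that(2)] by (simp add: L_def)
    qed
    show "F \<in> carrier H" "F \<notin> L" using F by (auto simp: L_def)
  qed
  then show ?thesis using res unfolding dual_bass_zero_tv by blast
qed

end

section \<open>Support and attached primes\<close>

context artmod
begin

definition iadd :: "'a set \<Rightarrow> 'a \<Rightarrow> 'a set" where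
  "iadd I a = {x \<oplus> r \<otimes> a | x r. x \<in> I \<and> r \<in> carrier R}"

lemma iadd:
  assumes I: "ideal I R" and a: "a \<in> carrier R"
  shows "ideal (iadd I a) R" "I \<subseteq> iadd I a" "a \<in> iadd I a"
proof -
  note i = idealD[OF I]
  show sub: "I \<subseteq> iadd I a"
  proof
    fix x assume "x \<in> I"
    then have "x = x \<oplus> \<zero> \<otimes> a" using a i(7) by simp
    then show "x \<in> iadd I a" unfolding iadd_def using \<open>x \<in> I\<close> by blast
  qed
  have "a = \<zero> \<oplus> \<one> \<otimes> a" using a by simp
  then show "a \<in> iadd I a" unfolding iadd_def using i(2) by blast
  have "(x \<oplus> r \<otimes> a) \<oplus> (y \<oplus> s \<otimes> a) \<in> iadd I a" if "x \<in> I" "y \<in> I" "r \<in> carrier R" "s \<in> carrier R" for x y r s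
  proof -
    have "(x \<oplus> r \<otimes> a) \<oplus> (y \<oplus> s \<otimes> a) = (x \<oplus> y) \<oplus> (r \<oplus> s) \<otimes> a"
      using that a i(7) by (simp add: R.l_distr R.a_ac)
    then show ?thesis unfolding iadd_def using i(3)[OF that(1,2)] that by blast
  qed
  moreover have "s \<otimes> (x \<oplus> r \<otimes> a) \<in> iadd I a" if "x \<in> I" "r \<in> carrier R" "s \<in> carrier R" for x r s
  proof -
    have "s \<otimes> (x \<oplus> r \<otimes> a) = s \<otimes> x \<oplus> (s \<otimes> r) \<otimes> a" using that a i(7) by (simp add: R.r_distr m_assoc)
    then show ?thesis unfolding iadd_def using i(4)[OF that(3,1)] that by blast
  qed
  moreover have "iadd I a \<subseteq> carrier R" using a i(7) by (auto simp: iadd_def)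
  moreover have "\<zero> \<in> iadd I a" using i(2) sub by blast
  ultimately show "ideal (iadd I a) R" unfolding ideal_iff by (auto simp: iadd_def)
qed

lemma iadd_least: "ideal L R \<Longrightarrow> I \<subseteq> L \<Longrightarrow> a \<in> L \<Longrightarrow> iadd I a \<subseteq> L"
  using idealD(3,4)[of L] by (auto simp: iadd_def subset_iff)

lemma prime_disjoint:
  assumes I: "ideal I R" and T: "T \<subseteq> carrier R" "\<one> \<in> T" "\<And>s t. s \<in> T \<Longrightarrow> t \<in> T \<Longrightarrow> s \<otimes> t \<in> T"
    and IT: "I \<inter> T = {}"
  shows "\<exists>p. primeideal p R \<and> I \<subseteq> p \<and> p \<inter> T = {}"
proof -
  define \<I> where "\<I> = {J. ideal J R \<and> I \<subseteq> J \<and> J \<inter> T = {}}"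
  have "\<exists>P\<in>\<I>. \<forall>J\<in>\<I>. P \<subseteq> J \<longrightarrow> J = P"
    by (rule noetherian_maximal) (use I IT in \<open>auto simp: \<I>_def\<close>)
  then obtain P where P0: "P \<in> \<I>" "\<And>J. J \<in> \<I> \<Longrightarrow> P \<subseteq> J \<Longrightarrow> J = P" by metis
  have P: "ideal P R" "I \<subseteq> P" "P \<inter> T = {}" using P0(1) by (auto simp: \<I>_def)
  have mx: "J = P" if "ideal J R" "P \<subseteq> J" "J \<inter> T = {}" for J
    using P0(2)[of J] that P(2) by (auto simp: \<I>_def)
  note i = idealD[OF P(1)]
  have meet: "\<exists>x r. x \<in> P \<and> r \<in> carrier R \<and> x \<oplus> r \<otimes> a \<in> T" if "a \<in> carrier R" "a \<notin> P" for a
    using mx[OF iadd(1,2)[OF P(1) that(1)]] iadd(3)[OF P(1) that(1)] that(2) unfolding iadd_def by blast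
  have "a \<in> P \<or> b \<in> P" if ab: "a \<in> carrier R" "b \<in> carrier R" "a \<otimes> b \<in> P" for a b
  proof (rule ccontr)
    assume "\<not> (a \<in> P \<or> b \<in> P)"
    then obtain x r y s where h: "x \<in> P" "r \<in> carrier R" "x \<oplus> r \<otimes> a \<in> T" "y \<in> P" "s \<in> carrier R" "y \<oplus> s \<otimes> b \<in> T"
      using meet ab by metis
    have c: "x \<in> carrier R" "y \<in> carrier R" using h i(7) by auto
    have "(x \<oplus> r \<otimes> a) \<otimes> (y \<oplus> s \<otimes> b) = (y \<oplus> s \<otimes> b) \<otimes> x \<oplus> ((r \<otimes> a) \<otimes> y \<oplus> (r \<otimes> s) \<otimes> (a \<otimes> b))"
      using h(2,5) ab(1,2) c by (simp add: R.l_distr R.r_distr m_ac R.a_ac)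
    also have "\<dots> \<in> P"
      using i(3)[OF i(4)[of "y \<oplus> s \<otimes> b" x] i(3)[OF i(4)[of "r \<otimes> a" y] i(4)[of "r \<otimes> s" "a \<otimes> b"]]] h ab c by simp
    finally show False using T(3)[OF h(3,6)] P(3) by blast
  qed
  moreover have "\<one> \<notin> P" using P(3) T(2) by blast
  ultimately have "primeideal P R" using P(1) by (simp add: primeideal_iff)
  then show ?thesis using P by blast
qed

lemma prime_above:
  assumes "ideal I R" "\<one> \<notin> I" shows "\<exists>p. primeideal p R \<and> I \<subseteq> p"
  using prime_disjoint[OF assms(1), of "{\<one>}"] assms(2) by auto

lemma prime_product:
  assumes "finite \<Q>" "ideal I R" "primeideal q R" "\<not> I \<subseteq> q" "\<And>q'. q' \<in> \<Q> \<Longrightarrow> ideal q' R \<and> \<not> q' \<subseteq> q"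
  shows "\<exists>w\<in>I. w \<notin> q \<and> (\<forall>q'\<in>\<Q>. w \<in> q')"
  using assms(1,5)
proof (induction \<Q>)
  case empty
  then show ?case using assms(4) by blast
next
  case (insert p \<Q>)
  then obtain w where w: "w \<in> I" "w \<notin> q" "\<forall>q'\<in>\<Q>. w \<in> q'" by blast
  obtain z where z: "z \<in> p" "z \<notin> q" using insert.prems by blast
  have c: "w \<in> carrier R" "z \<in> carrier R" using w(1) assms(2) idealD(7) z(1) insert.prems by blast+
  have "w \<otimes> z \<notin> q" using primeD(3)[OF assms(3) c] w z by blast
  moreover have "w \<otimes> z \<in> I" using idealD(8)[OF assms(2) c(2) w(1)] .
  moreover have "w \<otimes> z \<in> q'" if "q' \<in> insert p \<Q>" for q'
  proof (cases "q' = p")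
    case True
    then show ?thesis using idealD(4)[of p] insert.prems z(1) c by blast
  next
    case False
    then have "q' \<in> \<Q>" using that by blast
    then show ?thesis using idealD(8)[of q'] insert.prems w(3) c by blast
  qed
  ultimately show ?case by blast
qed

text \<open>Primes contained in another member of \<open>\<Q>\<close> are dropped first. If the rest
  are incomparable and the element avoiding all but \<open>q\<close> happens to lie in
  \<open>q\<close>, it is corrected by adding an element of \<open>I\<close> that lies in all of
  them except \<open>q\<close>.\<close>

lemma prime_avoidance:
  assumes "finite \<Q>" "ideal I R" "\<And>q. q \<in> \<Q> \<Longrightarrow> primeideal q R \<and> \<not> I \<subseteq> q"
  shows "\<exists>x\<in>I. \<forall>q\<in>\<Q>. x \<notin> q"
  using assms(1,3)
proof (induction "card \<Q>" arbitrary: \<Q> rule: less_induct)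
  case less
  show ?case
  proof (cases "\<exists>q\<in>\<Q>. \<exists>q'\<in>\<Q>. q \<noteq> q' \<and> q' \<subseteq> q")
    case True
    then obtain q q' where q: "q \<in> \<Q>" "q' \<in> \<Q>" "q \<noteq> q'" "q' \<subseteq> q" by blast
    have "card (\<Q> - {q'}) < card \<Q>" using q less.prems by (meson card_Diff1_less)
    then obtain x where "x \<in> I" "\<forall>q\<in>\<Q> - {q'}. x \<notin> q" using less.hyps[of "\<Q> - {q'}"] less.prems by blast
    then show ?thesis using q by blast
  next
    case False
    show ?thesis
    proof (cases "\<Q> = {}")
      case True
      then show ?thesis using idealD(2)[OF assms(2)] by blast
    next
      case ne: False
      then obtain q where q: "q \<in> \<Q>" by blast
      have qp: "primeideal q R" "\<not> I \<subseteq> q" using q less.prems by blast+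
      have "card (\<Q> - {q}) < card \<Q>" using q less.prems by (meson card_Diff1_less)
      then obtain x where x: "x \<in> I" "\<forall>q'\<in>\<Q> - {q}. x \<notin> q'" using less.hyps[of "\<Q> - {q}"] less.prems by blast
      show ?thesis
      proof (cases "x \<in> q")
        case False
        then show ?thesis using x by blast
      next
        case True
        have "ideal q' R \<and> \<not> q' \<subseteq> q" if "q' \<in> \<Q> - {q}" for q'
          using that False q less.prems primeD(1) by blast
        then obtain w where w: "w \<in> I" "w \<notin> q" "\<forall>q'\<in>\<Q> - {q}. w \<in> q'"
          using prime_product[OF _ assms(2) qp, of "\<Q> - {q}"] less.prems(1) by blast
        have c: "x \<in> carrier R" "w \<in> carrier R" using x w idealD(7)[OF assms(2)] by blast+
        have xw: "(x \<oplus> w) \<ominus> w = x" "(w \<oplus> x) \<ominus> x = w"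
          using c by (simp_all add: R.minus_eq R.a_assoc R.r_neg)
        have "x \<oplus> w \<notin> q'" if "q' \<in> \<Q>" for q'
        proof
          assume h: "x \<oplus> w \<in> q'"
          have id: "ideal q' R" using that less.prems primeD(1) by blast
          show False
          proof (cases "q' = q")
            case True
            then show False using idealD(6)[OF id h, of x] xw(2) R.a_comm[OF c] \<open>x \<in> q\<close> w(2) by simp
          next
            case False
            then have "w \<in> q'" "x \<notin> q'" using w(3) x(2) that by blast+
            then show False using idealD(6)[OF id h, of w] xw(1) by simp
          qed
        qed
        then show ?thesis using idealD(3)[OF assms(2) x(1) w(1)] by blast
      qed
    qed
  qed
qed

text \<open>\<open>m\<close> is in the support of \<open>M/K\<close>; \<open>elann\<close> and \<open>quann\<close> below are annihilators in \<open>M/K\<close>.\<close>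
definition atsupp :: "'m set \<Rightarrow> 'a set \<Rightarrow> bool" where
  "atsupp K m \<longleftrightarrow> (\<exists>y\<in>carrier M. \<forall>s\<in>carrier R - m. s \<odot>\<^bsub>M\<^esub> y \<notin> K)"

lemma atsupp_antimono: "atsupp K m \<Longrightarrow> L \<subseteq> K \<Longrightarrow> atsupp L m"
  unfolding atsupp_def by blast

lemma proper_atsupp:
  assumes K: "sm K" and y: "y \<in> carrier M" "y \<notin> K"
  shows "\<exists>m. primeideal m R \<and> atsupp K m \<and> {r \<in> carrier R. r \<odot>\<^bsub>M\<^esub> y \<in> K} \<subseteq> m"
proof -
  have "ideal {r \<in> carrier R. \<forall>x\<in>{y}. r \<odot>\<^bsub>M\<^esub> x \<in> K} R" using ideal_quot_annih[OF K, of "{y}"] y by blast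
  moreover have "\<one> \<notin> {r \<in> carrier R. \<forall>x\<in>{y}. r \<odot>\<^bsub>M\<^esub> x \<in> K}" using y by simp
  ultimately obtain m where m: "primeideal m R" "{r \<in> carrier R. \<forall>x\<in>{y}. r \<odot>\<^bsub>M\<^esub> x \<in> K} \<subseteq> m"
    using prime_above by blast
  then show ?thesis using y(1) unfolding atsupp_def by blast
qed

text \<open>An annihilator in M/K maximal among those inside \<open>m\<close> is prime. Passing from
  z to the multiple b z may leave \<open>m\<close>, but then some s outside \<open>m\<close> kills b
  z, and s z has the same annihilator as z while being killed by b.\<close>

lemma elt_annih_prime:
  assumes K: "sm K" and m: "primeideal m R" and at: "atsupp K m"
  shows "\<exists>z\<in>carrier M. primeideal {r \<in> carrier R. r \<odot>\<^bsub>M\<^esub> z \<in> K} R \<and> {r \<in> carrier R. r \<odot>\<^bsub>M\<^esub> z \<in> K} \<subseteq> m"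
proof -
  define An where "An y = {r \<in> carrier R. r \<odot>\<^bsub>M\<^esub> y \<in> K}" for y
  have idA: "ideal (An y) R" if "y \<in> carrier M" for y
    using ideal_quot_annih[OF K, of "{y}"] that by (simp add: An_def)
  define \<I> where "\<I> = {An y | y. y \<in> carrier M \<and> An y \<subseteq> m}"
  have "\<exists>P\<in>\<I>. \<forall>J\<in>\<I>. P \<subseteq> J \<longrightarrow> J = P"
  proof (rule noetherian_maximal)
    show "\<I> \<noteq> {}" using at unfolding atsupp_def \<I>_def An_def by blast
    show "ideal I R" if "I \<in> \<I>" for I using that idA by (auto simp: \<I>_def)
  qed
  then obtain P where P: "P \<in> \<I>" "\<And>J. J \<in> \<I> \<Longrightarrow> P \<subseteq> J \<Longrightarrow> J = P" by metis
  obtain z where z: "z \<in> carrier M" "An z \<subseteq> m" "P = An z" using P(1) by (auto simp: \<I>_def)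
  have mx: "An y = An z" if "y \<in> carrier M" "An y \<subseteq> m" "An z \<subseteq> An y" for y
    using P(2)[of "An y"] that z by (auto simp: \<I>_def)
  have up: "An z \<subseteq> An (s \<odot>\<^bsub>M\<^esub> z)" if "s \<in> carrier R" for s
    using that z(1) smD(4)[OF K] by (auto simp: An_def smult_comm[of _ s])
  have "a \<in> An z \<or> b \<in> An z" if ab: "a \<in> carrier R" "b \<in> carrier R" "a \<otimes> b \<in> An z" for a b
  proof (cases "An (b \<odot>\<^bsub>M\<^esub> z) \<subseteq> m")
    case True
    then have "An (b \<odot>\<^bsub>M\<^esub> z) = An z" using mx up ab z(1) by simp
    moreover have "a \<in> An (b \<odot>\<^bsub>M\<^esub> z)" using ab z(1) by (simp add: An_def smult_assoc1)
    ultimately show ?thesis by simp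
  next
    case False
    then obtain s where s: "s \<in> carrier R" "s \<odot>\<^bsub>M\<^esub> (b \<odot>\<^bsub>M\<^esub> z) \<in> K" "s \<notin> m" by (auto simp: An_def)
    have "An (s \<odot>\<^bsub>M\<^esub> z) \<subseteq> m"
    proof
      fix r assume r: "r \<in> An (s \<odot>\<^bsub>M\<^esub> z)"
      then have "r \<otimes> s \<in> An z" "r \<in> carrier R" using s(1) z(1) by (simp_all add: An_def smult_assoc1)
      then show "r \<in> m" using primeD(3)[OF m _ s(1), of r] z(2) s(3) by blast
    qed
    then have "An (s \<odot>\<^bsub>M\<^esub> z) = An z" using mx up s(1) z(1) by simp
    moreover have "b \<in> An (s \<odot>\<^bsub>M\<^esub> z)" using ab(2) s z(1) by (simp add: An_def smult_comm[of b s])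
    ultimately show ?thesis by simp
  qed
  moreover have "\<one> \<notin> An z" using z(2) primeD(2)[OF m] by blast
  ultimately have "primeideal (An z) R" using idA[OF z(1)] by (simp add: primeideal_iff)
  then show ?thesis using z(1,2) unfolding An_def by blast
qed

lemma addset_mono: "K \<subseteq> K' \<Longrightarrow> addset M K L \<subseteq> addset M K' L"
  by (auto simp: addset_def)

abbreviation elann :: "'m set \<Rightarrow> 'm \<Rightarrow> 'a set" where
  "elann K z \<equiv> {r \<in> carrier R. r \<odot>\<^bsub>M\<^esub> z \<in> K}"

text \<open>Modulo K, the submodule generated by z is a copy of R/P with P prime. Its descending
  chain of multiples by powers of r becomes stationary, and cancelling the power of r inverts r
  modulo P: an Artinian domain is a field.\<close>

lemma elt_annih_inverse:
  assumes K: "sm K" and z: "z \<in> carrier M" and P: "primeideal (elann K z) R"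
    and r: "r \<in> carrier R" "r \<notin> elann K z"
  shows "\<exists>c\<in>carrier R. \<one> \<ominus> c \<otimes> r \<in> elann K z"
proof -
  have smz: "sm ((\<lambda>c. c \<odot>\<^bsub>M\<^esub> z) ` carrier R)"
  proof -
    have "c \<odot>\<^bsub>M\<^esub> z \<oplus>\<^bsub>M\<^esub> d \<odot>\<^bsub>M\<^esub> z = (c \<oplus> d) \<odot>\<^bsub>M\<^esub> z" if "c \<in> carrier R" "d \<in> carrier R" for c d
      using that z by (simp add: smult_l_distr)
    moreover have "d \<odot>\<^bsub>M\<^esub> (c \<odot>\<^bsub>M\<^esub> z) = (d \<otimes> c) \<odot>\<^bsub>M\<^esub> z"
      if "c \<in> carrier R" "d \<in> carrier R" for c d using z that by (simp add: smult_assoc1)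
    moreover have "\<zero>\<^bsub>M\<^esub> \<in> (\<lambda>c. c \<odot>\<^bsub>M\<^esub> z) ` carrier R"
      using imageI[OF R.zero_closed, of "\<lambda>c. c \<odot>\<^bsub>M\<^esub> z"] z by simp
    ultimately show ?thesis unfolding submodule_iff using z by auto
  qed
  define Z where "Z = addset M ((\<lambda>c. c \<odot>\<^bsub>M\<^esub> z) ` carrier R) K"
  define L where "L n = addset M (mulset M (r [^] (n::nat)) Z) K" for n
  have Z: "sm Z" unfolding Z_def by (rule sm_addset(1)[OF smz K])
  have rn: "r [^] n \<in> carrier R" for n :: nat using r by simp
  have "sm (L n)" for n unfolding L_def by (rule sm_addset(1)[OF sm_mulset[OF Z rn] K])
  moreover have "L (Suc n) \<subseteq> L n" for n
  proof -
    have "mulset M (r [^] Suc n) Z \<subseteq> mulset M (r [^] n) Z"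
      using smD(4,7)[OF Z] r by (auto simp: mulset_def smult_assoc1)
    then show ?thesis unfolding L_def by (rule addset_mono)
  qed
  ultimately obtain n where n: "\<forall>k\<ge>n. L k = L n"
    using artinian unfolding artinian_module_def by blast
  have eq: "L (Suc n) = L n" using n[rule_format, of "Suc n"] by (simp only: le_SucI le_refl)
  have "\<one> \<odot>\<^bsub>M\<^esub> z \<in> (\<lambda>c. c \<odot>\<^bsub>M\<^esub> z) ` carrier R" by (rule imageI) simp
  then have "z \<in> Z" using sm_addset(2)[OF smz K] z unfolding Z_def by auto
  then have "r [^] n \<odot>\<^bsub>M\<^esub> z \<in> mulset M (r [^] n) Z" by (auto simp: mulset_def)
  then have "r [^] n \<odot>\<^bsub>M\<^esub> z \<in> L (Suc n)"
    using sm_addset(2)[OF sm_mulset[OF Z rn] K] unfolding eq unfolding L_def by blast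
  then obtain w k where w: "w \<in> Z" "k \<in> K" "r [^] n \<odot>\<^bsub>M\<^esub> z = r [^] Suc n \<odot>\<^bsub>M\<^esub> w \<oplus>\<^bsub>M\<^esub> k"
    unfolding L_def addset_def mulset_def by blast
  obtain c l where c: "c \<in> carrier R" "l \<in> K" "w = c \<odot>\<^bsub>M\<^esub> z \<oplus>\<^bsub>M\<^esub> l"
    using w(1) unfolding Z_def addset_def by blast
  have lk: "l \<in> carrier M" "k \<in> carrier M" using w c smD(7)[OF K] by blast+
  have rS: "r [^] Suc n \<odot>\<^bsub>M\<^esub> (c \<odot>\<^bsub>M\<^esub> z) = (r [^] n \<otimes> (c \<otimes> r)) \<odot>\<^bsub>M\<^esub> z"
    using r c z by (simp add: smult_assoc1[symmetric] m_ac)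
  have "r [^] n \<odot>\<^bsub>M\<^esub> z = (r [^] n \<otimes> (c \<otimes> r)) \<odot>\<^bsub>M\<^esub> z \<oplus>\<^bsub>M\<^esub> (r [^] Suc n \<odot>\<^bsub>M\<^esub> l \<oplus>\<^bsub>M\<^esub> k)"
    unfolding w(3) c(3) using r c(1) z lk rS
    by (simp add: smult_r_distr M.a_assoc del: nat_pow_Suc)
  moreover have "r [^] Suc n \<odot>\<^bsub>M\<^esub> l \<oplus>\<^bsub>M\<^esub> k \<in> K" using w c smD(3,4)[OF K] rn by blast
  moreover have "(r [^] n \<otimes> (\<one> \<ominus> c \<otimes> r)) \<odot>\<^bsub>M\<^esub> z = r [^] n \<odot>\<^bsub>M\<^esub> z \<ominus>\<^bsub>M\<^esub> (r [^] n \<otimes> (c \<otimes> r)) \<odot>\<^bsub>M\<^esub> z"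
    using r c(1) z by (simp add: R.minus_eq R.r_distr r_minus smult_l_distr smult_l_minus a_minus_def)
  ultimately have "(r [^] n \<otimes> (\<one> \<ominus> c \<otimes> r)) \<odot>\<^bsub>M\<^esub> z \<in> K"
    using add_mdiff[of "r [^] Suc n \<odot>\<^bsub>M\<^esub> l \<oplus>\<^bsub>M\<^esub> k" "(r [^] n \<otimes> (c \<otimes> r)) \<odot>\<^bsub>M\<^esub> z"]
      r c(1) z lk by (simp add: M.a_comm del: nat_pow_Suc)
  then have f1: "r [^] n \<otimes> (\<one> \<ominus> c \<otimes> r) \<in> elann K z" using r c(1) by simp
  have f2: "\<one> \<ominus> c \<otimes> r \<in> carrier R" using r c(1) by simp
  have f3: "r [^] n \<in> elann K z \<or> \<one> \<ominus> c \<otimes> r \<in> elann K z" by (rule primeD(3)[OF P rn f2 f1])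
  have f4: "r [^] n \<notin> elann K z" by (rule contrapos_nn[OF r(2)]) (rule prime_pow[OF P r(1)])
  show ?thesis by (rule bexI[OF _ c(1)]) (rule disj_imp[THEN iffD1, OF f3, THEN mp, OF f4])
qed

lemma elt_annih_maximal:
  assumes K: "sm K" and z: "z \<in> carrier M" and P: "primeideal (elann K z) R"
    and I: "ideal I R" "elann K z \<subseteq> I" "\<one> \<notin> I"
  shows "I = elann K z"
proof -
  have "r \<in> elann K z" if r: "r \<in> I" for r
  proof (rule ccontr)
    assume "r \<notin> elann K z"
    have rR: "r \<in> carrier R" using r I idealD(7) by blast
    obtain c where c: "c \<in> carrier R" "\<one> \<ominus> c \<otimes> r \<in> elann K z" using elt_annih_inverse[OF K z P rR \<open>r \<notin> elann K z\<close>] by blast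
    have "(\<one> \<ominus> c \<otimes> r) \<oplus> c \<otimes> r \<in> I" using c I r idealD(3,4)[OF I(1)] by blast
    moreover have "(\<one> \<ominus> c \<otimes> r) \<oplus> c \<otimes> r = \<one>" using c rR by (simp add: R.minus_eq R.a_assoc R.l_neg)
    ultimately show False using I(3) by simp
  qed
  then show ?thesis using I(2) by blast
qed

text \<open>The prime annihilator found inside \<open>m\<close> is already a maximal ideal, hence
  equal to \<open>m\<close>. So the support of any quotient of \<open>M\<close> consists of maximal
  ideals, each being the annihilator of an element.\<close>

lemma atsupp_maximal:
  assumes K: "sm K" and m: "primeideal m R" and at: "atsupp K m"
  shows "\<exists>z\<in>carrier M. {r \<in> carrier R. r \<odot>\<^bsub>M\<^esub> z \<in> K} = m"
    and "\<And>I. ideal I R \<Longrightarrow> m \<subseteq> I \<Longrightarrow> \<one> \<notin> I \<Longrightarrow> I = m"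
    and "\<And>r. r \<in> carrier R \<Longrightarrow> r \<notin> m \<Longrightarrow> \<exists>c\<in>carrier R. \<one> \<ominus> c \<otimes> r \<in> m"
proof -
  obtain z where z: "z \<in> carrier M" "primeideal {r \<in> carrier R. r \<odot>\<^bsub>M\<^esub> z \<in> K} R" "{r \<in> carrier R. r \<odot>\<^bsub>M\<^esub> z \<in> K} \<subseteq> m"
    using elt_annih_prime[OF assms] by blast
  have eq: "m = {r \<in> carrier R. r \<odot>\<^bsub>M\<^esub> z \<in> K}"
    by (rule elt_annih_maximal[OF K z(1,2) primeD(1)[OF m] z(3) primeD(2)[OF m]])
  then show "\<exists>z\<in>carrier M. {r \<in> carrier R. r \<odot>\<^bsub>M\<^esub> z \<in> K} = m" using z(1) by blast
  show "\<And>I. ideal I R \<Longrightarrow> m \<subseteq> I \<Longrightarrow> \<one> \<notin> I \<Longrightarrow> I = m" unfolding eq by (rule elt_annih_maximal[OF K z(1,2)])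
  show "\<And>r. r \<in> carrier R \<Longrightarrow> r \<notin> m \<Longrightarrow> \<exists>c\<in>carrier R. \<one> \<ominus> c \<otimes> r \<in> m"
    unfolding eq by (rule elt_annih_inverse[OF K z(1,2)])
qed

abbreviation quann :: "'m set \<Rightarrow> 'a set" where
  "quann K \<equiv> {r \<in> carrier R. \<forall>y\<in>carrier M. r \<odot>\<^bsub>M\<^esub> y \<in> K}"

text \<open>Dual to the existence of associated primes: among quotients M/K with \<open>m\<close> in
  their support, one with maximal annihilator is taken. If \<open>a\<close> is not in it, M/(K + a
  M) has lost \<open>m\<close> from its support. If this held for \<open>a\<close> and
  \<open>b\<close> with \<open>a \<otimes> b\<close> in the annihilator, a multiple of
  \<open>y\<close> by an element outside \<open>m\<close> would lie in K + a b M = K.\<close>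

lemma quotient_annih_prime:
  assumes K0: "sm K0" and m: "primeideal m R" and at: "atsupp K0 m"
  shows "\<exists>K. sm K \<and> K0 \<subseteq> K \<and> atsupp K m \<and> primeideal (quann K) R"
proof -
  define \<I> where "\<I> = {quann K | K. sm K \<and> K0 \<subseteq> K \<and> atsupp K m}"
  have "\<exists>P\<in>\<I>. \<forall>J\<in>\<I>. P \<subseteq> J \<longrightarrow> J = P"
    by (rule noetherian_maximal) (use K0 at ideal_quot_annih in \<open>auto simp: \<I>_def\<close>)
  then obtain P where P: "P \<in> \<I>" "\<And>J. J \<in> \<I> \<Longrightarrow> P \<subseteq> J \<Longrightarrow> J = P" by metis
  obtain K where K: "sm K" "K0 \<subseteq> K" "atsupp K m" "P = quann K" using P(1) by (auto simp: \<I>_def)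
  have mx: "quann L = quann K" if "sm L" "K \<subseteq> L" "atsupp L m" for L
  proof -
    have "quann L \<in> \<I>" using that K(2) by (auto simp: \<I>_def)
    moreover have "quann K \<subseteq> quann L" using that(2) by blast
    ultimately show ?thesis using P(2) K(4) by simp
  qed
  have grow: "a \<in> quann K" if a: "a \<in> carrier R" "atsupp (addset M K (mulset M a (carrier M))) m" for a
  proof -
    note s = sm_addset[OF K(1) sm_mulset[OF sm_carrier a(1)]]
    have "quann (addset M K (mulset M a (carrier M))) = quann K" by (rule mx[OF s(1,2) a(2)])
    moreover have "a \<in> quann (addset M K (mulset M a (carrier M)))" using a(1) s(3) by (auto simp: mulset_def)
    ultimately show ?thesis by simp
  qed
  obtain y where y: "y \<in> carrier M" "\<forall>s\<in>carrier R - m. s \<odot>\<^bsub>M\<^esub> y \<notin> K" using K(3) unfolding atsupp_def by blast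
  have "a \<in> quann K \<or> b \<in> quann K" if ab: "a \<in> carrier R" "b \<in> carrier R" "a \<otimes> b \<in> quann K" for a b
  proof (rule ccontr)
    assume "\<not> (a \<in> quann K \<or> b \<in> quann K)"
    then have n: "\<not> atsupp (addset M K (mulset M a (carrier M))) m" "\<not> atsupp (addset M K (mulset M b (carrier M))) m"
      using grow ab(1,2) by blast+
    obtain s where s: "s \<in> carrier R - m" "s \<odot>\<^bsub>M\<^esub> y \<in> addset M K (mulset M b (carrier M))"
      using n(2) y(1) unfolding atsupp_def by blast
    then obtain k u where k: "k \<in> K" "u \<in> carrier M" "s \<odot>\<^bsub>M\<^esub> y = k \<oplus>\<^bsub>M\<^esub> b \<odot>\<^bsub>M\<^esub> u"
      unfolding addset_def mulset_def by blast
    obtain t where t: "t \<in> carrier R - m" "t \<odot>\<^bsub>M\<^esub> u \<in> addset M K (mulset M a (carrier M))"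
      using n(1) k(2) unfolding atsupp_def by blast
    then obtain l v where l: "l \<in> K" "v \<in> carrier M" "t \<odot>\<^bsub>M\<^esub> u = l \<oplus>\<^bsub>M\<^esub> a \<odot>\<^bsub>M\<^esub> v"
      unfolding addset_def mulset_def by blast
    have c: "k \<in> carrier M" "l \<in> carrier M" "s \<in> carrier R" "t \<in> carrier R" using k l s t smD(7)[OF K(1)] by blast+
    have "(t \<otimes> s) \<odot>\<^bsub>M\<^esub> y = t \<odot>\<^bsub>M\<^esub> k \<oplus>\<^bsub>M\<^esub> b \<odot>\<^bsub>M\<^esub> (t \<odot>\<^bsub>M\<^esub> u)"
      using c y(1) k ab(2) by (simp add: smult_assoc1 smult_r_distr smult_comm[of t b])
    also have "\<dots> = t \<odot>\<^bsub>M\<^esub> k \<oplus>\<^bsub>M\<^esub> (b \<odot>\<^bsub>M\<^esub> l \<oplus>\<^bsub>M\<^esub> (a \<otimes> b) \<odot>\<^bsub>M\<^esub> v)"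
      using c l ab by (simp add: smult_r_distr m_comm[of a b] smult_assoc1)
    also have "\<dots> \<in> K"
      by (rule smD(3)[OF K(1) smD(4)[OF K(1) c(4) k(1)] smD(3)[OF K(1) smD(4)[OF K(1) ab(2) l(1)]]])
        (use ab(3) l(2) in simp)
    finally have "(t \<otimes> s) \<odot>\<^bsub>M\<^esub> y \<in> K" .
    moreover have "t \<otimes> s \<in> carrier R - m" using primeD(3)[OF m c(4,3)] s(1) t(1) by auto
    ultimately show False using y(2) by (simp del: Diff_iff)
  qed
  moreover have "\<one> \<notin> quann K" using y primeD(2)[OF m] by force
  ultimately have "primeideal (quann K) R" using ideal_quot_annih[OF K(1), of "carrier M"] by (simp add: primeideal_iff)
  then show ?thesis using K by blast
qed

end

section \<open>Secondary decomposition and finiteness of the support\<close>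

context artmod
begin

lemma dcc:
  assumes "\<And>n. sm (K n)" "\<And>n. K (Suc n) \<subseteq> K n" shows "\<exists>n. \<forall>k\<ge>n. K k = K n"
  using artinian assms unfolding artinian_module_def by blast

lemma mulset_mulset: "a \<in> carrier R \<Longrightarrow> b \<in> carrier R \<Longrightarrow> K \<subseteq> carrier M \<Longrightarrow>
   mulset M a (mulset M b K) = mulset M (a \<otimes> b) K"
  by (force simp: mulset_def smult_assoc1 subset_iff)

lemma mulset_mono: "K \<subseteq> L \<Longrightarrow> mulset M a K \<subseteq> mulset M a L"
  by (auto simp: mulset_def)

lemma mulset_sub: "sm K \<Longrightarrow> a \<in> carrier R \<Longrightarrow> mulset M a K \<subseteq> K"
  using smD(4) by (auto simp: mulset_def)

lemma mulset_addset:
  assumes "sm K" "sm L" "a \<in> carrier R"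
  shows "mulset M a (addset M K L) = addset M (mulset M a K) (mulset M a L)"
  using smD(7)[OF assms(1)] smD(7)[OF assms(2)] assms(3)
  by (force simp: mulset_def addset_def smult_r_distr)

text \<open>Records the part of a secondary decomposition of \<open>K\<close> belonging to attached primes not
  containing \<open>I\<close>: \<open>K'\<close> is the sum of those components.\<close>
definition decomposed :: "'a set \<Rightarrow> 'm set \<Rightarrow> bool" where
  "decomposed I K \<longleftrightarrow> (\<exists>K' \<Q>. sm K' \<and> K' \<subseteq> K \<and> finite \<Q> \<and> (\<forall>q\<in>\<Q>. primeideal q R \<and> \<not> I \<subseteq> q) \<and>
     (\<forall>x\<in>carrier R. (\<forall>q\<in>\<Q>. x \<notin> q) \<longrightarrow> mulset M x K' = K') \<and>
     (\<forall>a\<in>I. \<exists>n::nat. mulset M (a [^] n) K \<subseteq> K'))"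

lemma decomposed_add:
  assumes I: "I \<subseteq> carrier R" and K: "sm K1" "sm K2" and d: "decomposed I K1" "decomposed I K2"
  shows "decomposed I (addset M K1 K2)"
proof -
  obtain L1 \<Q>1 where 1: "sm L1" "L1 \<subseteq> K1" "finite \<Q>1" "\<forall>q\<in>\<Q>1. primeideal q R \<and> \<not> I \<subseteq> q"
    "\<forall>x\<in>carrier R. (\<forall>q\<in>\<Q>1. x \<notin> q) \<longrightarrow> mulset M x L1 = L1"
    "\<forall>a\<in>I. \<exists>n::nat. mulset M (a [^] n) K1 \<subseteq> L1"
    using d(1) unfolding decomposed_def by blast
  obtain L2 \<Q>2 where 2: "sm L2" "L2 \<subseteq> K2" "finite \<Q>2" "\<forall>q\<in>\<Q>2. primeideal q R \<and> \<not> I \<subseteq> q"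
    "\<forall>x\<in>carrier R. (\<forall>q\<in>\<Q>2. x \<notin> q) \<longrightarrow> mulset M x L2 = L2"
    "\<forall>a\<in>I. \<exists>n::nat. mulset M (a [^] n) K2 \<subseteq> L2"
    using d(2) unfolding decomposed_def by blast
  have pw: "mulset M (a [^] (n + k)) K \<subseteq> L" if "a \<in> carrier R" "sm K" "sm L" "mulset M (a [^] n) K \<subseteq> L"
    for a K L and n k :: nat
  proof -
    have "mulset M (a [^] (n + k)) K = mulset M (a [^] k) (mulset M (a [^] n) K)"
      using that smD(1)[of K] by (simp add: mulset_mulset nat_pow_mult add.commute)
    also have "\<dots> \<subseteq> mulset M (a [^] k) L" by (rule mulset_mono) (rule that)
    also have "\<dots> \<subseteq> L" by (rule mulset_sub) (use that in simp_all)
    finally show ?thesis .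
  qed
  have "addset M L1 L2 \<subseteq> addset M K1 K2" using 1(2) 2(2) by (auto simp: addset_def)
  moreover have "\<forall>x\<in>carrier R. (\<forall>q\<in>\<Q>1 \<union> \<Q>2. x \<notin> q) \<longrightarrow> mulset M x (addset M L1 L2) = addset M L1 L2"
    using 1(1,5) 2(1,5) by (simp add: mulset_addset)
  moreover have "\<exists>n::nat. mulset M (a [^] n) (addset M K1 K2) \<subseteq> addset M L1 L2" if a: "a \<in> I" for a
  proof -
    obtain n1 n2 :: nat where n: "mulset M (a [^] n1) K1 \<subseteq> L1" "mulset M (a [^] n2) K2 \<subseteq> L2"
      using 1(6) 2(6) a by blast
    have aR: "a \<in> carrier R" using a I by blast
    have "mulset M (a [^] (n1 + n2)) K1 \<subseteq> L1" "mulset M (a [^] (n1 + n2)) K2 \<subseteq> L2"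
      using pw[OF aR K(1) 1(1) n(1), of n2] pw[OF aR K(2) 2(1) n(2), of n1] by (simp_all add: add.commute)
    then have "mulset M (a [^] (n1 + n2)) (addset M K1 K2) \<subseteq> addset M L1 L2"
      using mulset_addset[OF K, of "a [^] (n1 + n2)"] aR by (auto simp: addset_def)
    then show ?thesis by blast
  qed
  ultimately show ?thesis
    unfolding decomposed_def using 1(3,4) 2(3,4) sm_addset(1)[OF 1(1) 2(1)]
    by (intro exI[of _ "addset M L1 L2"] exI[of _ "\<Q>1 \<union> \<Q>2"]) auto
qed

lemma decomposed_zero:
  assumes "sm K" "\<forall>a\<in>I. \<exists>n::nat. mulset M (a [^] n) K \<subseteq> {\<zero>\<^bsub>M\<^esub>}"
  shows "decomposed I K"
proof -
  have "mulset M x {\<zero>\<^bsub>M\<^esub>} = {\<zero>\<^bsub>M\<^esub>}" if "x \<in> carrier R" for x using that by (simp add: mulset_def)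
  then show ?thesis unfolding decomposed_def using sm_zero smD(2)[OF assms(1)] assms(2)
    by (intro exI[of _ "{\<zero>\<^bsub>M\<^esub>}"] exI[of _ "{}"]) simp
qed

text \<open>For a secondary module the non-surjective multipliers form a prime. For closure under
  sums, suppose x + y is surjective and y^m = 0 on K. Iterating K = (x + y) K gives K = x K + y^i K
  for every i, and i = m makes x surjective. Depending on whether \<open>I\<close> is inside this
  prime, the recorded part is 0 or all of K.\<close>

lemma decomposed_secondary:
  assumes K: "sm K" "K \<noteq> {\<zero>\<^bsub>M\<^esub>}"
    and sec: "\<And>x. x \<in> carrier R \<Longrightarrow> mulset M x K = K \<or> (\<exists>n::nat. mulset M (x [^] n) K \<subseteq> {\<zero>\<^bsub>M\<^esub>})"
  shows "decomposed I K \<or> \<not> I \<subseteq> carrier R"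
proof -
  define p where "p = {x \<in> carrier R. mulset M x K \<noteq> K}"
  have KM: "K \<subseteq> carrier M" using smD(1)[OF K(1)] .
  have add: "x \<oplus> y \<in> p" if "x \<in> p" "y \<in> p" for x y
  proof (rule ccontr)
    have c: "x \<in> carrier R" "y \<in> carrier R" "mulset M x K \<noteq> K" "mulset M y K \<noteq> K" using that by (auto simp: p_def)
    assume "x \<oplus> y \<notin> p"
    then have s: "mulset M (x \<oplus> y) K = K" using c by (simp add: p_def)
    obtain m :: nat where m: "mulset M (y [^] m) K \<subseteq> {\<zero>\<^bsub>M\<^esub>}" using sec[OF c(2)] c(4) by blast
    have "\<forall>k\<in>K. \<exists>u\<in>K. \<exists>v\<in>K. k = x \<odot>\<^bsub>M\<^esub> u \<oplus>\<^bsub>M\<^esub> (y [^] i) \<odot>\<^bsub>M\<^esub> v" for i :: nat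
    proof (induction i)
      case 0
      show ?case
      proof
        fix k assume k: "k \<in> K"
        then have "k = x \<odot>\<^bsub>M\<^esub> \<zero>\<^bsub>M\<^esub> \<oplus>\<^bsub>M\<^esub> (y [^] (0::nat)) \<odot>\<^bsub>M\<^esub> k" using c(1) KM by (simp add: subset_iff)
        then show "\<exists>u\<in>K. \<exists>v\<in>K. k = x \<odot>\<^bsub>M\<^esub> u \<oplus>\<^bsub>M\<^esub> (y [^] (0::nat)) \<odot>\<^bsub>M\<^esub> v" using k smD(2)[OF K(1)] by blast
      qed
    next
      case (Suc i)
      show ?case
      proof
        fix k assume "k \<in> K"
        then obtain u v where uv: "u \<in> K" "v \<in> K" "k = x \<odot>\<^bsub>M\<^esub> u \<oplus>\<^bsub>M\<^esub> (y [^] i) \<odot>\<^bsub>M\<^esub> v" using Suc by blast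
        have "v \<in> mulset M (x \<oplus> y) K" using uv(2) s by simp
        then obtain w where w: "w \<in> K" "v = (x \<oplus> y) \<odot>\<^bsub>M\<^esub> w" by (auto simp: mulset_def)
        have cM: "u \<in> carrier M" "w \<in> carrier M" "y [^] i \<in> carrier R" using uv w KM c by auto
        have "(y [^] i) \<odot>\<^bsub>M\<^esub> v = x \<odot>\<^bsub>M\<^esub> ((y [^] i) \<odot>\<^bsub>M\<^esub> w) \<oplus>\<^bsub>M\<^esub> (y [^] Suc i) \<odot>\<^bsub>M\<^esub> w"
          using c cM unfolding w(2) by (simp add: smult_l_distr smult_r_distr smult_comm[of x] smult_assoc1)
        then have "k = x \<odot>\<^bsub>M\<^esub> (u \<oplus>\<^bsub>M\<^esub> (y [^] i) \<odot>\<^bsub>M\<^esub> w) \<oplus>\<^bsub>M\<^esub> (y [^] Suc i) \<odot>\<^bsub>M\<^esub> w"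
          using c cM uv(3) by (simp add: smult_r_distr M.a_assoc del: nat_pow_Suc)
        moreover have "u \<oplus>\<^bsub>M\<^esub> (y [^] i) \<odot>\<^bsub>M\<^esub> w \<in> K" by (rule smD(3)[OF K(1) uv(1) smD(4)[OF K(1) cM(3) w(1)]])
        ultimately show "\<exists>u\<in>K. \<exists>v\<in>K. k = x \<odot>\<^bsub>M\<^esub> u \<oplus>\<^bsub>M\<^esub> (y [^] Suc i) \<odot>\<^bsub>M\<^esub> v" using w(1) by blast
      qed
    qed
    then have step: "\<forall>k\<in>K. \<exists>u\<in>K. \<exists>v\<in>K. k = x \<odot>\<^bsub>M\<^esub> u \<oplus>\<^bsub>M\<^esub> (y [^] m) \<odot>\<^bsub>M\<^esub> v" .
    have "K \<subseteq> mulset M x K"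
    proof
      fix k assume "k \<in> K"
      then obtain u v where uv: "u \<in> K" "v \<in> K" "k = x \<odot>\<^bsub>M\<^esub> u \<oplus>\<^bsub>M\<^esub> (y [^] m) \<odot>\<^bsub>M\<^esub> v" using step by blast
      have "(y [^] m) \<odot>\<^bsub>M\<^esub> v = \<zero>\<^bsub>M\<^esub>" using m uv(2) by (auto simp: mulset_def)
      then have "k = x \<odot>\<^bsub>M\<^esub> u" using uv c(1) KM by auto
      then show "k \<in> mulset M x K" using uv(1) by (simp add: mulset_def)
    qed
    then show False using c(3) mulset_sub[OF K(1) c(1)] by blast
  qed
  have absorb: "r \<otimes> x \<in> p" if "r \<in> carrier R" "x \<in> p" for r x
  proof -
    have x: "x \<in> carrier R" "mulset M x K \<noteq> K" using that by (auto simp: p_def)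
    have "mulset M (r \<otimes> x) K = mulset M x (mulset M r K)"
      using that(1) x KM by (simp add: mulset_mulset m_comm)
    also have "\<dots> \<subseteq> mulset M x K" by (rule mulset_mono[OF mulset_sub[OF K(1) that(1)]])
    finally have "mulset M (r \<otimes> x) K \<noteq> K" using x mulset_sub[OF K(1) x(1)] by blast
    then show ?thesis using that(1) x by (simp add: p_def)
  qed
  have prm: "a \<in> p \<or> b \<in> p" if "a \<in> carrier R" "b \<in> carrier R" "a \<otimes> b \<in> p" for a b
    using that mulset_mulset[OF that(1,2) KM] by (auto simp: p_def)
  have "mulset M \<zero> K = {\<zero>\<^bsub>M\<^esub>}" using KM smD(2)[OF K(1)] by (force simp: mulset_def)
  then have p0: "\<zero> \<in> p" using K(2) by (simp add: p_def)
  have K1: "mulset M \<one> K = K" using KM by (force simp: mulset_def)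
  then have p1: "\<one> \<notin> p" by (simp add: p_def)
  have pR: "p \<subseteq> carrier R" by (simp add: p_def)
  have P: "primeideal p R"
    unfolding primeideal_iff ideal_iff
    by (intro conjI ballI impI) (rule pR p0 p1 add absorb prm; assumption)+
  show ?thesis
  proof (cases "I \<subseteq> p")
    case True
    have "\<forall>a\<in>I. \<exists>n::nat. mulset M (a [^] n) K \<subseteq> {\<zero>\<^bsub>M\<^esub>}"
    proof
      fix a assume "a \<in> I"
      then have "a \<in> p" using True by blast
      then have a: "a \<in> carrier R" "mulset M a K \<noteq> K" by (simp_all add: p_def)
      show "\<exists>n::nat. mulset M (a [^] n) K \<subseteq> {\<zero>\<^bsub>M\<^esub>}"
        by (rule disj_imp[THEN iffD1, OF sec[OF a(1)], THEN mp, OF a(2)])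
    qed
    then show ?thesis by (intro disjI1 decomposed_zero[OF K(1)])
  next
    case False
    have "\<exists>n::nat. mulset M (a [^] n) K \<subseteq> K" for a using K1 by (intro exI[of _ 0]) simp
    moreover have "mulset M x K = K" if "x \<in> carrier R" "x \<notin> p" for x using that by (simp add: p_def)
    ultimately show ?thesis unfolding decomposed_def using K(1) P False
      by (intro disjI1 exI[of _ K] exI[of _ "{p}"]) auto
  qed
qed

text \<open>Take a minimal counterexample U. When the powers of x have become stationary, Fitting's
  argument gives U = x^n U + ker x^n, so by minimality one summand is U. Each x thus acts
  surjectively or nilpotently, which makes U secondary.\<close>

lemma all_decomposed:
  assumes I: "I \<subseteq> carrier R" and K: "sm K" shows "decomposed I K"
proof (rule ccontr)
  assume nd: "\<not> decomposed I K"
  define \<F> where "\<F> = {K. sm K \<and> \<not> decomposed I K}"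
  have "\<exists>U\<in>\<F>. \<forall>V\<in>\<F>. V \<subseteq> U \<longrightarrow> V = U"
    by (rule artinian_minimal) (use nd K in \<open>auto simp: \<F>_def\<close>)
  then obtain U where U0: "U \<in> \<F>" "\<And>V. V \<in> \<F> \<Longrightarrow> V \<subseteq> U \<Longrightarrow> V = U" by metis
  have U: "sm U" "\<not> decomposed I U" using U0(1) by (auto simp: \<F>_def)
  have small: "decomposed I V" if "sm V" "V \<subseteq> U" "V \<noteq> U" for V using U0(2)[of V] that by (auto simp: \<F>_def)
  have "mulset M x U = U \<or> (\<exists>n::nat. mulset M (x [^] n) U \<subseteq> {\<zero>\<^bsub>M\<^esub>})" if x: "x \<in> carrier R" for x
  proof -
    have xn: "x [^] n \<in> carrier R" for n :: nat using x by simp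
    have d1: "sm (mulset M (x [^] n) U)" for n :: nat by (rule sm_mulset[OF U(1) xn])
    have Sm: "mulset M (x [^] Suc n) U = mulset M x (mulset M (x [^] n) U)" for n :: nat
      using x smD(1)[OF U(1)] by (simp add: mulset_mulset m_comm)
    have d2: "mulset M (x [^] Suc n) U \<subseteq> mulset M (x [^] n) U" for n :: nat
      unfolding Sm by (rule mulset_sub[OF sm_mulset[OF U(1) xn] x])
    obtain n :: nat where n: "\<forall>k\<ge>n. mulset M (x [^] k) U = mulset M (x [^] n) U"
      using dcc[of "\<lambda>n. mulset M (x [^] n) U", OF d1 d2] by blast
    define A where "A = mulset M (x [^] n) U"
    define B where "B = {y \<in> U. (x [^] n) \<odot>\<^bsub>M\<^esub> y \<in> {\<zero>\<^bsub>M\<^esub>}}"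
    have AB: "sm A" "sm B" unfolding A_def B_def
      by (rule sm_mulset[OF U(1) xn], rule sm_preimage[OF sm_zero U(1) xn])
    have sub: "A \<subseteq> U" "B \<subseteq> U" unfolding A_def B_def using mulset_sub[OF U(1) xn] by auto
    have "U \<subseteq> addset M A B"
    proof
      fix y assume y: "y \<in> U"
      have "mulset M (x [^] (n + n)) U = A" using n[rule_format, of "n + n"] unfolding A_def by simp
      moreover have "(x [^] n) \<odot>\<^bsub>M\<^esub> y \<in> A" using y by (simp add: A_def mulset_def)
      ultimately obtain z where z: "z \<in> U" "(x [^] n) \<odot>\<^bsub>M\<^esub> y = (x [^] (n + n)) \<odot>\<^bsub>M\<^esub> z"
        by (auto simp: mulset_def)
      have c: "y \<in> carrier M" "z \<in> carrier M" using y z smD(7)[OF U(1)] by blast+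
      have "(x [^] n) \<odot>\<^bsub>M\<^esub> z \<in> A" using z(1) by (simp add: A_def mulset_def)
      moreover have "y \<ominus>\<^bsub>M\<^esub> (x [^] n) \<odot>\<^bsub>M\<^esub> z \<in> B"
      proof -
        have "y \<ominus>\<^bsub>M\<^esub> (x [^] n) \<odot>\<^bsub>M\<^esub> z \<in> U" by (rule smD(6)[OF U(1) y smD(4)[OF U(1) xn z(1)]])
        moreover have "(x [^] n) \<odot>\<^bsub>M\<^esub> (y \<ominus>\<^bsub>M\<^esub> (x [^] n) \<odot>\<^bsub>M\<^esub> z) = \<zero>\<^bsub>M\<^esub>"
          using x c z(2) by (simp add: smult_r_diff nat_pow_mult[symmetric] smult_assoc1)
        ultimately show ?thesis by (simp add: B_def)
      qed
      ultimately have "(x [^] n) \<odot>\<^bsub>M\<^esub> z \<oplus>\<^bsub>M\<^esub> (y \<ominus>\<^bsub>M\<^esub> (x [^] n) \<odot>\<^bsub>M\<^esub> z) \<in> addset M A B" by (rule addsetI)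
      moreover have "(x [^] n) \<odot>\<^bsub>M\<^esub> z \<oplus>\<^bsub>M\<^esub> (y \<ominus>\<^bsub>M\<^esub> (x [^] n) \<odot>\<^bsub>M\<^esub> z) = y"
        using mdiff_add[of y "(x [^] n) \<odot>\<^bsub>M\<^esub> z"] c x by (simp add: M.a_comm)
      ultimately show "y \<in> addset M A B" by simp
    qed
    then have "addset M A B = U" using addset_least[OF U(1) sub] by blast
    then have "A = U \<or> B = U" using decomposed_add[OF I AB small[OF AB(1) sub(1)] small[OF AB(2) sub(2)]] U(2) by metis
    then show ?thesis
    proof
      assume "A = U"
      then have "mulset M x U = U"
        using Sm[of n] n[rule_format, of "Suc n"] unfolding A_def by (simp only: le_SucI le_refl)
      then show ?thesis ..
    next
      assume "B = U"
      then have "mulset M (x [^] n) U \<subseteq> {\<zero>\<^bsub>M\<^esub>}" by (auto simp: mulset_def B_def)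
      then show ?thesis by blast
    qed
  qed
  moreover have "U \<noteq> {\<zero>\<^bsub>M\<^esub>}"
  proof
    assume h: "U = {\<zero>\<^bsub>M\<^esub>}"
    have "mulset M (a [^] (0::nat)) U \<subseteq> {\<zero>\<^bsub>M\<^esub>}" for a by (simp add: mulset_def h)
    then show False using U(2) decomposed_zero[OF U(1), of I] by blast
  qed
  ultimately show False using decomposed_secondary[OF U(1)] U(2) I by blast
qed

lemma quann_sub_atsupp: "atsupp K m \<Longrightarrow> quann K \<subseteq> m"
  unfolding atsupp_def by blast

lemma atsupp_proper: "primeideal m R \<Longrightarrow> atsupp K m \<Longrightarrow> \<exists>y\<in>carrier M. y \<notin> K"
  unfolding atsupp_def using primeD(2) smult_one by (metis DiffI one_closed)

lemma proper_quann_prime: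
  assumes K: "sm K" and y: "y \<in> carrier M" "y \<notin> K"
  shows "\<exists>K' m. sm K' \<and> K \<subseteq> K' \<and> primeideal m R \<and> atsupp K' m \<and> primeideal (quann K') R"
  using proper_atsupp[OF K y] quotient_annih_prime[OF K] by blast

text \<open>The attached primes containing \<open>I\<close> are the obstruction to a surjective multiplication by an
  element of \<open>I\<close>.\<close>
lemma surjective_or_attached:
  assumes I: "ideal I R" and ns: "\<And>x. x \<in> I \<Longrightarrow> mulset M x (carrier M) \<noteq> carrier M"
  shows "\<exists>K m. sm K \<and> primeideal m R \<and> atsupp K m \<and> primeideal (quann K) R \<and> I \<subseteq> quann K"
proof -
  note i = idealD[OF I]
  obtain K' \<Q> where d: "sm K'" "K' \<subseteq> carrier M" "finite \<Q>" "\<forall>q\<in>\<Q>. primeideal q R \<and> \<not> I \<subseteq> q"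
     "\<forall>x\<in>carrier R. (\<forall>q\<in>\<Q>. x \<notin> q) \<longrightarrow> mulset M x K' = K'"
     "\<forall>a\<in>I. \<exists>n::nat. mulset M (a [^] n) (carrier M) \<subseteq> K'"
    using all_decomposed[OF i(1) sm_carrier] unfolding decomposed_def by blast
  \<comment> \<open>This \<open>x\<close> is surjective on \<open>K'\<close> but, lying in
    \<open>I\<close>, not on \<open>M\<close>. Hence \<open>K'\<close> is proper, and an attached
    prime of the quotient is available.\<close>
  obtain x where x: "x \<in> I" "\<forall>q\<in>\<Q>. x \<notin> q" using prime_avoidance[OF d(3) I] d(4) by blast
  have "K' \<noteq> carrier M" using d(5) x i(7) ns by blast
  then obtain y where y: "y \<in> carrier M" "y \<notin> K'" using d(2) by blast
  obtain K m where K: "sm K" "K' \<subseteq> K" "primeideal m R" "atsupp K m" "primeideal (quann K) R"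
    using proper_quann_prime[OF d(1) y] by blast
  have "a \<in> quann K" if a: "a \<in> I" for a
  proof -
    obtain n :: nat where n: "mulset M (a [^] n) (carrier M) \<subseteq> K'" using d(6) a by blast
    have "a [^] n \<in> quann K" using n K(2) i(7)[OF a] by (auto simp: mulset_def)
    then show ?thesis by (rule prime_pow[OF K(5) i(7)[OF a]])
  qed
  then show ?thesis using K by blast
qed

lemma mem_Supp: "p \<in> Supp R M \<longleftrightarrow> primeideal p R \<and> atsupp {\<zero>\<^bsub>M\<^esub>} p"
  by (simp add: Supp_def atsupp_def)

text \<open>For distinct primes \<open>f i\<close> in the support, \<open>K n\<close> consists of
  the elements killed by something outside \<open>f 0\<close>, ..., \<open>f (n - 1)\<close>. An
  element with annihilator \<open>f n\<close> lies in \<open>K n\<close> by prime avoidance but not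
  in \<open>K (Suc n)\<close>, so this descending chain would never stop.\<close>

lemma finite_Supp: "finite (Supp R M)"
proof (rule ccontr)
  assume "infinite (Supp R M)"
  then obtain f :: "nat \<Rightarrow> 'a set" where f: "inj f" "range f \<subseteq> Supp R M"
    using infinite_countable_subset by blast
  have fs: "primeideal (f i) R" "atsupp {\<zero>\<^bsub>M\<^esub>} (f i)" for i
    using f(2) mem_Supp by blast+
  define K where "K n = {y \<in> carrier M. \<exists>s\<in>carrier R. (\<forall>i<n. s \<notin> f i) \<and> s \<odot>\<^bsub>M\<^esub> y = \<zero>\<^bsub>M\<^esub>}" for n
  have "sm (K n)" for n unfolding submodule_iff
  proof (intro conjI ballI)
    show "K n \<subseteq> carrier M" by (auto simp: K_def)
    show "\<zero>\<^bsub>M\<^esub> \<in> K n" using primeD(2)[OF fs(1)] by (auto simp: K_def intro!: bexI[of _ \<one>])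
  next
    fix x y assume "x \<in> K n" "y \<in> K n"
    then obtain s t where h: "x \<in> carrier M" "y \<in> carrier M" "s \<in> carrier R" "t \<in> carrier R"
      "\<forall>i<n. s \<notin> f i" "\<forall>i<n. t \<notin> f i" "s \<odot>\<^bsub>M\<^esub> x = \<zero>\<^bsub>M\<^esub>" "t \<odot>\<^bsub>M\<^esub> y = \<zero>\<^bsub>M\<^esub>" by (auto simp: K_def)
    have "(s \<otimes> t) \<odot>\<^bsub>M\<^esub> (x \<oplus>\<^bsub>M\<^esub> y) = t \<odot>\<^bsub>M\<^esub> (s \<odot>\<^bsub>M\<^esub> x) \<oplus>\<^bsub>M\<^esub> s \<odot>\<^bsub>M\<^esub> (t \<odot>\<^bsub>M\<^esub> y)"
      using h(1-4) by (simp add: smult_r_distr smult_assoc1 smult_comm[of t s x])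
    also have "\<dots> = \<zero>\<^bsub>M\<^esub>" using h by simp
    finally show "x \<oplus>\<^bsub>M\<^esub> y \<in> K n" using h primeD(3)[OF fs(1) h(3,4)] unfolding K_def
      by (auto intro!: bexI[of _ "s \<otimes> t"])
  next
    fix r x assume "r \<in> carrier R" "x \<in> K n"
    then show "r \<odot>\<^bsub>M\<^esub> x \<in> K n" unfolding K_def by (auto simp: smult_comm[of _ r])
  qed
  moreover have "K (Suc n) \<subseteq> K n" for n unfolding K_def using less_SucI by blast
  ultimately obtain n where n: "\<forall>k\<ge>n. K k = K n" using dcc[of K] by blast
  have eq: "K (Suc n) = K n" using n[rule_format, of "Suc n"] by (simp only: le_SucI le_refl)
  obtain z where z: "z \<in> carrier M" "{r \<in> carrier R. r \<odot>\<^bsub>M\<^esub> z \<in> {\<zero>\<^bsub>M\<^esub>}} = f n"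
    using atsupp_maximal(1)[OF sm_zero fs] by blast
  have "primeideal q R \<and> \<not> f n \<subseteq> q" if q: "q \<in> f ` {..<n}" for q
  proof -
    obtain i where i: "i < n" "q = f i" using q by blast
    have "f i \<noteq> f n" using f(1) i(1) by (auto dest: injD)
    then show ?thesis using atsupp_maximal(2)[OF sm_zero fs[of n] primeD(1)[OF fs(1)[of i]] _ primeD(2)[OF fs(1)[of i]]] fs(1) i(2) by blast
  qed
  then obtain s where s: "s \<in> f n" "\<forall>q\<in>f ` {..<n}. s \<notin> q"
    using prime_avoidance[of "f ` {..<n}", OF _ primeD(1)[OF fs(1)[of n]]] by blast
  have "s \<in> carrier R" "s \<odot>\<^bsub>M\<^esub> z = \<zero>\<^bsub>M\<^esub>" using s(1) z(2) by blast+
  then have "z \<in> K n" using s(2) z(1) unfolding K_def by blast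
  then have "z \<in> K (Suc n)" using eq by simp
  then obtain t where "t \<in> carrier R" "t \<notin> f n" "t \<odot>\<^bsub>M\<^esub> z = \<zero>\<^bsub>M\<^esub>" unfolding K_def by blast
  then show False using z(2) by blast
qed

end

section \<open>Chains of primes and co-regular sequences\<close>

definition primechain :: "'a ring \<Rightarrow> 'a set \<Rightarrow> nat \<Rightarrow> 'a set \<Rightarrow> 'a set \<Rightarrow> bool" where
  "primechain R I n p q \<longleftrightarrow> (\<exists>c :: nat \<Rightarrow> 'a set. c 0 = p \<and> c n = q \<and>
     (\<forall>i\<le>n. primeideal (c i) R \<and> I \<subseteq> c i) \<and> (\<forall>i<n. c i \<subset> c (Suc i)))"

lemma primechain_0: "primeideal p R \<Longrightarrow> I \<subseteq> p \<Longrightarrow> primechain R I 0 p p"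
  unfolding primechain_def by (intro exI[of _ "\<lambda>_. p"]) simp

lemma primechain_Cons:
  assumes "primechain R I n p q" "primeideal P R" "I \<subseteq> P" "P \<subset> p"
  shows "primechain R I (Suc n) P q"
proof -
  obtain c where c: "c 0 = p" "c n = q" "\<forall>i\<le>n. primeideal (c i) R \<and> I \<subseteq> c i" "\<forall>i<n. c i \<subset> c (Suc i)"
    using assms(1) unfolding primechain_def by blast
  define d where "d = (\<lambda>i. case i of 0 \<Rightarrow> P | Suc j \<Rightarrow> c j)"
  have "primeideal (d i) R \<and> I \<subseteq> d i" if "i \<le> Suc n" for i
    using that assms(2,3) c(3) by (cases i) (simp_all add: d_def)
  moreover have "d i \<subset> d (Suc i)" if "i < Suc n" for i
    using that assms(4) c(1,4) by (cases i) (simp_all add: d_def)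
  moreover have "d 0 = P" "d (Suc n) = q" using c(2) by (simp_all add: d_def)
  ultimately show ?thesis unfolding primechain_def by blast
qed

lemma primechain_shift:
  assumes c: "c (Suc n) = q" "\<forall>i\<le>Suc n. primeideal (c i) R \<and> I \<subseteq> c i" "\<forall>i<Suc n. c i \<subset> c (Suc i)"
  shows "primechain R I n (c (Suc 0)) q"
  unfolding primechain_def by (intro exI[of _ "\<lambda>i. c (Suc i)"]) (use c in auto)

lemma primechain_SucE:
  assumes "primechain R I (Suc n) p q"
  obtains p' where "primeideal p R" "I \<subseteq> p" "p \<subset> p'" "primechain R I n p' q"
proof -
  obtain c where c: "c 0 = p" "c (Suc n) = q" "\<forall>i\<le>Suc n. primeideal (c i) R \<and> I \<subseteq> c i" "\<forall>i<Suc n. c i \<subset> c (Suc i)"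
    using assms unfolding primechain_def by blast
  show thesis by (rule that[of "c (Suc 0)"]) (use c primechain_shift[OF c(2-4)] in auto)
qed

lemma primechain_append:
  "primechain R I m p q \<Longrightarrow> primechain R I n q r \<Longrightarrow> primechain R I (m + n) p r"
proof (induction m arbitrary: p)
  case 0
  then show ?case by (simp add: primechain_def) metis
next
  case (Suc m)
  from Suc.prems(1) show ?case
    by (rule primechain_SucE) (use Suc primechain_Cons in fastforce)
qed

lemma primechain_ends:
  "primechain R I n p q \<Longrightarrow> primeideal p R \<and> I \<subseteq> p \<and> primeideal q R \<and> I \<subseteq> q \<and> p \<subseteq> q"
proof (induction n arbitrary: p)
  case 0
  then show ?case by (auto simp: primechain_def)
next
  case (Suc n)
  from Suc.prems show ?case by (rule primechain_SucE) (use Suc.IH in blast)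
qed

lemma primechain_mono: "primechain R I n p q \<Longrightarrow> I' \<subseteq> p \<Longrightarrow> primechain R I' n p q"
proof (induction n arbitrary: p)
  case 0
  then show ?case by (auto simp: primechain_def)
next
  case (Suc n)
  from Suc.prems(1) show ?case
    by (rule primechain_SucE) (use Suc primechain_Cons in blast)
qed

section \<open>The annihilator condition and co-regular sequences\<close>

definition annih_closed :: "'a ring \<Rightarrow> ('a, 'm) module \<Rightarrow> bool" where
  "annih_closed R M \<longleftrightarrow> (\<forall>p \<in> Vset R (annih R M (carrier M)). annih R M (colon M p) = p)"

lemma annih_sub [simp]: "annih R (sub M K) T = annih R M T"
  by (simp add: annih_def)

lemma colon_sub: "colon (sub M (colon M A)) B = colon M (A \<union> B)"
  by (auto simp: colon_def)

lemma colon_empty [simp]: "colon M {} = carrier M"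
  by (simp add: colon_def)

lemma sub_carrier [simp]: "sub M (carrier M) = M"
  by simp

lemma mulset_sub_carrier [simp]: "mulset (sub M K) x L = mulset M x L"
  by (simp add: mulset_def)

text \<open>The definition speaks about prefixes of the list. Splitting off the first element
  replaces the module by 0 : x, so inductions on lists must leave the module arbitrary.\<close>

lemma coreg_seq_Cons:
  "coreg_seq R M (x # xs) \<longleftrightarrow> x \<in> carrier R \<and> mulset M x (carrier M) = carrier M \<and>
     coreg_seq R (sub M (colon M {x})) xs"
  by (simp add: coreg_seq_def All_less_Suc2 colon_sub mulset_def conj_ac)

lemma coreg_seq_snoc:
  assumes "coreg_seq R M xs" "x \<in> carrier R" "mulset M x (colon M (set xs)) = colon M (set xs)"
    "colon M (insert x (set xs)) \<noteq> {\<zero>\<^bsub>M\<^esub>}"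
  shows "coreg_seq R M (xs @ [x])"
proof -
  have "((xs @ [x]) ! i = xs ! i \<and> take i (xs @ [x]) = take i xs)" if "i < length xs" for i
    using that by (simp add: nth_append)
  then show ?thesis using assms unfolding coreg_seq_def mulset_def by (simp add: less_Suc_eq)
qed

context artmod
begin

text \<open>Since 0 : p is contained in 0 : T, the condition assumed at the single prime
  \<open>p\<close> controls 0 : T for every subset \<open>T\<close> of it.\<close>

lemma annih_colon_sub:
  assumes H: "annih_closed R M" and p: "primeideal p R" "annih R M (carrier M) \<subseteq> p" and T: "T \<subseteq> p"
  shows "annih R M (colon M T) \<subseteq> p" "colon M T \<noteq> {\<zero>\<^bsub>M\<^esub>}"
proof -
  have e: "annih R M (colon M p) = p" using H p by (simp add: annih_closed_def Vset_def)
  have s: "colon M p \<subseteq> colon M T" using T by (auto simp: colon_def)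
  then show "annih R M (colon M T) \<subseteq> p" using e by (force simp: annih_def)
  have "colon M p \<noteq> {\<zero>\<^bsub>M\<^esub>}"
  proof
    assume "colon M p = {\<zero>\<^bsub>M\<^esub>}"
    then have "\<one> \<in> annih R M (colon M p)" by (simp add: annih_def)
    then show False using e primeD(2)[OF p(1)] by simp
  qed
  moreover have "\<zero>\<^bsub>M\<^esub> \<in> colon M p" using smD(2)[OF sm_colon[OF primeD(4)[OF p(1)]]] .
  ultimately show "colon M T \<noteq> {\<zero>\<^bsub>M\<^esub>}" using s by blast
qed

lemma artmod_colon: "T \<subseteq> carrier R \<Longrightarrow> artmod R (sub M (colon M T))"
  unfolding artmod_def by (rule art_sub[OF sm_colon])

text \<open>Dual to a regular element raising the height. If s x^k kills \<open>M\<close>,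
  surjectivity of x shows that s kills \<open>M\<close>, so s lies in Ann(0 : x) and hence in
  \<open>q\<close>. The multiplicative set \<open>T\<close> of all s x^k with s outside
  \<open>q\<close> therefore misses Ann M, and a prime disjoint from \<open>T\<close> lies in
  \<open>q\<close> and omits x.\<close>

lemma prime_below_colon:
  assumes x: "x \<in> carrier R" "mulset M x (carrier M) = carrier M"
    and q: "primeideal q R" "annih R M (colon M {x}) \<subseteq> q"
  shows "\<exists>P. primeideal P R \<and> annih R M (carrier M) \<subseteq> P \<and> P \<subset> q"
proof -
  define T where "T = {s \<otimes> x [^] (k::nat) | s k. s \<in> carrier R - q}"
  have xq: "x \<in> q" using q(2) x(1) by (auto simp: annih_def colon_def)
  have xk: "x [^] k \<in> carrier R" for k :: nat using x(1) by simp
  have one: "\<one> \<in> carrier R - q" using primeD(2)[OF q(1)] by simp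
  have surj: "mulset M (x [^] (k::nat)) (carrier M) = carrier M" for k
  proof (induction k)
    case 0
    then show ?case by (force simp: mulset_def)
  next
    case (Suc k)
    have "mulset M (x [^] Suc k) (carrier M) = mulset M (x [^] k) (mulset M x (carrier M))"
      using x(1) by (simp add: mulset_mulset)
    then show ?case using Suc x(2) by simp
  qed
  have "annih R M (carrier M) \<inter> T = {}"
  proof (rule ccontr)
    assume "annih R M (carrier M) \<inter> T \<noteq> {}"
    then obtain s k where s: "s \<in> carrier R - q" "s \<otimes> x [^] (k::nat) \<in> annih R M (carrier M)" unfolding T_def by blast
    have "s \<odot>\<^bsub>M\<^esub> y = \<zero>\<^bsub>M\<^esub>" if y: "y \<in> carrier M" for y
    proof -
      obtain z where "z \<in> carrier M" "y = x [^] k \<odot>\<^bsub>M\<^esub> z" using surj[of k] y unfolding mulset_def by blast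
      then show ?thesis using s xk by (simp add: annih_def smult_assoc1)
    qed
    then have "s \<in> annih R M (colon M {x})" using s(1) by (auto simp: annih_def colon_def)
    then show False using q(2) s(1) by blast
  qed
  moreover have "ideal (annih R M (carrier M)) R" by (rule ideal_annih) simp
  moreover have "T \<subseteq> carrier R" using x(1) by (auto simp: T_def)
  moreover have T0: "s \<otimes> x [^] (k::nat) \<in> T" if "s \<in> carrier R - q" for s k using that by (auto simp: T_def)
  have "\<one> \<in> T" using T0[OF one, of 0] by simp
  moreover have "u \<otimes> v \<in> T" if uv: "u \<in> T" "v \<in> T" for u v
  proof -
    obtain s k t l where h: "s \<in> carrier R - q" "u = s \<otimes> x [^] (k::nat)" "t \<in> carrier R - q" "v = t \<otimes> x [^] (l::nat)"
      using uv unfolding T_def by blast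
    have "s \<otimes> t \<in> carrier R - q" using primeD(3)[OF q(1), of s t] h by auto
    moreover have "u \<otimes> v = (s \<otimes> t) \<otimes> x [^] (k + l)"
      using h x(1) by (simp add: nat_pow_mult[symmetric] m_ac)
    ultimately show ?thesis using T0 by simp
  qed
  ultimately obtain P where P: "primeideal P R" "annih R M (carrier M) \<subseteq> P" "P \<inter> T = {}"
    using prime_disjoint[of "annih R M (carrier M)" T] by blast
  have "P \<subseteq> q"
  proof
    fix s assume s: "s \<in> P"
    have sR: "s \<in> carrier R" using s primeD(4)[OF P(1)] by blast
    show "s \<in> q"
    proof (rule ccontr)
      assume "s \<notin> q"
      then have "s \<otimes> x [^] (0::nat) \<in> T" using sR T0 by blast
      then show False using P(3) s sR by auto
    qed
  qed
  moreover have "x \<notin> P" using T0[OF one, of 1] P(3) x(1) by auto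
  ultimately show ?thesis using P xq by blast
qed

end

text \<open>Each element of the sequence prolongs the chain by one prime at its lower end, while the
  ideal that must be contained shrinks from Ann(0 : xs) to Ann M. The upper end \<open>p\<close> is
  kept.\<close>

lemma coreg_seq_primechain:
  assumes "art_module R M" "coreg_seq R M xs" "primechain R (annih R M (colon M (set xs))) k q p"
  shows "\<exists>q'. primechain R (annih R M (carrier M)) (k + length xs) q' p"
  using assms
proof (induction xs arbitrary: M)
  case Nil
  then show ?case by auto
next
  case (Cons x xs)
  interpret artmod R M using Cons.prems(1) by (simp add: artmod_def)
  have x: "x \<in> carrier R" "mulset M x (carrier M) = carrier M" "coreg_seq R (sub M (colon M {x})) xs"
    using Cons.prems(2) by (simp_all add: coreg_seq_Cons)
  have "art_module R (sub M (colon M {x}))" by (rule art_sub[OF sm_colon]) (use x in simp)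
  moreover have "primechain R (annih R (sub M (colon M {x})) (colon (sub M (colon M {x})) (set xs))) k q p"
    using Cons.prems(3) by (simp add: colon_sub)
  ultimately obtain q' where q': "primechain R (annih R M (colon M {x})) (k + length xs) q' p"
    using Cons.IH[OF _ x(3)] by auto
  have qe: "primeideal q' R" "annih R M (colon M {x}) \<subseteq> q'" using primechain_ends[OF q'] by blast+
  obtain P where P: "primeideal P R" "annih R M (carrier M) \<subseteq> P" "P \<subset> q'"
    using prime_below_colon[OF x(1,2) qe] by blast
  have "primechain R (annih R M (carrier M)) (k + length xs) q' p"
    by (rule primechain_mono[OF q']) (use P in blast)
  from primechain_Cons[OF this P] show ?case by auto
qed

lemma tor_zero_below_coreg_seq:
  assumes "art_module R M" "coreg_seq R M xs" "set xs \<subseteq> p" "primeideal p R"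
  shows "tor_zero_below R M p (n + length xs) \<longleftrightarrow> tor_zero_below R (sub M (colon M (set xs))) p n"
  using assms
proof (induction xs arbitrary: M)
  case Nil
  then show ?case by simp
next
  case (Cons x xs)
  interpret artmod R M using Cons.prems(1) by (simp add: artmod_def)
  interpret coloc R M p
    by (intro coloc.intro locring.intro locring_axioms.intro artmod_axioms is_cring Cons.prems(4))
  have x: "x \<in> carrier R" "mulset M x (carrier M) = carrier M" "coreg_seq R (sub M (colon M {x})) xs"
    using Cons.prems(2) by (simp_all add: coreg_seq_Cons)
  have a: "art_module R (sub M (colon M {x}))" by (rule art_sub[OF sm_colon]) (use x in simp)
  have "tor_zero_below R M p (n + length (x # xs)) \<longleftrightarrow> tor_zero_below R (sub M (colon M {x})) p (n + length xs)"
    using tor_zero_below_Suc[of x "n + length xs"] Cons.prems(3) x(2) by simp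
  also have "\<dots> \<longleftrightarrow> tor_zero_below R (sub M (colon M (set (x # xs)))) p n"
    using Cons.IH[OF a x(3) _ Cons.prems(4)] Cons.prems(3) by (simp add: colon_sub)
  finally show ?case .
qed

section \<open>Vanishing dual Bass numbers at a maximal ideal\<close>

context artmod
begin

lemma coloc_prime: "primeideal p R \<Longrightarrow> coloc R M p"
  by (intro coloc.intro locring.intro locring_axioms.intro artmod_axioms is_cring)

definition maxprime :: "'a set \<Rightarrow> bool" where
  "maxprime m \<longleftrightarrow> primeideal m R \<and> (\<forall>I. ideal I R \<longrightarrow> m \<subseteq> I \<longrightarrow> \<one> \<notin> I \<longrightarrow> I = m)"

lemma maxprime_eq: "maxprime m \<Longrightarrow> primeideal q R \<Longrightarrow> m \<subseteq> q \<Longrightarrow> q = m"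
  using primeD unfolding maxprime_def by blast

lemma atsupp_maxprime: "sm K \<Longrightarrow> primeideal m R \<Longrightarrow> atsupp K m \<Longrightarrow> maxprime m"
  unfolding maxprime_def using atsupp_maximal(2) by blast

lemma tor_zero_not_quann:
  assumes "sm K" "primeideal (quann K) R" "tor_zero_below R M (quann K) (Suc n)" shows False
  using coloc.not_dual_bass_zero_0[OF coloc_prime[OF assms(2)] assms(1)] assms(3)
  unfolding tor_zero_below_def by blast

lemma tor_zero_surjective:
  assumes "maxprime m" "tor_zero_below R M m (Suc n)"
  shows "\<exists>x\<in>m. mulset M x (carrier M) = carrier M"
proof (rule ccontr)
  assume n: "\<not> ?thesis"
  have m: "primeideal m R" using assms(1) by (simp add: maxprime_def)
  obtain K where K: "sm K" "primeideal (quann K) R" "m \<subseteq> quann K"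
    using surjective_or_attached[OF primeD(1)[OF m]] n by blast
  have "quann K = m" by (rule maxprime_eq[OF assms(1) K(2,3)])
  then show False using tor_zero_not_quann[OF K(1,2)] assms(2) by metis
qed

text \<open>Let \<open>L\<close> be generated by \<open>quann K\<close> times \<open>M\<close>. As \<open>x L = L\<close>, an element of \<open>M/L\<close> with annihilator \<open>m\<close>
  lifts to one killed by \<open>x\<close>.\<close>
lemma quann_colon:
  assumes m: "primeideal m R" and x: "x \<in> m" "mulset M x (carrier M) = carrier M"
    and K: "sm K" "atsupp K m" "primeideal (quann K) R"
  shows "\<exists>K'. submodule K' R (sub M (colon M {x})) \<and> artmod.atsupp R (sub M (colon M {x})) K' m \<and>
    primeideal (artmod.quann R (sub M (colon M {x})) K') R \<and> quann K \<subset> artmod.quann R (sub M (colon M {x})) K'"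
proof -
  have xR: "x \<in> carrier R" using x(1) primeD(4)[OF m] by blast
  interpret N: artmod R "sub M (colon M {x})" by (rule artmod_colon) (use xR in simp)
  define G where "G = {r \<odot>\<^bsub>M\<^esub> y | r y. r \<in> quann K \<and> y \<in> carrier M}"
  define L where "L = \<Inter>{N. sm N \<and> G \<subseteq> N}"
  have GK: "G \<subseteq> K" by (auto simp: G_def)
  then have LK: "L \<subseteq> K" unfolding L_def using K(1) by blast
  have GL: "G \<subseteq> L" by (auto simp: L_def)
  have L: "sm L"
  proof -
    have "L \<subseteq> carrier M" using LK smD(1)[OF K(1)] by blast
    moreover have "\<zero>\<^bsub>M\<^esub> \<in> L" using smD(2) unfolding L_def by blast
    moreover have "x \<oplus>\<^bsub>M\<^esub> y \<in> L" if "x \<in> L" "y \<in> L" for x y using that smD(3) unfolding L_def by blast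
    moreover have "r \<odot>\<^bsub>M\<^esub> y \<in> L" if "r \<in> carrier R" "y \<in> L" for r y using that smD(4) unfolding L_def by blast
    ultimately show ?thesis unfolding submodule_iff by blast
  qed
  have "G \<subseteq> mulset M x L"
  proof
    fix g assume "g \<in> G"
    then obtain r y where r: "r \<in> quann K" "y \<in> carrier M" "g = r \<odot>\<^bsub>M\<^esub> y" unfolding G_def by blast
    obtain y' where y': "y' \<in> carrier M" "y = x \<odot>\<^bsub>M\<^esub> y'" using r(2) x(2) unfolding mulset_def by blast
    have "g = x \<odot>\<^bsub>M\<^esub> (r \<odot>\<^bsub>M\<^esub> y')" using r y' xR smult_comm by simp
    moreover have "r \<odot>\<^bsub>M\<^esub> y' \<in> L" using GL r(1) y'(1) unfolding G_def by blast
    ultimately show "g \<in> mulset M x L" by (auto simp: mulset_def)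
  qed
  then have LxL: "L \<subseteq> mulset M x L" using sm_mulset[OF L xR] unfolding L_def by blast
  have atL: "atsupp L m" by (rule atsupp_antimono[OF K(2) LK])
  obtain z where z: "z \<in> carrier M" "{r \<in> carrier R. r \<odot>\<^bsub>M\<^esub> z \<in> L} = m"
    using atsupp_maximal(1)[OF L m atL] by blast
  have "x \<odot>\<^bsub>M\<^esub> z \<in> L" using z(2) x(1) by blast
  then obtain b where b: "b \<in> L" "x \<odot>\<^bsub>M\<^esub> z = x \<odot>\<^bsub>M\<^esub> b" using LxL unfolding mulset_def by blast
  have bM: "b \<in> carrier M" using b(1) smD(7)[OF L] by blast
  define y0 where "y0 = z \<ominus>\<^bsub>M\<^esub> b"
  have y0: "y0 \<in> colon M {x}" using z(1) bM xR b(2) by (simp add: y0_def colon_def smult_r_diff)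
  have "s \<odot>\<^bsub>M\<^esub> y0 \<notin> L" if s: "s \<in> carrier R - m" for s
  proof
    assume "s \<odot>\<^bsub>M\<^esub> y0 \<in> L"
    then have "s \<odot>\<^bsub>M\<^esub> z \<ominus>\<^bsub>M\<^esub> s \<odot>\<^bsub>M\<^esub> b \<in> L" using s z(1) bM by (simp add: y0_def smult_r_diff)
    then have "s \<odot>\<^bsub>M\<^esub> z \<in> L" using sm_diff_cancel[OF L _ smD(4)[OF L _ b(1)]] s z(1) by simp
    then show False using z(2) s by blast
  qed
  then have at0: "N.atsupp (L \<inter> colon M {x}) m" unfolding N.atsupp_def using y0 by auto
  have C: "sm (colon M {x})" by (rule sm_colon) (use xR in simp)
  have "submodule (L \<inter> colon M {x}) R (sub M (colon M {x}))"
    using submodule_sub[OF C] sm_Int[OF L C] by blast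
  then obtain K' where K': "submodule K' R (sub M (colon M {x}))" "L \<inter> colon M {x} \<subseteq> K'" "N.atsupp K' m"
      "primeideal (N.quann K') R" using N.quotient_annih_prime[OF _ m at0] by blast
  have "r \<in> N.quann K'" if r: "r \<in> quann K" for r
  proof -
    have "r \<odot>\<^bsub>M\<^esub> y \<in> L \<inter> colon M {x}" if "y \<in> colon M {x}" for y
      using that GL r smD(4)[OF C, of r y] unfolding G_def by (auto simp: colon_def)
    then show ?thesis using K'(2) r by auto
  qed
  moreover have "x \<in> N.quann K'" using xR smD(2)[OF L] smD(2)[OF C] K'(2) by (auto simp: colon_def)
  \<comment> \<open>This makes the inclusion of attached primes strict: x M = M cannot lie in the
    proper submodule K.\<close>
  moreover have "x \<notin> quann K"
  proof
    assume "x \<in> quann K"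
    then have "mulset M x (carrier M) \<subseteq> K" by (auto simp: mulset_def)
    then show False using atsupp_proper[OF m K(2)] x(2) by blast
  qed
  ultimately have "quann K \<subset> N.quann K'" by blast
  then show ?thesis using K' by blast
qed

end

text \<open>Dual to the inequality between depth M and dim R/q for an associated prime q. As long as
  a degree of vanishing is left, \<open>m\<close> contains a surjective x. Passing to 0 : x uses up
  one degree and, by \<open>quann_colon\<close>, replaces the attached prime by a strictly larger
  one.\<close>

lemma tor_zero_dimension:
  assumes "art_module R M" "artmod.maxprime R m" "tor_zero_below R M m n"
    "submodule K R M" "artmod.atsupp R M K m" "primeideal (artmod.quann R M K) R"
  shows "\<exists>q. primechain R (artmod.quann R M K) n (artmod.quann R M K) q"
  using assms
proof (induction n arbitrary: M K)
  case 0
  then show ?case using primechain_0 by blast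
next
  case (Suc n)
  interpret artmod R M using Suc.prems(1) by (simp add: artmod_def)
  have m: "primeideal m R" using Suc.prems(2) by (simp add: maxprime_def)
  interpret coloc R M m by (rule coloc_prime[OF m])
  obtain x where x: "x \<in> m" "mulset M x (carrier M) = carrier M"
    using tor_zero_surjective[OF Suc.prems(2,3)] by blast
  have xR: "x \<in> carrier R" using x(1) primeD(4)[OF m] by blast
  have a: "art_module R (sub M (colon M {x}))" by (rule art_sub[OF sm_colon]) (use xR in simp)
  obtain K' where K': "submodule K' R (sub M (colon M {x}))" "artmod.atsupp R (sub M (colon M {x})) K' m"
    "primeideal (artmod.quann R (sub M (colon M {x})) K') R" "quann K \<subset> artmod.quann R (sub M (colon M {x})) K'"
    using quann_colon[OF m x Suc.prems(4-6)] by blast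
  have "tor_zero_below R (sub M (colon M {x})) m n" using tor_zero_below_Suc[OF x] Suc.prems(3) by simp
  then obtain q where q: "primechain R (artmod.quann R (sub M (colon M {x})) K') n (artmod.quann R (sub M (colon M {x})) K') q"
    using Suc.IH[OF a Suc.prems(2) _ K'(1-3)] by blast
  have "primechain R (quann K) n (artmod.quann R (sub M (colon M {x})) K') q"
    by (rule primechain_mono[OF q]) (use K'(4) in blast)
  from primechain_Cons[OF this Suc.prems(6) _ K'(4)] show ?case by blast
qed

lemma ndle_eq_devlt: "ndle R M k N L \<longleftrightarrow> devlt {K. submodule K R M} (\<subseteq>) k L N"
proof (induction k arbitrary: N L)
  case 0
  then show ?case by auto
next
  case (Suc k)
  then show ?case by simp
qed

section \<open>Deviation of submodules and of ideals\<close>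

context artmod
begin

abbreviation "dvM \<equiv> devlt {K. sm K} (\<subseteq>)"

lemma dvM_subinterval:
  "dvM k A B \<Longrightarrow> sm A \<Longrightarrow> sm B \<Longrightarrow> sm C \<Longrightarrow> sm D \<Longrightarrow> A \<subseteq> C \<Longrightarrow> C \<subseteq> D \<Longrightarrow> D \<subseteq> B \<Longrightarrow> dvM k C D"
  by (rule devlt_subinterval[where a = A and b = B]) auto

lemma mulset_pow_surj:
  assumes "sm U" "x \<in> carrier R" "mulset M x U = U"
  shows "mulset M (x [^] (n::nat)) U = U"
proof (induction n)
  case 0
  then show ?case using smD(1)[OF assms(1)] by (force simp: mulset_def)
next
  case (Suc n)
  have "mulset M (x [^] Suc n) U = mulset M (x [^] n) (mulset M x U)"
    using assms(2) smD(1)[OF assms(1)] by (simp add: mulset_mulset)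
  then show ?case using Suc assms(3) by simp
qed

text \<open>The submodules killed by x^n form an ascending chain in U, so some step of it has
  deviation below k. Taking preimages under x^n embeds the interval below 0 : x into that step, and
  surjectivity of x^n makes the embedding strict.\<close>

lemma dvM_kernel:
  assumes U: "sm U" and x: "x \<in> carrier R" "mulset M x U = U" and d: "dvM (Suc k) {\<zero>\<^bsub>M\<^esub>} U"
  shows "dvM k {\<zero>\<^bsub>M\<^esub>} {y \<in> U. x \<odot>\<^bsub>M\<^esub> y = \<zero>\<^bsub>M\<^esub>}"
proof -
  let ?V = "{y \<in> U. x \<odot>\<^bsub>M\<^esub> y = \<zero>\<^bsub>M\<^esub>}"
  have V: "sm ?V" using sm_preimage[OF sm_zero U x(1)] by simp
  have z: "\<zero>\<^bsub>M\<^esub> \<in> ?V" by (rule smD(2)[OF V])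
  have xn: "x [^] n \<in> carrier R" for n :: nat using x by simp
  show ?thesis
  proof (cases "dvM k {\<zero>\<^bsub>M\<^esub>} U")
    case True
    show ?thesis by (rule dvM_subinterval[OF True sm_zero U sm_zero V]) (use z in auto)
  next
    case False
    define f where "f n T = {y \<in> U. x [^] (n::nat) \<odot>\<^bsub>M\<^esub> y \<in> T}" for n T
    have f: "sm (f n T)" if "sm T" for n T unfolding f_def by (rule sm_preimage[OF that U xn])
    have up: "f n ?V = f (Suc n) {\<zero>\<^bsub>M\<^esub>}" for n
    proof -
      have "x [^] n \<odot>\<^bsub>M\<^esub> y \<in> ?V \<longleftrightarrow> x [^] Suc n \<odot>\<^bsub>M\<^esub> y = \<zero>\<^bsub>M\<^esub>" if y: "y \<in> U" for y
        using smD(4)[OF U xn y] smD(7)[OF U y] x(1) by (simp add: smult_assoc1[symmetric] m_comm[of x])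
      then show ?thesis by (auto simp: f_def)
    qed
    have mono: "f n T \<subseteq> f n T'" if "T \<subseteq> T'" for n T T' using that by (auto simp: f_def)
    have "\<forall>n. f n {\<zero>\<^bsub>M\<^esub>} \<in> {K. sm K} \<and> {\<zero>\<^bsub>M\<^esub>} \<subseteq> f n {\<zero>\<^bsub>M\<^esub>} \<and> f n {\<zero>\<^bsub>M\<^esub>} \<subseteq> U \<and> f n {\<zero>\<^bsub>M\<^esub>} \<subseteq> f (Suc n) {\<zero>\<^bsub>M\<^esub>}"
    proof
      fix n
      have "f n {\<zero>\<^bsub>M\<^esub>} \<subseteq> U" by (auto simp: f_def)
      moreover have "f n {\<zero>\<^bsub>M\<^esub>} \<subseteq> f (Suc n) {\<zero>\<^bsub>M\<^esub>}" unfolding up[symmetric] by (rule mono) (use z in simp)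
      ultimately show "f n {\<zero>\<^bsub>M\<^esub>} \<in> {K. sm K} \<and> {\<zero>\<^bsub>M\<^esub>} \<subseteq> f n {\<zero>\<^bsub>M\<^esub>} \<and> f n {\<zero>\<^bsub>M\<^esub>} \<subseteq> U \<and> f n {\<zero>\<^bsub>M\<^esub>} \<subseteq> f (Suc n) {\<zero>\<^bsub>M\<^esub>}"
        using f[OF sm_zero] smD(2)[OF f[OF sm_zero]] by blast
    qed
    moreover have "(\<forall>K. (\<forall>n. K n \<in> {K. sm K} \<and> {\<zero>\<^bsub>M\<^esub>} \<subseteq> K n \<and> K n \<subseteq> U \<and> K n \<subseteq> K (Suc n))
        \<longrightarrow> (\<exists>n0. \<forall>n>n0. dvM k (K n) (K (Suc n))))"
      using d False by simp
    ultimately have "\<exists>n0. \<forall>n>n0. dvM k (f n {\<zero>\<^bsub>M\<^esub>}) (f (Suc n) {\<zero>\<^bsub>M\<^esub>})"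
      by (elim allE[of _ "\<lambda>n. f n {\<zero>\<^bsub>M\<^esub>}"]) (rule mp)
    then obtain n where n: "dvM k (f n {\<zero>\<^bsub>M\<^esub>}) (f n ?V)" unfolding up by blast
    show ?thesis
    proof (rule devlt_transport[where f = "f n" and a = "{\<zero>\<^bsub>M\<^esub>}" and b = "?V" and P' = "{K. sm K}" and lq' = "(\<subseteq>)"])
      fix T T' assume h: "T \<in> {K. sm K}" "T' \<in> {K. sm K}" "T \<subseteq> T'" "T' \<subseteq> ?V" "f n T = f n T'"
      have "t \<in> T" if t: "t \<in> T'" for t
      proof -
        have "t \<in> mulset M (x [^] n) U" using mulset_pow_surj[OF U x, of n] t h(4) by blast
        then obtain y where y: "y \<in> U" "t = x [^] n \<odot>\<^bsub>M\<^esub> y" by (auto simp: mulset_def)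
        then have "y \<in> f n T'" using t by (simp add: f_def)
        then show ?thesis using h(5) y(2) by (auto simp: f_def)
      qed
      then show "T = T'" using h(3) by blast
    qed (use V z n f mono sm_zero in auto)
  qed
qed

lemma dcc_decseqs: "G \<in> decseqs {K. sm K} (\<subseteq>) \<Longrightarrow> \<exists>n0. \<forall>n\<ge>n0. G n = G n0"
  using dcc[of G] by (auto simp: decseqs_def)

text \<open>\<open>G K i\<close> is x^i times the part of K killed by x^(i+1), the i-th leading part
  of K inside 0 : x. These parts decrease with i, and because U is x-torsion they distinguish
  comparable submodules. \<open>devlt_decseqs\<close> then charges one unit for using sequences in
  place of single submodules.\<close>

lemma dvM_torsion:
  assumes U: "sm U" and x: "x \<in> carrier R" and tors: "\<And>y. y \<in> U \<Longrightarrow> \<exists>n::nat. x [^] n \<odot>\<^bsub>M\<^esub> y = \<zero>\<^bsub>M\<^esub>"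
    and d: "dvM k {\<zero>\<^bsub>M\<^esub>} {y \<in> U. x \<odot>\<^bsub>M\<^esub> y = \<zero>\<^bsub>M\<^esub>}"
  shows "dvM (Suc k) {\<zero>\<^bsub>M\<^esub>} U"
proof -
  let ?V = "{y \<in> U. x \<odot>\<^bsub>M\<^esub> y = \<zero>\<^bsub>M\<^esub>}"
  have V: "sm ?V" using sm_preimage[OF sm_zero U x(1)] by simp
  have xn: "x [^] n \<in> carrier R" for n :: nat using x by simp
  define G where "G K i = mulset M (x [^] (i::nat)) {y \<in> K. x [^] Suc i \<odot>\<^bsub>M\<^esub> y \<in> {\<zero>\<^bsub>M\<^esub>}}" for K i
  have Gsm: "sm (G K i)" if "sm K" for K i
    unfolding G_def by (rule sm_mulset[OF sm_preimage[OF sm_zero that xn] xn])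
  have mono: "G K i \<subseteq> G K' i" if "K \<subseteq> K'" for K K' i
    unfolding G_def by (rule mulset_mono) (use that in auto)
  have pw: "x [^] Suc i \<odot>\<^bsub>M\<^esub> y = x \<odot>\<^bsub>M\<^esub> (x [^] i \<odot>\<^bsub>M\<^esub> y)" "x [^] Suc i \<odot>\<^bsub>M\<^esub> y = x [^] i \<odot>\<^bsub>M\<^esub> (x \<odot>\<^bsub>M\<^esub> y)"
    if "y \<in> carrier M" for y and i :: nat
    using that x by (simp_all add: smult_assoc1[symmetric] m_comm[of x])
  have dec: "G K (Suc i) \<subseteq> G K i" if K: "sm K" for K i
  proof
    fix u assume "u \<in> G K (Suc i)"
    then obtain y where y: "y \<in> K" "x [^] Suc (Suc i) \<odot>\<^bsub>M\<^esub> y = \<zero>\<^bsub>M\<^esub>" "u = x [^] Suc i \<odot>\<^bsub>M\<^esub> y"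
      unfolding G_def mulset_def by blast
    have yM: "y \<in> carrier M" using y(1) smD(7)[OF K] by blast
    have "x \<odot>\<^bsub>M\<^esub> y \<in> K" by (rule smD(4)[OF K x y(1)])
    moreover have "x [^] Suc i \<odot>\<^bsub>M\<^esub> (x \<odot>\<^bsub>M\<^esub> y) = \<zero>\<^bsub>M\<^esub>" using pw(2)[OF yM, of "Suc i"] y(2) by simp
    moreover have "u = x [^] i \<odot>\<^bsub>M\<^esub> (x \<odot>\<^bsub>M\<^esub> y)" using pw(2)[OF yM, of i] y(3) by simp
    ultimately show "u \<in> G K i" unfolding G_def mulset_def by blast
  qed
  have GV: "G K i \<subseteq> ?V" if K: "sm K" "K \<subseteq> U" for K i
  proof
    fix u assume "u \<in> G K i"
    then obtain y where y: "y \<in> K" "x [^] Suc i \<odot>\<^bsub>M\<^esub> y = \<zero>\<^bsub>M\<^esub>" "u = x [^] i \<odot>\<^bsub>M\<^esub> y"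
      unfolding G_def mulset_def by blast
    have yM: "y \<in> carrier M" using y(1) smD(7)[OF K(1)] by blast
    show "u \<in> ?V" using y smD(4)[OF K(1) xn y(1), of i] K(2) pw(1)[OF yM, of i] by auto
  qed
  have Gz: "{\<zero>\<^bsub>M\<^esub>} \<subseteq> G K i" if "sm K" for K i using smD(2)[OF Gsm[OF that]] by blast
  have Gdec: "G K \<in> decseqs {K. sm K} (\<subseteq>)" if "sm K" for K using Gsm[OF that] dec[OF that] by (simp add: decseqs_def)
  have U0: "{\<zero>\<^bsub>M\<^esub>} \<subseteq> U" using smD(2)[OF U] by blast
  have int: "dvM k (G {\<zero>\<^bsub>M\<^esub>} i) (G U i)" for i
    by (rule dvM_subinterval[OF d sm_zero V Gsm[OF sm_zero] Gsm[OF U] Gz[OF sm_zero] mono[OF U0] GV[OF U order_refl]])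
  have int': "dvM (Suc k) (G {\<zero>\<^bsub>M\<^esub>} i) (G U i)" for i
    using int by (rule devlt_mono_nat) simp
  have "devlt (decseqs {K. sm K} (\<subseteq>)) (\<lambda>G G'. \<forall>i. G i \<subseteq> G' i) (Suc k) (G {\<zero>\<^bsub>M\<^esub>}) (G U)"
  proof (rule devlt_decseqs)
    show "\<forall>i. dvM (Suc k) (G {\<zero>\<^bsub>M\<^esub>} i) (G U i)" using int' by blast
    show "\<exists>i0. \<forall>i\<ge>i0. dvM k (G {\<zero>\<^bsub>M\<^esub>} i) (G U i)" using int by blast
    show "\<forall>i. G {\<zero>\<^bsub>M\<^esub>} i \<subseteq> G U i" using mono[OF U0] by blast
  qed (use dcc_decseqs Gdec sm_zero U in auto)
  then show ?thesis
  proof (rule devlt_transport[where a = "{\<zero>\<^bsub>M\<^esub>}" and b = U, rotated -1])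
    fix K K' assume h: "K \<in> {K. sm K}" "K' \<in> {K. sm K}" "K \<subseteq> K'" "K' \<subseteq> U" "G K = G K'"
    then have K: "sm K" "sm K'" by simp_all
    \<comment> \<open>Induction on the exponent killing y. Equal leading parts provide a z in K with
      x^n y = x^n z, and the difference y - z is killed by a smaller power.\<close>
    have "y \<in> K' \<Longrightarrow> x [^] n \<odot>\<^bsub>M\<^esub> y = \<zero>\<^bsub>M\<^esub> \<Longrightarrow> y \<in> K" for y and n :: nat
    proof (induction n arbitrary: y)
      case 0
      then show ?case using smD(7)[OF K(2)] smD(2)[OF K(1)] by simp
    next
      case (Suc n)
      have "x [^] n \<odot>\<^bsub>M\<^esub> y \<in> G K' n" using Suc.prems unfolding G_def mulset_def by blast
      then have "x [^] n \<odot>\<^bsub>M\<^esub> y \<in> G K n" using h(5) by simp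
      then obtain z where z: "z \<in> K" "x [^] n \<odot>\<^bsub>M\<^esub> y = x [^] n \<odot>\<^bsub>M\<^esub> z" unfolding G_def mulset_def by blast
      have c: "y \<in> carrier M" "z \<in> carrier M" using Suc.prems(1) z(1) smD(7)[OF K(2)] smD(7)[OF K(1)] by blast+
      have "x [^] n \<odot>\<^bsub>M\<^esub> (y \<ominus>\<^bsub>M\<^esub> z) = \<zero>\<^bsub>M\<^esub>" using c xn z(2) by (simp add: smult_r_diff)
      moreover have "y \<ominus>\<^bsub>M\<^esub> z \<in> K'" by (rule smD(6)[OF K(2) Suc.prems(1)]) (use z(1) h(3) in blast)
      ultimately have "y \<ominus>\<^bsub>M\<^esub> z \<in> K" using Suc.IH by blast
      then show ?case by (rule sm_diff_cancel[OF K(1) _ z(1) c(1)])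
    qed
    then have "K' \<subseteq> K" using tors h(4) by blast
    then show "K = K'" using h(3) by blast
  qed (use mono Gdec U0 U sm_zero in auto)
qed

section \<open>Ascending chains of submodules annihilated by zero-dimensional ideals\<close>

definition acc :: "'m set \<Rightarrow> bool" where
  "acc U \<longleftrightarrow> (\<forall>K. (\<forall>n. sm (K n) \<and> K n \<subseteq> U \<and> K n \<subseteq> K (Suc n)) \<longrightarrow> (\<exists>n0::nat. \<forall>n>n0. K n = K (Suc n)))"

lemma accD:
  assumes "acc U" "\<And>n. sm (K n)" "\<And>n. K n \<subseteq> U" "\<And>n. K n \<subseteq> K (Suc n)"
  shows "\<exists>n0::nat. \<forall>n>n0. K n = K (Suc n)"
  using assms unfolding acc_def by simp

lemma acc_iff_dvM:
  assumes "sm U" shows "acc U \<longleftrightarrow> dvM (Suc 0) {\<zero>\<^bsub>M\<^esub>} U"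
proof
  assume "acc U"
  then show "dvM (Suc 0) {\<zero>\<^bsub>M\<^esub>} U" by (simp add: acc_def)
next
  assume d: "dvM (Suc 0) {\<zero>\<^bsub>M\<^esub>} U"
  show "acc U" unfolding acc_def
  proof (intro allI impI)
    fix K assume K: "\<forall>n. sm (K n) \<and> K n \<subseteq> U \<and> K n \<subseteq> K (Suc n)"
    have z: "{\<zero>\<^bsub>M\<^esub>} \<subseteq> K n" for n :: nat using K smD(2) by blast
    show "\<exists>n0. \<forall>n>n0. K n = K (Suc n)"
    proof (cases "U = {\<zero>\<^bsub>M\<^esub>}")
      case True
      then have "K n = {\<zero>\<^bsub>M\<^esub>}" for n using K z by blast
      then show ?thesis by simp
    next
      case False
      then show ?thesis using d K z by simp
    qed
  qed
qed

lemma maxprime_inverse: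
  assumes "maxprime m" "r \<in> carrier R" "r \<notin> m"
  shows "\<exists>c\<in>carrier R. \<one> \<ominus> c \<otimes> r \<in> m"
proof -
  have m: "ideal m R" using assms(1) primeD(1) unfolding maxprime_def by blast
  note i = iadd[OF m assms(2)]
  have "\<one> \<in> iadd m r"
  proof (rule ccontr)
    assume "\<one> \<notin> iadd m r"
    then have "iadd m r = m" using assms(1) i(1,2) unfolding maxprime_def by blast
    then show False using i(3) assms(3) by simp
  qed
  then obtain x c where c: "x \<in> m" "c \<in> carrier R" "\<one> = x \<oplus> c \<otimes> r" unfolding iadd_def by blast
  have xR: "x \<in> carrier R" using c(1) idealD(7)[OF m] by blast
  have "(x \<oplus> c \<otimes> r) \<ominus> c \<otimes> r = x" using c(2) xR assms(2) by (simp add: R.minus_eq R.a_assoc R.r_neg)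
  then show ?thesis using c by (intro bexI[of _ c]) simp_all
qed

lemma sm_cyclic: "z \<in> carrier M \<Longrightarrow> sm ((\<lambda>c. c \<odot>\<^bsub>M\<^esub> z) ` carrier R)"
proof -
  assume z: "z \<in> carrier M"
  have "c \<odot>\<^bsub>M\<^esub> z \<oplus>\<^bsub>M\<^esub> d \<odot>\<^bsub>M\<^esub> z = (c \<oplus> d) \<odot>\<^bsub>M\<^esub> z" "d \<odot>\<^bsub>M\<^esub> (c \<odot>\<^bsub>M\<^esub> z) = (d \<otimes> c) \<odot>\<^bsub>M\<^esub> z"
    if "c \<in> carrier R" "d \<in> carrier R" for c d
    using that z by (simp_all add: smult_l_distr smult_assoc1)
  moreover have "\<zero>\<^bsub>M\<^esub> \<in> (\<lambda>c. c \<odot>\<^bsub>M\<^esub> z) ` carrier R"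
    using imageI[OF R.zero_closed, of "\<lambda>c. c \<odot>\<^bsub>M\<^esub> z"] z by simp
  ultimately show ?thesis unfolding submodule_iff using z by auto
qed

text \<open>For a module killed by a maximal ideal: elements \<open>y n \<in> K (n+1) - K n\<close> of an
  ascending chain are linearly independent, so their tails span a descending chain.\<close>
lemma acc_colon_maxprime:
  assumes m: "maxprime m" shows "acc (colon M m)"
  unfolding acc_def
proof (intro allI impI, rule ccontr)
  fix K assume K: "\<forall>n::nat. sm (K n) \<and> K n \<subseteq> colon M m \<and> K n \<subseteq> K (Suc n)"
    and n0: "\<not> (\<exists>n0. \<forall>n>n0. K n = K (Suc n))"
  have mp: "primeideal m R" using m by (simp add: maxprime_def)
  have Ks: "sm (K n)" for n using K by blast
  have Kmono: "K i \<subseteq> K j" if "i \<le> j" for i j using that K lift_Suc_mono_le[of K] by blast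
  \<comment> \<open>Where the chain repeats a term, \<open>y n\<close> is set to zero. This spares
    the passage to a strictly increasing subsequence.\<close>
  have "\<forall>n. \<exists>y\<in>K (Suc n). (if K n = K (Suc n) then y = \<zero>\<^bsub>M\<^esub> else y \<notin> K n)"
    using K smD(2)[OF Ks] by (metis psubsetE psubsetI subsetI)
  then obtain y where y: "\<And>n. y n \<in> K (Suc n)" "\<And>n. K n = K (Suc n) \<Longrightarrow> y n = \<zero>\<^bsub>M\<^esub>"
    "\<And>n. K n \<noteq> K (Suc n) \<Longrightarrow> y n \<notin> K n" by metis
  have yM: "y n \<in> carrier M" for n using y(1) smD(7)[OF Ks] by blast
  \<comment> \<open>\<open>W n k\<close> is the span of \<open>y n\<close>, ...,
    \<open>y (n + k - 1)\<close>. Independence is expressed by \<open>indep\<close>: the span meets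
    \<open>K n\<close> in zero only.\<close>
  define W where "W n k = rec_nat {\<zero>\<^bsub>M\<^esub>} (\<lambda>k B. addset M B ((\<lambda>c. c \<odot>\<^bsub>M\<^esub> y (n + k)) ` carrier R)) k" for n k :: nat
  have W0: "W n 0 = {\<zero>\<^bsub>M\<^esub>}" and WS: "W n (Suc k) = addset M (W n k) ((\<lambda>c. c \<odot>\<^bsub>M\<^esub> y (n + k)) ` carrier R)" for n k
    by (simp_all add: W_def)
  have Wsm: "sm (W n k)" for n k
    by (induction k) (simp_all add: W0 WS sm_zero sm_addset(1) sm_cyclic yM)
  have Winc: "W n k \<subseteq> W n (Suc k)" for n k unfolding WS by (rule sm_addset(2)[OF Wsm sm_cyclic[OF yM]])
  have Wmono: "W n i \<subseteq> W n j" if "i \<le> j" for n i j using that Winc lift_Suc_mono_le[of "W n"] by blast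
  have WK: "W n k \<subseteq> K (n + k)" for n k
  proof (induction k)
    case 0
    then show ?case using smD(2)[OF Ks] by (simp add: W0)
  next
    case (Suc k)
    show ?case unfolding WS
    proof (rule addset_least[OF Ks])
      show "W n k \<subseteq> K (n + Suc k)" using Suc Kmono[of "n + k" "n + Suc k"] by auto
      show "(\<lambda>c. c \<odot>\<^bsub>M\<^esub> y (n + k)) ` carrier R \<subseteq> K (n + Suc k)"
        using smD(4)[OF Ks _ y(1)[of "n + k"]] by auto
    qed
  qed
  have indep: "w \<in> W n k \<Longrightarrow> w \<in> K n \<Longrightarrow> w = \<zero>\<^bsub>M\<^esub>" for w n k
  proof (induction k arbitrary: w)
    case 0
    then show ?case by (simp add: W0)
  next
    case (Suc k)
    then obtain w' c where w: "w' \<in> W n k" "c \<in> carrier R" "w = w' \<oplus>\<^bsub>M\<^esub> c \<odot>\<^bsub>M\<^esub> y (n + k)"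
      unfolding WS addset_def by blast
    have w'M: "w' \<in> carrier M" using w(1) smD(7)[OF Wsm] by blast
    have "c \<odot>\<^bsub>M\<^esub> y (n + k) = \<zero>\<^bsub>M\<^esub>"
    proof (cases "c \<in> m")
      case True
      then show ?thesis using y(1)[of "n + k"] K unfolding colon_def by blast
    next
      case False
      obtain d where d: "d \<in> carrier R" "\<one> \<ominus> d \<otimes> c \<in> m" using maxprime_inverse[OF m w(2) False] by blast
      have "w \<in> K (n + k)" "w' \<in> K (n + k)" using Suc.prems(2) Kmono[of n "n + k"] WK w(1) by auto
      then have "(c \<odot>\<^bsub>M\<^esub> y (n + k) \<oplus>\<^bsub>M\<^esub> w') \<ominus>\<^bsub>M\<^esub> w' \<in> K (n + k)"
        using smD(6)[OF Ks] w w'M yM by (simp add: M.a_comm)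
      then have cy: "c \<odot>\<^bsub>M\<^esub> y (n + k) \<in> K (n + k)" using add_mdiff w'M w(2) yM by simp
      have "(\<one> \<ominus> d \<otimes> c) \<odot>\<^bsub>M\<^esub> y (n + k) = \<zero>\<^bsub>M\<^esub>" using d(2) y(1)[of "n + k"] K unfolding colon_def by blast
      then have "y (n + k) = d \<odot>\<^bsub>M\<^esub> (c \<odot>\<^bsub>M\<^esub> y (n + k))"
        using d(1) w(2) yM[of "n + k"] by (simp add: smult_l_diff mdiff_zero smult_assoc1)
      then have "y (n + k) \<in> K (n + k)" using smD(4)[OF Ks d(1) cy] by simp
      then have "y (n + k) = \<zero>\<^bsub>M\<^esub>" using y(2,3) by blast
      then show ?thesis using w(2) by simp
    qed
    then have "w = w'" using w(3) w'M by simp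
    then show ?case using Suc.IH[of w'] w(1) Suc.prems(2) by simp
  qed
  define Tl where "Tl n = (\<Union>k. W n k)" for n
  have dirs: "\<exists>k. u \<in> W n k \<and> v \<in> W n k" if uv: "u \<in> Tl n" "v \<in> Tl n" for u v n
  proof -
    obtain i j where "u \<in> W n i" "v \<in> W n j" using uv unfolding Tl_def by blast
    then show ?thesis using Wmono[of i "max i j"] Wmono[of j "max i j"] by (intro exI[of _ "max i j"]) auto
  qed
  have Xsm: "sm (Tl n)" for n unfolding submodule_iff
  proof (intro conjI ballI)
    show "Tl n \<subseteq> carrier M" using smD(1)[OF Wsm] unfolding Tl_def by blast
    show "\<zero>\<^bsub>M\<^esub> \<in> Tl n" using smD(2)[OF Wsm] unfolding Tl_def by blast
  next
    fix u v assume "u \<in> Tl n" "v \<in> Tl n"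
    then obtain k where "u \<in> W n k" "v \<in> W n k" using dirs by blast
    then show "u \<oplus>\<^bsub>M\<^esub> v \<in> Tl n" using smD(3)[OF Wsm] unfolding Tl_def by blast
  next
    fix r u assume "r \<in> carrier R" "u \<in> Tl n"
    then show "r \<odot>\<^bsub>M\<^esub> u \<in> Tl n" using smD(4)[OF Wsm] unfolding Tl_def by blast
  qed
  have "W (Suc n) k \<subseteq> W n (Suc k)" for n k
  proof (induction k)
    case 0
    then show ?case using smD(2)[OF Wsm] by (simp add: W0)
  next
    case (Suc k)
    have "addset M (W (Suc n) k) ((\<lambda>c. c \<odot>\<^bsub>M\<^esub> y (Suc n + k)) ` carrier R)
       \<subseteq> addset M (W n (Suc k)) ((\<lambda>c. c \<odot>\<^bsub>M\<^esub> y (Suc n + k)) ` carrier R)" by (rule addset_mono[OF Suc])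
    then show ?case unfolding WS[of "Suc n" k] WS[of n "Suc k"] by simp
  qed
  then have "Tl (Suc n) \<subseteq> Tl n" for n unfolding Tl_def by blast
  then obtain n1 where n1: "\<forall>k\<ge>n1. Tl k = Tl n1" using dcc[of Tl, OF Xsm] by blast
  obtain n where n: "n > n1" "K n \<noteq> K (Suc n)" using n0 by blast
  have eq: "Tl n = Tl (Suc n)" using n1[rule_format, of n] n1[rule_format, of "Suc n"] n(1) by simp
  have "y n \<in> (\<lambda>c. c \<odot>\<^bsub>M\<^esub> y n) ` carrier R"
    using imageI[OF one_closed, of "\<lambda>c. c \<odot>\<^bsub>M\<^esub> y n"] yM[of n] by simp
  from subsetD[OF sm_addset(3)[OF Wsm[of n 0] sm_cyclic[OF yM[of n]]] this]
  have "y n \<in> W n (Suc 0)" by (simp add: WS)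
  then have "y n \<in> Tl n" unfolding Tl_def by (rule UN_I[OF UNIV_I])
  then have "y n \<in> Tl (Suc n)" by (simp only: eq)
  then obtain k where "y n \<in> W (Suc n) k" unfolding Tl_def by (rule UN_E)
  then have "y n = \<zero>\<^bsub>M\<^esub>" using indep y(1) by blast
  then show False using y(3)[OF n(2)] smD(2)[OF Ks] by simp
qed

text \<open>Stands in for a filtration of R/I with prime cyclic factors. A maximal ideal without the
  property \<open>Q\<close> is neither the unit ideal nor prime, since all primes above it are
  maximal; so it contains some a b with a and b outside, and adding either one gives a larger ideal
  with \<open>Q\<close>.\<close>

lemma noetherian_ideal_induct:
  assumes I: "ideal I R" "\<And>q. primeideal q R \<Longrightarrow> I \<subseteq> q \<Longrightarrow> maxprime q"
    and one: "\<And>I. ideal I R \<Longrightarrow> \<one> \<in> I \<Longrightarrow> Q I" and mx: "\<And>I. maxprime I \<Longrightarrow> Q I"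
    and step: "\<And>I a b. ideal I R \<Longrightarrow> a \<in> carrier R \<Longrightarrow> b \<in> carrier R \<Longrightarrow> a \<otimes> b \<in> I \<Longrightarrow>
       Q (iadd I a) \<Longrightarrow> Q (iadd I b) \<Longrightarrow> Q I"
  shows "Q I"
proof (rule ccontr)
  assume "\<not> Q I"
  define \<B> where "\<B> = {I. ideal I R \<and> (\<forall>q. primeideal q R \<longrightarrow> I \<subseteq> q \<longrightarrow> maxprime q) \<and> \<not> Q I}"
  have "\<exists>P\<in>\<B>. \<forall>L\<in>\<B>. P \<subseteq> L \<longrightarrow> L = P"
    by (rule noetherian_maximal) (use \<open>\<not> Q I\<close> I in \<open>auto simp: \<B>_def\<close>)
  then obtain P where P0: "P \<in> \<B>" "\<And>L. L \<in> \<B> \<Longrightarrow> P \<subseteq> L \<Longrightarrow> L = P" by metis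
  have P: "ideal P R" "\<And>q. primeideal q R \<Longrightarrow> P \<subseteq> q \<Longrightarrow> maxprime q" "\<not> Q P" using P0(1) by (auto simp: \<B>_def)
  have bigger: "Q (iadd P a)" if a: "a \<in> carrier R" "a \<notin> P" for a
  proof (rule ccontr)
    assume "\<not> Q (iadd P a)"
    then have "iadd P a \<in> \<B>" using iadd(1,2)[OF P(1) a(1)] P(2) by (auto simp: \<B>_def)
    then have "iadd P a = P" using P0(2) iadd(2)[OF P(1) a(1)] by blast
    then show False using iadd(3)[OF P(1) a(1)] a(2) by simp
  qed
  have "\<not> primeideal P R" using P(2)[of P] P(3) mx by blast
  then obtain a b where "a \<in> carrier R" "b \<in> carrier R" "a \<otimes> b \<in> P" "a \<notin> P" "b \<notin> P"
    using P(1,3) one unfolding primeideal_iff by blast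
  then show False using step[OF P(1), of a b] bigger P(3) by blast
qed

text \<open>In the induction step, multiplication by a maps 0 : I into 0 : (I + (b)) with kernel 0 :
  (I + (a)). The ascending chain condition passes from the two outer terms to the middle
  one.\<close>

lemma acc_colon:
  assumes I: "ideal I R" "\<And>q. primeideal q R \<Longrightarrow> I \<subseteq> q \<Longrightarrow> maxprime q"
  shows "acc (colon M I)"
  using I
proof (rule noetherian_ideal_induct)
  fix I assume I: "ideal I R" "\<one> \<in> I"
  then have "colon M I \<subseteq> {\<zero>\<^bsub>M\<^esub>}" by (force simp: colon_def)
  then have "colon M I = {\<zero>\<^bsub>M\<^esub>}" using smD(2)[OF sm_colon[OF idealD(1)[OF I(1)]]] by blast
  then have "dvM (Suc 0) {\<zero>\<^bsub>M\<^esub>} (colon M I)" by simp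
  then show "acc (colon M I)" using acc_iff_dvM[OF sm_colon[OF idealD(1)[OF I(1)]]] by blast
next
  fix I a b assume I: "ideal I R" and ab: "a \<in> carrier R" "b \<in> carrier R" "a \<otimes> b \<in> I"
    and acc: "acc (colon M (iadd I a))" "acc (colon M (iadd I b))"
  show "acc (colon M I)" unfolding acc_def
  proof (intro allI impI)
    fix K assume K: "\<forall>n::nat. sm (K n) \<and> K n \<subseteq> colon M I \<and> K n \<subseteq> K (Suc n)"
    have Ks: "sm (K n)" for n using K by blast
    have ia: "sm (colon M (iadd I a))" by (rule sm_colon[OF idealD(1)[OF iadd(1)[OF I ab(1)]]])
    have kin: "y \<in> colon M (iadd I c)" if y: "y \<in> colon M I" "c \<odot>\<^bsub>M\<^esub> y = \<zero>\<^bsub>M\<^esub>" "c \<in> carrier R" for y c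
    proof -
      have "(x \<oplus> r \<otimes> c) \<odot>\<^bsub>M\<^esub> y = \<zero>\<^bsub>M\<^esub>" if "x \<in> I" "r \<in> carrier R" for x r
        using that y idealD(7)[OF I] by (auto simp: colon_def smult_l_distr smult_assoc1)
      then show ?thesis using y(1) unfolding colon_def iadd_def by blast
    qed
    have "\<exists>n0. \<forall>n>n0. K n \<inter> colon M (iadd I a) = K (Suc n) \<inter> colon M (iadd I a)"
      by (rule accD[OF acc(1) sm_Int[OF Ks ia]]) (use K in blast)+
    then obtain n1 where n1: "\<And>n. n > n1 \<Longrightarrow> K n \<inter> colon M (iadd I a) = K (Suc n) \<inter> colon M (iadd I a)" by blast
    have "\<exists>n0. \<forall>n>n0. mulset M a (K n) = mulset M a (K (Suc n))"
    proof -
      have "mulset M a (K n) \<subseteq> colon M (iadd I b)" for n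
      proof
        fix u assume "u \<in> mulset M a (K n)"
        then obtain y where y: "y \<in> K n" "u = a \<odot>\<^bsub>M\<^esub> y" by (auto simp: mulset_def)
        have yc: "y \<in> colon M I" using y(1) K by blast
        then have yM: "y \<in> carrier M" by (simp add: colon_def)
        have "u \<in> colon M I" unfolding y(2) by (rule smD(4)[OF sm_colon[OF idealD(1)[OF I]] ab(1) yc])
        moreover have "b \<odot>\<^bsub>M\<^esub> u = (a \<otimes> b) \<odot>\<^bsub>M\<^esub> y" using ab yM y(2) by (simp add: smult_assoc1 smult_comm[of b])
        then have "b \<odot>\<^bsub>M\<^esub> u = \<zero>\<^bsub>M\<^esub>" using yc ab(3) by (simp add: colon_def)
        ultimately show "u \<in> colon M (iadd I b)" using kin ab(2) by blast
      qed
      moreover have "mulset M a (K n) \<subseteq> mulset M a (K (Suc n))" for n by (rule mulset_mono) (use K in blast)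
      ultimately show ?thesis by (intro accD[OF acc(2) sm_mulset[OF Ks ab(1)]])
    qed
    then obtain n2 where n2: "\<And>n. n > n2 \<Longrightarrow> mulset M a (K n) = mulset M a (K (Suc n))" by blast
    have "K n = K (Suc n)" if n: "n > max n1 n2" for n
    proof -
      have "K (Suc n) \<subseteq> K n"
      proof
        fix y assume y: "y \<in> K (Suc n)"
        then have "a \<odot>\<^bsub>M\<^esub> y \<in> mulset M a (K n)" using n2[of n] n by (simp add: mulset_def)
        then obtain z where z: "z \<in> K n" "a \<odot>\<^bsub>M\<^esub> y = a \<odot>\<^bsub>M\<^esub> z" by (auto simp: mulset_def)
        have c: "y \<in> carrier M" "z \<in> carrier M" using y z(1) smD(7)[OF Ks] by blast+
        have d: "y \<ominus>\<^bsub>M\<^esub> z \<in> K (Suc n)" by (rule smD(6)[OF Ks y]) (use z(1) K in blast)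
        moreover have "a \<odot>\<^bsub>M\<^esub> (y \<ominus>\<^bsub>M\<^esub> z) = \<zero>\<^bsub>M\<^esub>" using c ab(1) z(2) by (simp add: smult_r_diff)
        ultimately have "y \<ominus>\<^bsub>M\<^esub> z \<in> K (Suc n) \<inter> colon M (iadd I a)" using kin[OF _ _ ab(1)] K by blast
        then have "y \<ominus>\<^bsub>M\<^esub> z \<in> K n" using n1[of n] n by auto
        then show "y \<in> K n" by (rule sm_diff_cancel[OF Ks _ z(1) c(1)])
      qed
      then show ?thesis using K by blast
    qed
    then show "\<exists>n0. \<forall>n>n0. K n = K (Suc n)" by blast
  qed
qed (assumption | rule acc_colon_maxprime)+

end

section \<open>The lattice of ideals and chains of primes\<close>

context artmod
begin

text \<open>The order is reverse inclusion, so \<open>carrier R\<close> is the lower end of the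
  interval and the chains tested are descending chains of ideals. The deviation of the interval from
  \<open>carrier R\<close> to I is the Krull dimension of R/I in the sense of Gabriel and
  Rentschler.\<close>

abbreviation "dvI \<equiv> devlt {I. ideal I R} (\<lambda>A B. B \<subseteq> A)"

lemma dvI_subinterval:
  "dvI k A B \<Longrightarrow> ideal A R \<Longrightarrow> ideal B R \<Longrightarrow> ideal C R \<Longrightarrow> ideal D R \<Longrightarrow> C \<subseteq> A \<Longrightarrow> D \<subseteq> C \<Longrightarrow> B \<subseteq> D \<Longrightarrow> dvI k C D"
  by (rule devlt_subinterval[where a = A and b = B]) auto

lemma ideal_carrier: "ideal (carrier R) R"
  by (auto simp: ideal_iff)

lemma iadd_mono: "K \<subseteq> K' \<Longrightarrow> iadd K a \<subseteq> iadd K' a"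
  by (auto simp: iadd_def)

definition dcI :: "'a set \<Rightarrow> bool" where
  "dcI I \<longleftrightarrow> (\<forall>K. (\<forall>n. ideal (K n) R \<and> I \<subseteq> K n \<and> K (Suc n) \<subseteq> K n) \<longrightarrow> (\<exists>n0::nat. \<forall>n>n0. K n = K (Suc n)))"

lemma dcID:
  assumes "dcI I" "\<And>n. ideal (K n) R" "\<And>n. I \<subseteq> K n" "\<And>n. K (Suc n) \<subseteq> K n"
  shows "\<exists>n0::nat. \<forall>n>n0. K n = K (Suc n)"
  using assms unfolding dcI_def by simp

lemma ideal_iquot: "ideal K R \<Longrightarrow> a \<in> carrier R \<Longrightarrow> ideal {r \<in> carrier R. r \<otimes> a \<in> K} R"
proof -
  assume K: "ideal K R" and a: "a \<in> carrier R"
  have "(r \<oplus> s) \<otimes> a \<in> K" if "r \<in> carrier R" "s \<in> carrier R" "r \<otimes> a \<in> K" "s \<otimes> a \<in> K" for r s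
    using idealD(3)[OF K that(3,4)] that(1,2) a by (simp add: R.l_distr)
  moreover have "(r \<otimes> s) \<otimes> a \<in> K" if "r \<in> carrier R" "s \<in> carrier R" "s \<otimes> a \<in> K" for r s
    using idealD(4)[OF K that(1,3)] that(1,2) a by (simp add: m_assoc)
  moreover have "\<zero> \<otimes> a \<in> K" using idealD(2)[OF K] a by simp
  ultimately show ?thesis unfolding ideal_iff by auto
qed

text \<open>In the induction step a descending chain K n above I is controlled by the chains K n +
  (a), which lie above I + (a), and K n : a, which lie above I + (b) because a b is in I. Once both
  are stationary, so is K n.\<close>

lemma dcI_maxprimes:
  assumes I: "ideal I R" "\<And>q. primeideal q R \<Longrightarrow> I \<subseteq> q \<Longrightarrow> maxprime q"
  shows "dcI I"
  using I
proof (rule noetherian_ideal_induct)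
  fix I assume I: "ideal I R" "\<one> \<in> I"
  have "K = carrier R" if "ideal K R" "I \<subseteq> K" for K
    using ideal.one_imp_carrier[OF that(1)] that(2) I(2) by blast
  then show "dcI I" unfolding dcI_def by metis
next
  fix I assume I: "maxprime I"
  show "dcI I" unfolding dcI_def
  proof (intro allI impI)
    fix K assume K: "\<forall>n::nat. ideal (K n) R \<and> I \<subseteq> K n \<and> K (Suc n) \<subseteq> K n"
    have dec: "K j \<subseteq> K i" if "i \<le> j" for i j using that K lift_Suc_antimono_le[of K] by blast
    have alt: "K n = carrier R \<or> K n = I" for n
      using K I ideal.one_imp_carrier[of "K n" R] unfolding maxprime_def by blast
    show "\<exists>n0. \<forall>n>n0. K n = K (Suc n)"
    proof (cases "\<exists>n0. K n0 = I")
      case True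
      then obtain n0 where n0: "K n0 = I" by blast
      have "K n = I" if "n \<ge> n0" for n using dec[OF that] n0 K by blast
      then show ?thesis by (intro exI[of _ n0]) simp
    next
      case False
      then show ?thesis using alt by metis
    qed
  qed
next
  fix I a b assume I: "ideal I R" and ab: "a \<in> carrier R" "b \<in> carrier R" "a \<otimes> b \<in> I"
    and d: "dcI (iadd I a)" "dcI (iadd I b)"
  show "dcI I" unfolding dcI_def
  proof (intro allI impI)
    fix K assume K: "\<forall>n::nat. ideal (K n) R \<and> I \<subseteq> K n \<and> K (Suc n) \<subseteq> K n"
    have Kid: "ideal (K n) R" and IK: "I \<subseteq> K n" and dec: "K (Suc n) \<subseteq> K n" for n using K by blast+
    obtain n1 where n1: "\<And>n. n > n1 \<Longrightarrow> iadd (K n) a = iadd (K (Suc n)) a"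
      using dcID[OF d(1), of "\<lambda>n. iadd (K n) a", OF iadd(1)[OF Kid ab(1)] iadd_mono[OF IK] iadd_mono[OF dec]] by blast
    have qi: "iadd I b \<subseteq> {r \<in> carrier R. r \<otimes> a \<in> K n}" for n
    proof (rule iadd_least[OF ideal_iquot[OF Kid ab(1)]])
      show "I \<subseteq> {r \<in> carrier R. r \<otimes> a \<in> K n}"
        using idealD(7)[OF I] idealD(8)[OF I ab(1)] IK[of n] by blast
      have "b \<otimes> a \<in> I" using ab(3) m_comm[OF ab(1,2)] by simp
      then show "b \<in> {r \<in> carrier R. r \<otimes> a \<in> K n}" using ab(2) IK[of n] by blast
    qed
    have qd: "{r \<in> carrier R. r \<otimes> a \<in> K (Suc n)} \<subseteq> {r \<in> carrier R. r \<otimes> a \<in> K n}" for n using dec[of n] by blast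
    obtain n2 where n2: "\<And>n. n > n2 \<Longrightarrow> {r \<in> carrier R. r \<otimes> a \<in> K n} = {r \<in> carrier R. r \<otimes> a \<in> K (Suc n)}"
      using dcID[OF d(2), of "\<lambda>n. {r \<in> carrier R. r \<otimes> a \<in> K n}", OF ideal_iquot[OF Kid ab(1)] qi qd] by blast
    have "K n = K (Suc n)" if n: "n > max n1 n2" for n
    proof -
      have "K n \<subseteq> K (Suc n)"
      proof
        fix y assume y: "y \<in> K n"
        then have "y \<in> iadd (K (Suc n)) a" using n1[of n] n iadd(2)[OF Kid[of n] ab(1)] by auto
        then obtain u r where u: "u \<in> K (Suc n)" "r \<in> carrier R" "y = u \<oplus> r \<otimes> a" unfolding iadd_def by blast
        have uR: "u \<in> carrier R" using u(1) idealD(7)[OF Kid] by blast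
        have "y \<ominus> u \<in> K n" by (rule idealD(6)[OF Kid y]) (use u(1) dec in blast)
        moreover have "y \<ominus> u = r \<otimes> a" using uR u(2) ab(1) unfolding u(3)
          by (simp add: R.minus_eq R.a_comm[of u] R.a_assoc R.r_neg)
        ultimately have "r \<in> {r \<in> carrier R. r \<otimes> a \<in> K n}" using u(2) by simp
        then have "r \<otimes> a \<in> K (Suc n)" using n2[of n] n by auto
        then show "y \<in> K (Suc n)" unfolding u(3) by (rule idealD(3)[OF Kid u(1)])
      qed
      then show ?thesis using dec by blast
    qed
    then show "\<exists>n0. \<forall>n>n0. K n = K (Suc n)" by blast
  qed
qed

lemma dvI_of_dcI: "dcI I \<Longrightarrow> dvI (Suc 0) (carrier R) I"
  unfolding dcI_def by simp

lemma acc_decseqs_ideal: "G \<in> decseqs {I. ideal I R} (\<lambda>A B. B \<subseteq> A) \<Longrightarrow> \<exists>n0. \<forall>n\<ge>n0. G n = G n0"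
proof -
  assume G: "G \<in> decseqs {I. ideal I R} (\<lambda>A B. B \<subseteq> A)"
  then have inc: "G i \<subseteq> G j" if "i \<le> j" for i j
    using that lift_Suc_mono_le[of G] by (auto simp: decseqs_def)
  have "\<exists>P\<in>range G. \<forall>L\<in>range G. P \<subseteq> L \<longrightarrow> L = P"
    by (rule noetherian_maximal) (use G in \<open>auto simp: decseqs_def\<close>)
  then obtain P where P: "P \<in> range G" "\<forall>L\<in>range G. P \<subseteq> L \<longrightarrow> L = P" by (rule bexE)
  obtain n0 where "P = G n0" using P(1) by (rule imageE)
  then have n0: "G n = G n0" if "G n0 \<subseteq> G n" for n using P(2) that by simp
  have "G n = G n0" if "n0 \<le> n" for n by (rule n0[OF inc[OF that]])
  then show ?thesis by blast
qed

text \<open>The condition on \<open>x\<close> says that \<open>x\<close> lies in the Jacobson radical modulo \<open>I\<close>; it makes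
  every ideal above \<open>I\<close> closed in the \<open>x\<close>-adic topology.\<close>
lemma dvI_iadd:
  assumes I: "ideal I R" and x: "x \<in> carrier R"
    and rad: "\<And>K y c. ideal K R \<Longrightarrow> I \<subseteq> K \<Longrightarrow> y \<in> carrier R \<Longrightarrow> c \<in> carrier R \<Longrightarrow> y \<otimes> (\<one> \<ominus> x \<otimes> c) \<in> K \<Longrightarrow> y \<in> K"
    and d: "dvI k (carrier R) (iadd I x)"
  shows "dvI (Suc k) (carrier R) I"
proof -
  have xn: "x [^] n \<in> carrier R" for n :: nat using x by simp
  \<comment> \<open>\<open>G K i\<close> is the ideal of leading coefficients of K at x^i. It
    contains I and x for each K above I, and it grows with i, which means descending in the reversed
    order.\<close>
  define G where "G K i = {r \<in> carrier R. r \<otimes> x [^] (i::nat) \<in> iadd K (x [^] Suc i)}" for K i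
  have Gid: "ideal (G K i) R" if "ideal K R" for K i
    unfolding G_def by (rule ideal_iquot[OF iadd(1)[OF that xn] xn])
  have mono: "G K i \<subseteq> G K' i" if "K \<subseteq> K'" for K K' i
    using iadd_mono[OF that] unfolding G_def by blast
  have inc: "G K i \<subseteq> G K (Suc i)" if K: "ideal K R" for K i
  proof
    fix r assume "r \<in> G K i"
    then obtain u s where h: "r \<in> carrier R" "u \<in> K" "s \<in> carrier R" "r \<otimes> x [^] i = u \<oplus> s \<otimes> x [^] Suc i"
      unfolding G_def iadd_def by blast
    have uR: "u \<in> carrier R" using h(2) idealD(7)[OF K] by blast
    have "r \<otimes> x [^] Suc i = (r \<otimes> x [^] i) \<otimes> x" using h(1) x by (simp add: m_assoc)
    also have "\<dots> = u \<otimes> x \<oplus> s \<otimes> x [^] Suc (Suc i)"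
      unfolding h(4) using uR h(3) x by (simp add: R.l_distr m_assoc)
    finally have "r \<otimes> x [^] Suc i \<in> iadd K (x [^] Suc (Suc i))"
      using idealD(8)[OF K x h(2)] h(3) unfolding iadd_def by blast
    then show "r \<in> G K (Suc i)" using h(1) by (simp add: G_def)
  qed
  have Gdec: "G K \<in> decseqs {I. ideal I R} (\<lambda>A B. B \<subseteq> A)" if "ideal K R" for K
    using Gid[OF that] inc[OF that] by (simp add: decseqs_def)
  have GI: "iadd I x \<subseteq> G K i" if K: "ideal K R" "I \<subseteq> K" for K i
  proof (rule iadd_least[OF Gid[OF K(1)]])
    show "I \<subseteq> G K i"
    proof
      fix r assume r: "r \<in> I"
      then have "r \<otimes> x [^] i \<in> K" using idealD(8)[OF I xn] K(2) by blast
      then show "r \<in> G K i" using iadd(2)[OF K(1) xn] idealD(7)[OF I r] unfolding G_def by blast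
    qed
    have "x \<otimes> x [^] i = x [^] Suc i" using x by (simp add: m_comm)
    then show "x \<in> G K i" using iadd(3)[OF K(1) xn, of "Suc i"] x unfolding G_def by simp
  qed
  have GR: "G K i \<subseteq> carrier R" for K i by (auto simp: G_def)
  have IR: "I \<subseteq> carrier R" by (rule idealD(1)[OF I])
  have int: "dvI k (G (carrier R) i) (G I i)" for i
    by (rule dvI_subinterval[OF d ideal_carrier iadd(1)[OF I x] Gid[OF ideal_carrier] Gid[OF I] GR mono[OF IR] GI[OF I order_refl]])
  have int': "dvI (Suc k) (G (carrier R) i) (G I i)" for i
    using int by (rule devlt_mono_nat) simp
  have "devlt (decseqs {I. ideal I R} (\<lambda>A B. B \<subseteq> A)) (\<lambda>G G'. \<forall>i. G' i \<subseteq> G i) (Suc k) (G (carrier R)) (G I)"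
  proof (rule devlt_decseqs)
    show "\<forall>i. dvI (Suc k) (G (carrier R) i) (G I i)" using int' by blast
    show "\<exists>i0. \<forall>i\<ge>i0. dvI k (G (carrier R) i) (G I i)" using int by blast
    show "\<forall>i. G I i \<subseteq> G (carrier R) i" using mono[OF IR] by blast
  qed (use acc_decseqs_ideal Gdec ideal_carrier I in auto)
  then show ?thesis
  proof (rule devlt_transport[where a = "carrier R" and b = I, rotated -1])
    fix K' K assume h: "K' \<in> {I. ideal I R}" "K \<in> {I. ideal I R}" "K' \<subseteq> carrier R" "K \<subseteq> K'" "I \<subseteq> K" "G K' = G K"
    then have K: "ideal K R" "ideal K' R" by simp_all
    have "y \<in> K" if y: "y \<in> K'" for y
    proof -
      have yR: "y \<in> carrier R" using y idealD(7)[OF K(2)] by blast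
      have "y \<in> iadd K (x [^] i)" for i :: nat
      proof (induction i)
        case 0
        have "y = \<zero> \<oplus> y \<otimes> x [^] (0::nat)" using yR by simp
        then show ?case using idealD(2)[OF K(1)] yR unfolding iadd_def by blast
      next
        case (Suc i)
        then obtain u r where u: "u \<in> K" "r \<in> carrier R" "y = u \<oplus> r \<otimes> x [^] i" unfolding iadd_def by blast
        have uR: "u \<in> carrier R" using u(1) idealD(7)[OF K(1)] by blast
        have "y \<ominus> u \<in> K'" by (rule idealD(6)[OF K(2) y]) (use u(1) h(4) in blast)
        moreover have "y \<ominus> u = r \<otimes> x [^] i" using uR u(2) xn unfolding u(3)
          by (simp add: R.minus_eq R.a_comm[of u] R.a_assoc R.r_neg)
        ultimately have rx: "r \<otimes> x [^] i \<in> K'" by simp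
        have "r \<in> G K' i" unfolding G_def
          by (intro CollectI conjI u(2) subsetD[OF iadd(2)[OF K(2) xn] rx])
        then have "r \<in> G K i" by (simp only: h(6))
        then have "r \<otimes> x [^] i \<in> iadd K (x [^] Suc i)" unfolding G_def by blast
        then show ?case unfolding u(3)
          using idealD(3)[OF iadd(1)[OF K(1) xn]] iadd(2)[OF K(1) xn] u(1) by blast
      qed
      then have "\<forall>i. \<exists>a. a \<in> carrier R \<and> (\<exists>u\<in>K. y = u \<oplus> a \<otimes> x [^] (i::nat))" unfolding iadd_def by blast
      then obtain a where a: "\<And>i. a i \<in> carrier R" "\<And>i. \<exists>u\<in>K. y = u \<oplus> a i \<otimes> x [^] (i::nat)" by metis
      \<comment> \<open>This takes the place of Krull's intersection theorem. Modulo K, y equals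
        \<open>a i\<close> x^i for every i. The ideals K + (a 0, ..., a (n - 1)) become stationary,
        so \<open>a n\<close> is a combination of earlier coefficients modulo K. Multiplied by x^n,
        each earlier term is a positive power of x times y, whence y is congruent to x c y.\<close>
      define L where "L n = rec_nat K (\<lambda>n B. iadd B (a n)) n" for n :: nat
      have L0: "L 0 = K" and LS: "L (Suc n) = iadd (L n) (a n)" for n by (simp_all add: L_def)
      have Lid: "ideal (L n) R" for n by (induction n) (simp_all add: L0 LS K iadd(1) a(1))
      have "L \<in> decseqs {I. ideal I R} (\<lambda>A B. B \<subseteq> A)"
        using Lid iadd(2)[OF Lid a(1)] by (simp add: decseqs_def LS)
      then obtain n where n: "\<forall>k\<ge>n. L k = L n" using acc_decseqs_ideal by blast
      have "L (Suc n) = L n" using n[rule_format, of "Suc n"] by (simp only: le_SucI le_refl)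
      then have an: "a n \<in> L n" using iadd(3)[OF Lid[of n] a(1)[of n]] by (simp add: LS)
      have key: "z \<in> L k \<Longrightarrow> k \<le> n \<Longrightarrow> \<exists>c\<in>carrier R. z \<otimes> x [^] n \<ominus> (x \<otimes> c) \<otimes> y \<in> K" for z k
      proof (induction k arbitrary: z)
        case 0
        then have "z \<otimes> x [^] n \<in> K" using idealD(8)[OF K(1) xn] by (simp add: L0)
        moreover have "z \<otimes> x [^] n \<in> carrier R" using calculation idealD(7)[OF K(1)] by blast
        ultimately have "z \<otimes> x [^] n \<ominus> (x \<otimes> \<zero>) \<otimes> y \<in> K" using x yR by (simp add: R.minus_eq)
        then show ?case by blast
      next
        case (Suc k)
        then obtain w r where w: "w \<in> L k" "r \<in> carrier R" "z = w \<oplus> r \<otimes> a k" unfolding LS iadd_def by blast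
        obtain c where c: "c \<in> carrier R" "w \<otimes> x [^] n \<ominus> (x \<otimes> c) \<otimes> y \<in> K" using Suc.IH[OF w(1)] Suc.prems(2) by auto
        obtain u where u: "u \<in> K" "y = u \<oplus> a k \<otimes> x [^] k" using a(2) by blast
        define j where "j = n - Suc k"
        have j: "n = k + Suc j" using Suc.prems(2) by (simp add: j_def)
        have cR: "w \<in> carrier R" "u \<in> carrier R" "a k \<in> carrier R"
          using w(1) idealD(7)[OF Lid] u(1) idealD(7)[OF K(1)] a(1) by blast+
        define e where "e = r \<otimes> x [^] j"
        have eR: "e \<in> carrier R" using w(2) x by (simp add: e_def)
        have ya: "a k \<otimes> x [^] k = y \<ominus> u" using cR x unfolding u(2)
          by (simp add: R.minus_eq R.a_comm[of u] R.a_assoc R.r_neg)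
        have "(r \<otimes> a k) \<otimes> x [^] n = (x \<otimes> e) \<otimes> (a k \<otimes> x [^] k)"
          using cR w(2) x unfolding e_def j by (simp add: nat_pow_mult[symmetric] m_ac)
        also have "\<dots> = (x \<otimes> e) \<otimes> y \<ominus> (x \<otimes> e) \<otimes> u"
          unfolding ya using yR cR x eR by (simp add: R.minus_eq R.r_distr R.r_minus)
        finally have ra: "(r \<otimes> a k) \<otimes> x [^] n = (x \<otimes> e) \<otimes> y \<ominus> (x \<otimes> e) \<otimes> u" .
        define W where "W = w \<otimes> x [^] n"
        have WR: "W \<in> carrier R" using cR x by (simp add: W_def)
        have "z \<otimes> x [^] n = W \<oplus> ((x \<otimes> e) \<otimes> y \<ominus> (x \<otimes> e) \<otimes> u)"
          using w cR xn unfolding w(3) W_def ra[symmetric] by (simp add: R.l_distr)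
        moreover have "(x \<otimes> (c \<oplus> e)) \<otimes> y = (x \<otimes> c) \<otimes> y \<oplus> (x \<otimes> e) \<otimes> y"
          using x c(1) eR yR by (simp add: R.r_distr R.l_distr)
        ultimately have "z \<otimes> x [^] n \<ominus> (x \<otimes> (c \<oplus> e)) \<otimes> y
           = (W \<oplus> ((x \<otimes> e) \<otimes> y \<ominus> (x \<otimes> e) \<otimes> u)) \<ominus> ((x \<otimes> c) \<otimes> y \<oplus> (x \<otimes> e) \<otimes> y)" by simp
        also have "\<dots> = (W \<ominus> (x \<otimes> c) \<otimes> y) \<ominus> (x \<otimes> e) \<otimes> u"
        proof -
          have "(W \<oplus> (p \<ominus> q)) \<ominus> (s \<oplus> p) = (W \<ominus> s) \<ominus> q"
            if "p \<in> carrier R" "q \<in> carrier R" "s \<in> carrier R" for p q s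
            using that WR by algebra
          then show ?thesis using x eR yR cR c(1) by simp
        qed
        also have "\<dots> \<in> K"
          unfolding W_def by (rule idealD(6)[OF K(1) c(2) idealD(4)[OF K(1) _ u(1)]]) (use x eR in simp)
        finally show ?case using c(1) eR by blast
      qed
      obtain c where c: "c \<in> carrier R" "a n \<otimes> x [^] n \<ominus> (x \<otimes> c) \<otimes> y \<in> K" using key[OF an order_refl] by blast
      obtain u where u: "u \<in> K" "y = u \<oplus> a n \<otimes> x [^] n" using a(2) by blast
      have uR: "u \<in> carrier R" "a n \<otimes> x [^] n \<in> carrier R" using u(1) idealD(7)[OF K(1)] a(1) xn by auto
      have "u \<oplus> (a n \<otimes> x [^] n \<ominus> (x \<otimes> c) \<otimes> y) \<in> K" by (rule idealD(3)[OF K(1) u(1) c(2)])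
      moreover have "u \<oplus> (a n \<otimes> x [^] n \<ominus> (x \<otimes> c) \<otimes> y) = y \<ominus> (x \<otimes> c) \<otimes> y"
      proof -
        have "u \<oplus> (v \<ominus> w) = (u \<oplus> v) \<ominus> w" if "v \<in> carrier R" "w \<in> carrier R" for v w
          using that uR(1) by (simp add: R.minus_eq R.a_assoc)
        from this[OF uR(2), of "(x \<otimes> c) \<otimes> y"] show ?thesis using u(2) x c(1) yR by simp
      qed
      moreover have "y \<ominus> (x \<otimes> c) \<otimes> y = y \<otimes> (\<one> \<ominus> x \<otimes> c)"
        using yR x c(1) by (simp add: R.minus_eq R.r_distr R.r_minus m_comm)
      ultimately have "y \<otimes> (\<one> \<ominus> x \<otimes> c) \<in> K" by simp
      then show ?thesis by (rule rad[OF K(1) h(5) yR c(1)])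
    qed
    then show "K' = K" using h(4) by blast
  qed (use mono Gdec IR I ideal_carrier in auto)
qed

text \<open>Choose x in p' outside p. Some step of the chain p + (x^k) has deviation below n.
  Sending T to p + T x^k embeds the ideals between p' and R into that step, strictly because p is
  prime and omits x. So the interval at p' has deviation below n, contrary to the induction
  hypothesis.\<close>

lemma primechain_not_dvI: "primechain R A n p q \<Longrightarrow> \<not> dvI n (carrier R) p"
proof (induction n arbitrary: p)
  case 0
  then have "primeideal p R" using primechain_ends by blast
  then have "p \<noteq> carrier R" using primeD(2) by blast
  then show ?case by simp
next
  case (Suc n)
  obtain p' where p': "primeideal p R" "A \<subseteq> p" "p \<subset> p'" "primechain R A n p' q"
    using Suc.prems by (rule primechain_SucE)
  have p'p: "primeideal p' R" using primechain_ends[OF p'(4)] by blast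
  have ids: "ideal p R" "ideal p' R" using primeD(1) p'(1) p'p by blast+
  have nd: "\<not> dvI n (carrier R) p'" by (rule Suc.IH[OF p'(4)])
  show ?case
  proof
    assume d: "dvI (Suc n) (carrier R) p"
    obtain x where x: "x \<in> p'" "x \<notin> p" using p'(3) by blast
    have xR: "x \<in> carrier R" using x(1) idealD(7)[OF ids(2)] by blast
    have xk: "x [^] k \<in> carrier R" for k :: nat using xR by simp
    have nd': "\<not> dvI n (carrier R) p"
    proof
      assume "dvI n (carrier R) p"
      then have "dvI n (carrier R) p'"
        by (rule dvI_subinterval[OF _ ideal_carrier ids(1) ideal_carrier ids(2)])
          (use p'(3) idealD(1)[OF ids(2)] in auto)
      then show False using nd by simp
    qed
    define f where "f k T = {u \<oplus> t \<otimes> x [^] (k::nat) | u t. u \<in> p \<and> t \<in> T}" for k T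
    have fR: "f k (carrier R) = iadd p (x [^] k)" for k by (simp add: f_def iadd_def)
    have fid: "ideal (f k T) R" if T: "ideal T R" for k T
    proof -
      have "(u \<oplus> t \<otimes> x [^] k) \<oplus> (v \<oplus> s \<otimes> x [^] k) \<in> f k T"
        if "u \<in> p" "t \<in> T" "v \<in> p" "s \<in> T" for u t v s
      proof -
        have "u \<in> carrier R" "v \<in> carrier R" "t \<in> carrier R" "s \<in> carrier R"
          using that idealD(7)[OF ids(1)] idealD(7)[OF T] by blast+
        then have "(u \<oplus> t \<otimes> x [^] k) \<oplus> (v \<oplus> s \<otimes> x [^] k) = (u \<oplus> v) \<oplus> (t \<oplus> s) \<otimes> x [^] k"
          using xk by (simp add: R.l_distr R.a_ac)
        then show ?thesis using idealD(3)[OF ids(1) that(1,3)] idealD(3)[OF T that(2,4)] unfolding f_def by blast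
      qed
      moreover have "r \<otimes> (u \<oplus> t \<otimes> x [^] k) \<in> f k T" if "r \<in> carrier R" "u \<in> p" "t \<in> T" for r u t
      proof -
        have "u \<in> carrier R" "t \<in> carrier R" using that idealD(7)[OF ids(1)] idealD(7)[OF T] by blast+
        then have "r \<otimes> (u \<oplus> t \<otimes> x [^] k) = r \<otimes> u \<oplus> (r \<otimes> t) \<otimes> x [^] k"
          using xk that(1) by (simp add: R.r_distr m_assoc)
        then show ?thesis using idealD(4)[OF ids(1) that(1,2)] idealD(4)[OF T that(1,3)] unfolding f_def by blast
      qed
      moreover have "\<zero> \<in> f k T"
      proof -
        have "\<zero> = \<zero> \<oplus> \<zero> \<otimes> x [^] k" using xk by simp
        then show ?thesis using idealD(2)[OF ids(1)] idealD(2)[OF T] unfolding f_def by blast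
      qed
      moreover have "f k T \<subseteq> carrier R"
        using idealD(7)[OF ids(1)] idealD(7)[OF T] xk unfolding f_def by auto
      ultimately show ?thesis unfolding ideal_iff by (auto simp: f_def)
    qed
    have mono: "f k T \<subseteq> f k T'" if "T \<subseteq> T'" for k T T' using that unfolding f_def by blast
    have step: "iadd p (x [^] Suc k) \<subseteq> f k p'" for k
    proof
      fix y assume "y \<in> iadd p (x [^] Suc k)"
      then obtain u r where u: "u \<in> p" "r \<in> carrier R" "y = u \<oplus> r \<otimes> x [^] Suc k" unfolding iadd_def by blast
      have "r \<otimes> x [^] Suc k = (r \<otimes> x) \<otimes> x [^] k" using u(2) xR by (simp add: m_ac)
      then show "y \<in> f k p'" using u idealD(4)[OF ids(2) u(2) x(1)] unfolding f_def by auto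
    qed
    have p'R: "p' \<subseteq> carrier R" by (rule idealD(1)[OF ids(2)])
    let ?K = "\<lambda>k. iadd p (x [^] (k::nat))"
    have "\<forall>k. ?K k \<in> {I. ideal I R} \<and> ?K k \<subseteq> carrier R \<and> p \<subseteq> ?K k \<and> ?K (Suc k) \<subseteq> ?K k"
      using iadd(1,2)[OF ids(1) xk] idealD(1)[OF iadd(1)[OF ids(1) xk]] step mono[OF p'R] fR by blast
    moreover have "\<forall>K. (\<forall>k. K k \<in> {I. ideal I R} \<and> K k \<subseteq> carrier R \<and> p \<subseteq> K k \<and> K (Suc k) \<subseteq> K k)
        \<longrightarrow> (\<exists>n0. \<forall>k>n0. dvI n (K k) (K (Suc k)))" using d nd' by simp
    ultimately have "\<exists>n0. \<forall>k>n0. dvI n (?K k) (?K (Suc k))" by (elim allE[of _ ?K]) (rule mp)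
    then obtain k where "dvI n (?K k) (?K (Suc k))" by blast
    then have df: "dvI n (f k (carrier R)) (f k p')"
      by (rule dvI_subinterval[OF _ iadd(1)[OF ids(1) xk] iadd(1)[OF ids(1) xk] fid[OF ideal_carrier] fid[OF ids(2)] _ mono[OF p'R] step])
        (simp add: fR)
    have "dvI n (carrier R) p'"
    proof (rule devlt_transport[where f = "f k" and a = "carrier R" and b = p' and P' = "{I. ideal I R}" and lq' = "\<lambda>A B. B \<subseteq> A"])
      fix T' T assume h: "T' \<in> {I. ideal I R}" "T \<in> {I. ideal I R}" "T' \<subseteq> carrier R" "T \<subseteq> T'" "p' \<subseteq> T" "f k T' = f k T"
      then have T: "ideal T R" "ideal T' R" by simp_all
      have "t \<in> T" if t: "t \<in> T'" for t
      proof -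
        have tR: "t \<in> carrier R" using t idealD(7)[OF T(2)] by blast
        have "\<zero> \<oplus> t \<otimes> x [^] k \<in> f k T'" using idealD(2)[OF ids(1)] t unfolding f_def by blast
        then obtain u s where u: "u \<in> p" "s \<in> T" "\<zero> \<oplus> t \<otimes> x [^] k = u \<oplus> s \<otimes> x [^] k"
          unfolding h(6) unfolding f_def by blast
        have c: "u \<in> carrier R" "s \<in> carrier R" using u idealD(7)[OF ids(1)] idealD(7)[OF T(1)] by blast+
        have "(t \<ominus> s) \<otimes> x [^] k = (\<zero> \<oplus> t \<otimes> x [^] k) \<ominus> s \<otimes> x [^] k"
          using tR c xk by (simp add: R.minus_eq R.l_distr R.l_minus)
        also have "\<dots> = u" unfolding u(3) using c xk by (simp add: R.minus_eq R.a_assoc R.r_neg)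
        finally have "(t \<ominus> s) \<otimes> x [^] k \<in> p" using u(1) by simp
        then have "t \<ominus> s \<in> p \<or> x [^] k \<in> p" using primeD(3)[OF p'(1) _ xk] tR c by blast
        moreover have "x [^] k \<notin> p" using prime_pow[OF p'(1) xR] x(2) by blast
        ultimately have "t \<ominus> s \<in> T" using p'(3) h(5) by blast
        then have "(t \<ominus> s) \<oplus> s \<in> T" by (rule idealD(3)[OF T(1) _ u(2)])
        then show ?thesis using tR c by (simp add: R.minus_eq R.a_assoc R.l_neg)
      qed
      then show "T' = T" using h(4) by blast
    qed (use df fid mono ids ideal_carrier p'R in auto)
    then show False using nd by simp
  qed
qed

end

section \<open>Suprema of natural numbers, and co-regular sequences from vanishing Tor\<close>

lemma enat_le_of_nat_le:
  fixes a b :: enat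
  assumes "\<And>n. enat n \<le> a \<Longrightarrow> enat n \<le> b" shows "a \<le> b"
proof (cases a)
  case (enat k)
  then show ?thesis using assms[of k] by simp
next
  case infinity
  then have "enat n \<le> b" for n using assms by simp
  then have "b = \<infinity>" by (metis enat_ord_simps(1) not_enat_eq not_less_eq_eq order_refl)
  then show ?thesis by simp
qed

lemma Sup_enat_attained:
  assumes "S \<noteq> {}" "Sup (enat ` S) = enat d" shows "d \<in> S"
proof (rule ccontr)
  assume n: "d \<notin> S"
  have le: "s \<le> d" if "s \<in> S" for s
  proof -
    have "enat s \<le> Sup (enat ` S)" using that by (intro Sup_upper) simp
    then show ?thesis using assms(2) by simp
  qed
  have lt: "s < d" if "s \<in> S" for s using le[OF that] that n by (metis le_neq_implies_less)
  obtain s0 where "s0 \<in> S" using assms(1) by blast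
  then have d: "d > 0" using lt by fastforce
  have "Sup (enat ` S) \<le> enat (d - 1)" using lt d by (intro Sup_least) fastforce
  then show False using assms(2) d by simp
qed

text \<open>The case \<open>n = 0\<close> stands apart because the supremum of the empty set is
  0.\<close>

lemma enat_le_Sup_iff: "enat n \<le> Sup (enat ` S) \<longleftrightarrow> n = 0 \<or> (\<exists>s\<in>S. n \<le> s)"
proof
  assume h: "enat n \<le> Sup (enat ` S)"
  show "n = 0 \<or> (\<exists>s\<in>S. n \<le> s)"
  proof (rule ccontr)
    assume "\<not> ?thesis"
    then have n: "n > 0" "\<And>s. s \<in> S \<Longrightarrow> s < n" by auto
    then have "Sup (enat ` S) \<le> enat (n - 1)" by (intro Sup_least) fastforce
    then show False using h n(1) by (metis Suc_pred' enat_ord_simps(1) order_trans Suc_n_not_le_n)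
  qed
next
  assume "n = 0 \<or> (\<exists>s\<in>S. n \<le> s)"
  then show "enat n \<le> Sup (enat ` S)"
  proof
    assume "n = 0"
    then show ?thesis by (simp add: zero_enat_def[symmetric])
  next
    assume "\<exists>s\<in>S. n \<le> s"
    then obtain s where s: "s \<in> S" "n \<le> s" by blast
    have "enat s \<le> Sup (enat ` S)" using s(1) by (intro Sup_upper) simp
    then show ?thesis using s(2) by (meson enat_ord_simps(1) order_trans)
  qed
qed

text \<open>Vanishing is required at all primes above I, since the attached prime obstructing
  surjectivity could be any of them. The ideal \<open>p0\<close> above I guarantees that 0 : xs
  stays nonzero. The statement is not tied to a single maximal ideal, so that it serves both for I =
  m and for I = J(M).\<close>

lemma tor_zero_coreg_exists:
  assumes "art_module R M" "ideal I R"
    "\<And>q. primeideal q R \<Longrightarrow> I \<subseteq> q \<Longrightarrow> tor_zero_below R M q n"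
    "I \<subseteq> p0" "ideal p0 R" "colon M p0 \<noteq> {\<zero>\<^bsub>M\<^esub>}"
  shows "\<exists>xs. length xs = n \<and> coreg_seq R M xs \<and> set xs \<subseteq> I"
  using assms
proof (induction n arbitrary: M)
  case 0
  interpret artmod R M using 0(1) by (simp add: artmod_def)
  have "colon M p0 \<subseteq> carrier M" by (auto simp: colon_def)
  moreover have "\<zero>\<^bsub>M\<^esub> \<in> colon M p0" by (rule smD(2)[OF sm_colon[OF idealD(1)[OF 0(5)]]])
  ultimately have "carrier M \<noteq> {\<zero>\<^bsub>M\<^esub>}" using 0(6) by blast
  then show ?case by (intro exI[of _ "[]"]) (simp add: coreg_seq_def)
next
  case (Suc n)
  interpret artmod R M using Suc.prems(1) by (simp add: artmod_def)
  have "\<exists>x\<in>I. mulset M x (carrier M) = carrier M"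
  proof (rule ccontr)
    assume "\<not> ?thesis"
    then obtain K where K: "sm K" "primeideal (quann K) R" "I \<subseteq> quann K"
      using surjective_or_attached[OF Suc.prems(2)] by blast
    show False by (rule tor_zero_not_quann[OF K(1,2) Suc.prems(3)[OF K(2,3)]])
  qed
  then obtain x where x: "x \<in> I" "mulset M x (carrier M) = carrier M" by blast
  have xR: "x \<in> carrier R" using x(1) idealD(7)[OF Suc.prems(2)] by blast
  have a: "art_module R (sub M (colon M {x}))" by (rule art_sub[OF sm_colon]) (use xR in simp)
  have t: "tor_zero_below R (sub M (colon M {x})) q n" if q: "primeideal q R" "I \<subseteq> q" for q
    using coloc.tor_zero_below_Suc[OF coloc_prime[OF q(1)] _ x(2)] Suc.prems(3)[OF q] x(1) q(2) by blast
  have "{x} \<union> p0 = p0" using x(1) Suc.prems(4) by blast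
  then have "colon (sub M (colon M {x})) p0 \<noteq> {\<zero>\<^bsub>sub M (colon M {x})\<^esub>}" using Suc.prems(6) by (simp add: colon_sub)
  from Suc.IH[OF a Suc.prems(2) t Suc.prems(4,5) this]
  obtain xs where xs: "length xs = n" "coreg_seq R (sub M (colon M {x})) xs" "set xs \<subseteq> I" by blast
  show ?case using xs x xR by (intro exI[of _ "x # xs"]) (simp add: coreg_seq_Cons)
qed

section \<open>Deviation, heights and co-dimension in terms of sequences and chains\<close>

context artmod
begin

lemma colon_insert: "colon M (insert x T) = {y \<in> colon M T. x \<odot>\<^bsub>M\<^esub> y = \<zero>\<^bsub>M\<^esub>}"
  by (auto simp: colon_def)

lemma coreg_seqD:
  assumes "coreg_seq R M xs"
  shows "set xs \<subseteq> carrier R" "colon M (set xs) \<noteq> {\<zero>\<^bsub>M\<^esub>}"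
    "\<And>i. i < length xs \<Longrightarrow> mulset M (xs ! i) (colon M (set (take i xs))) = colon M (set (take i xs))"
  using assms by (auto simp: coreg_seq_def mulset_def)

lemma dvM_coreg:
  assumes xs: "coreg_seq R M xs"
  shows "i \<le> length xs \<Longrightarrow> dvM (i + k) {\<zero>\<^bsub>M\<^esub>} (carrier M) \<Longrightarrow> dvM k {\<zero>\<^bsub>M\<^esub>} (colon M (set (take i xs)))"
proof (induction i arbitrary: k)
  case 0
  then show ?case by simp
next
  case (Suc i)
  have i: "i < length xs" using Suc.prems(1) by simp
  have sR: "set (take i xs) \<subseteq> carrier R" using coreg_seqD(1)[OF xs] set_take_subset[of i xs] by blast
  have "xs ! i \<in> carrier R" using coreg_seqD(1)[OF xs] i by auto
  moreover have "dvM (Suc k) {\<zero>\<^bsub>M\<^esub>} (colon M (set (take i xs)))" using Suc.IH[of "Suc k"] Suc.prems by simp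
  ultimately have "dvM k {\<zero>\<^bsub>M\<^esub>} {y \<in> colon M (set (take i xs)). xs ! i \<odot>\<^bsub>M\<^esub> y = \<zero>\<^bsub>M\<^esub>}"
    by (intro dvM_kernel[OF sm_colon[OF sR] _ coreg_seqD(3)[OF xs i]])
  then show ?case using i by (simp add: take_Suc_conv_app_nth colon_insert)
qed

lemma dvM_torsion_seq:
  assumes "\<And>x y. x \<in> set xs \<Longrightarrow> y \<in> carrier M \<Longrightarrow> \<exists>n::nat. x [^] n \<odot>\<^bsub>M\<^esub> y = \<zero>\<^bsub>M\<^esub>" "set xs \<subseteq> carrier R"
    "dvM k {\<zero>\<^bsub>M\<^esub>} (colon M (set xs))"
  shows "dvM (length xs + k) {\<zero>\<^bsub>M\<^esub>} (carrier M)"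
  using assms
proof (induction xs arbitrary: k rule: rev_induct)
  case Nil
  then show ?case by simp
next
  case (snoc x xs)
  have U: "sm (colon M (set xs))" by (rule sm_colon) (use snoc.prems(2) in simp)
  have "dvM (Suc k) {\<zero>\<^bsub>M\<^esub>} (colon M (set xs))"
  proof (rule dvM_torsion[OF U])
    show "x \<in> carrier R" using snoc.prems(2) by simp
    show "\<exists>n::nat. x [^] n \<odot>\<^bsub>M\<^esub> y = \<zero>\<^bsub>M\<^esub>" if "y \<in> colon M (set xs)" for y
      using snoc.prems(1)[of x y] smD(7)[OF U that] by simp
    show "dvM k {\<zero>\<^bsub>M\<^esub>} {y \<in> colon M (set xs). x \<odot>\<^bsub>M\<^esub> y = \<zero>\<^bsub>M\<^esub>}"
      using snoc.prems(3) by (simp add: colon_insert)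
  qed
  from snoc.IH[OF snoc.prems(1) _ this] snoc.prems(2)
  have "dvM (length xs + Suc k) {\<zero>\<^bsub>M\<^esub>} (carrier M)" by (simp del: devlt.simps)
  then show ?case by (simp del: devlt.simps)
qed

text \<open>Among the kernels in U of elements outside q, one that is maximal contains all others,
  because kernels of s and s0 lie in that of their product. An element of U outside this kernel is
  killed by nothing outside q. Its annihilator is thus q itself, and prime annihilators of elements
  are maximal.\<close>

lemma acc_annih_maxprime:
  assumes U: "sm U" and acc: "acc U" and q: "primeideal (annih R M U) R"
  shows "maxprime (annih R M U)"
proof -
  let ?q = "annih R M U"
  define f where "f s = {y \<in> U. s \<odot>\<^bsub>M\<^esub> y \<in> {\<zero>\<^bsub>M\<^esub>}}" for s
  have fs: "sm (f s)" if "s \<in> carrier R" for s unfolding f_def by (rule sm_preimage[OF sm_zero U that])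
  have "\<exists>s0\<in>carrier R - ?q. \<forall>s\<in>carrier R - ?q. f s0 \<subseteq> f s \<longrightarrow> f s = f s0"
  proof (rule ccontr)
    assume "\<not> ?thesis"
    then have "\<forall>s. \<exists>t. s \<in> carrier R - ?q \<longrightarrow> t \<in> carrier R - ?q \<and> f s \<subset> f t" by blast
    then obtain g where g: "\<And>s. s \<in> carrier R - ?q \<Longrightarrow> g s \<in> carrier R - ?q \<and> f s \<subset> f (g s)" by metis
    have one: "\<one> \<in> carrier R - ?q" using primeD(2)[OF q] by simp
    have st: "(g ^^ n) \<one> \<in> carrier R - ?q" for n by (induction n) (use g one in auto)
    have "f ((g ^^ n) \<one>) \<subset> f ((g ^^ Suc n) \<one>)" for n using g[OF st[of n]] by simp
    moreover from this have "\<exists>n0. \<forall>n>n0. f ((g ^^ n) \<one>) = f ((g ^^ Suc n) \<one>)"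
      by (intro accD[OF acc fs]) (use st in \<open>auto simp: f_def\<close>)
    ultimately show False by (metis lessI psubset_eq)
  qed
  then obtain s0 where s0: "s0 \<in> carrier R - ?q" "\<And>s. s \<in> carrier R - ?q \<Longrightarrow> f s0 \<subseteq> f s \<Longrightarrow> f s = f s0" by blast
  have top: "f s \<subseteq> f s0" if s: "s \<in> carrier R - ?q" for s
  proof -
    have ss: "s \<otimes> s0 \<in> carrier R - ?q" using primeD(3)[OF q, of s s0] s s0(1) by auto
    have cR: "s \<in> carrier R" "s0 \<in> carrier R" using s s0(1) by auto
    have "f s0 \<subseteq> f (s \<otimes> s0)" "f s \<subseteq> f (s \<otimes> s0)"
      using cR smD(7)[OF U] by (auto simp: f_def smult_assoc1 smult_comm[of s s0])
    then show ?thesis using s0(2)[OF ss] by blast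
  qed
  obtain y where y: "y \<in> U" "s0 \<odot>\<^bsub>M\<^esub> y \<noteq> \<zero>\<^bsub>M\<^esub>" using s0(1) by (auto simp: annih_def)
  have yM: "y \<in> carrier M" using y(1) smD(7)[OF U] by blast
  have "elann {\<zero>\<^bsub>M\<^esub>} y = ?q"
  proof
    show "?q \<subseteq> elann {\<zero>\<^bsub>M\<^esub>} y" using y(1) by (auto simp: annih_def)
    show "elann {\<zero>\<^bsub>M\<^esub>} y \<subseteq> ?q"
    proof
      fix s assume s: "s \<in> elann {\<zero>\<^bsub>M\<^esub>} y"
      show "s \<in> ?q"
      proof (rule ccontr)
        assume "s \<notin> ?q"
        then have "y \<in> f s0" using top[of s] s y(1) by (auto simp: f_def)
        then show False using y(2) by (simp add: f_def)
      qed
    qed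
  qed
  then show ?thesis using elt_annih_maximal[OF sm_zero yM] q unfolding maxprime_def by metis
qed

text \<open>Maximality comes from a minimal submodule U = 0 : xs, not from a bound on lengths. A
  further surjective x in p would leave U unchanged, hence kill it, so that U = x U = 0; but 0 : p
  is a nonzero submodule of U.\<close>

lemma maximal_coreg_seq:
  assumes p: "primeideal p R" "colon M p \<noteq> {\<zero>\<^bsub>M\<^esub>}"
  shows "\<exists>xs. coreg_seq R M xs \<and> set xs \<subseteq> p \<and> (\<forall>x\<in>p. mulset M x (colon M (set xs)) \<noteq> colon M (set xs))"
proof -
  have pR: "p \<subseteq> carrier R" by (rule primeD(4)[OF p(1)])
  have cp: "colon M T \<noteq> {\<zero>\<^bsub>M\<^esub>}" if "T \<subseteq> p" for T
  proof -
    have "colon M p \<subseteq> colon M T" using that by (auto simp: colon_def)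
    then show ?thesis using p(2) smD(2)[OF sm_colon[OF pR]] by blast
  qed
  define \<F> where "\<F> = {colon M (set xs) | xs. coreg_seq R M xs \<and> set xs \<subseteq> p}"
  have "\<exists>U\<in>\<F>. \<forall>V\<in>\<F>. V \<subseteq> U \<longrightarrow> V = U"
  proof (rule artinian_minimal)
    have "coreg_seq R M []" using cp[of "{}"] by (simp add: coreg_seq_def)
    then show "\<F> \<noteq> {}" unfolding \<F>_def by fastforce
    show "sm K" if "K \<in> \<F>" for K using that pR by (auto simp: \<F>_def intro!: sm_colon)
  qed
  then obtain U where U: "U \<in> \<F>" "\<And>V. V \<in> \<F> \<Longrightarrow> V \<subseteq> U \<Longrightarrow> V = U" by metis
  obtain xs where xs: "coreg_seq R M xs" "set xs \<subseteq> p" "U = colon M (set xs)" using U(1) by (auto simp: \<F>_def)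
  have "mulset M x U \<noteq> U" if x: "x \<in> p" for x
  proof
    assume s: "mulset M x U = U"
    have c: "coreg_seq R M (xs @ [x])"
      by (rule coreg_seq_snoc[OF xs(1)]) (use x pR s xs(2,3) cp in auto)
    have "colon M (set (xs @ [x])) \<in> \<F>" unfolding \<F>_def using c x xs(2) by fastforce
    then have "colon M (set (xs @ [x])) = U" by (rule U(2)) (auto simp: xs(3) colon_def)
    then have "x \<odot>\<^bsub>M\<^esub> y = \<zero>\<^bsub>M\<^esub>" if "y \<in> U" for y using that by (auto simp: colon_def)
    then have "mulset M x U \<subseteq> {\<zero>\<^bsub>M\<^esub>}" by (auto simp: mulset_def)
    then have "U = {\<zero>\<^bsub>M\<^esub>}" using s smD(2)[OF sm_colon[of "set xs"]] xs pR by blast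
    then show False using cp[OF xs(2)] xs(3) by simp
  qed
  then show ?thesis using xs by blast
qed

text \<open>Vanishing in all degrees would, after the shift along a maximal co-regular sequence in
  m, still leave degree 0 vanishing on 0 : xs and so provide one more surjective element.\<close>

lemma tor_zero_finite:
  assumes m: "maxprime m" "colon M m \<noteq> {\<zero>\<^bsub>M\<^esub>}" shows "\<exists>n. \<not> tor_zero_below R M m n"
proof (rule ccontr)
  assume "\<not> ?thesis"
  then have t: "tor_zero_below R M m n" for n by blast
  have mp: "primeideal m R" using m(1) by (simp add: maxprime_def)
  obtain xs where xs: "coreg_seq R M xs" "set xs \<subseteq> m"
    "\<forall>x\<in>m. mulset M x (colon M (set xs)) \<noteq> colon M (set xs)" using maximal_coreg_seq[OF mp m(2)] by blast
  interpret N: artmod R "sub M (colon M (set xs))" by (rule artmod_colon) (rule coreg_seqD(1)[OF xs(1)])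
  have "tor_zero_below R (sub M (colon M (set xs))) m (Suc 0)"
    using tor_zero_below_coreg_seq[OF art xs(1,2) mp] t by blast
  then have "\<exists>x\<in>m. mulset (sub M (colon M (set xs))) x (carrier (sub M (colon M (set xs)))) = carrier (sub M (colon M (set xs)))"
    by (rule N.tor_zero_surjective[OF m(1)])
  then show False using xs(3) by simp
qed

lemma Cos_iff: "p \<in> Cos R M \<longleftrightarrow> primeideal p R \<and> annih R M (carrier M) \<subseteq> p"
  using coloc.mem_Cos[OF coloc_prime] by (auto simp: Cos_def Vset_def)

lemma ht_M_eq: "ht_M R M p = Sup (enat ` {n. \<exists>q. primechain R (annih R M (carrier M)) n q p})"
proof -
  have "{enat n | n. \<exists>c :: nat \<Rightarrow> 'a set. c n = p \<and> (\<forall>i\<le>n. c i \<in> Cos R M) \<and> (\<forall>i<n. c i \<subset> c (Suc i))}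
     = enat ` {n. \<exists>q. primechain R (annih R M (carrier M)) n q p}"
    by (auto simp: primechain_def Cos_iff image_iff)
  then show ?thesis by (simp add: ht_M_def)
qed

lemma codim_ge:
  assumes "primechain R (annih R M (carrier M)) n q p" shows "enat n \<le> codim R M"
proof -
  obtain c where c: "c 0 = q" "c n = p" "\<forall>i\<le>n. primeideal (c i) R \<and> annih R M (carrier M) \<subseteq> c i" "\<forall>i<n. c i \<subset> c (Suc i)"
    using assms unfolding primechain_def by blast
  have "enat n \<le> dim_quot R q" unfolding dim_quot_def
    by (rule Sup_upper) (use c in blast)
  also have "\<dots> \<le> codim R M" unfolding codim_def
    by (rule Sup_upper) (use c(1) c(3)[rule_format, of 0] in \<open>auto simp: Cos_iff\<close>)
  finally show ?thesis .
qed

lemma codim_le: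
  assumes "\<And>n q p. primechain R (annih R M (carrier M)) n q p \<Longrightarrow> n \<le> d" shows "codim R M \<le> enat d"
  unfolding codim_def
proof (rule Sup_least)
  fix e assume "e \<in> dim_quot R ` Cos R M"
  then obtain q where q: "primeideal q R" "annih R M (carrier M) \<subseteq> q" "e = dim_quot R q" by (auto simp: Cos_iff)
  show "e \<le> enat d" unfolding q(3) dim_quot_def
  proof (rule Sup_least)
    fix f assume "f \<in> {enat n | n. \<exists>c :: nat \<Rightarrow> 'a set. c 0 = q \<and> (\<forall>i\<le>n. primeideal (c i) R) \<and> (\<forall>i<n. c i \<subset> c (Suc i))}"
    then obtain n and c :: "nat \<Rightarrow> 'a set" where c: "f = enat n" "c 0 = q" "\<forall>i\<le>n. primeideal (c i) R" "\<forall>i<n. c i \<subset> c (Suc i)" by blast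
    \<comment> \<open>The chains in \<open>dim_quot\<close> consist of arbitrary primes, but all of
      them contain the starting prime q and therefore Ann M.\<close>
    have up: "i \<le> n \<Longrightarrow> annih R M (carrier M) \<subseteq> c i" for i
    proof (induction i)
      case 0
      then show ?case using q c by simp
    next
      case (Suc i)
      then show ?case using c(4)[rule_format, of i] by auto
    qed
    have "primechain R (annih R M (carrier M)) n q (c n)" unfolding primechain_def
      by (intro exI[of _ c]) (use c up in blast)
    then show "f \<le> enat d" using assms c(1) by simp
  qed
qed

end

section \<open>The equivalences\<close>

locale closed_artmod = artmod +
  assumes nonzero: "carrier M \<noteq> {\<zero>\<^bsub>M\<^esub>}" and closed: "annih_closed R M"
begin

abbreviation "Ann \<equiv> annih R M (carrier M)"
abbreviation "J \<equiv> JM R M"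

lemma ideal_Ann: "ideal Ann R"
  by (rule ideal_annih) simp

lemma SuppD:
  assumes "m \<in> Supp R M"
  shows "primeideal m R" "maxprime m" "Ann \<subseteq> m" "J \<subseteq> m" "colon M m \<noteq> {\<zero>\<^bsub>M\<^esub>}"
proof -
  have m: "primeideal m R" "atsupp {\<zero>\<^bsub>M\<^esub>} m" using assms mem_Supp by blast+
  show "primeideal m R" by fact
  show "maxprime m" by (rule atsupp_maxprime[OF sm_zero m])
  show A: "Ann \<subseteq> m" using quann_sub_atsupp[OF m(2)] by (auto simp: annih_def)
  show "J \<subseteq> m" using assms by (auto simp: JM_def)
  show "colon M m \<noteq> {\<zero>\<^bsub>M\<^esub>}" by (rule annih_colon_sub(2)[OF closed m(1) A order_refl])
qed

text \<open>The annihilator condition yields a nonzero element killed by q, and any prime over its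
  annihilator is in the support. In particular the maximal ideals above Ann M all belong to Supp
  M.\<close>

lemma below_Supp:
  assumes q: "primeideal q R" "Ann \<subseteq> q" shows "\<exists>m\<in>Supp R M. q \<subseteq> m"
proof -
  have "colon M q \<noteq> {\<zero>\<^bsub>M\<^esub>}" by (rule annih_colon_sub(2)[OF closed q order_refl])
  moreover have "\<zero>\<^bsub>M\<^esub> \<in> colon M q" by (rule smD(2)[OF sm_colon[OF primeD(4)[OF q(1)]]])
  ultimately obtain z where z: "z \<in> colon M q" "z \<noteq> \<zero>\<^bsub>M\<^esub>" by blast
  have zM: "z \<in> carrier M" using z(1) by (simp add: colon_def)
  obtain m where m: "primeideal m R" "atsupp {\<zero>\<^bsub>M\<^esub>} m" "elann {\<zero>\<^bsub>M\<^esub>} z \<subseteq> m"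
    using proper_atsupp[OF sm_zero zM] z(2) by blast
  have "q \<subseteq> elann {\<zero>\<^bsub>M\<^esub>} z" using z(1) primeD(4)[OF q(1)] by (auto simp: colon_def)
  then show ?thesis using m mem_Supp by blast
qed

lemma Supp_nonempty: "Supp R M \<noteq> {}"
proof -
  have "\<one> \<notin> Ann"
  proof
    assume "\<one> \<in> Ann"
    then have "carrier M \<subseteq> {\<zero>\<^bsub>M\<^esub>}" by (auto simp: annih_def)
    then show False using nonzero smD(2)[OF sm_carrier] by blast
  qed
  then obtain q where "primeideal q R" "Ann \<subseteq> q" using prime_above[OF ideal_Ann] by blast
  then show ?thesis using below_Supp by blast
qed

lemma ideal_J: "ideal J R"
proof -
  have id: "ideal m R" if "m \<in> Supp R M" for m using primeD(1)[OF SuppD(1)[OF that]] .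
  show ?thesis unfolding ideal_iff JM_def
    using idealD(2,3,4)[OF id] by auto
qed

text \<open>Here the finiteness of Supp M matters: if no support prime were inside q, a product of
  elements taken from each of them would lie in J(M) but not in q.\<close>

lemma J_in_prime:
  assumes q: "primeideal q R" "J \<subseteq> q" shows "q \<in> Supp R M"
proof -
  have "\<exists>m\<in>Supp R M. m \<subseteq> q"
  proof (rule ccontr)
    assume n: "\<not> ?thesis"
    have "\<exists>w\<in>carrier R. w \<notin> q \<and> (\<forall>m\<in>Supp R M. w \<in> m)"
    proof (rule prime_product[OF finite_Supp ideal_carrier q(1)])
      show "\<not> carrier R \<subseteq> q" using primeD(2)[OF q(1)] by auto
      show "ideal m R \<and> \<not> m \<subseteq> q" if "m \<in> Supp R M" for m using n that primeD(1)[OF SuppD(1)[OF that]] by blast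
    qed
    then show False using q(2) by (auto simp: JM_def)
  qed
  then obtain m where m: "m \<in> Supp R M" "m \<subseteq> q" by blast
  then show ?thesis using maxprime_eq[OF SuppD(2)[OF m(1)] q(1) m(2)] by simp
qed

text \<open>J(M) lies in the Jacobson radical modulo Ann M. If y were outside K, the proper ideal K
  : y would be contained in a support prime, which would then contain both 1 - x c and x c.\<close>

lemma J_radical:
  assumes K: "ideal K R" "Ann \<subseteq> K" and y: "y \<in> carrier R" and x: "x \<in> J" and c: "c \<in> carrier R"
    and h: "y \<otimes> (\<one> \<ominus> x \<otimes> c) \<in> K"
  shows "y \<in> K"
proof (rule ccontr)
  assume n: "y \<notin> K"
  have xR: "x \<in> carrier R" using x idealD(7)[OF ideal_J] by blast
  let ?L = "{r \<in> carrier R. r \<otimes> y \<in> K}"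
  have "ideal ?L R" by (rule ideal_iquot[OF K(1) y])
  moreover have "\<one> \<notin> ?L" using n y by simp
  ultimately obtain q where q: "primeideal q R" "?L \<subseteq> q" using prime_above by blast
  have "K \<subseteq> ?L" using idealD(7)[OF K(1)] idealD(8)[OF K(1) y] by blast
  then have "Ann \<subseteq> q" using K(2) q(2) by blast
  then obtain m where m: "m \<in> Supp R M" "q \<subseteq> m" using below_Supp[OF q(1)] by blast
  note mi = idealD[OF primeD(1)[OF SuppD(1)[OF m(1)]]]
  have "\<one> \<ominus> x \<otimes> c \<in> ?L" using h y xR c by (simp add: m_comm)
  then have "\<one> \<ominus> x \<otimes> c \<in> m" using q(2) m(2) by blast
  moreover have "x \<otimes> c \<in> m" using mi(8)[OF c] x SuppD(4)[OF m(1)] by blast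
  ultimately have "(\<one> \<ominus> x \<otimes> c) \<oplus> x \<otimes> c \<in> m" by (rule mi(3))
  moreover have "(\<one> \<ominus> x \<otimes> c) \<oplus> x \<otimes> c = \<one>" using xR c by (simp add: R.minus_eq R.a_assoc R.l_neg)
  ultimately show False using primeD(2)[OF SuppD(1)[OF m(1)]] by simp
qed

text \<open>The chain x^n R y becomes stationary, so z = x^n y satisfies z = x c z for some c. If z
  were nonzero, a support prime above its annihilator would contain 1 - x c as well as x.\<close>

lemma J_torsion:
  assumes x: "x \<in> J" and y: "y \<in> carrier M" shows "\<exists>n::nat. x [^] n \<odot>\<^bsub>M\<^esub> y = \<zero>\<^bsub>M\<^esub>"
proof -
  have xR: "x \<in> carrier R" using x idealD(7)[OF ideal_J] by blast
  have xn: "x [^] n \<in> carrier R" for n :: nat using xR by simp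
  let ?C = "(\<lambda>c. c \<odot>\<^bsub>M\<^esub> y) ` carrier R"
  have C: "sm ?C" by (rule sm_cyclic[OF y])
  have Sm: "mulset M (x [^] Suc n) ?C = mulset M x (mulset M (x [^] n) ?C)" for n :: nat
    using xR smD(1)[OF C] by (simp add: mulset_mulset m_comm)
  have dec: "mulset M (x [^] Suc n) ?C \<subseteq> mulset M (x [^] n) ?C" for n :: nat
    unfolding Sm by (rule mulset_sub[OF sm_mulset[OF C xn] xR])
  obtain n :: nat where n: "\<forall>k\<ge>n. mulset M (x [^] k) ?C = mulset M (x [^] n) ?C"
    using dcc[of "\<lambda>n. mulset M (x [^] n) ?C", OF sm_mulset[OF C xn] dec] by blast
  have eq: "mulset M (x [^] Suc n) ?C = mulset M (x [^] n) ?C"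
    using n[rule_format, of "Suc n"] by (simp only: le_SucI le_refl)
  have "y \<in> ?C" using imageI[OF one_closed, of "\<lambda>c. c \<odot>\<^bsub>M\<^esub> y"] y by simp
  then have "x [^] n \<odot>\<^bsub>M\<^esub> y \<in> mulset M (x [^] Suc n) ?C" unfolding eq unfolding mulset_def by (rule imageI)
  then obtain c where c: "c \<in> carrier R" "x [^] n \<odot>\<^bsub>M\<^esub> y = x [^] Suc n \<odot>\<^bsub>M\<^esub> (c \<odot>\<^bsub>M\<^esub> y)"
    unfolding mulset_def by blast
  define z where "z = x [^] n \<odot>\<^bsub>M\<^esub> y"
  have zM: "z \<in> carrier M" using y xn by (simp add: z_def)
  have "(x \<otimes> c) \<odot>\<^bsub>M\<^esub> z = x [^] Suc n \<odot>\<^bsub>M\<^esub> (c \<odot>\<^bsub>M\<^esub> y)"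
    using c(1) y xR unfolding z_def by (simp add: smult_assoc1[symmetric] m_ac)
  then have "z = (x \<otimes> c) \<odot>\<^bsub>M\<^esub> z" using c(2) by (simp only: z_def)
  then have kz: "(\<one> \<ominus> x \<otimes> c) \<odot>\<^bsub>M\<^esub> z = \<zero>\<^bsub>M\<^esub>" using zM c(1) xR by (simp add: smult_l_diff)
  have "z = \<zero>\<^bsub>M\<^esub>"
  proof (rule ccontr)
    assume "z \<noteq> \<zero>\<^bsub>M\<^esub>"
    then obtain m where m: "primeideal m R" "atsupp {\<zero>\<^bsub>M\<^esub>} m" "elann {\<zero>\<^bsub>M\<^esub>} z \<subseteq> m"
      using proper_atsupp[OF sm_zero zM] by blast
    then have ms: "m \<in> Supp R M" using mem_Supp by blast
    note mi = idealD[OF primeD(1)[OF m(1)]]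
    have "\<one> \<ominus> x \<otimes> c \<in> m" using kz m(3) xR c(1) by auto
    moreover have "x \<otimes> c \<in> m" using mi(8)[OF c(1)] x SuppD(4)[OF ms] by blast
    ultimately have "(\<one> \<ominus> x \<otimes> c) \<oplus> x \<otimes> c \<in> m" by (rule mi(3))
    moreover have "(\<one> \<ominus> x \<otimes> c) \<oplus> x \<otimes> c = \<one>" using xR c(1) by (simp add: R.minus_eq R.a_assoc R.l_neg)
    ultimately show False using primeD(2)[OF m(1)] by simp
  qed
  then show ?thesis unfolding z_def by blast
qed

lemma cograde_eq: "cograde R I M = Sup (enat ` {n. \<exists>xs. length xs = n \<and> coreg_seq R M xs \<and> set xs \<subseteq> I})"
proof -
  have "{enat (length xs) | xs. coreg_seq R M xs \<and> set xs \<subseteq> I}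
    = enat ` {n. \<exists>xs. length xs = n \<and> coreg_seq R M xs \<and> set xs \<subseteq> I}" by blast
  then show ?thesis by (simp add: cograde_def)
qed

lemma coreg_Nil: "coreg_seq R M []"
  using nonzero by (simp add: coreg_seq_def)

lemma cograde_mono: "I \<subseteq> I' \<Longrightarrow> cograde R I M \<le> cograde R I' M"
  unfolding cograde_def by (rule Sup_subset_mono) blast

text \<open>The chain starts as the single prime p, which lies above Ann(0 : xs) by the annihilator
  condition, and is prolonged downwards once per element. This is the source of Cograde <=
  height.\<close>

lemma coreg_chain:
  assumes xs: "coreg_seq R M xs" and p: "primeideal p R" "Ann \<subseteq> p" "set xs \<subseteq> p"
  shows "\<exists>q. primechain R Ann (length xs) q p"
  using coreg_seq_primechain[OF art xs primechain_0[OF p(1) annih_colon_sub(1)[OF closed p]]] by simp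

lemma cograde_le_ht:
  assumes p: "primeideal p R" "Ann \<subseteq> p" shows "cograde R p M \<le> ht_M R M p"
  unfolding cograde_eq ht_M_eq using coreg_chain[OF _ p] by (intro Sup_subset_mono image_mono) blast

lemma ht_le_codim: "ht_M R M p \<le> codim R M"
  unfolding ht_M_eq by (rule Sup_least) (use codim_ge in blast)

text \<open>The converse \<open>cograde_tor_zero\<close> holds at every prime. This direction relies
  on \<open>m\<close> being a maximal ideal, since then \<open>m\<close> is the only prime above it
  at which Tor has to vanish.\<close>

lemma tor_zero_le_cograde:
  assumes m: "m \<in> Supp R M" and t: "tor_zero_below R M m n" shows "enat n \<le> cograde R m M"
proof -
  have "\<exists>xs. length xs = n \<and> coreg_seq R M xs \<and> set xs \<subseteq> m"
  proof (rule tor_zero_coreg_exists[OF art primeD(1)[OF SuppD(1)[OF m]] _ order_refl primeD(1)[OF SuppD(1)[OF m]] SuppD(5)[OF m]])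
    show "tor_zero_below R M q n" if "primeideal q R" "m \<subseteq> q" for q
      using maxprime_eq[OF SuppD(2)[OF m] that] t by simp
  qed
  then show ?thesis unfolding cograde_eq enat_le_Sup_iff by blast
qed

lemma cograde_tor_zero:
  assumes p: "primeideal p R" and n: "enat n \<le> cograde R p M" shows "tor_zero_below R M p n"
proof (cases "n = 0")
  case True
  then show ?thesis by (simp add: tor_zero_below_def)
next
  case False
  then obtain xs where xs: "n \<le> length xs" "coreg_seq R M xs" "set xs \<subseteq> p"
    using n unfolding cograde_eq enat_le_Sup_iff by blast
  have "tor_zero_below R M p (0 + length xs)"
    unfolding tor_zero_below_coreg_seq[OF art xs(2,3) p] by (simp add: tor_zero_below_def)
  then show ?thesis using xs(1) by (simp add: tor_zero_below_def)
qed

lemma tor_zero_below_iff: "(\<forall>i. enat i < ht_M R M p \<longrightarrow> dual_bass_zero R M p i)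
    \<longleftrightarrow> (\<forall>n. enat n \<le> ht_M R M p \<longrightarrow> tor_zero_below R M p n)"
proof
  assume h: "\<forall>i. enat i < ht_M R M p \<longrightarrow> dual_bass_zero R M p i"
  show "\<forall>n. enat n \<le> ht_M R M p \<longrightarrow> tor_zero_below R M p n" unfolding tor_zero_below_def
    using h by (meson enat_ord_simps(2) less_le_trans)
next
  assume h: "\<forall>n. enat n \<le> ht_M R M p \<longrightarrow> tor_zero_below R M p n"
  show "\<forall>i. enat i < ht_M R M p \<longrightarrow> dual_bass_zero R M p i"
  proof (intro allI impI)
    fix i assume "enat i < ht_M R M p"
    then have "enat (Suc i) \<le> ht_M R M p" by (metis Suc_ile_eq)
    then show "dual_bass_zero R M p i" using h unfolding tor_zero_below_def by blast
  qed
qed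

lemma colon_annih_colon: 
  assumes "T \<subseteq> carrier R" shows "colon M (annih R M (colon M T)) = colon M T"
  using assms by (auto simp: colon_def annih_def)

section \<open>The cycle (2), (3), (5), (4), (2) and the equivalence of (4) with (1)\<close>

definition "cond2 \<longleftrightarrow> (\<forall>p \<in> Cos R M. cograde_loc R M p = ht_M R M p) \<and> (\<forall>m \<in> Supp R M. ht_M R M m = codim R M)"
definition "cond3 \<longleftrightarrow> (\<forall>p \<in> Cos R M. \<forall>i. enat i < ht_M R M p \<longrightarrow> dual_bass_zero R M p i) \<and>
            (\<forall>m \<in> Supp R M. ht_M R M m = codim R M)"
definition "cond4 \<longleftrightarrow> (\<forall>m \<in> Supp R M. cograde R m M = ht_M R M m \<and> ht_M R M m = codim R M)"
definition "cond5 \<longleftrightarrow> (\<forall>m \<in> Supp R M. (\<forall>i. enat i < ht_M R M m \<longrightarrow> dual_bass_zero R M m i) \<and> ht_M R M m = codim R M)"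

lemma cond2_imp_3: assumes cond2 shows cond3
proof -
  have "dual_bass_zero R M p i" if "enat i < cograde_loc R M p" for p i
    using that not_less_Least[of i "\<lambda>i. \<not> dual_bass_zero R M p i"] unfolding cograde_loc_def by (auto split: if_splits)
  then show ?thesis using assms unfolding cond2_def cond3_def by auto
qed

lemma cond3_imp_5: assumes cond3 shows cond5
proof -
  have "m \<in> Cos R M" if "m \<in> Supp R M" for m using SuppD(1,3)[OF that] by (simp add: Cos_iff)
  then show ?thesis using assms unfolding cond3_def cond5_def by blast
qed

lemma cond5_imp_4: assumes cond5 shows cond4
  unfolding cond4_def
proof
  fix m assume m: "m \<in> Supp R M"
  have h: "\<forall>i. enat i < ht_M R M m \<longrightarrow> dual_bass_zero R M m i" "ht_M R M m = codim R M"
    using assms m unfolding cond5_def by blast+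
  have "ht_M R M m \<le> cograde R m M"
  proof (rule enat_le_of_nat_le)
    fix n assume "enat n \<le> ht_M R M m"
    then show "enat n \<le> cograde R m M"
      using tor_zero_le_cograde[OF m] h(1)[unfolded tor_zero_below_iff] by simp
  qed
  then show "cograde R m M = ht_M R M m \<and> ht_M R M m = codim R M"
    using cograde_le_ht[OF SuppD(1,3)[OF m]] h(2) by simp
qed

text \<open>Co-dim M is only an extended natural number at first. Under (4) it equals Cograde(m, M),
  and an infinite value would force Tor to vanish in all degrees at m, contrary to
  \<open>tor_zero_finite\<close>.\<close>

lemma cond4_finite:
  assumes cond4
  shows "\<exists>d. codim R M = enat d \<and> (\<forall>m\<in>Supp R M. tor_zero_below R M m d)"
proof -
  obtain m where m: "m \<in> Supp R M" using Supp_nonempty by blast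
  have c: "cograde R m M = codim R M" if "m \<in> Supp R M" for m using assms that unfolding cond4_def by simp
  obtain n where n: "\<not> tor_zero_below R M m n" using tor_zero_finite[OF SuppD(2,5)[OF m]] by blast
  then have "\<not> enat n \<le> codim R M" using cograde_tor_zero[OF SuppD(1)[OF m]] c[OF m] by auto
  then obtain d where d: "codim R M = enat d" by (cases "codim R M") auto
  then show ?thesis using cograde_tor_zero[OF SuppD(1)] c by auto
qed

lemma cond4_imp_2: assumes cond4 shows cond2
proof -
  obtain d where d: "codim R M = enat d" "\<And>m. m \<in> Supp R M \<Longrightarrow> tor_zero_below R M m d"
    using cond4_finite[OF assms] by blast
  have len: "n \<le> d" if "primechain R Ann n q p" for n q p using codim_ge[OF that] d(1) by simp
  have "cograde_loc R M p = ht_M R M p" if p0: "p \<in> Cos R M" for p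
  proof -
    have p: "primeideal p R" "Ann \<subseteq> p" using p0 by (simp_all add: Cos_iff)
    obtain xs where xs: "coreg_seq R M xs" "set xs \<subseteq> p"
      "\<forall>x\<in>p. mulset M x (colon M (set xs)) \<noteq> colon M (set xs)"
      using maximal_coreg_seq[OF p(1) annih_colon_sub(2)[OF closed p order_refl]] by blast
    let ?N = "sub M (colon M (set xs))"
    let ?l = "length xs"
    have sR: "set xs \<subseteq> carrier R" by (rule coreg_seqD(1)[OF xs(1)])
    interpret N: artmod R ?N by (rule artmod_colon[OF sR])
    obtain K m where K: "submodule K R ?N" "primeideal m R" "N.atsupp K m" "primeideal (N.quann K) R" "p \<subseteq> N.quann K"
      using N.surjective_or_attached[OF primeD(1)[OF p(1)]] xs(3) by auto
    have qm: "N.quann K \<subseteq> m" by (rule N.quann_sub_atsupp[OF K(3)])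
    have pm: "p \<subseteq> m" using K(5) qm by blast
    have nm: "N.maxprime m" by (rule N.atsupp_maxprime[OF K(1-3)])
    \<comment> \<open>\<open>m\<close> was found in the support of a quotient of 0 : xs. It is a
      maximal ideal above Ann M, so \<open>below_Supp\<close> places it in Supp M, where (4) gives
      \<open>d\<close> vanishing degrees.\<close>
    have mS: "m \<in> Supp R M"
    proof -
      have "maxprime m" using nm by simp
      then obtain m' where "m' \<in> Supp R M" "m \<subseteq> m'" using below_Supp[OF K(2)] p(2) pm by blast
      then show ?thesis using maxprime_eq[OF \<open>maxprime m\<close> SuppD(1)] by metis
    qed
    obtain q1 where q1: "primechain R Ann ?l q1 p" using coreg_chain[OF xs(1) p xs(2)] by blast
    have ld: "?l \<le> d" by (rule len[OF q1])
    have "set xs \<subseteq> m" using xs(2) pm by blast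
    then have t: "tor_zero_below R ?N m (d - ?l)"
      using tor_zero_below_coreg_seq[OF art xs(1) _ K(2), of "d - ?l"] d(2)[OF mS] ld by simp
    obtain q2 where q2: "primechain R (N.quann K) (d - ?l) (N.quann K) q2"
      using tor_zero_dimension[OF N.art nm t K(1,3,4)] by blast
    have q2': "primechain R Ann (d - ?l) (N.quann K) q2"
      by (rule primechain_mono[OF q2]) (use p(2) K(5) in blast)
    \<comment> \<open>There are \<open>?l\<close> strict inclusions up to p and
      \<open>d - ?l\<close> from the attached prime upwards. A strict inclusion between p and the
      attached prime would make a chain of length \<open>d + 1\<close>, exceeding Co-dim M =
      d.\<close>
    have pq: "N.quann K = p"
    proof (rule ccontr)
      assume "N.quann K \<noteq> p"
      then have "primechain R Ann (Suc (d - ?l)) p q2"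
        by (intro primechain_Cons[OF q2' p]) (use K(5) in blast)
      from len[OF primechain_append[OF q1 this]] show False using ld by simp
    qed
    \<comment> \<open>The \<open>d - ?l\<close> inclusions now start at p itself, so a chain ending
      in p can have at most \<open>?l\<close> inclusions.\<close>
    have "n \<le> ?l" if "primechain R Ann n q p" for n q
      using len[OF primechain_append[OF that q2'[unfolded pq]]] ld by simp
    then have ht: "ht_M R M p = enat ?l" unfolding ht_M_eq
      using q1 by (intro antisym Sup_least Sup_upper) auto
    have z: "tor_zero_below R M p ?l"
      using tor_zero_below_coreg_seq[OF art xs(1,2) p(1), of 0] by (simp add: tor_zero_below_def)
    have "\<not> tor_zero_below R ?N p (Suc 0)"
      using N.tor_zero_not_quann[OF K(1,4), of 0] pq by auto
    then have "\<not> tor_zero_below R M p (Suc ?l)"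
      using tor_zero_below_coreg_seq[OF art xs(1,2) p(1), of "Suc 0"] by simp
    then have nz: "\<not> dual_bass_zero R M p ?l" using z unfolding tor_zero_below_def by (metis less_Suc_eq)
    have "(LEAST i. \<not> dual_bass_zero R M p i) = ?l"
    proof (rule Least_equality)
      show "\<not> dual_bass_zero R M p ?l" by (rule nz)
      show "?l \<le> i" if "\<not> dual_bass_zero R M p i" for i
        using z that unfolding tor_zero_below_def not_less[symmetric] by metis
    qed
    then show ?thesis using nz ht unfolding cograde_loc_def by auto
  qed
  then show ?thesis using assms unfolding cond2_def cond4_def by blast
qed

text \<open>A co-regular sequence of length d = Co-dim M exists inside J(M), because every prime
  above J(M) is in the support. It bounds Ndim M from below by d, as 0 : xs is nonzero, and from
  above by d, as 0 : xs has finite length and its elements act locally nilpotently.\<close>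

lemma cond4_imp_co_CM: assumes cond4 shows "co_CM R M"
proof -
  obtain d where d: "codim R M = enat d" "\<And>m. m \<in> Supp R M \<Longrightarrow> tor_zero_below R M m d"
    using cond4_finite[OF assms] by blast
  have len: "n \<le> d" if "primechain R Ann n q p" for n q p using codim_ge[OF that] d(1) by simp
  obtain m where m: "m \<in> Supp R M" using Supp_nonempty by blast
  have "\<exists>xs. length xs = d \<and> coreg_seq R M xs \<and> set xs \<subseteq> J"
    by (rule tor_zero_coreg_exists[OF art ideal_J _ SuppD(4)[OF m] primeD(1)[OF SuppD(1)[OF m]] SuppD(5)[OF m]])
      (use d(2) J_in_prime in blast)
  then obtain xs where xs: "length xs = d" "coreg_seq R M xs" "set xs \<subseteq> J" by blast
  have sR: "set xs \<subseteq> carrier R" by (rule coreg_seqD(1)[OF xs(2)])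
  have "enat d \<le> cograde R J M" unfolding cograde_eq enat_le_Sup_iff using xs by blast
  moreover have "cograde R J M \<le> enat d"
    using cograde_mono[OF SuppD(4)[OF m]] assms m d(1) unfolding cond4_def by simp
  ultimately have cg: "cograde R J M = enat d" by simp
  let ?N = "colon M (set xs)"
  have N: "sm ?N" by (rule sm_colon[OF sR])
  have "\<not> dvM d {\<zero>\<^bsub>M\<^esub>} (carrier M)"
  proof
    assume "dvM d {\<zero>\<^bsub>M\<^esub>} (carrier M)"
    then have "dvM 0 {\<zero>\<^bsub>M\<^esub>} ?N" using dvM_coreg[OF xs(2), of d 0] xs(1) by simp
    then show False using coreg_seqD(2)[OF xs(2)] by simp
  qed
  moreover have "dvM (Suc d) {\<zero>\<^bsub>M\<^esub>} (carrier M)"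
  proof -
    \<comment> \<open>A prime strictly above q would give a chain with one inclusion above Ann(0 :
      xs). Prolonged downwards by the d elements of \<open>xs\<close>, it would have length
      \<open>d + 1\<close> in V(Ann M).\<close>
    have mx: "maxprime q" if q: "primeideal q R" "annih R M ?N \<subseteq> q" for q
      unfolding maxprime_def
    proof (intro conjI allI impI q(1))
      fix I assume I: "ideal I R" "q \<subseteq> I" "\<one> \<notin> I"
      show "I = q"
      proof (rule ccontr)
        assume "I \<noteq> q"
        obtain p where p: "primeideal p R" "I \<subseteq> p" using prime_above[OF I(1,3)] by blast
        have "primechain R (annih R M ?N) (Suc 0) q p"
          by (rule primechain_Cons[OF primechain_0[OF p(1)] q]) (use q(2) I(2) p(2) \<open>I \<noteq> q\<close> in auto)
        from coreg_seq_primechain[OF art xs(2) this] show False using len xs(1) by fastforce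
      qed
    qed
    have "ideal (annih R M ?N) R" by (rule ideal_annih[OF smD(1)[OF N]])
    then have "acc ?N" using acc_colon[OF _ mx] colon_annih_colon[OF sR] by metis
    then have "dvM (Suc 0) {\<zero>\<^bsub>M\<^esub>} ?N" using acc_iff_dvM[OF N] by blast
    moreover have "\<exists>n::nat. x [^] n \<odot>\<^bsub>M\<^esub> y = \<zero>\<^bsub>M\<^esub>" if "x \<in> set xs" "y \<in> carrier M" for x y
      by (rule J_torsion) (use that xs(3) in auto)
    ultimately have "dvM (length xs + Suc 0) {\<zero>\<^bsub>M\<^esub>} (carrier M)" by (intro dvM_torsion_seq[OF _ sR])
    then show ?thesis by (simp add: xs(1) del: devlt.simps)
  qed
  ultimately have "ndim_eq R M d" unfolding ndim_eq_def ndle_eq_devlt by simp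
  then show ?thesis using cg unfolding co_CM_def by blast
qed

lemma dvI_foldl:
  assumes "ideal I R" "Ann \<subseteq> I" "set xs \<subseteq> J" "dvI k (carrier R) (foldl iadd I xs)"
  shows "dvI (length xs + k) (carrier R) I"
  using assms
proof (induction xs arbitrary: I)
  case Nil
  then show ?case by simp
next
  case (Cons x xs)
  have x: "x \<in> J" "x \<in> carrier R" using Cons.prems(3) idealD(7)[OF ideal_J] by auto
  have d: "dvI (length xs + k) (carrier R) (iadd I x)"
    by (rule Cons.IH) (use Cons.prems iadd(1,2)[OF Cons.prems(1) x(2)] in auto)
  have "dvI (Suc (length xs + k)) (carrier R) I"
  proof (rule dvI_iadd[OF Cons.prems(1) x(2) _ d])
    fix K y c
    assume h: "ideal K R" "I \<subseteq> K" "y \<in> carrier R" "c \<in> carrier R" "y \<otimes> (\<one> \<ominus> x \<otimes> c) \<in> K"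
    show "y \<in> K" by (rule J_radical[OF h(1) subset_trans[OF Cons.prems(2) h(2)] h(3) x(1) h(4,5)])
  qed
  then show ?case by (simp del: devlt.simps)
qed

lemma foldl_iadd:
  "ideal I R \<Longrightarrow> set xs \<subseteq> carrier R \<Longrightarrow> ideal (foldl iadd I xs) R \<and> I \<subseteq> foldl iadd I xs \<and> set xs \<subseteq> foldl iadd I xs"
proof (induction xs arbitrary: I)
  case (Cons x xs)
  have x: "x \<in> carrier R" using Cons.prems(2) by simp
  show ?case using Cons.IH[OF iadd(1)[OF Cons.prems(1) x]] Cons.prems(2) iadd(2,3)[OF Cons.prems(1) x] by auto
qed simp

lemma co_CM_imp_cond4: assumes "co_CM R M" shows cond4
proof -
  obtain d where d: "ndim_eq R M d" "cograde R J M = enat d" using assms unfolding co_CM_def by blast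
  \<comment> \<open>A supremum with the finite value d over a nonempty set of lengths is attained,
    so there is a co-regular sequence of length exactly d.\<close>
  have "d \<in> {n. \<exists>xs. length xs = n \<and> coreg_seq R M xs \<and> set xs \<subseteq> J}"
    by (rule Sup_enat_attained) (use d(2) coreg_Nil in \<open>auto simp: cograde_eq\<close>)
  then obtain xs where xs: "length xs = d" "coreg_seq R M xs" "set xs \<subseteq> J" by blast
  have sR: "set xs \<subseteq> carrier R" by (rule coreg_seqD(1)[OF xs(2)])
  let ?N = "colon M (set xs)"
  have N: "sm ?N" by (rule sm_colon[OF sR])
  have "dvM (d + Suc 0) {\<zero>\<^bsub>M\<^esub>} (carrier M)"
    using d(1) unfolding ndim_eq_def ndle_eq_devlt by (simp del: devlt.simps)
  then have "dvM (Suc 0) {\<zero>\<^bsub>M\<^esub>} ?N" using dvM_coreg[OF xs(2), of d "Suc 0"] xs(1) by (simp del: devlt.simps)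
  then have acc: "acc ?N" using acc_iff_dvM[OF N] by blast
  let ?I = "foldl iadd Ann xs"
  note I = foldl_iadd[OF ideal_Ann sR]
  have "dcI ?I"
  proof (rule dcI_maxprimes)
    show "ideal ?I R" using I by blast
    fix q assume q: "primeideal q R" "?I \<subseteq> q"
    have Aq: "Ann \<subseteq> q" "set xs \<subseteq> q" using I q(2) by blast+
    \<comment> \<open>Here q is any prime above Ann M + (xs). The submodule 0 : q lies in 0 : xs, so
      it inherits the ascending chain condition, and by the annihilator condition its annihilator is
      q. This forces q to be maximal.\<close>
    have e: "annih R M (colon M q) = q" using closed q(1) Aq(1) by (simp add: annih_closed_def Vset_def)
    have U: "sm (colon M q)" by (rule sm_colon[OF primeD(4)[OF q(1)]])
    have sub: "colon M q \<subseteq> ?N" using Aq(2) by (auto simp: colon_def)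
    have "acc (colon M q)" unfolding acc_def
    proof (intro allI impI)
      fix K assume K: "\<forall>n::nat. sm (K n) \<and> K n \<subseteq> colon M q \<and> K n \<subseteq> K (Suc n)"
      show "\<exists>n0. \<forall>n>n0. K n = K (Suc n)" by (rule accD[OF acc]) (use K sub in blast)+
    qed
    from acc_annih_maxprime[OF U this] show "maxprime q" using e q(1) by simp
  qed
  then have "dvI (Suc 0) (carrier R) ?I" by (rule dvI_of_dcI)
  from dvI_foldl[OF ideal_Ann order_refl xs(3) this]
  have dv: "dvI (Suc d) (carrier R) Ann" using xs(1) by (simp del: devlt.simps)
  have "n \<le> d" if c: "primechain R Ann n q p" for n q p
  proof (rule ccontr)
    assume "\<not> n \<le> d"
    have q: "primeideal q R" "Ann \<subseteq> q" using primechain_ends[OF c] by blast+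
    have "dvI n (carrier R) Ann" by (rule devlt_mono_nat[OF dv]) (use \<open>\<not> n \<le> d\<close> in simp)
    then have "dvI n (carrier R) q"
      by (rule dvI_subinterval[OF _ ideal_carrier ideal_Ann ideal_carrier primeD(1)[OF q(1)] order_refl primeD(4)[OF q(1)] q(2)])
    then show False using primechain_not_dvI[OF c] by simp
  qed
  then have cd: "codim R M \<le> enat d" by (rule codim_le)
  show ?thesis unfolding cond4_def
  proof
    fix m assume m: "m \<in> Supp R M"
    \<comment> \<open>The circle d <= Cograde(m, M) <= ht m <= Co-dim M <= d turns all inequalities
      into equalities.\<close>
    have "enat d \<le> cograde R m M" using cograde_mono[OF SuppD(4)[OF m]] d(2) by simp
    moreover have "cograde R m M \<le> ht_M R M m" by (rule cograde_le_ht[OF SuppD(1,3)[OF m]])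
    moreover have "ht_M R M m \<le> codim R M" by (rule ht_le_codim)
    ultimately show "cograde R m M = ht_M R M m \<and> ht_M R M m = codim R M"
      using cd by (metis order_antisym order_trans)
  qed
qed

end

theorem theorem3p8:
  fixes R :: "'a ring" and M :: "('a, 'm) module"
  assumes "cring R" and "noetherian_ring R" and "module R M"
    and "artinian_module R M" and "carrier M \<noteq> {\<zero>\<^bsub>M\<^esub>}"
    and "\<forall>p \<in> Vset R (annih R M (carrier M)). annih R M (colon M p) = p"
  shows "(co_CM R M \<longleftrightarrow>
           ((\<forall>p \<in> Cos R M. cograde_loc R M p = ht_M R M p) \<and>
            (\<forall>m \<in> Supp R M. ht_M R M m = codim R M))) \<and>
         (((\<forall>p \<in> Cos R M. cograde_loc R M p = ht_M R M p) \<and>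
            (\<forall>m \<in> Supp R M. ht_M R M m = codim R M)) \<longleftrightarrow>
          ((\<forall>p \<in> Cos R M. \<forall>i. enat i < ht_M R M p \<longrightarrow> dual_bass_zero R M p i) \<and>
            (\<forall>m \<in> Supp R M. ht_M R M m = codim R M))) \<and>
         (((\<forall>p \<in> Cos R M. \<forall>i. enat i < ht_M R M p \<longrightarrow> dual_bass_zero R M p i) \<and>
            (\<forall>m \<in> Supp R M. ht_M R M m = codim R M)) \<longleftrightarrow>
          (\<forall>m \<in> Supp R M. cograde R m M = ht_M R M m \<and> ht_M R M m = codim R M)) \<and>
         ((\<forall>m \<in> Supp R M. cograde R m M = ht_M R M m \<and> ht_M R M m = codim R M) \<longleftrightarrow>
          (\<forall>m \<in> Supp R M. (\<forall>i. enat i < ht_M R M m \<longrightarrow> dual_bass_zero R M m i) \<and>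
                          ht_M R M m = codim R M))"
proof -
  interpret closed_artmod R M
    using assms by unfold_locales (simp_all add: art_module_def annih_closed_def)
  have "co_CM R M \<longleftrightarrow> cond2" "cond2 \<longleftrightarrow> cond3" "cond3 \<longleftrightarrow> cond4" "cond4 \<longleftrightarrow> cond5"
    using co_CM_imp_cond4 cond4_imp_co_CM cond4_imp_2 cond2_imp_3 cond3_imp_5 cond5_imp_4 by blast+
  then show ?thesis unfolding cond2_def cond3_def cond4_def cond5_def by blast
qed

end
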